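(* Let $d\ge2$ and let $(M,g_{ab})$ be pure (global) AdS$_{d+1}$ with AdS scale $\ell>0$. Consider regular and $C^2$ metric perturbations $\delta g_{ab}$ of $(M,g_{ab})$ which leave the causal structure of the conformal boundary unchanged. Then, to linear order in $\delta g_{ab}$: (1) The averaged null curvature condition (ANCC) implies the boundary causality condition (BCC): if such a $\delta g_{ab}$ satisfies the linearized ANCC, then it preserves boundary causality to linear order. (2) The BCC does not imply the ANCC: there exists such a $\delta g_{ab}$ which preserves boundary causality to linear order but violates the linearized ANCC.
   Context: **Background.** Global AdS$_{d+1}$ is $M=\mathbb{R}\times\mathbb{R}^d$ with metric $$ds^2=-(1+r^2/\ell^2)\,dt^2+\frac{dr^2}{1+r^2/\ell^2}+r^2\,d\Omega_{d-1}^2,\qquad t\in\mathbb{R}.$$ It is time-oriented by $\partial_t$. Its Riemann tensor is $R_{abcd}=\frac{1}{\ell^2}(g_{ad}g_{cb}-g_{ac}g_{db})$ (Wald's conventions, signature $(-,+,\dots,+)$), its Ricci tensor is $R_{ab}=-\frac{d}{\ell^2}g_{ab}$, and $\nabla$ is its Levi-Civita connection. Let $\Omega$ be a conformal factor, e.g. $\Omega=(1+r^2/\ell^2)^{-1/2}$, such that $\tilde g_{ab}=\Omega^2 g_{ab}$ extends smoothly and nondegenerately to the manifold with boundary $\tilde M=M\cup\partial M$, where $\partial M\cong\mathbb{R}\times S^{d-1}$ is the conformal boundary. Every complete null geodesic of $(M,g_{ab})$, with future-directed affine parameter $\lambda$ and tangent $k^a=(\partial_\lambda)^a$, goes from a point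 $p_-\in\partial M$ (as $\lambda\to-\infty$) to the antipodal boundary point $p_+\in\partial M$ (as $\lambda\to+\infty$), which depends only on $p_-$: it is the point at which the null geodesics of $\partial M$ from $p_-$ first reconverge. **Admissible perturbations.** "Regular and $C^2$" means that $\widetilde{\delta g}_{ab}=\Omega^2\,\delta g_{ab}$ is a symmetric tensor field extending in a $C^2$ way to $\tilde M$. "Leaves the causal structure of the boundary unchanged" means that the pullback of $\widetilde{\delta g}_{ab}$ to $\partial M$ is pointwise a (possibly zero) multiple of the pullback of $\tilde g_{ab}$. **Linearized ANCC.** The ANCC is the condition $\int_\gamma R_{ab}k^ak^b\,d\lambda\ge0$ for all complete null geodesics $\gamma$. Pure AdS saturates it. The linearized ANCC is the condition that, for every complete null geodesic $\gamma$ of pure AdS, the first-order variation $$\delta\Big(\int_\gamma R_{ab}k^ak^b\,d\lambda\Big)=\int_\gamma\big(\delta R_{ab}\,k^ak^b+2R_{ab}k^a\delta k^b\big)\,d\lambda$$ is $\ge0$. Here $\delta R_{ab}$ is the first-order variation of the Ricci tensor under $g_{ab}\to g_{ab}+\delta g_{ab}$, and $\delta k^a$ is the first-order variation of the geodesic tangent, which satisfies the linearized null condition $g_{ab}k^a\delta k^b=-\frac12\delta g_{ab}k^ak^b$. Thus the variation equals $\int_\gamma(\delta R_{ab}+\frac{d}{\ell^2}\delta g_{ab})k^ak^b\,d\lambda$. **Poincaré horizons and deviation vectors.** For $p_-\in\partial M$, the Poincaré horizon $\mathcal H$ of $p_-$ is the boundary in $M$ of the causal future of $p_-$ through AdS.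 It is the null hypersurface ruled by the complete null geodesics (its generators) going from $p_-$ to $p_+$. In the perturbed metric $g_{ab}+\delta g_{ab}$, the generators $\gamma$ of $\mathcal H$ are displaced, to first order, by a deviation vector field $\eta^a$. Along each $\gamma$, $\eta^a$ satisfies: 1. the inhomogeneous equation of geodesic deviation $$k^a\nabla_a(k^b\nabla_b\eta^c)+R_{abd}{}^{c}k^ak^d\eta^b=-\delta\Gamma^c_{ab}k^ak^b,\qquad \delta\Gamma^a_{bc}=\tfrac12 g^{ad}(\nabla_b\delta g_{cd}+\nabla_c\delta g_{bd}-\nabla_d\delta g_{bc});$$ 2. the linearized null condition $k^a\nabla_a(k_b\eta^b)=-\tfrac12\,\delta g_{ab}k^ak^b$; 3. the initial condition $\eta^a_-(\gamma)=\lim_{\lambda\to-\infty}\eta^a=0$ along $\gamma$. Limits are taken in $\tilde M$, i.e. with components in a frame that is regular at $\partial M$ with respect to $\tilde g_{ab}$. The limit $\eta^a_+(\gamma)=\lim_{\lambda\to+\infty}\eta^a$ along $\gamma$ exists, is a vector at $p_+$ tangent to $\partial M$, and does not depend on the remaining freedom in the solution of 1–3. **Preservation of boundary causality (BCC) to linear order.** The BCC states that two boundary points are causally related through the bulk only if they are causally related on the boundary. To linear order in $\delta g_{ab}$, boundary causality is preserved when, for every $p_-\in\partial M$ and every generator $\gamma$ of the Poincaré horizon of $p_-$, the vector $\eta^a_+(\gamma)$ is not past-directed, i.e. it is not a nonzero past-directed causal (timelike or null) vector with respect to $\tilde g_{ab}$. *)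

theory Defs
  imports "HOL-Analysis.Analysis"
begin

section \<open>Curvature of a metric in one global chart\<close>

text \<open>
  Tensor fields live on a single chart, a Euclidean space \<open>'a\<close>; a covariant 2-tensor field maps a
  point and two vectors to a number.  Since \<open>frechet_derivative\<close> below only acts on fields contracted
  with constant vectors, evaluating at basis vectors gives the usual coordinate formulas.
\<close>

type_synonym 'a tensor2 = "'a \<Rightarrow> 'a \<Rightarrow> 'a \<Rightarrow> real"

definition symmetric_form :: "('a::real_vector \<Rightarrow> 'a \<Rightarrow> real) \<Rightarrow> bool" where
  "symmetric_form B \<longleftrightarrow> bilinear B \<and> (\<forall>u v. B u v = B v u)"

text \<open>Index raising; meaningful when \<open>g x\<close> is nondegenerate and \<open>\<alpha>\<close> is linear.\<close>

definition sharp :: "'a::euclidean_space tensor2 \<Rightarrow> 'a \<Rightarrow> ('a \<Rightarrow> real) \<Rightarrow> 'a" where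
  "sharp g x \<alpha> = (THE v. \<forall>w. g x v w = \<alpha> w)"

definition partial2 :: "'a::euclidean_space tensor2 \<Rightarrow> 'a \<Rightarrow> 'a \<Rightarrow> 'a \<Rightarrow> 'a \<Rightarrow> real" where
  "partial2 h x w u v = frechet_derivative (\<lambda>y. h y u v) (at x) w"

text \<open>\<open>christoffel g x u v\<close> is the vector with components
  \<open>\<Gamma>\<^sup>c\<^sub>a\<^sub>b u\<^sup>a v\<^sup>b\<close>.\<close>

definition christoffel :: "'a::euclidean_space tensor2 \<Rightarrow> 'a \<Rightarrow> 'a \<Rightarrow> 'a \<Rightarrow> 'a" where
  "christoffel g x u v = sharp g x
     (\<lambda>w. (partial2 g x u v w + partial2 g x v u w - partial2 g x w u v) / 2)"

text \<open>\<open>riemann g x u v w\<close> is the vector with components \<open>R\<^sub>a\<^sub>b\<^sub>c\<^sup>d u\<^sup>a v\<^sup>b w\<^sup>c\<close>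
  in Wald's conventions:
  \<open>R\<^sub>a\<^sub>b\<^sub>c\<^sup>d = \<partial>\<^sub>b \<Gamma>\<^sup>d\<^sub>a\<^sub>c - \<partial>\<^sub>a \<Gamma>\<^sup>d\<^sub>b\<^sub>c
     + \<Gamma>\<^sup>e\<^sub>a\<^sub>c \<Gamma>\<^sup>d\<^sub>b\<^sub>e - \<Gamma>\<^sup>e\<^sub>b\<^sub>c \<Gamma>\<^sup>d\<^sub>a\<^sub>e\<close> and
  \<open>R\<^sub>a\<^sub>c = R\<^sub>a\<^sub>b\<^sub>c\<^sup>b\<close>.\<close>

definition riemann :: "'a::euclidean_space tensor2 \<Rightarrow> 'a \<Rightarrow> 'a \<Rightarrow> 'a \<Rightarrow> 'a \<Rightarrow> 'a" where
  "riemann g x u v w =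
     frechet_derivative (\<lambda>y. christoffel g y u w) (at x) v
   - frechet_derivative (\<lambda>y. christoffel g y v w) (at x) u
   + christoffel g x v (christoffel g x u w)
   - christoffel g x u (christoffel g x v w)"

definition ricci :: "'a::euclidean_space tensor2 \<Rightarrow> 'a tensor2" where
  "ricci g x u w = (\<Sum>b\<in>Basis. riemann g x u b w \<bullet> b)"

text \<open>\<open>w\<^sup>c u\<^sup>a v\<^sup>b \<nabla>\<^sub>c h\<^sub>a\<^sub>b\<close>\<close>

definition nabla2 :: "'a::euclidean_space tensor2 \<Rightarrow> 'a tensor2 \<Rightarrow> 'a \<Rightarrow> 'a \<Rightarrow> 'a \<Rightarrow> 'a \<Rightarrow> real" where
  "nabla2 g h x w u v =
     partial2 h x w u v - h x (christoffel g x w u) v - h x u (christoffel g x w v)"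

definition delta_christoffel :: "'a::euclidean_space tensor2 \<Rightarrow> 'a tensor2 \<Rightarrow> 'a \<Rightarrow> 'a \<Rightarrow> 'a \<Rightarrow> 'a" where
  "delta_christoffel g h x u v = sharp g x
     (\<lambda>w. (nabla2 g h x u v w + nabla2 g h x v u w - nabla2 g h x w u v) / 2)"

definition delta_ricci :: "'a::euclidean_space tensor2 \<Rightarrow> 'a tensor2 \<Rightarrow> 'a tensor2" where
  "delta_ricci g h x u v = deriv (\<lambda>s. ricci (\<lambda>y a b. g y a b + s * h y a b) x u v) 0"

definition tangent :: "(real \<Rightarrow> 'a::euclidean_space) \<Rightarrow> real \<Rightarrow> 'a" where
  "tangent \<gamma> s = vector_derivative \<gamma> (at s)"

text \<open>Covariant derivative of a vector field \<open>V\<close> along the curve \<open>\<gamma>\<close>.\<close>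

definition cov_along ::
  "'a::euclidean_space tensor2 \<Rightarrow> (real \<Rightarrow> 'a) \<Rightarrow> (real \<Rightarrow> 'a) \<Rightarrow> real \<Rightarrow> 'a" where
  "cov_along g \<gamma> V s = vector_derivative V (at s) + christoffel g (\<gamma> s) (tangent \<gamma> s) (V s)"


section \<open>Regularity up to the boundary\<close>

text \<open>Only used for open \<open>U\<close>.\<close>

primrec Ck_on :: "nat \<Rightarrow> ('a::euclidean_space \<Rightarrow> real) \<Rightarrow> 'a set \<Rightarrow> bool" where
  "Ck_on 0 f U \<longleftrightarrow> continuous_on U f"
| "Ck_on (Suc k) f U \<longleftrightarrow>
     f differentiable_on U \<and> (\<forall>v. Ck_on k (\<lambda>x. frechet_derivative f (at x) v) U)"

text \<open>On a manifold with boundary \<open>S\<close>: local existence of extensions across the boundary.\<close>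

definition Ck_upto_boundary :: "nat \<Rightarrow> ('a::euclidean_space \<Rightarrow> real) \<Rightarrow> 'a set \<Rightarrow> bool" where
  "Ck_upto_boundary k f S \<longleftrightarrow>
     (\<forall>x\<in>S. \<exists>U F. open U \<and> x \<in> U \<and> Ck_on k F U \<and> (\<forall>y\<in>U \<inter> S. F y = f y))"


section \<open>Global AdS and its conformal compactification\<close>

text \<open>
  The manifold is \<open>real \<times> 'a\<close> with \<open>DIM('a) = d\<close> and AdS scale \<open>L\<close>; a point is \<open>(t, x)\<close>, \<open>r = norm x\<close>.
  In Cartesian coordinates \<open>dr\<^sup>2 = (x \<bullet> dx)\<^sup>2 / r\<^sup>2\<close> and
  \<open>r\<^sup>2 d\<Omega>\<^sup>2 = dx \<bullet> dx - dr\<^sup>2\<close>, hence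
  \<open>dr\<^sup>2 / (1 + r\<^sup>2 / L\<^sup>2) + r\<^sup>2 d\<Omega>\<^sup>2 = dx \<bullet> dx - (x \<bullet> dx)\<^sup>2 / (L\<^sup>2 + r\<^sup>2)\<close>,
  which is smooth at \<open>r = 0\<close>.
\<close>

definition ads_metric :: "real \<Rightarrow> (real \<times> 'a::euclidean_space) tensor2" where
  "ads_metric L p u v =
     (let x = snd p in
       - (1 + (norm x)\<^sup>2 / L\<^sup>2) * fst u * fst v
       + snd u \<bullet> snd v - (x \<bullet> snd u) * (x \<bullet> snd v) / (L\<^sup>2 + (norm x)\<^sup>2))"

definition conf_factor :: "real \<Rightarrow> real \<times> 'a::euclidean_space \<Rightarrow> real" where
  "conf_factor L p = 1 / sqrt (1 + (norm (snd p))\<^sup>2 / L\<^sup>2)"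

definition time_vec :: "real \<times> 'a::euclidean_space" where
  "time_vec = (1, 0)"

text \<open>
  With \<open>r = L * tan \<rho>\<close> the rescaled metric is \<open>- dt\<^sup>2 + L\<^sup>2 (d\<rho>\<^sup>2 + sin\<^sup>2 \<rho> d\<Omega>\<^sup>2)\<close>,
  the product of time and a hemisphere of radius \<open>L\<close>.  Stereographic projection, of radius
  \<open>tan (\<rho> / 2) = r / (L + sqrt (L\<^sup>2 + r\<^sup>2))\<close>, identifies the closed hemisphere with the closed unit
  ball, so that \<open>(t, y)\<close> are regular coordinates up to the boundary \<open>norm y = 1\<close>.
  (The simpler rescaling with \<open>norm y = sin \<rho>\<close> would not give a regular chart at the boundary.)
\<close>

definition compactify :: "real \<Rightarrow> real \<times> 'a::euclidean_space \<Rightarrow> real \<times> 'a" where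
  "compactify L p = (fst p, snd p /\<^sub>R (L + sqrt (L\<^sup>2 + (norm (snd p))\<^sup>2)))"

definition push :: "real \<Rightarrow> real \<times> 'a::euclidean_space \<Rightarrow> real \<times> 'a \<Rightarrow> real \<times> 'a" where
  "push L p = frechet_derivative (compactify L) (at p)"

definition ads_closure :: "(real \<times> 'a::euclidean_space) set" where
  "ads_closure = UNIV \<times> cball 0 1"

definition ads_boundary :: "(real \<times> 'a::euclidean_space) set" where
  "ads_boundary = UNIV \<times> sphere 0 1"

text \<open>The smooth extension of \<open>\<Omega>\<^sup>2 g\<close> to \<open>ads_closure\<close>; see \<open>conf_metric_pullback\<close> below.\<close>

definition conf_metric :: "real \<Rightarrow> (real \<times> 'a::euclidean_space) tensor2" where
  "conf_metric L q u v =
     - fst u * fst v + 4 * L\<^sup>2 / (1 + (norm (snd q))\<^sup>2)\<^sup>2 * (snd u \<bullet> snd v)"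

lemma compactify_has_derivative:
  fixes p :: "real \<times> 'a::euclidean_space"
  assumes "L > 0"
  defines "w \<equiv> sqrt (L\<^sup>2 + (norm (snd p))\<^sup>2)"
  shows "(compactify L has_derivative
    (\<lambda>u. (fst u, snd u /\<^sub>R (L + w) - ((snd p \<bullet> snd u) / (w * (L + w)\<^sup>2)) *\<^sub>R snd p))) (at p)"
proof -
  have w0: "L\<^sup>2 + snd p \<bullet> snd p > 0" using assms by (simp add: add_pos_nonneg)
  have w: "w = sqrt (L\<^sup>2 + snd p \<bullet> snd p)" by (simp add: w_def power2_norm_eq_inner)
  have wp: "w > 0" using w0 w by simp
  have nz: "L + w > 0" using wp assms(1) by simp
  have c: "compactify L = (\<lambda>p::real \<times> 'a. (fst p, inverse (L + sqrt (L\<^sup>2 + snd p \<bullet> snd p)) *\<^sub>R snd p))"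
    by (rule ext) (simp add: compactify_def power2_norm_eq_inner)
  have i: "((\<lambda>p::real \<times> 'a. L\<^sup>2 + snd p \<bullet> snd p) has_derivative (\<lambda>u. 2 * (snd p \<bullet> snd u))) (at p)"
    by (rule has_derivative_eq_rhs[OF has_derivative_add[OF has_derivative_const
          has_derivative_inner[OF has_derivative_snd[OF has_derivative_ident]
            has_derivative_snd[OF has_derivative_ident]]]])
      (simp add: inner_commute)
  have "((\<lambda>p::real \<times> 'a. sqrt (L\<^sup>2 + snd p \<bullet> snd p)) has_derivative
      (\<lambda>u. 2 * (snd p \<bullet> snd u) * (inverse w / 2))) (at p)"
    unfolding w by (rule has_derivative_real_sqrt[OF w0 i])
  from has_derivative_add[OF has_derivative_const this]
  have sq: "((\<lambda>p::real \<times> 'a. L + sqrt (L\<^sup>2 + snd p \<bullet> snd p)) has_derivative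
      (\<lambda>u. (snd p \<bullet> snd u) / w)) (at p)"
    by (rule has_derivative_eq_rhs) (simp add: inverse_eq_divide)
  have "((\<lambda>p::real \<times> 'a. inverse (L + sqrt (L\<^sup>2 + snd p \<bullet> snd p))) has_derivative
      (\<lambda>u. - (inverse (L + w) * ((snd p \<bullet> snd u) / w) * inverse (L + w)))) (at p)"
    unfolding w by (rule Deriv.has_derivative_inverse[OF _ sq[unfolded w]]) (use nz w in simp)
  also have "(\<lambda>u. - (inverse (L + w) * ((snd p \<bullet> snd u) / w) * inverse (L + w)))
      = (\<lambda>u. - ((snd p \<bullet> snd u) / (w * (L + w)\<^sup>2)))"
    by (rule ext) (simp add: divide_inverse power2_eq_square)
  finally have inv: "((\<lambda>p::real \<times> 'a. inverse (L + sqrt (L\<^sup>2 + snd p \<bullet> snd p))) has_derivative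
      (\<lambda>u. - ((snd p \<bullet> snd u) / (w * (L + w)\<^sup>2)))) (at p)" .
  have "((\<lambda>p::real \<times> 'a. inverse (L + sqrt (L\<^sup>2 + snd p \<bullet> snd p)) *\<^sub>R snd p) has_derivative
      (\<lambda>u. snd u /\<^sub>R (L + w) - ((snd p \<bullet> snd u) / (w * (L + w)\<^sup>2)) *\<^sub>R snd p)) (at p)"
    by (rule has_derivative_eq_rhs
          [OF has_derivative_scaleR[OF inv has_derivative_snd[OF has_derivative_ident]]])
      (simp add: w[symmetric])
  then show ?thesis
    unfolding c by (intro has_derivative_Pair has_derivative_fst has_derivative_ident)
qed

lemma conf_metric_pullback:
  fixes p :: "real \<times> 'a::euclidean_space"
  assumes L: "L > 0"
  shows "conf_metric L (compactify L p) (push L p u) (push L p v) =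
         (conf_factor L p)\<^sup>2 * ads_metric L p u v"
proof -
  define x where "x = snd p"
  define w where "w = sqrt (L\<^sup>2 + (norm x)\<^sup>2)"
  define a where "a = x \<bullet> snd u"
  define b where "b = x \<bullet> snd v"
  have w2: "w\<^sup>2 = L\<^sup>2 + (norm x)\<^sup>2" by (simp add: w_def)
  have wp: "w > 0" using L by (simp add: w_def add_pos_nonneg)
  have nz: "L + w > 0" using wp L by simp
  have xx2: "(norm x)\<^sup>2 = (w - L) * (w + L)"
    using w2 by (simp add: algebra_simps power2_eq_square)
  then have xx: "x \<bullet> x = (w - L) * (w + L)" by (simp add: power2_norm_eq_inner)
  have P: "push L p u = (fst u, snd u /\<^sub>R (L + w) - ((x \<bullet> snd u) / (w * (L + w)\<^sup>2)) *\<^sub>R x)" for u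
    using frechet_derivative_at[OF compactify_has_derivative[OF L, of p]]
    by (simp add: push_def x_def w_def fun_eq_iff)
  have "(norm (snd (compactify L p)))\<^sup>2 = (norm x)\<^sup>2 / (L + w)\<^sup>2"
    by (simp add: compactify_def x_def[symmetric] w_def[symmetric] power_mult_distrib divide_inverse
        power_inverse mult.commute)
  also have "\<dots> = (w - L) / (w + L)"
    unfolding xx2 using nz by (simp add: add.commute[of w L] power2_eq_square)
  finally have y: "1 + (norm (snd (compactify L p)))\<^sup>2 = 2 * w / (L + w)"
    using nz by (simp add: field_simps)
  have D: "snd (push L p u) \<bullet> snd (push L p v) = (snd u \<bullet> snd v - a * b / w\<^sup>2) / (L + w)\<^sup>2"
  proof -
    define q where "q = inverse (L + w)"
    define c where "c = 1 / (w * (L + w)\<^sup>2)"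
    have "snd (push L p u) \<bullet> snd (push L p v) = (q *\<^sub>R snd u - (a * c) *\<^sub>R x) \<bullet> (q *\<^sub>R snd v - (b * c) *\<^sub>R x)"
      by (simp add: P q_def c_def a_def b_def)
    also have "\<dots> = q\<^sup>2 * (snd u \<bullet> snd v) + (a * b) * (c * c * (x \<bullet> x) - 2 * q * c)"
      by (simp add: inner_diff_left inner_diff_right inner_commute[of "snd u" x]
          a_def[symmetric] b_def[symmetric] algebra_simps power2_eq_square)
    also have "c * c * (x \<bullet> x) - 2 * q * c = - q\<^sup>2 / w\<^sup>2"
    proof -
      have c: "c = q\<^sup>2 / w" by (simp add: c_def q_def power_inverse divide_inverse)
      have qm: "q * (w + L) = 1" using nz by (simp add: q_def add.commute)
      have "c * c * (x \<bullet> x) - 2 * q * c = q ^ 3 / w\<^sup>2 * ((q * (w + L)) * (w - L) - 2 * w)"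
        using wp by (simp add: c xx field_simps power2_eq_square power3_eq_cube)
      also have "\<dots> = - q\<^sup>2 / w\<^sup>2 * (q * (w + L))"
      proof -
        have "q ^ 3 / w\<^sup>2 * (1 * (w - L) - 2 * w) = - q\<^sup>2 / w\<^sup>2 * (q * (w + L))"
          by (simp add: power2_eq_square power3_eq_cube algebra_simps diff_divide_distrib add_divide_distrib)
        then show ?thesis unfolding qm .
      qed
      finally show ?thesis unfolding qm by simp
    qed
    also have "q\<^sup>2 * (snd u \<bullet> snd v) + (a * b) * (- q\<^sup>2 / w\<^sup>2) = q\<^sup>2 * (snd u \<bullet> snd v - a * b / w\<^sup>2)"
      by (simp add: right_diff_distrib)
    finally show ?thesis by (simp add: q_def power_inverse divide_inverse mult.commute)
  qed
  have wL: "1 + (norm x)\<^sup>2 / L\<^sup>2 = w\<^sup>2 / L\<^sup>2"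
    using L by (simp add: w2 add_divide_distrib)
  have F: "(conf_factor L p)\<^sup>2 = L\<^sup>2 / w\<^sup>2"
  proof -
    have "0 \<le> 1 + (norm x)\<^sup>2 / L\<^sup>2" by simp
    then have "(conf_factor L p)\<^sup>2 = 1 / (1 + (norm x)\<^sup>2 / L\<^sup>2)"
      by (simp add: conf_factor_def x_def power_divide)
    then show ?thesis unfolding wL by simp
  qed
  have C: "conf_metric L (compactify L p) (push L p u) (push L p v) =
      - fst u * fst v + L\<^sup>2 / w\<^sup>2 * (snd u \<bullet> snd v - a * b / w\<^sup>2)"
    unfolding conf_metric_def y D using nz wp
    by (simp add: P power_divide power_mult_distrib)
  have A: "ads_metric L p u v = - (w\<^sup>2 / L\<^sup>2) * fst u * fst v + snd u \<bullet> snd v - a * b / w\<^sup>2"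
    unfolding ads_metric_def Let_def x_def[symmetric] a_def b_def wL w2[symmetric] by (rule refl)
  have arith: "- s + c * (i - j) = c * (- e * f * g + i - j)"
    if "c * e = 1" "s = f * g" for s c i j e f g :: real
  proof -
    have "c * (- e * f * g + i - j) = - (c * e) * (f * g) + c * (i - j)"
      by (simp add: algebra_simps)
    then show ?thesis using that by simp
  qed
  show ?thesis
    unfolding C F A mult_minus_left[of "fst u"] by (rule arith) (use L wp in simp_all)
qed


section \<open>Perturbations, null geodesics and the two conditions\<close>

text \<open>
  \<open>h\<close> is the extension of \<open>\<Omega>\<^sup>2 \<delta>g\<close> in the coordinates \<open>(t, y)\<close>.  The last conjunct says
  that its pullback to the boundary is pointwise a multiple of the pullback of \<open>conf_metric L\<close>.
\<close>

definition admissible :: "real \<Rightarrow> (real \<times> 'a::euclidean_space) tensor2 \<Rightarrow> bool" where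
  "admissible L dg \<longleftrightarrow> (\<exists>h.
     (\<forall>q\<in>ads_closure. symmetric_form (h q)) \<and>
     (\<forall>u v. Ck_upto_boundary 2 (\<lambda>q. h q u v) ads_closure) \<and>
     (\<forall>p u v. h (compactify L p) (push L p u) (push L p v) = (conf_factor L p)\<^sup>2 * dg p u v) \<and>
     (\<forall>q\<in>ads_boundary. \<exists>c. \<forall>u v. snd u \<bullet> snd q = 0 \<longrightarrow> snd v \<bullet> snd q = 0 \<longrightarrow>
        h q u v = c * conf_metric L q u v))"

text \<open>Future-directed, affinely parametrized, and complete because the parameter ranges over all reals.\<close>

definition complete_null_geodesic :: "real \<Rightarrow> (real \<Rightarrow> real \<times> 'a::euclidean_space) \<Rightarrow> bool" where
  "complete_null_geodesic L \<gamma> \<longleftrightarrow> (\<forall>s.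
     \<gamma> differentiable (at s) \<and> tangent \<gamma> differentiable (at s) \<and>
     cov_along (ads_metric L) \<gamma> (tangent \<gamma>) s = 0 \<and>
     ads_metric L (\<gamma> s) (tangent \<gamma> s) (tangent \<gamma> s) = 0 \<and>
     ads_metric L (\<gamma> s) time_vec (tangent \<gamma> s) < 0)"

text \<open>
  The variation \<open>dk\<close> of the tangent is only constrained by the linearized null condition, which
  determines the integrand because \<open>ricci (ads_metric L)\<close> is a multiple of \<open>ads_metric L\<close>.
  For admissible \<open>dg\<close> the integrals converge absolutely.
\<close>

definition linearized_ANCC :: "real \<Rightarrow> (real \<times> 'a::euclidean_space) tensor2 \<Rightarrow> bool" where
  "linearized_ANCC L dg \<longleftrightarrow> (\<forall>\<gamma> dk. complete_null_geodesic L \<gamma> \<longrightarrow>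
     (\<forall>s. ads_metric L (\<gamma> s) (tangent \<gamma> s) (dk s) =
          - (1/2) * dg (\<gamma> s) (tangent \<gamma> s) (tangent \<gamma> s)) \<longrightarrow>
     0 \<le> (LINT s|lborel.
           delta_ricci (ads_metric L) dg (\<gamma> s) (tangent \<gamma> s) (tangent \<gamma> s)
           + 2 * ricci (ads_metric L) (\<gamma> s) (tangent \<gamma> s) (dk s)))"

text \<open>
  The null geodesics of the boundary, with metric \<open>- dt\<^sup>2 + L\<^sup>2 d\<Omega>\<^sup>2\<close>, from \<open>(t, y)\<close> first reconverge
  at the antipode of \<open>y\<close> after time \<open>pi * L\<close>.
\<close>

definition reconvergence_point :: "real \<Rightarrow> real \<times> 'a::euclidean_space \<Rightarrow> real \<times> 'a" where
  "reconvergence_point L q = (fst q + pi * L, - snd q)"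

text \<open>Generators of the Poincare horizon of the boundary point \<open>q\<close>.\<close>

definition horizon_generator ::
  "real \<Rightarrow> real \<times> 'a::euclidean_space \<Rightarrow> (real \<Rightarrow> real \<times> 'a) \<Rightarrow> bool" where
  "horizon_generator L q \<gamma> \<longleftrightarrow> complete_null_geodesic L \<gamma> \<and>
     ((\<lambda>s. compactify L (\<gamma> s)) \<longlongrightarrow> q) at_bot \<and>
     ((\<lambda>s. compactify L (\<gamma> s)) \<longlongrightarrow> reconvergence_point L q) at_top"

definition deviation_vector ::
  "real \<Rightarrow> (real \<times> 'a::euclidean_space) tensor2 \<Rightarrow> (real \<Rightarrow> real \<times> 'a) \<Rightarrow> (real \<Rightarrow> real \<times> 'a) \<Rightarrow> bool" where
  "deviation_vector L dg \<gamma> \<eta> \<longleftrightarrow>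
     (let g = ads_metric L; k = tangent \<gamma> in
       (\<forall>s. \<eta> differentiable (at s) \<and> cov_along g \<gamma> \<eta> differentiable (at s) \<and>
          cov_along g \<gamma> (cov_along g \<gamma> \<eta>) s + riemann g (\<gamma> s) (k s) (\<eta> s) (k s)
            = - delta_christoffel g dg (\<gamma> s) (k s) (k s)) \<and>
       (\<forall>s. ((\<lambda>s. g (\<gamma> s) (k s) (\<eta> s)) has_real_derivative
              - (1/2) * dg (\<gamma> s) (k s) (k s)) (at s)) \<and>
       ((\<lambda>s. push L (\<gamma> s) (\<eta> s)) \<longlongrightarrow> 0) at_bot)"

definition past_causal :: "real \<Rightarrow> real \<times> 'a::euclidean_space \<Rightarrow> real \<times> 'a \<Rightarrow> bool" where
  "past_causal L q v \<longleftrightarrow> v \<noteq> 0 \<and> conf_metric L q v v \<le> 0 \<and> conf_metric L q time_vec v > 0"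

text \<open>
  For admissible \<open>dg\<close>, deviation vectors along \<open>\<gamma>\<close> exist, and the limit \<open>v\<close> exists and is the same for
  all of them; so it does not matter how \<open>\<eta>\<close> is quantified.
\<close>

definition preserves_BCC :: "real \<Rightarrow> (real \<times> 'a::euclidean_space) tensor2 \<Rightarrow> bool" where
  "preserves_BCC L dg \<longleftrightarrow> (\<forall>q\<in>ads_boundary. \<forall>\<gamma>. horizon_generator L q \<gamma> \<longrightarrow>
     (\<forall>\<eta> v. deviation_vector L dg \<gamma> \<eta> \<longrightarrow>
        ((\<lambda>s. push L (\<gamma> s) (\<eta> s)) \<longlongrightarrow> v) at_top \<longrightarrow>
        \<not> past_causal L (reconvergence_point L q) v))"

end

theory Submission
  imports Defs "HOL-Real_Asymp.Real_Asymp"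
begin

text \<open>
  The Poincare horizon of a boundary point is a graph over space, on which its generators are the parallel
  lines \<open>z + s *\<^sub>R x1\<close> with \<open>z\<close> orthogonal to \<open>x1\<close>.  Let \<open>ff z\<close> be the integral of \<open>\<delta>g(k, k)\<close> over
  such a generator.

  Integrating the linearized null condition along the generator expresses \<open>ff z\<close> by the limit
  \<open>v\<close> of the deviation vector.  The geodesic deviation equation bounds the growth of the deviation vector, so
  that \<open>v\<close> is tangent to the boundary; hence, if \<open>v\<close> were past-directed causal, \<open>ff z\<close> would be negative.
  So boundary causality is preserved as soon as \<open>ff \<ge> 0\<close>.

  In \<open>\<delta>R(k, k) + d / L\<^sup>2 * \<delta>g(k, k)\<close>, all derivatives transversal to the horizon and all other components of
  \<open>\<delta>g\<close> combine into a derivative along the generator, which integrates to zero.  What remains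
  is an elliptic operator applied to \<open>ff\<close> on the space of generators.
  The averaged null curvature condition says that \<open>ff\<close> is a supersolution; as \<open>ff\<close> is small at infinity by the
  boundary condition on \<open>\<delta>g\<close>, the minimum principle yields \<open>ff \<ge> 0\<close>.

  Conversely, a perturbation with \<open>\<delta>g(k, k) \<ge> 0\<close> everywhere and vanishing exactly to second order along one
  generator preserves boundary causality, but violates the averaged condition on that generator.
\<close>

section \<open>Twice differentiable functions\<close>

text \<open>The elliptic operator is that of hyperbolic space: with \<open>z\<close> as Cartesian
  part and \<open>w0 z\<close> as height on the hyperboloid of radius L in dimension d - 1, it is
  the Laplacian minus (d - 1) / L^2. The height \<open>w0\<close> lies in its kernel, and the
  constant L is mapped to - (d - 1) / L. This is why \<open>w0 + L\<close> serves as comparison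
  function, and why smallness at infinity means smallness relative to \<open>w0\<close>. A
  perturbation has only two derivatives, so the linearized Ricci tensor cannot be differentiated
  again. The divergence structure is therefore exhibited by pointwise identities between second
  derivatives, and \<open>ff\<close> is never shown to be differentiable: its difference quotients,
  in constant directions and under dilations of space, are compared directly with integrals of
  derivatives along the generator. The identities stay manageable because the horizon is the zero
  set of an ambient linear function, whose Hessian is a multiple of the metric. Fields such as
  \<open>P\<close> and \<open>eT\<close> then have a covariant derivative proportional to the
  identity, so derivatives of components of \<delta>g along them are covariant derivatives up to
  zeroth order terms.\<close>

definition c2 :: "('a::euclidean_space \<Rightarrow> real) \<Rightarrow> ('a \<Rightarrow> 'a \<Rightarrow> real) \<Rightarrow> ('a \<Rightarrow> 'a \<Rightarrow> 'a \<Rightarrow> real) \<Rightarrow> bool" where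
  "c2 F F1 F2 \<longleftrightarrow> (\<forall>x. (F has_derivative F1 x) (at x)) \<and>
     (\<forall>x u. ((\<lambda>y. F1 y u) has_derivative F2 x u) (at x))"

lemma c2D1: "c2 F F1 F2 \<Longrightarrow> (F has_derivative F1 x) (at x)"
  by (simp add: c2_def)

lemma c2D2: "c2 F F1 F2 \<Longrightarrow> ((\<lambda>y. F1 y u) has_derivative F2 x u) (at x)"
  by (simp add: c2_def)

lemma linear_c2D1: "c2 F F1 F2 \<Longrightarrow> linear (F1 x)"
  using c2D1 has_derivative_linear by blast

lemma linear_c2D2: "c2 F F1 F2 \<Longrightarrow> linear (F2 x u)"
  using c2D2 has_derivative_linear by blast

lemma linear_c2D2': 
  assumes "c2 F F1 F2"
  shows "linear (\<lambda>u. F2 x u v)"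
proof (rule linearI)
  fix u u' :: 'a and r :: real
  have "((\<lambda>y. F1 y (u + u')) has_derivative F2 x (u + u')) (at x)"
    using assms by (rule c2D2)
  moreover have "((\<lambda>y. F1 y (u + u')) has_derivative (\<lambda>v. F2 x u v + F2 x u' v)) (at x)"
    unfolding linear_add[OF linear_c2D1[OF assms]]
    by (intro has_derivative_add c2D2[OF assms])
  ultimately show "F2 x (u + u') v = F2 x u v + F2 x u' v"
    by (metis has_derivative_unique)
  have "((\<lambda>y. F1 y (r *\<^sub>R u)) has_derivative F2 x (r *\<^sub>R u)) (at x)"
    using assms by (rule c2D2)
  moreover have "((\<lambda>y. F1 y (r *\<^sub>R u)) has_derivative (\<lambda>v. r *\<^sub>R F2 x u v)) (at x)"
    unfolding linear_scale[OF linear_c2D1[OF assms]]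
    by (intro has_derivative_scaleR_right c2D2[OF assms])
  ultimately show "F2 x (r *\<^sub>R u) v = r *\<^sub>R F2 x u v"
    by (metis has_derivative_unique)
qed

lemma c2_unique:
  assumes "c2 F F1 F2" "c2 F G1 G2"
  shows "F1 = G1" "F2 = G2"
proof -
  show 1: "F1 = G1"
    using assms by (metis c2D1 has_derivative_unique ext)
  show "F2 = G2"
  proof (rule ext, rule ext)
    fix x u
    show "F2 x u = G2 x u"
      using c2D2[OF assms(1), of u x] c2D2[OF assms(2), of u x] unfolding 1
      by (rule has_derivative_unique)
  qed
qed

text \<open>The second difference along the two sides of a small parallelogram, divided by its
  squared scale, tends to the mixed derivative; but it is symmetric in the two directions.\<close>

lemma second_difference_tendsto:
  assumes c: "c2 F F1 F2"
  shows "((\<lambda>t. (F (x + t *\<^sub>R u + t *\<^sub>R v) - F (x + t *\<^sub>R u) - F (x + t *\<^sub>R v) + F x) / t\<^sup>2)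
    \<longlongrightarrow> F2 x u v) (at_right 0)"
proof (rule tendstoI)
  fix e :: real assume e: "e > 0"
  \<comment> \<open>After division by \<open>t\<close> the linearization errors of \<open>F1\<close>
    at the two endpoints add up to at most \<open>e' * (2 * norm u + norm v)\<close>; the added 1
    keeps the denominator positive when both vectors vanish.\<close>
  define e' where "e' = e / (2 * (2 * norm u + norm v + 1))"
  have den: "2 * norm u + norm v + 1 > 0" by (simp add: add_nonneg_pos)
  have e': "e' > 0" using e den by (simp add: e'_def)
  obtain d where d: "d > 0"
    and D: "\<And>y. norm (y - x) < d \<Longrightarrow> \<bar>F1 y u - F1 x u - F2 x u (y - x)\<bar> \<le> e' * norm (y - x)"
    using c2D2[OF c, of u x] e' unfolding has_derivative_at_alt by auto
  have nuv: "norm u + norm v + 1 > 0" by (simp add: add_nonneg_pos)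
  have "eventually (\<lambda>t. t \<in> {0<..<d / (norm u + norm v + 1)}) (at_right (0::real))"
    by (rule eventually_at_right_real) (use d nuv in simp)
  then show "eventually (\<lambda>t. dist ((F (x + t *\<^sub>R u + t *\<^sub>R v) - F (x + t *\<^sub>R u) - F (x + t *\<^sub>R v) + F x) / t\<^sup>2) (F2 x u v) < e) (at_right 0)"
  proof eventually_elim
    case (elim t)
    then have t: "t > 0" and td: "t * (norm u + norm v + 1) < d"
      using nuv by (auto simp: field_simps)
    \<comment> \<open>The mean value theorem in the step along \<open>u\<close> leaves first
      derivatives at two points near \<open>x\<close>, which the differentiability of
      \<open>F1\<close> at the single point \<open>x\<close> compares.\<close>
    define \<phi> where "\<phi> s = F (x + s *\<^sub>R u + t *\<^sub>R v) - F (x + s *\<^sub>R u)" for s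
    have "(\<phi> has_real_derivative (F1 (x + s *\<^sub>R u + t *\<^sub>R v) u - F1 (x + s *\<^sub>R u) u)) (at s)" for s
    proof -
      have a: "((\<lambda>s. x + s *\<^sub>R u + t *\<^sub>R v) has_derivative (\<lambda>h. h *\<^sub>R u)) (at s)"
        by (auto intro!: derivative_eq_intros)
      have b: "((\<lambda>s. x + s *\<^sub>R u) has_derivative (\<lambda>h. h *\<^sub>R u)) (at s)"
        by (auto intro!: derivative_eq_intros)
      have "(\<phi> has_derivative (\<lambda>h. F1 (x + s *\<^sub>R u + t *\<^sub>R v) (h *\<^sub>R u) - F1 (x + s *\<^sub>R u) (h *\<^sub>R u))) (at s)"
        unfolding \<phi>_def
        by (intro has_derivative_diff has_derivative_compose[OF a] has_derivative_compose[OF b] c2D1[OF c])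
      then show ?thesis
        unfolding has_field_derivative_def
        by (rule has_derivative_eq_rhs) (simp add: fun_eq_iff linear_scale[OF linear_c2D1[OF c]] algebra_simps)
    qed
    from MVT2[OF t this] obtain z where z: "0 < z" "z < t"
      and eq: "\<phi> t - \<phi> 0 = (t - 0) * (F1 (x + z *\<^sub>R u + t *\<^sub>R v) u - F1 (x + z *\<^sub>R u) u)"
      by blast
    let ?a = "x + z *\<^sub>R u + t *\<^sub>R v" and ?b = "x + z *\<^sub>R u"
    have na: "norm (?a - x) \<le> t * (norm u + norm v)"
    proof -
      have "norm (?a - x) \<le> z * norm u + t * norm v"
        using norm_triangle_ineq[of "z *\<^sub>R u" "t *\<^sub>R v"] z t by simp
      also have "\<dots> \<le> t * norm u + t * norm v"
        using z by (simp add: mult_right_mono)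
      finally show ?thesis by (simp add: algebra_simps)
    qed
    have nb: "norm (?b - x) \<le> t * norm u"
      using z by (simp add: mult_right_mono)
    have nn: "0 \<le> norm u" "0 \<le> norm v" by auto
    have A: "\<bar>F1 ?a u - F1 x u - F2 x u (?a - x)\<bar> \<le> e' * (t * (norm u + norm v))"
      using D[of ?a] na td t e' by (smt (verit) mult_left_mono distrib_left mult.right_neutral)
    have "t * norm v \<ge> 0" using t by simp
    then have B: "\<bar>F1 ?b u - F1 x u - F2 x u (?b - x)\<bar> \<le> e' * (t * norm u)"
      using D[of ?b] nb td t e' by (smt (verit) mult_left_mono distrib_left mult.right_neutral)
    have lin: "linear (F2 x u)" by (rule linear_c2D2[OF c])
    have L: "F2 x u (?a - x) = F2 x u (?b - x) + t * F2 x u v"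
      using linear_add[OF lin, of "?b - x" "t *\<^sub>R v"] linear_scale[OF lin, of t v]
      by (simp add: algebra_simps)
    define A1 where "A1 = F1 ?a u - F1 ?b u"
    have "\<bar>A1 - t * F2 x u v\<bar> \<le> e' * (t * (norm u + norm v)) + e' * (t * norm u)"
      using A B unfolding A1_def L by linarith
    also have "\<dots> = e' * (2 * norm u + norm v) * t" by (simp add: algebra_simps)
    finally have C: "\<bar>A1 - t * F2 x u v\<bar> / t \<le> e' * (2 * norm u + norm v)"
      using t by (simp add: divide_le_eq)
    have "(\<phi> t - \<phi> 0) / t\<^sup>2 - F2 x u v = (A1 - t * F2 x u v) / t"
      unfolding eq A1_def[symmetric] using t by (simp add: power2_eq_square diff_divide_distrib)
    then have "\<bar>(\<phi> t - \<phi> 0) / t\<^sup>2 - F2 x u v\<bar> \<le> e' * (2 * norm u + norm v)"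
      using C t by (simp add: abs_divide)
    also have "\<dots> < e"
    proof -
      have "e' * (2 * norm u + norm v) \<le> e' * (2 * norm u + norm v + 1)" using e' by simp
      also have "\<dots> = e / 2"
        unfolding e'_def using nonzero_mult_div_cancel_right[of "2 * norm u + norm v + 1" "e / 2"] den by simp
      finally show ?thesis using e by simp
    qed
    finally show ?case by (simp add: dist_real_def \<phi>_def algebra_simps)
  qed
qed

lemma c2_symmetric:
  assumes "c2 F F1 F2"
  shows "F2 x u v = F2 x v u"
proof -
  have "((\<lambda>t. (F (x + t *\<^sub>R v + t *\<^sub>R u) - F (x + t *\<^sub>R v) - F (x + t *\<^sub>R u) + F x) / t\<^sup>2)
    \<longlongrightarrow> F2 x u v) (at_right 0)"
    using second_difference_tendsto[OF assms, of x u v] by (simp add: algebra_simps)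
  then show ?thesis
    by (rule tendsto_unique[OF trivial_limit_at_right_real]) (rule second_difference_tendsto[OF assms])
qed


section \<open>Solutions of linear systems depending on a parameter\<close>

text \<open>In \<open>(f - f a) * g\<close> the first factor tends to 0 while \<open>g\<close> is of
  first order, so this part has derivative 0. In a linear system the coefficients of the unknown are
  known to be continuous before they are known to be differentiable; they play the role of
  \<open>f\<close>.\<close>

lemma has_derivative_mult_vanishing:
  fixes f g :: "'p::real_normed_vector \<Rightarrow> real"
  assumes f: "isCont f a" and g: "(g has_derivative g') (at a)" and ga: "g a = 0"
  shows "((\<lambda>q. f q * g q) has_derivative (\<lambda>d. f a * g' d)) (at a)"
proof -
  obtain K where K: "K > 0" "\<And>d. norm (g' d) \<le> norm d * K"
    using has_derivative_bounded_linear[OF g] bounded_linear.pos_bounded by blast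
  have "((\<lambda>q. (f q - f a) * g q) has_derivative (\<lambda>d. 0)) (at a)"
    unfolding has_derivative_at_alt
  proof (intro conjI allI impI)
    fix e :: real assume e: "e > 0"
    obtain d1 where d1: "d1 > 0" "\<And>q. norm (q - a) < d1 \<Longrightarrow> norm (g q - g a - g' (q - a)) \<le> 1 * norm (q - a)"
      using g unfolding has_derivative_at_alt by (meson zero_less_one)
    obtain d2 where d2: "d2 > 0" "\<And>q. dist q a < d2 \<Longrightarrow> dist (f q) (f a) < e / (1 + K)"
      using f e K(1) unfolding continuous_at_eps_delta by (metis add_pos_pos divide_pos_pos zero_less_one)
    show "\<exists>d>0. \<forall>y. norm (y - a) < d \<longrightarrow>
        norm ((f y - f a) * g y - (f a - f a) * g a - 0) \<le> e * norm (y - a)"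
    proof (intro exI[of _ "min d1 d2"] conjI allI impI)
      fix y assume y: "norm (y - a) < min d1 d2"
      have "\<bar>g y\<bar> \<le> (1 + K) * norm (y - a)"
        using d1(2)[of y] K(2)[of "y - a"] y ga by (simp add: algebra_simps abs_le_iff)
      moreover have "\<bar>f y - f a\<bar> \<le> e / (1 + K)"
        using d2(2)[of y] y by (simp add: dist_norm)
      ultimately have "\<bar>f y - f a\<bar> * \<bar>g y\<bar> \<le> e / (1 + K) * ((1 + K) * norm (y - a))"
        by (intro mult_mono) (use e K in auto)
      then show "norm ((f y - f a) * g y - (f a - f a) * g a - 0) \<le> e * norm (y - a)"
        using K by (simp add: abs_mult)
    qed (use d1 d2 in auto)
  qed simp
  from has_derivative_add[OF has_derivative_mult_right[OF g, of "f a"] this]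
  show ?thesis by (simp add: algebra_simps)
qed

lemma linear_expand:
  fixes f :: "'a::euclidean_space \<Rightarrow> 'b::real_vector"
  assumes "linear f"
  shows "f v = (\<Sum>i\<in>Basis. (v \<bullet> i) *\<^sub>R f i)"
proof -
  have "f (\<Sum>i\<in>Basis. (v \<bullet> i) *\<^sub>R i) = (\<Sum>i\<in>Basis. (v \<bullet> i) *\<^sub>R f i)"
    using assms by (simp add: linear_sum linear_scale)
  then show ?thesis by (simp add: euclidean_representation)
qed

lemma bilinear_expand:
  fixes B :: "'a::euclidean_space \<Rightarrow> 'b::euclidean_space \<Rightarrow> real"
  assumes "bilinear B"
  shows "B v w = (\<Sum>i\<in>Basis. (v \<bullet> i) * B i w)"
  using linear_expand[of "\<lambda>v. B v w" v] assms by (simp add: bilinear_def)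

section \<open>Nondegenerate forms and parameter dependence of index raising\<close>

definition nondegenerate :: "('a::real_vector \<Rightarrow> 'a \<Rightarrow> real) \<Rightarrow> bool" where
  "nondegenerate B \<longleftrightarrow> (\<forall>v. (\<forall>w. B v w = 0) \<longrightarrow> v = 0)"

lemma nondegenerate_uniqueE:
  assumes "bilinear B" "nondegenerate B" "\<And>w. B v w = \<alpha> w" "\<And>w. B v' w = \<alpha> w"
  shows "v = v'"
proof -
  have "B (v - v') w = 0" for w
    using assms by (simp add: bilinear_lsub)
  then show ?thesis using assms(2) by (force simp: nondegenerate_def)
qed

lemma sharp_eqI:
  assumes "bilinear (g x)" "nondegenerate (g x)" "\<And>w. g x v w = \<alpha> w"
  shows "sharp g x \<alpha> = v"
  unfolding sharp_def
  by (rule the_equality) (use assms nondegenerate_uniqueE in blast)+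

text \<open>Index lowering read as an endomorphism through the standard inner product, so that
  injectivity, surjectivity and lower bounds of linear maps apply to the form.\<close>

definition flat :: "('a::euclidean_space \<Rightarrow> 'a \<Rightarrow> real) \<Rightarrow> 'a \<Rightarrow> 'a" where
  "flat B v = (\<Sum>b\<in>Basis. B v b *\<^sub>R b)"

lemma linear_flat: "bilinear B \<Longrightarrow> linear (flat B)"
  unfolding flat_def by (rule linearI)
    (simp_all add: bilinear_ladd bilinear_lmul scaleR_add_left sum.distrib scaleR_sum_right)

lemma flat_inner: "b \<in> Basis \<Longrightarrow> flat B v \<bullet> b = B v b"
  by (simp add: flat_def inner_sum_left inner_Basis if_distrib sum.delta cong: if_cong)

lemma flat_eq_iff:
  assumes "bilinear B" "linear \<alpha>"
  shows "flat B v = (\<Sum>b\<in>Basis. \<alpha> b *\<^sub>R b) \<longleftrightarrow> (\<forall>w. B v w = \<alpha> w)"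
proof
  assume h: "flat B v = (\<Sum>b\<in>Basis. \<alpha> b *\<^sub>R b)"
  have b: "B v b = \<alpha> b" if "b \<in> Basis" for b
    using arg_cong[OF h, of "\<lambda>z. z \<bullet> b"] that
    by (simp add: flat_inner inner_sum_left inner_Basis if_distrib sum.delta cong: if_cong)
  have l: "linear (B v)" using assms(1) by (simp add: bilinear_def)
  show "\<forall>w. B v w = \<alpha> w"
  proof
    fix w
    show "B v w = \<alpha> w"
      by (subst linear_expand[OF l], subst linear_expand[OF assms(2)]) (use b in simp)
  qed
qed (simp add: flat_def)

lemma inj_flat:
  fixes B :: "'a::euclidean_space \<Rightarrow> 'a \<Rightarrow> real"
  assumes "bilinear B" "nondegenerate B"
  shows "inj (flat B)"
proof (rule linear_injective_0[OF linear_flat[OF assms(1)], THEN iffD2], intro allI impI)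
  fix v assume "flat B v = 0"
  then have "flat B v = (\<Sum>b\<in>Basis. 0 *\<^sub>R b)" by simp
  then have "\<forall>w. B v w = 0"
    using flat_eq_iff[OF assms(1), of "\<lambda>_. 0" v] by (simp add: linear_iff)
  then show "v = 0" using assms(2) by (auto simp: nondegenerate_def)
qed

lemma nondegenerate_solution:
  fixes B :: "'a::euclidean_space \<Rightarrow> 'a \<Rightarrow> real"
  assumes "bilinear B" "nondegenerate B" "linear \<alpha>"
  shows "\<exists>v. \<forall>w. B v w = \<alpha> w"
proof -
  have "inj (flat B)" by (rule inj_flat[OF assms(1,2)])
  then have "surj (flat B)"
    using linear_injective_imp_surjective linear_flat[OF assms(1)] by blast
  then obtain v where "flat B v = (\<Sum>b\<in>Basis. \<alpha> b *\<^sub>R b)" by (metis surj_def)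
  then show ?thesis using flat_eq_iff[OF assms(1,3)] by blast
qed

lemma sharp_solves:
  assumes "bilinear (g x)" "nondegenerate (g x)" "linear \<alpha>"
  shows "g x (sharp g x \<alpha>) w = \<alpha> w"
proof -
  obtain v where v: "\<And>w. g x v w = \<alpha> w" using nondegenerate_solution[OF assms] by blast
  then have "sharp g x \<alpha> = v" by (intro sharp_eqI[of g x] assms)
  then show ?thesis using v by simp
qed

lemma nondegenerate_bound:
  assumes bil: "bilinear B" and nd: "nondegenerate B"
  obtains c where "c > 0" "\<And>v. norm v \<le> c * (\<Sum>b\<in>Basis. \<bar>B v b\<bar>)"
proof -
  have "inj (flat B)" by (rule inj_flat[OF bil nd])
  then obtain k where k: "k > 0" "\<And>v. norm (flat B v) \<ge> k * norm v"
    using linear_inj_bounded_below_pos[OF linear_flat[OF bil]] by blast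
  have "norm v \<le> (1 / k) * (\<Sum>b\<in>Basis. \<bar>B v b\<bar>)" for v
  proof -
    have "k * norm v \<le> norm (flat B v)" using k by blast
    also have "\<dots> \<le> (\<Sum>b\<in>Basis. \<bar>flat B v \<bullet> b\<bar>)" by (rule norm_le_l1)
    also have "\<dots> = (\<Sum>b\<in>Basis. \<bar>B v b\<bar>)" by (simp add: flat_inner)
    finally show ?thesis using k by (simp add: field_simps)
  qed
  then show ?thesis using that k by (metis zero_less_divide_1_iff)
qed

text \<open>Entries of the form within \<open>e\<close> of those at \<open>q0\<close> change each
  test value by at most \<open>D * e * norm v\<close>. The resulting bound is uniform along
  \<open>F\<close>, so it gives both solvability and boundedness of the solutions.\<close>

lemma nondegenerate_perturb:
  fixes B :: "'p::topological_space \<Rightarrow> 'a::euclidean_space \<Rightarrow> 'a \<Rightarrow> real"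
  assumes bil: "\<And>q. bilinear (B q)" and nd: "nondegenerate (B q0)"
    and cont: "\<And>v w. ((\<lambda>q. B q v w) \<longlongrightarrow> B q0 v w) F"
  obtains c where "c > 0" "eventually (\<lambda>q. \<forall>v. norm v \<le> c * (\<Sum>b\<in>Basis. \<bar>B q v b\<bar>)) F"
proof -
  obtain c where c: "c > 0" "\<And>v. norm v \<le> c * (\<Sum>b\<in>Basis. \<bar>B q0 v b\<bar>)"
    using nondegenerate_bound[OF bil nd] by metis
  define D where "D = real DIM('a)"
  have D: "D > 0" by (simp add: D_def)
  \<comment> \<open>With this value the total perturbation \<open>c * D * D * e * norm v\<close> is
    half of \<open>norm v\<close> and can be absorbed on the left, which doubles the
    constant.\<close>
  define e where "e = 1 / (2 * c * D * D)"
  have e: "e > 0" using c D by (simp add: e_def)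
  have "eventually (\<lambda>q. \<forall>i\<in>Basis. \<forall>b\<in>Basis. \<bar>B q i b - B q0 i b\<bar> < e) F"
    using tendstoD[OF cont e] by (simp add: eventually_ball_finite dist_real_def)
  then have "eventually (\<lambda>q. \<forall>v. norm v \<le> (2 * c) * (\<Sum>b\<in>Basis. \<bar>B q v b\<bar>)) F"
  proof eventually_elim
    case (elim q)
    show ?case
    proof
      fix v
      have 1: "\<bar>B q0 v b\<bar> \<le> \<bar>B q v b\<bar> + D * e * norm v" if b: "b \<in> Basis" for b
      proof -
        have "\<bar>B q v b - B q0 v b\<bar> = \<bar>\<Sum>i\<in>Basis. (v \<bullet> i) * (B q i b - B q0 i b)\<bar>"
          by (subst (1 2) bilinear_expand[OF bil]) (simp add: sum_subtractf right_diff_distrib)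
        also have "\<dots> \<le> (\<Sum>i\<in>(Basis::'a set). norm v * e)"
        proof (rule order_trans[OF sum_abs], rule sum_mono)
          fix i :: 'a assume i: "i \<in> Basis"
          have "\<bar>B q i b - B q0 i b\<bar> < e" using elim i b by blast
          then show "\<bar>(v \<bullet> i) * (B q i b - B q0 i b)\<bar> \<le> norm v * e"
            unfolding abs_mult using Basis_le_norm[OF i, of v] by (intro mult_mono) auto
        qed
        finally show ?thesis by (simp add: D_def algebra_simps)
      qed
      have "norm v \<le> c * (\<Sum>b\<in>Basis. \<bar>B q0 v b\<bar>)" by (rule c)
      also have "\<dots> \<le> c * (\<Sum>b\<in>Basis. \<bar>B q v b\<bar> + D * e * norm v)"
        using c 1 by (intro mult_left_mono sum_mono) auto
      also have "\<dots> = c * (\<Sum>b\<in>Basis. \<bar>B q v b\<bar>) + c * D * D * e * norm v"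
        by (simp add: sum.distrib D_def algebra_simps)
      also have "c * D * D * e * norm v = norm v / 2"
        using c D by (simp add: e_def)
      finally show "norm v \<le> (2 * c) * (\<Sum>b\<in>Basis. \<bar>B q v b\<bar>)" by simp
    qed
  qed
  then show ?thesis using that[of "2 * c"] c by simp
qed

lemma nondegenerate_if_bound:
  assumes "\<forall>v. norm v \<le> c * (\<Sum>b\<in>Basis. \<bar>B v b\<bar>)"
  shows "nondegenerate B"
  unfolding nondegenerate_def
proof (intro allI impI)
  fix v assume "\<forall>w. B v w = 0"
  then have "(\<Sum>b\<in>Basis. \<bar>B v b\<bar>) = 0" by simp
  then show "v = 0" using assms[rule_format, of v] by simp
qed

lemma has_derivative_nhds_eq:
  assumes "(f has_derivative D) (at a)" "eventually (\<lambda>q. f q = g q) (nhds a)"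
  shows "(g has_derivative D) (at a)"
  by (rule has_derivative_transform_eventually[OF assms(1)])
    (use assms(2) in \<open>auto simp: eventually_nhds_conv_at dest: eventually_nhds_x_imp_x\<close>)

lemma isCont_tendsto_nhds: "isCont f a \<Longrightarrow> (f \<longlongrightarrow> f a) (nhds a)"
  unfolding isCont_def tendsto_at_iff_tendsto_nhds .

text \<open>Implicit differentiation: \<open>dv\<close> solves the formally differentiated equation.
  Solutions near \<open>q0\<close> are bounded, hence converge to \<open>v0\<close>, hence are
  continuous at \<open>q0\<close>; as the change of \<open>B\<close> vanishes at \<open>q0\<close>,
  the product rule with a merely continuous factor then gives the derivative. Where
  \<open>B q\<close> is degenerate the described vector is arbitrary, but this does not happen near
  \<open>q0\<close>.\<close>

lemma sharp_param_has_derivative: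
  fixes B :: "'p::real_normed_vector \<Rightarrow> 'a::euclidean_space \<Rightarrow> 'a \<Rightarrow> real"
  assumes bil: "\<And>q. bilinear (B q)" and lin: "\<And>q. linear (\<alpha> q)"
    and B': "\<And>v w. ((\<lambda>q. B q v w) has_derivative (\<lambda>d. B' d v w)) (at q0)"
    and \<alpha>': "\<And>w. ((\<lambda>q. \<alpha> q w) has_derivative (\<lambda>d. \<alpha>' d w)) (at q0)"
    and nd: "nondegenerate (B q0)"
    and sol: "\<And>w. B q0 v0 w = \<alpha> q0 w"
    and dv: "\<And>d w. B q0 (dv d) w = \<alpha>' d w - B' d v0 w"
  shows "((\<lambda>q. THE v. \<forall>w. B q v w = \<alpha> q w) has_derivative dv) (at q0)"
proof -
  define V where "V q = (THE v. \<forall>w. B q v w = \<alpha> q w)" for q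
  have contB: "isCont (\<lambda>q. B q v w) q0" for v w using B' has_derivative_continuous by blast
  have cont\<alpha>: "isCont (\<lambda>q. \<alpha> q w) q0" for w using \<alpha>' has_derivative_continuous by blast
  have Bexp: "B q v w = (\<Sum>i\<in>Basis. (v \<bullet> i) * B q i w)" for q v w by (rule bilinear_expand[OF bil])
  obtain c where c: "c > 0" "eventually (\<lambda>q. \<forall>v. norm v \<le> c * (\<Sum>b\<in>Basis. \<bar>B q v b\<bar>)) (nhds q0)"
    using nondegenerate_perturb[of B q0 "nhds q0"] bil nd contB isCont_tendsto_nhds by blast
  have Vsol: "B q (V q) w = \<alpha> q w" if "nondegenerate (B q)" for q w
    using sharp_solves[of "\<lambda>_. B q" undefined "\<alpha> q"] that bil lin by (simp add: sharp_def V_def)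
  have V0: "V q0 = v0"
    using nondegenerate_uniqueE[OF bil nd Vsol[OF nd] sol] .
  obtain k where k: "k > 0" "\<And>v. norm v \<le> k * (\<Sum>b\<in>Basis. \<bar>B q0 v b\<bar>)"
    using nondegenerate_bound[OF bil nd] by metis
  define M where "M = c * (\<Sum>b\<in>Basis. \<bar>\<alpha> q0 b\<bar> + 1)"
  have "eventually (\<lambda>q. \<forall>b\<in>Basis. \<bar>\<alpha> q b\<bar> \<le> \<bar>\<alpha> q0 b\<bar> + 1) (nhds q0)"
  proof (rule eventually_ball_finite, simp, rule ballI)
    fix b
    have "((\<lambda>q. \<alpha> q b) \<longlongrightarrow> \<alpha> q0 b) (nhds q0)" by (rule isCont_tendsto_nhds[OF cont\<alpha>])
    from tendstoD[OF this zero_less_one] show "eventually (\<lambda>q. \<bar>\<alpha> q b\<bar> \<le> \<bar>\<alpha> q0 b\<bar> + 1) (nhds q0)"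
      by eventually_elim (auto simp: dist_real_def)
  qed
  with c(2) have good: "eventually (\<lambda>q. (\<forall>w. B q (V q) w = \<alpha> q w) \<and> norm (V q) \<le> M) (nhds q0)"
  proof eventually_elim
    case (elim q)
    have s: "\<forall>w. B q (V q) w = \<alpha> q w" using Vsol nondegenerate_if_bound elim by blast
    have "norm (V q) \<le> c * (\<Sum>b\<in>Basis. \<bar>B q (V q) b\<bar>)" using elim by blast
    also have "\<dots> \<le> M" unfolding M_def using s elim c by (intro mult_left_mono sum_mono) auto
    finally show ?case using s by blast
  qed
  \<comment> \<open>\<open>V q - v0\<close> solves the system at \<open>q0\<close> with the right-hand side \<open>R q\<close>, which is small.\<close>
  define R where "R q b = (\<alpha> q b - \<alpha> q0 b) - (\<Sum>i\<in>Basis. (V q \<bullet> i) * (B q i b - B q0 i b))" for q b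
  have R: "B q0 (V q - v0) b = R q b" if "\<forall>w. B q (V q) w = \<alpha> q w" for q b
  proof -
    have "R q b = (\<alpha> q b - \<alpha> q0 b) - (B q (V q) b - B q0 (V q) b)"
      unfolding R_def by (subst (3 4) Bexp) (simp add: sum_subtractf right_diff_distrib)
    then show ?thesis using that sol by (simp add: bilinear_lsub[OF bil])
  qed
  have Rlim: "((\<lambda>q. R q b) \<longlongrightarrow> 0) (nhds q0)" for b
  proof -
    have "((\<lambda>q. (V q \<bullet> i) * (B q i b - B q0 i b)) \<longlongrightarrow> 0) (nhds q0)" if i: "i \<in> Basis" for i
    proof (rule Lim_null_comparison[where g = "\<lambda>q. M * \<bar>B q i b - B q0 i b\<bar>"])
      show "eventually (\<lambda>q. norm (V q \<bullet> i * (B q i b - B q0 i b)) \<le> M * \<bar>B q i b - B q0 i b\<bar>) (nhds q0)"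
        using good
      proof eventually_elim
        case (elim q)
        then have "\<bar>V q \<bullet> i\<bar> \<le> M" using Basis_le_norm[OF i, of "V q"] by linarith
        then show ?case by (simp add: abs_mult mult_right_mono)
      qed
      have "((\<lambda>q. B q i b) \<longlongrightarrow> B q0 i b) (nhds q0)"
        by (rule isCont_tendsto_nhds[OF contB])
      then have "((\<lambda>q. M * \<bar>B q i b - B q0 i b\<bar>) \<longlongrightarrow> M * \<bar>B q0 i b - B q0 i b\<bar>) (nhds q0)"
        by (intro tendsto_intros)
      then show "((\<lambda>q. M * \<bar>B q i b - B q0 i b\<bar>) \<longlongrightarrow> 0) (nhds q0)" by simp
    qed
    moreover have "((\<lambda>q. \<alpha> q b) \<longlongrightarrow> \<alpha> q0 b) (nhds q0)"
      by (rule isCont_tendsto_nhds[OF cont\<alpha>])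
    ultimately have "((\<lambda>q. R q b) \<longlongrightarrow> (\<alpha> q0 b - \<alpha> q0 b) - (\<Sum>i\<in>(Basis::'a set). 0)) (nhds q0)"
      unfolding R_def by (intro tendsto_intros) auto
    then show ?thesis by simp
  qed
  have Vlim: "(V \<longlongrightarrow> v0) (nhds q0)"
  proof -
    have "((\<lambda>q. V q - v0) \<longlongrightarrow> 0) (nhds q0)"
    proof (rule Lim_null_comparison[where g = "\<lambda>q. k * (\<Sum>b\<in>Basis. \<bar>R q b\<bar>)"])
      show "eventually (\<lambda>q. norm (V q - v0) \<le> k * (\<Sum>b\<in>Basis. \<bar>R q b\<bar>)) (nhds q0)"
        using good
      proof eventually_elim
        case (elim q)
        then show ?case using k(2)[of "V q - v0"] R[of q] by simp
      qed
      have "((\<lambda>q. k * (\<Sum>b\<in>Basis. \<bar>R q b\<bar>)) \<longlongrightarrow> k * (\<Sum>b\<in>(Basis::'a set). \<bar>0\<bar>)) (nhds q0)"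
        by (intro tendsto_intros Rlim)
      then show "((\<lambda>q. k * (\<Sum>b\<in>Basis. \<bar>R q b\<bar>)) \<longlongrightarrow> 0) (nhds q0)" by simp
    qed
    then show ?thesis by (rule LIM_zero_cancel)
  qed
  then have Vcont: "isCont V q0" by (simp add: isCont_def V0 tendsto_mono[OF at_within_le_nhds])
  have R': "((\<lambda>q. R q b) has_derivative (\<lambda>d. \<alpha>' d b - B' d v0 b)) (at q0)" for b
  proof -
    have "((\<lambda>q. R q b) has_derivative (\<lambda>d. (\<alpha>' d b - 0) - (\<Sum>i\<in>Basis. (V q0 \<bullet> i) * (B' d i b - 0)))) (at q0)"
      unfolding R_def
    proof (intro has_derivative_diff has_derivative_sum has_derivative_mult_vanishing \<alpha>' B' has_derivative_const)
      fix i :: 'a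
      show "isCont (\<lambda>q. V q \<bullet> i) q0" using Vcont by (intro continuous_intros)
    qed auto
    moreover have "(\<Sum>i\<in>Basis. (v0 \<bullet> i) * B' d i b) = B' d v0 b" for d
    proof -
      have "((\<lambda>q. B q v0 b) has_derivative (\<lambda>d. \<Sum>i\<in>Basis. (v0 \<bullet> i) * B' d i b)) (at q0)"
        by (subst Bexp) (intro has_derivative_sum has_derivative_mult_right B')
      from fun_cong[OF has_derivative_unique[OF B'[of v0 b] this], of d] show ?thesis by simp
    qed
    ultimately show ?thesis by (simp add: V0)
  qed
  \<comment> \<open>Inverting only at the fixed point \<open>q0\<close> gives a single linear map,
    through which differentiability passes from \<open>R\<close> to \<open>V\<close>.\<close>
  define G where "G = inv (flat (B q0))"
  have inj: "inj (flat (B q0))" by (rule inj_flat[OF bil nd])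
  have linG: "linear G"
    unfolding G_def using linear_flat[OF bil] inj
    by (rule inj_linear_imp_inv_linear)
  have GV: "V q = v0 + G (\<Sum>b\<in>Basis. R q b *\<^sub>R b)" if "\<forall>w. B q (V q) w = \<alpha> q w" for q
  proof -
    have "flat (B q0) (V q - v0) = (\<Sum>b\<in>Basis. R q b *\<^sub>R b)"
      unfolding flat_def using R[OF that] by simp
    then have "V q - v0 = G (\<Sum>b\<in>Basis. R q b *\<^sub>R b)"
      unfolding G_def using inj by (metis inv_f_f)
    then show ?thesis by (simp add: algebra_simps)
  qed
  have "((\<lambda>q. v0 + G (\<Sum>b\<in>Basis. R q b *\<^sub>R b)) has_derivative
      (\<lambda>d. 0 + G (\<Sum>b\<in>Basis. (\<alpha>' d b - B' d v0 b) *\<^sub>R b))) (at q0)"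
    by (intro has_derivative_add has_derivative_const
        bounded_linear.has_derivative[OF linear_conv_bounded_linear[THEN iffD1, OF linG]]
        has_derivative_sum has_derivative_scaleR_left R')
  moreover have "G (\<Sum>b\<in>Basis. (\<alpha>' d b - B' d v0 b) *\<^sub>R b) = dv d" for d
  proof -
    have "flat (B q0) (dv d) = (\<Sum>b\<in>Basis. (\<alpha>' d b - B' d v0 b) *\<^sub>R b)"
      unfolding flat_def using dv by simp
    then show ?thesis unfolding G_def using inj by (metis inv_f_f)
  qed
  ultimately have "((\<lambda>q. v0 + G (\<Sum>b\<in>Basis. R q b *\<^sub>R b)) has_derivative dv) (at q0)"
    by simp
  moreover have "eventually (\<lambda>q. v0 + G (\<Sum>b\<in>Basis. R q b *\<^sub>R b) = V q) (nhds q0)"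
    using good by eventually_elim (rule GV[symmetric], blast)
  ultimately have "(V has_derivative dv) (at q0)"
    by (rule has_derivative_nhds_eq)
  then show ?thesis by (simp add: V_def[abs_def])
qed

lemma bilinear_expand2:
  fixes B :: "'a::euclidean_space \<Rightarrow> 'b::euclidean_space \<Rightarrow> 'c::real_vector"
  assumes "bilinear B"
  shows "B v w = (\<Sum>i\<in>Basis. \<Sum>j\<in>Basis. ((v \<bullet> i) * (w \<bullet> j)) *\<^sub>R B i j)"
proof -
  have l: "linear (\<lambda>v. B v w)" and r: "linear (B i)" for w i using assms by (auto simp: bilinear_def)
  have "B v w = (\<Sum>i\<in>Basis. (v \<bullet> i) *\<^sub>R B i w)"
    by (rule linear_expand[OF l])
  also have "\<dots> = (\<Sum>i\<in>Basis. (v \<bullet> i) *\<^sub>R (\<Sum>j\<in>Basis. (w \<bullet> j) *\<^sub>R B i j))"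
    by (subst linear_expand[OF r]) (rule refl)
  finally show ?thesis by (simp add: scaleR_sum_right)
qed

text \<open>Derivatives are unique, so each linearity relation valid near \<open>q0\<close> passes
  to the derivatives at \<open>q0\<close>.\<close>

lemma bilinear_derivative:
  fixes B :: "'p::real_normed_vector \<Rightarrow> 'a::euclidean_space \<Rightarrow> 'b::euclidean_space \<Rightarrow> 'c::real_normed_vector"
  assumes bil: "eventually (\<lambda>q. bilinear (B q)) (nhds q0)"
    and B': "\<And>v w. ((\<lambda>q. B q v w) has_derivative (\<lambda>d. B' d v w)) (at q0)"
  shows "bilinear (B' d)"
proof -
  have *: "B' d v w = D d" if "((\<lambda>q. B q v w) has_derivative D) (at q0)" for v w D
    using fun_cong[OF has_derivative_unique[OF B' that], of d] by simp
  show ?thesis unfolding bilinear_def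
  proof (intro conjI allI linearI)
    fix v w w' :: 'b and u u' :: 'a and r :: real
    show "B' d u (w + w') = B' d u w + B' d u w'"
      by (rule *[of _ _ "\<lambda>d. B' d u w + B' d u w'"], rule has_derivative_nhds_eq, rule has_derivative_add[OF B' B'])
        (use bil in eventually_elim, simp add: bilinear_radd)
    show "B' d u (r *\<^sub>R w) = r *\<^sub>R B' d u w"
      by (rule *[of _ _ "\<lambda>d. r *\<^sub>R B' d u w"], rule has_derivative_nhds_eq, rule has_derivative_scaleR_right[OF B'])
        (use bil in eventually_elim, simp add: bilinear_rmul)
    show "B' d (u + u') w = B' d u w + B' d u' w"
      by (rule *[of _ _ "\<lambda>d. B' d u w + B' d u' w"], rule has_derivative_nhds_eq, rule has_derivative_add[OF B' B'])
        (use bil in eventually_elim, simp add: bilinear_ladd)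
    show "B' d (r *\<^sub>R u) w = r *\<^sub>R B' d u w"
      by (rule *[of _ _ "\<lambda>d. r *\<^sub>R B' d u w"], rule has_derivative_nhds_eq, rule has_derivative_scaleR_right[OF B'])
        (use bil in eventually_elim, simp add: bilinear_lmul)
  qed
qed

lemma bilinear_param_has_derivative:
  fixes B :: "'p::real_normed_vector \<Rightarrow> 'a::euclidean_space \<Rightarrow> 'b::euclidean_space \<Rightarrow> 'c::real_normed_vector"
  assumes bil: "eventually (\<lambda>q. bilinear (B q)) (nhds q0)"
    and B': "\<And>v w. ((\<lambda>q. B q v w) has_derivative (\<lambda>d. B' d v w)) (at q0)"
    and U: "(U has_derivative U') (at q0)" and V: "(V has_derivative V') (at q0)"
  shows "((\<lambda>q. B q (U q) (V q)) has_derivative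
    (\<lambda>d. B' d (U q0) (V q0) + B q0 (U' d) (V q0) + B q0 (U q0) (V' d))) (at q0)"
proof -
  have b0: "bilinear (B q0)" using bil by (rule eventually_nhds_x_imp_x)
  have b': "bilinear (B' d)" for d by (rule bilinear_derivative[OF bil B'])
  have "((\<lambda>q. \<Sum>i\<in>Basis. \<Sum>j\<in>Basis. ((U q \<bullet> i) * (V q \<bullet> j)) *\<^sub>R B q i j) has_derivative
    (\<lambda>d. \<Sum>i\<in>Basis. \<Sum>j\<in>Basis. ((U q0 \<bullet> i) * (V q0 \<bullet> j)) *\<^sub>R B' d i j
       + ((U q0 \<bullet> i) * (V' d \<bullet> j) + (U' d \<bullet> i) * (V q0 \<bullet> j)) *\<^sub>R B q0 i j)) (at q0)"
    by (intro has_derivative_sum has_derivative_scaleR has_derivative_mult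
        has_derivative_inner_left U V B')
  also have "(\<lambda>d. \<Sum>i\<in>Basis. \<Sum>j\<in>Basis. ((U q0 \<bullet> i) * (V q0 \<bullet> j)) *\<^sub>R B' d i j
       + ((U q0 \<bullet> i) * (V' d \<bullet> j) + (U' d \<bullet> i) * (V q0 \<bullet> j)) *\<^sub>R B q0 i j)
     = (\<lambda>d. B' d (U q0) (V q0) + B q0 (U' d) (V q0) + B q0 (U q0) (V' d))"
  proof
    fix d
    show "(\<Sum>i\<in>Basis. \<Sum>j\<in>Basis. ((U q0 \<bullet> i) * (V q0 \<bullet> j)) *\<^sub>R B' d i j
       + ((U q0 \<bullet> i) * (V' d \<bullet> j) + (U' d \<bullet> i) * (V q0 \<bullet> j)) *\<^sub>R B q0 i j)
     = B' d (U q0) (V q0) + B q0 (U' d) (V q0) + B q0 (U q0) (V' d)"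
      by (subst bilinear_expand2[OF b'], subst (2 3) bilinear_expand2[OF b0])
        (simp add: sum.distrib scaleR_add_left)
  qed
  finally have D: "((\<lambda>q. \<Sum>i\<in>Basis. \<Sum>j\<in>Basis. ((U q \<bullet> i) * (V q \<bullet> j)) *\<^sub>R B q i j) has_derivative
    (\<lambda>d. B' d (U q0) (V q0) + B q0 (U' d) (V q0) + B q0 (U q0) (V' d))) (at q0)" .
  have "eventually (\<lambda>q. (\<Sum>i\<in>Basis. \<Sum>j\<in>Basis. ((U q \<bullet> i) * (V q \<bullet> j)) *\<^sub>R B q i j) = B q (U q) (V q)) (nhds q0)"
    using bil by eventually_elim (rule bilinear_expand2[symmetric])
  with D show ?thesis by (rule has_derivative_nhds_eq)
qed


section \<open>The linearized Ricci tensor\<close>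

text \<open>The derivatives are hidden under an existential, so that closure rules chain without
  carrying formulas; \<open>twice_c2\<close> recovers the canonical derivatives.\<close>

definition twice :: "('a::euclidean_space \<Rightarrow> real) \<Rightarrow> bool" where
  "twice F \<longleftrightarrow> (\<exists>F1 F2. c2 F F1 F2)"

lemma twice_c2:
  assumes "twice F"
  shows "c2 F (\<lambda>x. frechet_derivative F (at x))
    (\<lambda>x u. frechet_derivative (\<lambda>y. frechet_derivative F (at y) u) (at x))"
proof -
  obtain F1 F2 where c: "c2 F F1 F2" using assms by (auto simp: twice_def)
  have 1: "F1 = (\<lambda>x. frechet_derivative F (at x))"
    using frechet_derivative_at[OF c2D1[OF c]] by (intro ext) simp
  have "F2 = (\<lambda>x u. frechet_derivative (\<lambda>y. F1 y u) (at x))"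
    using frechet_derivative_at[OF c2D2[OF c]] by (intro ext) simp
  then show ?thesis using c 1 by simp
qed

definition partial22 :: "'a::euclidean_space tensor2 \<Rightarrow> 'a \<Rightarrow> 'a \<Rightarrow> 'a \<Rightarrow> 'a \<Rightarrow> 'a \<Rightarrow> real" where
  "partial22 g p u d v w = frechet_derivative (\<lambda>y. partial2 g y u v w) (at p) d"

text \<open>The Christoffel symbol of the first kind, with \<open>w\<close> in the lowered slot;
  \<open>koszul2\<close> is its derivative in direction \<open>d\<close>. Unlike
  \<open>christoffel\<close>, both depend linearly on the tensor.\<close>

definition koszul :: "'a::euclidean_space tensor2 \<Rightarrow> 'a \<Rightarrow> 'a \<Rightarrow> 'a \<Rightarrow> 'a \<Rightarrow> real" where
  "koszul g p u v w = (partial2 g p u v w + partial2 g p v u w - partial2 g p w u v) / 2"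

definition koszul2 :: "'a::euclidean_space tensor2 \<Rightarrow> 'a \<Rightarrow> 'a \<Rightarrow> 'a \<Rightarrow> 'a \<Rightarrow> 'a \<Rightarrow> real" where
  "koszul2 g p d u v w = (partial22 g p u d v w + partial22 g p v d u w - partial22 g p w d u v) / 2"

lemma christoffel_koszul: "christoffel g p u v = sharp g p (koszul g p u v)"
  by (simp add: christoffel_def koszul_def[abs_def])

locale smooth_tensor =
  fixes g :: "'a::euclidean_space tensor2"
  assumes sym: "symmetric_form (g p)" and tw: "twice (\<lambda>p. g p u v)"
begin

lemma bil: "bilinear (g p)"
  using sym by (simp add: symmetric_form_def)

lemma commute: "g p u v = g p v u"
  using sym by (simp add: symmetric_form_def)

lemma g_c2: "c2 (\<lambda>p. g p u v) (\<lambda>p d. partial2 g p d u v) (\<lambda>p d e. partial22 g p d e u v)"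
  using twice_c2[OF tw] by (simp add: partial2_def partial22_def)

lemma D1: "((\<lambda>p. g p u v) has_derivative (\<lambda>d. partial2 g p d u v)) (at p)"
  by (rule c2D1[OF g_c2])

lemma D2: "((\<lambda>p. partial2 g p d u v) has_derivative (\<lambda>e. partial22 g p d e u v)) (at p)"
  by (rule c2D2[OF g_c2])

lemma partial2_bil: "bilinear (partial2 g p d)"
  by (rule bilinear_derivative[OF _ D1]) (simp add: bil)

lemma partial22_bil: "bilinear (partial22 g p d e)"
  by (rule bilinear_derivative[OF _ D2]) (simp add: partial2_bil)

lemma partial2_commute: "partial2 g p d u v = partial2 g p d v u"
  using commute by (simp add: partial2_def)

lemma partial2_lin: "linear (\<lambda>d. partial2 g p d u v)"
  by (rule linear_c2D1[OF g_c2])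

lemma partial22_lin: "linear (\<lambda>d. partial22 g p d e u v)" "linear (\<lambda>e. partial22 g p d e u v)"
  by (rule linear_c2D2'[OF g_c2], rule linear_c2D2[OF g_c2])

lemmas lins = partial2_lin partial22_lin partial2_bil[unfolded bilinear_def, THEN conjunct1, rule_format]
  partial2_bil[unfolded bilinear_def, THEN conjunct2, rule_format]
  partial22_bil[unfolded bilinear_def, THEN conjunct1, rule_format]
  partial22_bil[unfolded bilinear_def, THEN conjunct2, rule_format]

lemma koszul_linear: "linear (koszul g p u v)" "linear (\<lambda>v. koszul g p u v w)" "linear (\<lambda>u. koszul g p u v w)"
  unfolding koszul_def
  by (rule linearI; simp add: lins[THEN linear_add] lins[THEN linear_scale] field_simps)+

lemma koszul2_linear: "linear (koszul2 g p d u v)"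
  unfolding koszul2_def
  by (rule linearI) (simp_all add: lins[THEN linear_add] lins[THEN linear_scale] field_simps)

lemma koszul_has_derivative:
  "((\<lambda>y. koszul g y u v w) has_derivative (\<lambda>d. koszul2 g p d u v w)) (at p)"
  unfolding koszul_def koszul2_def
  unfolding divide_inverse
  by (intro has_derivative_mult_left has_derivative_add has_derivative_diff D2)

lemma tensor_has_derivative:
  assumes "(U has_derivative U') (at p)" "(V has_derivative V') (at p)"
  shows "((\<lambda>y. g y (U y) (V y)) has_derivative
    (\<lambda>d. partial2 g p d (U p) (V p) + g p (U' d) (V p) + g p (U p) (V' d))) (at p)"
  by (rule bilinear_param_has_derivative[OF _ D1 assms]) (simp add: bil)

end

lemma bilinear_sharp:
  assumes g: "bilinear (g p)" "nondegenerate (g p)"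
    and l: "\<And>u v. linear (\<alpha> u v)" "\<And>u w. linear (\<lambda>v. \<alpha> u v w)" "\<And>v w. linear (\<lambda>u. \<alpha> u v w)"
  shows "bilinear (\<lambda>u v. sharp g p (\<alpha> u v))"
proof -
  note s = sharp_solves[of g p, OF g l(1)]
  show ?thesis unfolding bilinear_def
    by (intro conjI allI linearI; rule sharp_eqI[of g p, OF g])
      (simp_all add: bilinear_ladd[OF g(1)] bilinear_lmul[OF g(1)] s l[THEN linear_add] l[THEN linear_scale])
qed

context smooth_tensor
begin

context
  fixes p assumes nd: "nondegenerate (g p)"
begin

lemma christoffel_solves: "g p (christoffel g p u v) w = koszul g p u v w"
  unfolding christoffel_koszul by (rule sharp_solves[of g p, OF bil nd koszul_linear(1)])

lemma christoffel_bil: "bilinear (christoffel g p)"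
  using bilinear_sharp[of g p "koszul g p", OF bil nd koszul_linear]
  by (simp add: christoffel_koszul[abs_def])

lemma christoffel_commute: "christoffel g p u v = christoffel g p v u"
  unfolding christoffel_def by (simp add: partial2_commute[of p _ u v] add.commute)

lemma dchristoffel_linear: "linear (\<lambda>w. koszul2 g p d u v w - partial2 g p d (christoffel g p u v) w)"
  by (intro linear_compose_sub koszul2_linear lins)

text \<open>The stated vector solves the system obtained by differentiating
  \<open>christoffel_solves\<close> in the base point.\<close>

lemma christoffel_has_derivative:
  "((\<lambda>y. christoffel g y u v) has_derivative
    (\<lambda>d. sharp g p (\<lambda>w. koszul2 g p d u v w - partial2 g p d (christoffel g p u v) w))) (at p)"
  unfolding christoffel_koszul sharp_def[of g]
proof (rule sharp_param_has_derivative[where B = g and \<alpha> = "\<lambda>y. koszul g y u v" and ?q0.0 = p])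
  show "g p (THE va. \<forall>w. g p va w = koszul g p u v w) w = koszul g p u v w" for w
    using christoffel_solves[of u v w] by (simp add: christoffel_koszul sharp_def)
  show "g p (THE va. \<forall>w. g p va w = koszul2 g p d u v w - partial2 g p d (THE va. \<forall>w. g p va w = koszul g p u v w) w) w =
      koszul2 g p d u v w - partial2 g p d (THE va. \<forall>w. g p va w = koszul g p u v w) w" for d w
    using sharp_solves[of g p, OF bil nd dchristoffel_linear[of d u v]]
    by (simp add: christoffel_koszul sharp_def)
qed (use bil nd koszul_linear(1) D1 koszul_has_derivative in auto)

end

end

locale metric_variation = smooth_tensor g + h: smooth_tensor h
  for g h :: "'a::euclidean_space tensor2" +
  assumes nd: "nondegenerate (g p)"
begin

abbreviation "G \<equiv> christoffel g"

abbreviation "C \<equiv> delta_christoffel g h"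

text \<open>The connection terms of the three covariant derivatives cancel in pairs by symmetry,
  except the two with \<open>G p u v\<close>, which add up.\<close>

lemma delta_christoffel_eq: "C p u v = sharp g p (\<lambda>w. koszul h p u v w - h p (G p u v) w)"
proof -
  have "(nabla2 g h p u v w + nabla2 g h p v u w - nabla2 g h p w u v) / 2 =
      koszul h p u v w - h p (G p u v) w" for w
    unfolding nabla2_def koszul_def christoffel_commute[OF nd, of p v u] christoffel_commute[OF nd, of p w]
      h.commute[of p v "G p u w"] by (simp add: field_simps)
  then show ?thesis unfolding delta_christoffel_def by (rule arg_cong[where f = "sharp g p", OF ext])
qed

lemma C_linear:
  "linear (\<lambda>w. koszul h p u v w - h p (G p u v) w)"
  "linear (\<lambda>v. koszul h p u v w - h p (G p u v) w)"
  "linear (\<lambda>u. koszul h p u v w - h p (G p u v) w)"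
proof -
  note b = christoffel_bil[OF nd, of p]
  show "linear (\<lambda>w. koszul h p u v w - h p (G p u v) w)"
    "linear (\<lambda>v. koszul h p u v w - h p (G p u v) w)"
    "linear (\<lambda>u. koszul h p u v w - h p (G p u v) w)"
    by (intro linear_compose_sub h.koszul_linear, rule linearI;
      simp add: bilinear_radd[OF h.bil] bilinear_rmul[OF h.bil] bilinear_ladd[OF h.bil] bilinear_lmul[OF h.bil]
       bilinear_radd[OF b] bilinear_rmul[OF b] bilinear_ladd[OF b] bilinear_lmul[OF b])+
qed

lemma C_bil: "bilinear (C p)"
  using bilinear_sharp[of g p "\<lambda>u v w. koszul h p u v w - h p (G p u v) w", OF bil nd C_linear]
  by (simp add: delta_christoffel_eq[abs_def])

lemma C_solves: "g p (C p u v) w = koszul h p u v w - h p (G p u v) w"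
  unfolding delta_christoffel_eq by (rule sharp_solves[of g p, OF bil nd C_linear(1)])

lemma C_commute: "C p u v = C p v u"
  by (simp add: delta_christoffel_eq koszul_def h.partial2_commute[of p _ u v] christoffel_commute[OF nd, of p u v] add.commute)

text \<open>The right-hand side comes from differentiating \<open>C_solves\<close> in the base point
  in direction \<open>d\<close> and isolating the derivative of \<open>C\<close>.\<close>

definition dC :: "'a \<Rightarrow> 'a \<Rightarrow> 'a \<Rightarrow> 'a \<Rightarrow> 'a" where
  "dC p d u v = sharp g p (\<lambda>w. koszul2 h p d u v w - partial2 h p d (G p u v) w
      - h p (frechet_derivative (\<lambda>y. G y u v) (at p) d) w - partial2 g p d (C p u v) w)"

lemma dC_linear: "linear (\<lambda>w. koszul2 h p d u v w - partial2 h p d (G p u v) w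
      - h p X w - partial2 g p d Y w)"
  by (intro linear_compose_sub h.koszul2_linear h.lins lins) (use h.bil in \<open>simp add: bilinear_def\<close>)

lemma dC_solves: "g p (dC p d u v) w = koszul2 h p d u v w - partial2 h p d (G p u v) w
      - h p (frechet_derivative (\<lambda>y. G y u v) (at p) d) w - partial2 g p d (C p u v) w"
  unfolding dC_def by (rule sharp_solves[of g p, OF bil nd dC_linear])

lemma G_differentiable: "((\<lambda>y. G y u v) has_derivative frechet_derivative (\<lambda>y. G y u v) (at p)) (at p)"
  using christoffel_has_derivative[OF nd] frechet_derivative_works differentiableI by blast

lemma C_has_derivative: "((\<lambda>y. C y u v) has_derivative (\<lambda>d. dC p d u v)) (at p)"
  unfolding delta_christoffel_eq sharp_def[of g]
proof (rule sharp_param_has_derivative[where B = g and \<alpha> = "\<lambda>y w. koszul h y u v w - h y (G y u v) w" and ?q0.0 = p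
    and B' = "\<lambda>d. partial2 g p d"
    and \<alpha>' = "\<lambda>d w. koszul2 h p d u v w - (partial2 h p d (G p u v) w + h p (frechet_derivative (\<lambda>y. G y u v) (at p) d) w + h p (G p u v) 0)"])
  show "g p (C p u v) w = koszul h p u v w - h p (G p u v) w" for w by (rule C_solves)
  show "((\<lambda>q. koszul h q u v w - h q (G q u v) w) has_derivative
       (\<lambda>d. koszul2 h p d u v w - (partial2 h p d (G p u v) w +
               h p (frechet_derivative (\<lambda>y. G y u v) (at p) d) w + h p (G p u v) 0))) (at p)" for w
    by (intro has_derivative_diff h.koszul_has_derivative h.tensor_has_derivative[OF G_differentiable] has_derivative_const)
  show "g p (dC p d u v) w = koszul2 h p d u v w - (partial2 h p d (G p u v) w +
         h p (frechet_derivative (\<lambda>y. G y u v) (at p) d) w + h p (G p u v) 0) - partial2 g p d (C p u v) w" for d w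
    unfolding dC_solves using bilinear_rzero[OF h.bil] by simp
qed (use bil nd C_linear(1) D1 in auto)

section \<open>The affine family of metrics and its derivative in the parameter\<close>

definition gs :: "real \<Rightarrow> 'a tensor2" where
  "gs s = (\<lambda>y a b. g y a b + s * h y a b)"

lemma gs_c2: "c2 (\<lambda>p. gs s p u v) (\<lambda>p d. partial2 g p d u v + s * partial2 h p d u v)
    (\<lambda>p d e. partial22 g p d e u v + s * partial22 h p d e u v)"
  unfolding gs_def c2_def
  by (intro conjI allI has_derivative_add has_derivative_mult_right D1 D2 h.D1 h.D2)

lemma gs_smooth: "smooth_tensor (gs s)"
proof
  show "twice (\<lambda>p. gs s p u v)" for u v unfolding twice_def by (intro exI) (rule gs_c2)
  show "symmetric_form (gs s p)" for p
    unfolding symmetric_form_def bilinear_def gs_def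
    by (intro conjI allI linearI)
      (simp_all add: bilinear_radd[OF h.bil] bilinear_rmul[OF h.bil] bilinear_ladd[OF h.bil] bilinear_lmul[OF h.bil]
       bilinear_radd[OF bil] bilinear_rmul[OF bil] bilinear_ladd[OF bil] bilinear_lmul[OF bil]
       commute[of p] h.commute[of p] algebra_simps)
qed

lemma partial2_gs: "partial2 (gs s) p d u v = partial2 g p d u v + s * partial2 h p d u v"
  using c2_unique(1)[OF smooth_tensor.g_c2[OF gs_smooth] gs_c2] by (metis (no_types, lifting))

lemma partial22_gs: "partial22 (gs s) p d e u v = partial22 g p d e u v + s * partial22 h p d e u v"
  using c2_unique(2)[OF smooth_tensor.g_c2[OF gs_smooth] gs_c2] by (metis (no_types, lifting))

lemma koszul_gs: "koszul (gs s) p u v w = koszul g p u v w + s * koszul h p u v w"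
  by (simp add: koszul_def partial2_gs field_simps)

lemma koszul2_gs: "koszul2 (gs s) p d u v w = koszul2 g p d u v w + s * koszul2 h p d u v w"
  by (simp add: koszul2_def partial22_gs field_simps)

text \<open>Nondegeneracy is an open condition at each fixed \<open>p\<close>. This suffices,
  because differentiating \<open>christoffel\<close> at \<open>p\<close> only asks for nondegeneracy
  at \<open>p\<close> itself.\<close>

lemma gs_nd: "eventually (\<lambda>s. nondegenerate (gs s p)) (nhds 0)"
proof -
  have "((\<lambda>s. gs s p v w) \<longlongrightarrow> gs 0 p v w) (nhds 0)" for v w
    unfolding gs_def by (intro isCont_tendsto_nhds[where f = "\<lambda>s. g p v w + s * h p v w"] continuous_intros)
  moreover have "nondegenerate (gs 0 p)" using nd by (simp add: gs_def)
  ultimately obtain c where "eventually (\<lambda>s. \<forall>v. norm v \<le> c * (\<Sum>b\<in>Basis. \<bar>gs s p v b\<bar>)) (nhds 0)"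
    using nondegenerate_perturb[of "\<lambda>s. gs s p" 0 "nhds 0"] smooth_tensor.bil[OF gs_smooth] by blast
  then show ?thesis by eventually_elim (rule nondegenerate_if_bound)
qed

lemma gs_deriv: "((\<lambda>s. gs s p v w) has_derivative (\<lambda>r. r * h p v w)) (at 0)"
  unfolding gs_def by (auto intro!: derivative_eq_intros)

lemma gs0: "gs 0 = g" by (simp add: gs_def)

lemma Gs_deriv: "((\<lambda>s. christoffel (gs s) p u v) has_derivative (\<lambda>r. r *\<^sub>R C p u v)) (at 0)"
  unfolding christoffel_koszul sharp_def[of "gs _"]
proof (rule sharp_param_has_derivative[where B = "\<lambda>s. gs s p" and \<alpha> = "\<lambda>s. koszul (gs s) p u v" and ?q0.0 = 0
    and B' = "\<lambda>r v w. r * h p v w" and \<alpha>' = "\<lambda>r w. r * koszul h p u v w" and ?v0.0 = "G p u v"])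
  show "((\<lambda>q. koszul (gs q) p u v w) has_derivative (\<lambda>d. d * koszul h p u v w)) (at 0)" for w
    unfolding koszul_gs by (auto intro!: derivative_eq_intros)
  show "gs 0 p (d *\<^sub>R C p u v) w = d * koszul h p u v w - d * h p (G p u v) w" for d w
    by (simp add: gs0 bilinear_lmul[OF bil] C_solves algebra_simps)
qed (use smooth_tensor.bil[OF gs_smooth] smooth_tensor.koszul_linear(1)[OF gs_smooth] nd
    christoffel_solves[OF nd] gs_deriv in \<open>auto simp: gs0\<close>)

definition dGs where
  "dGs p d u v s = sharp (gs s) p (\<lambda>w. koszul2 (gs s) p d u v w - partial2 (gs s) p d (christoffel (gs s) p u v) w)"

lemma frechet_Gs:
  assumes "nondegenerate (gs s p)"
  shows "frechet_derivative (\<lambda>y. christoffel (gs s) y u v) (at p) d = dGs p d u v s"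
  using fun_cong[OF frechet_derivative_at[OF smooth_tensor.christoffel_has_derivative[OF gs_smooth assms, of u v]], of d]
  by (simp add: dGs_def)

text \<open>Interchange of the derivatives in \<open>s\<close> and in the base point:
  \<open>dGs\<close> and \<open>dC\<close> both solve linear systems, and differentiating the system
  for \<open>dGs\<close> in \<open>s\<close> yields the one for \<open>dC\<close>. Two derivatives
  of the tensors are enough for this.\<close>

lemma dGs_deriv: "((\<lambda>s. dGs p d u v s) has_derivative (\<lambda>r. r *\<^sub>R dC p d u v)) (at 0)"
  unfolding dGs_def sharp_def[of "gs _"]
proof (rule sharp_param_has_derivative[where B = "\<lambda>s. gs s p" and ?q0.0 = 0
    and \<alpha> = "\<lambda>s w. koszul2 (gs s) p d u v w - partial2 (gs s) p d (christoffel (gs s) p u v) w"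
    and B' = "\<lambda>r v w. r * h p v w"
    and \<alpha>' = "\<lambda>r w. r * koszul2 h p d u v w - (r * partial2 h p d (G p u v) w + partial2 g p d (r *\<^sub>R C p u v) w + partial2 g p d (G p u v) 0)"
    and ?v0.0 = "frechet_derivative (\<lambda>y. G y u v) (at p) d"])
  show "((\<lambda>s. koszul2 (gs s) p d u v w - partial2 (gs s) p d (christoffel (gs s) p u v) w) has_derivative
     (\<lambda>r. r * koszul2 h p d u v w - (r * partial2 h p d (G p u v) w + partial2 g p d (r *\<^sub>R C p u v) w + partial2 g p d (G p u v) 0))) (at 0)" for w
  proof (rule has_derivative_diff)
    show "((\<lambda>s. koszul2 (gs s) p d u v w) has_derivative (\<lambda>r. r * koszul2 h p d u v w)) (at 0)"
      unfolding koszul2_gs by (auto intro!: derivative_eq_intros)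
    have "((\<lambda>s. partial2 (gs s) p d (christoffel (gs s) p u v) w) has_derivative
        (\<lambda>r. r * partial2 h p d (christoffel (gs 0) p u v) w + partial2 (gs 0) p d (r *\<^sub>R C p u v) w + partial2 (gs 0) p d (christoffel (gs 0) p u v) 0)) (at 0)"
    proof (rule bilinear_param_has_derivative[OF _ _ Gs_deriv has_derivative_const])
      show "eventually (\<lambda>s. bilinear (partial2 (gs s) p d)) (nhds 0)"
        by (simp add: smooth_tensor.partial2_bil[OF gs_smooth])
      show "((\<lambda>s. partial2 (gs s) p d v w) has_derivative (\<lambda>r. r * partial2 h p d v w)) (at 0)" for v w
        unfolding partial2_gs by (auto intro!: derivative_eq_intros)
    qed
    then show "((\<lambda>s. partial2 (gs s) p d (christoffel (gs s) p u v) w) has_derivative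
        (\<lambda>r. r * partial2 h p d (G p u v) w + partial2 g p d (r *\<^sub>R C p u v) w + partial2 g p d (G p u v) 0)) (at 0)"
      by (simp add: gs0)
  qed
  show "gs 0 p (frechet_derivative (\<lambda>y. G y u v) (at p) d) w =
      koszul2 (gs 0) p d u v w - partial2 (gs 0) p d (christoffel (gs 0) p u v) w" for w
  proof -
    have "frechet_derivative (\<lambda>y. G y u v) (at p) d = sharp g p (\<lambda>w. koszul2 g p d u v w - partial2 g p d (G p u v) w)"
      using fun_cong[OF frechet_derivative_at[OF christoffel_has_derivative[OF nd[of p]]]] by simp
    then show ?thesis
      using sharp_solves[of g p, OF bil nd dchristoffel_linear[OF nd[of p]]] by (simp add: gs0)
  qed
  show "gs 0 p (r *\<^sub>R dC p d u v) w = r * koszul2 h p d u v w -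
      (r * partial2 h p d (G p u v) w + partial2 g p d (r *\<^sub>R C p u v) w + partial2 g p d (G p u v) 0)
      - r * h p (frechet_derivative (\<lambda>y. G y u v) (at p) d) w" for r w
    by (simp add: gs0 bilinear_lmul[OF bil] dC_solves bilinear_lmul[OF partial2_bil] bilinear_rzero[OF partial2_bil] algebra_simps)
qed (use smooth_tensor.bil[OF gs_smooth] smooth_tensor.dchristoffel_linear[OF gs_smooth] gs_nd nd gs_deriv in
    \<open>auto simp: gs0 intro: linear_compose_sub smooth_tensor.koszul2_linear[OF gs_smooth] smooth_tensor.lins[OF gs_smooth]\<close>)

lemma Gs_bil: "eventually (\<lambda>s. bilinear (christoffel (gs s) p)) (nhds 0)"
  using gs_nd by eventually_elim (rule smooth_tensor.christoffel_bil[OF gs_smooth])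

lemma Gs_Gs_deriv:
  "((\<lambda>s. christoffel (gs s) p a (christoffel (gs s) p u v)) has_derivative
    (\<lambda>r. r *\<^sub>R (C p a (G p u v) + G p a (C p u v)))) (at 0)"
  by (rule has_derivative_eq_rhs, rule bilinear_param_has_derivative[OF Gs_bil Gs_deriv has_derivative_const Gs_deriv])
    (auto simp: gs0 bilinear_lzero[OF christoffel_bil[OF nd]] bilinear_rmul[OF christoffel_bil[OF nd]] scaleR_add_right)

text \<open>Curvature is linear in the derivatives of the Christoffel symbols and quadratic in the
  symbols themselves, so its variation consists of \<open>dC\<close> terms and of the mixed products
  of \<open>C\<close> and \<open>G\<close>.\<close>

theorem delta_ricci_formula:
  "delta_ricci g h p u w =
    (\<Sum>b\<in>Basis. (dC p b u w - dC p u b w + (C p b (G p u w) + G p b (C p u w))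
      - (C p u (G p b w) + G p u (C p b w))) \<bullet> b)"
proof -
  define R where "R s b = dGs p b u w s - dGs p u b w s
    + christoffel (gs s) p b (christoffel (gs s) p u w) - christoffel (gs s) p u (christoffel (gs s) p b w)" for s b
  have "((\<lambda>s. \<Sum>b\<in>Basis. R s b \<bullet> b) has_derivative
    (\<lambda>r. \<Sum>b\<in>Basis. (r *\<^sub>R dC p b u w - r *\<^sub>R dC p u b w + r *\<^sub>R (C p b (G p u w) + G p b (C p u w))
      - r *\<^sub>R (C p u (G p b w) + G p u (C p b w))) \<bullet> b)) (at 0)"
    unfolding R_def
    by (intro has_derivative_sum has_derivative_inner_left has_derivative_diff has_derivative_add dGs_deriv Gs_Gs_deriv)
  moreover have "eventually (\<lambda>s. (\<Sum>b\<in>Basis. R s b \<bullet> b) = ricci (gs s) p u w) (nhds 0)"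
    using gs_nd[of p]
  proof eventually_elim
    case (elim s)
    show ?case by (simp add: ricci_def riemann_def R_def frechet_Gs[OF elim])
  qed
  ultimately have "((\<lambda>s. ricci (gs s) p u w) has_derivative
    (\<lambda>r. \<Sum>b\<in>Basis. (r *\<^sub>R dC p b u w - r *\<^sub>R dC p u b w + r *\<^sub>R (C p b (G p u w) + G p b (C p u w))
      - r *\<^sub>R (C p u (G p b w) + G p u (C p b w))) \<bullet> b)) (at 0)"
    by (rule has_derivative_nhds_eq)
  then have "((\<lambda>s. ricci (gs s) p u w) has_real_derivative
    (\<Sum>b\<in>Basis. (dC p b u w - dC p u b w + (C p b (G p u w) + G p b (C p u w))
      - (C p u (G p b w) + G p u (C p b w))) \<bullet> b)) (at 0)"
    unfolding has_field_derivative_def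
    by (rule has_derivative_eq_rhs)
      (simp add: fun_eq_iff sum_distrib_left inner_diff_left inner_add_left algebra_simps)
  then show ?thesis
    unfolding delta_ricci_def gs_def by (rule DERIV_imp_deriv)
qed

end

section \<open>Symbol calculus\<close>

lemma c2_const: "c2 (\<lambda>x. c) (\<lambda>x u. 0) (\<lambda>x u v. 0)"
  by (simp add: c2_def)

lemma c2_linear: "linear F \<Longrightarrow> c2 F (\<lambda>x. F) (\<lambda>x u v. 0)"
  by (simp add: c2_def linear_imp_has_derivative)

lemma c2_add:
  assumes "c2 F F1 F2" "c2 G G1 G2"
  shows "c2 (\<lambda>x. F x + G x) (\<lambda>x u. F1 x u + G1 x u) (\<lambda>x u v. F2 x u v + G2 x u v)"
  using assms unfolding c2_def by (intro conjI allI has_derivative_add) auto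

lemma c2_mult:
  assumes "c2 F F1 F2" "c2 G G1 G2"
  shows "c2 (\<lambda>x. F x * G x) (\<lambda>x u. F x * G1 x u + F1 x u * G x)
    (\<lambda>x u v. (F x * G2 x u v + F1 x v * G1 x u) + (F1 x u * G1 x v + F2 x u v * G x))"
  unfolding c2_def
  by (intro conjI allI has_derivative_add has_derivative_mult c2D1[OF assms(1)] c2D1[OF assms(2)]
      c2D2[OF assms(1)] c2D2[OF assms(2)])

lemma c2_comp_real:
  assumes F: "c2 F F1 F2"
    and d1: "\<And>x. (\<phi> has_real_derivative \<phi>1 (F x)) (at (F x))"
    and d2: "\<And>x. (\<phi>1 has_real_derivative \<phi>2 (F x)) (at (F x))"
  shows "c2 (\<lambda>x. \<phi> (F x)) (\<lambda>x u. \<phi>1 (F x) * F1 x u)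
    (\<lambda>x u v. \<phi>1 (F x) * F2 x u v + \<phi>2 (F x) * F1 x v * F1 x u)"
  unfolding c2_def
  by (intro conjI allI has_derivative_mult c2D2[OF F]
      has_derivative_compose[OF c2D1[OF F] d1[unfolded has_field_derivative_def]]
      has_derivative_compose[OF c2D1[OF F] d2[unfolded has_field_derivative_def]])

lemma c2_compose:
  fixes q :: "'a::euclidean_space \<Rightarrow> 'b::euclidean_space"
  assumes q: "\<And>i. i \<in> Basis \<Longrightarrow> c2 (\<lambda>x. q x \<bullet> i) (q1 i) (q2 i)"
    and G1: "\<And>x. (G has_derivative G1 (q x)) (at (q x))"
    and G2: "\<And>x i. i \<in> Basis \<Longrightarrow> ((\<lambda>z. G1 z i) has_derivative G2 (q x) i) (at (q x))"
  shows "c2 (\<lambda>x. G (q x)) (\<lambda>x u. \<Sum>i\<in>Basis. q1 i x u * G1 (q x) i)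
    (\<lambda>x u v. \<Sum>i\<in>Basis. q1 i x u * (\<Sum>j\<in>Basis. q1 j x v * G2 (q x) i j) + q2 i x u v * G1 (q x) i)"
proof -
  have qd: "(q has_derivative (\<lambda>u. \<Sum>i\<in>Basis. q1 i x u *\<^sub>R i)) (at x)" for x
  proof -
    have "((\<lambda>x. \<Sum>i\<in>Basis. (q x \<bullet> i) *\<^sub>R i) has_derivative (\<lambda>u. \<Sum>i\<in>Basis. q1 i x u *\<^sub>R i)) (at x)"
      by (intro has_derivative_sum has_derivative_scaleR_left c2D1[OF q])
    then show ?thesis by (simp add: euclidean_representation)
  qed
  have *: "((\<lambda>x. f (q x)) has_derivative (\<lambda>u. \<Sum>i\<in>Basis. q1 i x u * D i)) (at x)"
    if "(f has_derivative D) (at (q x))" for f D x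
  proof -
    have l: "linear D" using that has_derivative_linear by blast
    have "((\<lambda>x. f (q x)) has_derivative (\<lambda>u. D (\<Sum>i\<in>Basis. q1 i x u *\<^sub>R i))) (at x)"
      by (rule has_derivative_compose[OF qd that])
    moreover have "D (\<Sum>i\<in>Basis. q1 i x u *\<^sub>R i) = (\<Sum>i\<in>Basis. q1 i x u * D i)" for u
      by (simp add: linear_sum[OF l] linear_scale[OF l])
    ultimately show ?thesis by simp
  qed
  show ?thesis unfolding c2_def
    by (intro conjI allI has_derivative_sum has_derivative_mult c2D2[OF q] *[OF G1] *[OF G2]) auto
qed

section \<open>Closure properties of twice differentiable functions\<close>

lemma twice_const: "twice (\<lambda>x. c)"
  using c2_const unfolding twice_def by blast

lemma twice_linear: "linear F \<Longrightarrow> twice F"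
  using c2_linear unfolding twice_def by blast

lemma twice_add: "twice F \<Longrightarrow> twice G \<Longrightarrow> twice (\<lambda>x. F x + G x)"
  unfolding twice_def using c2_add by blast

lemma twice_mult: "twice F \<Longrightarrow> twice G \<Longrightarrow> twice (\<lambda>x. F x * G x)"
  unfolding twice_def using c2_mult by blast

lemma twice_minus: "twice F \<Longrightarrow> twice (\<lambda>x. - F x)"
  using twice_mult[OF twice_const[of "-1"]] by simp

lemma twice_diff: "twice F \<Longrightarrow> twice G \<Longrightarrow> twice (\<lambda>x. F x - G x)"
  using twice_add[OF _ twice_minus] by fastforce

lemma twice_sum: "(\<And>i. i \<in> A \<Longrightarrow> twice (F i)) \<Longrightarrow> twice (\<lambda>x. \<Sum>i\<in>A. F i x)"
  by (induction A rule: infinite_finite_induct) (auto intro: twice_const twice_add)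

lemma twice_comp_real:
  assumes "twice F"
    and "\<And>x. (\<phi> has_real_derivative \<phi>1 (F x)) (at (F x))"
    and "\<And>x. (\<phi>1 has_real_derivative \<phi>2 (F x)) (at (F x))"
  shows "twice (\<lambda>x. \<phi> (F x))"
proof -
  obtain F1 F2 where "c2 F F1 F2" using assms(1) by (auto simp: twice_def)
  from c2_comp_real[of F F1 F2, OF this assms(2,3)] show ?thesis unfolding twice_def by blast
qed

lemma twice_inverse:
  assumes "twice F" "\<And>x. F x \<noteq> 0"
  shows "twice (\<lambda>x. inverse (F x))"
proof (rule twice_comp_real[OF assms(1), where \<phi> = inverse])
  fix x
  show "(inverse has_real_derivative - (inverse (F x))\<^sup>2) (at (F x))"
    using DERIV_inverse[OF assms(2), of x] by (simp add: power2_eq_square eval_nat_numeral)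
  have "((\<lambda>y. - (inverse y)\<^sup>2) has_real_derivative - (2 * inverse (F x) * - (inverse (F x))\<^sup>2)) (at (F x))"
    using assms(2)[of x] by (auto intro!: derivative_eq_intros simp: power2_eq_square divide_simps)
  then show "((\<lambda>y. - (inverse y)\<^sup>2) has_real_derivative 2 * (inverse (F x)) ^ 3) (at (F x))"
    by (simp add: power2_eq_square power3_eq_cube mult.assoc)
qed

lemma twice_divide: "twice F \<Longrightarrow> twice G \<Longrightarrow> (\<And>x. G x \<noteq> 0) \<Longrightarrow> twice (\<lambda>x. F x / G x)"
  unfolding divide_inverse by (intro twice_mult twice_inverse)

lemma DERIV_real_sqrt2:
  assumes "x > 0"
  shows "(sqrt has_real_derivative 1 / (2 * sqrt x)) (at x)"
    and "((\<lambda>y. 1 / (2 * sqrt y)) has_real_derivative - 1 / (4 * (sqrt x) ^ 3)) (at x)"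
proof -
  show 1: "(sqrt has_real_derivative 1 / (2 * sqrt x)) (at x)"
    using DERIV_real_sqrt[OF assms] by (simp add: field_simps)
  have "((\<lambda>y. 1 / (2 * sqrt y)) has_real_derivative (0 * (2 * sqrt x) - 1 * (2 * (1 / (2 * sqrt x)))) / (2 * sqrt x * (2 * sqrt x))) (at x)"
    by (intro derivative_intros DERIV_cmult 1) (use assms in simp)
  moreover have "(0 * (2 * sqrt x) - 1 * (2 * (1 / (2 * sqrt x)))) / (2 * sqrt x * (2 * sqrt x)) = - 1 / (4 * (sqrt x) ^ 3)"
    by (simp only: power3_eq_cube) simp
  ultimately show "((\<lambda>y. 1 / (2 * sqrt y)) has_real_derivative - 1 / (4 * (sqrt x) ^ 3)) (at x)"
    by (simp only:)
qed

lemma twice_sqrt: "twice F \<Longrightarrow> (\<And>x. F x > 0) \<Longrightarrow> twice (\<lambda>x. sqrt (F x))"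
  by (rule twice_comp_real[where \<phi> = sqrt]) (auto intro: DERIV_real_sqrt2)

lemma twice_compose:
  fixes q :: "'a::euclidean_space \<Rightarrow> 'b::euclidean_space"
  assumes q: "\<And>i. i \<in> Basis \<Longrightarrow> twice (\<lambda>x. q x \<bullet> i)"
    and G1: "\<And>x. (G has_derivative G1 (q x)) (at (q x))"
    and G2: "\<And>x i. i \<in> Basis \<Longrightarrow> ((\<lambda>z. G1 z i) has_derivative G2 (q x) i) (at (q x))"
  shows "twice (\<lambda>x. G (q x))"
proof -
  obtain q1 q2 where "\<And>i. i \<in> Basis \<Longrightarrow> c2 (\<lambda>x. q x \<bullet> i) (q1 i) (q2 i)"
    using q unfolding twice_def by metis
  from c2_compose[of q q1 q2 G G1 G2, OF this G1 G2] show ?thesis unfolding twice_def by blast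
qed

text \<open>Control of a function and its first two derivatives in the manner of symbol classes:
  \<open>f\<close> measures the size, \<open>N x u\<close> the cost of one derivative at
  \<open>x\<close> in direction \<open>u\<close>. Letting the cost depend on the direction allows
  anisotropic estimates.\<close>

definition symb :: "('a::euclidean_space \<Rightarrow> 'a \<Rightarrow> real) \<Rightarrow> 'a set \<Rightarrow> ('a \<Rightarrow> real) \<Rightarrow> ('a \<Rightarrow> real) \<Rightarrow> bool" where
  "symb N T f F \<longleftrightarrow> (\<exists>F1 F2 C. c2 F F1 F2 \<and> C \<ge> 0 \<and> (\<forall>x\<in>T. \<forall>u v. \<bar>F x\<bar> \<le> C * f x \<and>
     \<bar>F1 x u\<bar> \<le> C * f x * N x u \<and> \<bar>F2 x u v\<bar> \<le> C * f x * (N x u * N x v)))"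

lemma symbI:
  assumes "c2 F F1 F2" "C \<ge> 0" "\<And>x. x \<in> T \<Longrightarrow> \<bar>F x\<bar> \<le> C * f x"
    "\<And>x u. x \<in> T \<Longrightarrow> \<bar>F1 x u\<bar> \<le> C * f x * N x u"
    "\<And>x u v. x \<in> T \<Longrightarrow> \<bar>F2 x u v\<bar> \<le> C * f x * (N x u * N x v)"
  shows "symb N T f F"
  using assms unfolding symb_def by blast

lemma symbE:
  assumes "symb N T f F" "c2 F F1 F2"
  obtains C where "C \<ge> 0" "\<And>x. x \<in> T \<Longrightarrow> \<bar>F x\<bar> \<le> C * f x"
    "\<And>x u. x \<in> T \<Longrightarrow> \<bar>F1 x u\<bar> \<le> C * f x * N x u"
    "\<And>x u v. x \<in> T \<Longrightarrow> \<bar>F2 x u v\<bar> \<le> C * f x * (N x u * N x v)"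
proof -
  obtain F1' F2' C where c: "c2 F F1' F2'" and C: "C \<ge> 0" "\<forall>x\<in>T. \<forall>u v. \<bar>F x\<bar> \<le> C * f x \<and>
     \<bar>F1' x u\<bar> \<le> C * f x * N x u \<and> \<bar>F2' x u v\<bar> \<le> C * f x * (N x u * N x v)"
    using assms(1) unfolding symb_def by blast
  have "F1' = F1" "F2' = F2" using c2_unique[OF c assms(2)] by auto
  then show ?thesis using that[OF C(1)] C(2) by blast
qed

lemma symb_obtain_c2:
  assumes "symb N T f F"
  obtains F1 F2 where "c2 F F1 F2"
  using assms unfolding symb_def by blast

lemma symb_add:
  assumes F: "symb N T f F" and G: "symb N T f G"
  shows "symb N T f (\<lambda>x. F x + G x)"
proof -
  obtain F1 F2 where cF: "c2 F F1 F2" using symb_obtain_c2[OF F] .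
  obtain G1 G2 where cG: "c2 G G1 G2" using symb_obtain_c2[OF G] .
  obtain C where C: "C \<ge> 0" "\<And>x. x \<in> T \<Longrightarrow> \<bar>F x\<bar> \<le> C * f x"
    "\<And>x u. x \<in> T \<Longrightarrow> \<bar>F1 x u\<bar> \<le> C * f x * N x u"
    "\<And>x u v. x \<in> T \<Longrightarrow> \<bar>F2 x u v\<bar> \<le> C * f x * (N x u * N x v)"
    using symbE[OF F cF] by blast
  obtain D where D: "D \<ge> 0" "\<And>x. x \<in> T \<Longrightarrow> \<bar>G x\<bar> \<le> D * f x"
    "\<And>x u. x \<in> T \<Longrightarrow> \<bar>G1 x u\<bar> \<le> D * f x * N x u"
    "\<And>x u v. x \<in> T \<Longrightarrow> \<bar>G2 x u v\<bar> \<le> D * f x * (N x u * N x v)"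
    using symbE[OF G cG] by blast
  have *: "\<bar>a + b\<bar> \<le> (C + D) * k" if "\<bar>a\<bar> \<le> C * k" "\<bar>b\<bar> \<le> D * k" for a b k
    using that by (simp add: distrib_right)
  show ?thesis
  proof (rule symbI[OF c2_add[OF cF cG], of "C + D"])
    show "\<bar>F1 x u + G1 x u\<bar> \<le> (C + D) * f x * N x u" if "x \<in> T" for x u
      using *[of "F1 x u" "f x * N x u" "G1 x u"] C(3)[OF that, of u] D(3)[OF that, of u] by (simp add: mult.assoc)
    show "\<bar>F2 x u v + G2 x u v\<bar> \<le> (C + D) * f x * (N x u * N x v)" if "x \<in> T" for x u v
      using *[of "F2 x u v" "f x * (N x u * N x v)" "G2 x u v"] C(4)[OF that, of u v] D(4)[OF that, of u v] by (simp add: mult.assoc)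
  qed (use * C D in auto)
qed

lemma symb_mono:
  assumes F: "symb N T f F" and N: "\<And>x u. x \<in> T \<Longrightarrow> N x u \<ge> 0"
    and K: "K \<ge> 0" "\<And>x. x \<in> T \<Longrightarrow> f x \<le> K * g x"
  shows "symb N T g F"
proof -
  obtain F1 F2 where cF: "c2 F F1 F2" using symb_obtain_c2[OF F] .
  obtain C where C: "C \<ge> 0" "\<And>x. x \<in> T \<Longrightarrow> \<bar>F x\<bar> \<le> C * f x"
    "\<And>x u. x \<in> T \<Longrightarrow> \<bar>F1 x u\<bar> \<le> C * f x * N x u"
    "\<And>x u v. x \<in> T \<Longrightarrow> \<bar>F2 x u v\<bar> \<le> C * f x * (N x u * N x v)"
    using symbE[OF F cF] by blast
  have *: "C * f x \<le> C * K * g x" if "x \<in> T" for x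
    using mult_left_mono[OF K(2)[OF that] C(1)] by (simp add: mult.assoc)
  show ?thesis
  proof (rule symbI[OF cF, of "C * K"])
    show "\<bar>F x\<bar> \<le> C * K * g x" if "x \<in> T" for x using C(2)[OF that] *[OF that] by linarith
    show "\<bar>F1 x u\<bar> \<le> C * K * g x * N x u" if "x \<in> T" for x u
      using C(3)[OF that, of u] mult_right_mono[OF *[OF that] N[OF that, of u]] by linarith
    show "\<bar>F2 x u v\<bar> \<le> C * K * g x * (N x u * N x v)" if "x \<in> T" for x u v
      using C(4)[OF that, of u v]
        mult_right_mono[OF *[OF that] mult_nonneg_nonneg[OF N[OF that, of u] N[OF that, of v]]] by linarith
  qed (use C K in auto)
qed

lemma symb_mult:
  assumes F: "symb N T f F" and G: "symb N T g G" and N: "\<And>x u. x \<in> T \<Longrightarrow> N x u \<ge> 0"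
  shows "symb N T (\<lambda>x. f x * g x) (\<lambda>x. F x * G x)"
proof -
  obtain F1 F2 where cF: "c2 F F1 F2" using symb_obtain_c2[OF F] .
  obtain G1 G2 where cG: "c2 G G1 G2" using symb_obtain_c2[OF G] .
  obtain C where C: "C \<ge> 0" "\<And>x. x \<in> T \<Longrightarrow> \<bar>F x\<bar> \<le> C * f x"
    "\<And>x u. x \<in> T \<Longrightarrow> \<bar>F1 x u\<bar> \<le> C * f x * N x u"
    "\<And>x u v. x \<in> T \<Longrightarrow> \<bar>F2 x u v\<bar> \<le> C * f x * (N x u * N x v)"
    using symbE[OF F cF] by blast
  obtain D where D: "D \<ge> 0" "\<And>x. x \<in> T \<Longrightarrow> \<bar>G x\<bar> \<le> D * g x"
    "\<And>x u. x \<in> T \<Longrightarrow> \<bar>G1 x u\<bar> \<le> D * g x * N x u"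
    "\<And>x u v. x \<in> T \<Longrightarrow> \<bar>G2 x u v\<bar> \<le> D * g x * (N x u * N x v)"
    using symbE[OF G cG] by blast
  have *: "\<bar>a * b\<bar> \<le> k * l" if "\<bar>a\<bar> \<le> k" "\<bar>b\<bar> \<le> l" for a b k l :: real
    unfolding abs_mult by (rule mult_mono) (use that in auto)
  have CD: "0 \<le> (C * f x) * (D * g x)" if "x \<in> T" for x
    using *[OF C(2)[OF that] D(2)[OF that]] by (meson abs_ge_zero order_trans)
  show ?thesis
  \<comment> \<open>The second derivative of a product has four terms, each bounded with the
    constant \<open>C * D\<close>.\<close>
  proof (rule symbI[OF c2_mult[OF cF cG], of "4 * (C * D)"])
    fix x assume x: "x \<in> T"
    show "\<bar>F x * G x\<bar> \<le> 4 * (C * D) * (f x * g x)"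
      using *[OF C(2)[OF x] D(2)[OF x]] CD[OF x] by (simp add: algebra_simps)
    fix u
    have n: "0 \<le> (C * f x) * (D * g x) * N x u" using CD[OF x] N[OF x, of u] by simp
    show "\<bar>F x * G1 x u + F1 x u * G x\<bar> \<le> 4 * (C * D) * (f x * g x) * N x u"
      using *[OF C(2)[OF x] D(3)[OF x, of u]] *[OF C(3)[OF x, of u] D(2)[OF x]] n
      by (simp add: algebra_simps)
    fix v
    have "0 \<le> (C * f x) * (D * g x) * (N x u * N x v)"
      using CD[OF x] N[OF x, of u] N[OF x, of v] by simp
    show "\<bar>F x * G2 x u v + F1 x v * G1 x u + (F1 x u * G1 x v + F2 x u v * G x)\<bar>
        \<le> 4 * (C * D) * (f x * g x) * (N x u * N x v)"
      using *[OF C(2)[OF x] D(4)[OF x, of u v]] *[OF C(3)[OF x, of u] D(3)[OF x, of v]]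
        *[OF C(3)[OF x, of v] D(3)[OF x, of u]] *[OF C(4)[OF x, of u v] D(2)[OF x]]
      by (simp add: algebra_simps)
  qed (use C D in auto)
qed

lemma symb_const:
  assumes "K \<ge> 0" "\<And>x. x \<in> T \<Longrightarrow> 1 \<le> K * f x" "\<And>x u. x \<in> T \<Longrightarrow> N x u \<ge> 0"
  shows "symb N T f (\<lambda>x. c)"
proof (rule symbI[OF c2_const, of "K * \<bar>c\<bar>"])
  fix x assume x: "x \<in> T"
  have 1: "\<bar>c\<bar> \<le> K * \<bar>c\<bar> * f x" using mult_left_mono[OF assms(2)[OF x], of "\<bar>c\<bar>"] by (simp add: algebra_simps)
  then show "\<bar>c\<bar> \<le> K * \<bar>c\<bar> * f x" .
  have 0: "0 \<le> K * \<bar>c\<bar> * f x" using 1 by linarith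
  fix u show "\<bar>0\<bar> \<le> K * \<bar>c\<bar> * f x * N x u"
    using mult_nonneg_nonneg[OF 0 assms(3)[OF x, of u]] by simp
  fix v show "\<bar>0\<bar> \<le> K * \<bar>c\<bar> * f x * (N x u * N x v)"
    using mult_nonneg_nonneg[OF 0 mult_nonneg_nonneg[OF assms(3)[OF x, of u] assms(3)[OF x, of v]]] by simp
qed (use assms in auto)

text \<open>The chain rule pairs \<open>\<phi>1\<close> with one factor \<open>f\<close> and
  \<open>\<phi>2\<close> with two, which explains the powers of \<open>f\<close> in the hypotheses.
  Square roots, inverses and arctangents are treated this way.\<close>

lemma symb_comp_real:
  assumes F: "symb N T f F" and N: "\<And>x u. x \<in> T \<Longrightarrow> N x u \<ge> 0"
    and f: "\<And>x. x \<in> T \<Longrightarrow> f x \<ge> 0"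
    and d1: "\<And>x. (\<phi> has_real_derivative \<phi>1 (F x)) (at (F x))"
    and d2: "\<And>x. (\<phi>1 has_real_derivative \<phi>2 (F x)) (at (F x))"
    and g: "\<And>x. x \<in> T \<Longrightarrow> g x \<ge> 0"
    and K: "K \<ge> 0" and b0: "\<And>x. x \<in> T \<Longrightarrow> \<bar>\<phi> (F x)\<bar> \<le> K * g x"
    and b1: "\<And>x. x \<in> T \<Longrightarrow> \<bar>\<phi>1 (F x)\<bar> * f x \<le> K * g x"
    and b2: "\<And>x. x \<in> T \<Longrightarrow> \<bar>\<phi>2 (F x)\<bar> * (f x)\<^sup>2 \<le> K * g x"
  shows "symb N T g (\<lambda>x. \<phi> (F x))"
proof -
  obtain F1 F2 where cF: "c2 F F1 F2" using symb_obtain_c2[OF F] .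
  obtain C where C: "C \<ge> 0" "\<And>x. x \<in> T \<Longrightarrow> \<bar>F x\<bar> \<le> C * f x"
    "\<And>x u. x \<in> T \<Longrightarrow> \<bar>F1 x u\<bar> \<le> C * f x * N x u"
    "\<And>x u v. x \<in> T \<Longrightarrow> \<bar>F2 x u v\<bar> \<le> C * f x * (N x u * N x v)"
    using symbE[OF F cF] by blast
  define M where "M = K * (1 + C + C\<^sup>2)"
  have M: "M \<ge> K" "M \<ge> K * C" "M \<ge> K * C + K * C\<^sup>2"
    using K C(1) by (simp_all add: M_def algebra_simps)
  show ?thesis
  proof (rule symbI[OF c2_comp_real[OF cF d1 d2], of M])
    fix x assume x: "x \<in> T"
    show "\<bar>\<phi> (F x)\<bar> \<le> M * g x"
      using b0[OF x] mult_right_mono[OF M(1) g[OF x]] by linarith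
    fix u
    have a: "\<bar>\<phi>1 (F x)\<bar> * \<bar>F2 x u v\<bar> \<le> K * C * g x * n" if "\<bar>F2 x u v\<bar> \<le> C * f x * n" "n \<ge> 0" for n v
    proof -
      have "\<bar>\<phi>1 (F x)\<bar> * \<bar>F2 x u v\<bar> \<le> \<bar>\<phi>1 (F x)\<bar> * (C * f x * n)"
        using that by (intro mult_left_mono) auto
      also have "\<dots> = (\<bar>\<phi>1 (F x)\<bar> * f x) * (C * n)" by simp
      also have "\<dots> \<le> (K * g x) * (C * n)"
        using b1[OF x] C(1) that by (intro mult_right_mono) auto
      finally show ?thesis by (simp add: algebra_simps)
    qed
    have n: "N x u \<ge> 0" for u by (rule N[OF x])
    have "\<bar>\<phi>1 (F x)\<bar> * \<bar>F1 x u\<bar> \<le> \<bar>\<phi>1 (F x)\<bar> * (C * f x * N x u)"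
      using C(3)[OF x] by (intro mult_left_mono) auto
    also have "\<dots> = (\<bar>\<phi>1 (F x)\<bar> * f x) * (C * N x u)" by simp
    also have "\<dots> \<le> (K * g x) * (C * N x u)"
      using b1[OF x] C(1) n by (intro mult_right_mono) auto
    also have "\<dots> = K * C * (g x * N x u)" by simp
    also have "\<dots> \<le> M * (g x * N x u)"
      using M(2) g[OF x] n[of u] by (intro mult_right_mono) auto
    finally show "\<bar>\<phi>1 (F x) * F1 x u\<bar> \<le> M * g x * N x u" by (simp add: abs_mult)
    fix v
    let ?n = "N x u * N x v"
    have nn: "?n \<ge> 0" using n by simp
    have "\<bar>F1 x v\<bar> * \<bar>F1 x u\<bar> \<le> (C * f x * N x v) * (C * f x * N x u)"
      using C(3)[OF x] by (intro mult_mono) (auto intro: order_trans[OF abs_ge_zero])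
    then have "\<bar>\<phi>2 (F x)\<bar> * (\<bar>F1 x v\<bar> * \<bar>F1 x u\<bar>) \<le> \<bar>\<phi>2 (F x)\<bar> * ((C * f x * N x v) * (C * f x * N x u))"
      by (intro mult_left_mono) auto
    also have "\<dots> = (\<bar>\<phi>2 (F x)\<bar> * (f x)\<^sup>2) * (C\<^sup>2 * ?n)" by (simp add: power2_eq_square)
    also have "\<dots> \<le> (K * g x) * (C\<^sup>2 * ?n)"
      using b2[OF x] nn by (intro mult_right_mono) auto
    finally have b: "\<bar>\<phi>2 (F x)\<bar> * (\<bar>F1 x v\<bar> * \<bar>F1 x u\<bar>) \<le> K * C\<^sup>2 * (g x * ?n)" by (simp add: algebra_simps)
    have "\<bar>\<phi>1 (F x) * F2 x u v + \<phi>2 (F x) * F1 x v * F1 x u\<bar>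
        \<le> \<bar>\<phi>1 (F x)\<bar> * \<bar>F2 x u v\<bar> + \<bar>\<phi>2 (F x)\<bar> * (\<bar>F1 x v\<bar> * \<bar>F1 x u\<bar>)"
      by (rule order_trans[OF abs_triangle_ineq]) (simp add: abs_mult mult.assoc)
    also have "\<dots> \<le> (K * C + K * C\<^sup>2) * (g x * ?n)"
      using a[OF C(4)[OF x, of u v] nn] b by (simp add: algebra_simps)
    also have "\<dots> \<le> M * (g x * ?n)"
      using M(3) g[OF x] nn by (intro mult_right_mono) auto
    finally show "\<bar>\<phi>1 (F x) * F2 x u v + \<phi>2 (F x) * F1 x v * F1 x u\<bar> \<le> M * g x * ?n"
      by (simp add: mult.assoc)
  qed (use K C M in auto)
qed

text \<open>Meant for \<open>hb\<close>, whose derivatives are controlled in the compactified chart: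
  composed with the compactified embedding of a horizon, whose components are symbols of size 1, it
  again becomes a symbol of size 1.\<close>

lemma symb_compose:
  fixes q :: "'a::euclidean_space \<Rightarrow> 'b::euclidean_space"
  assumes q: "\<And>i. i \<in> Basis \<Longrightarrow> symb N T (\<lambda>_. 1) (\<lambda>x. q x \<bullet> i)"
    and N: "\<And>x u. x \<in> T \<Longrightarrow> N x u \<ge> 0"
    and G1: "\<And>x. (G has_derivative G1 (q x)) (at (q x))"
    and G2: "\<And>x i. i \<in> Basis \<Longrightarrow> ((\<lambda>z. G1 z i) has_derivative G2 (q x) i) (at (q x))"
    and K: "K \<ge> 0" and b0: "\<And>x. x \<in> T \<Longrightarrow> \<bar>G (q x)\<bar> \<le> K"
    and b1: "\<And>x i. x \<in> T \<Longrightarrow> i \<in> Basis \<Longrightarrow> \<bar>G1 (q x) i\<bar> \<le> K"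
    and b2: "\<And>x i j. x \<in> T \<Longrightarrow> i \<in> Basis \<Longrightarrow> j \<in> Basis \<Longrightarrow> \<bar>G2 (q x) i j\<bar> \<le> K"
  shows "symb N T (\<lambda>_. 1) (\<lambda>x. G (q x))"
proof -
  have "\<exists>q1 q2 C. c2 (\<lambda>x. q x \<bullet> i) q1 q2 \<and> C \<ge> 0 \<and> (\<forall>x\<in>T. \<forall>u v. \<bar>q1 x u\<bar> \<le> C * N x u \<and> \<bar>q2 x u v\<bar> \<le> C * (N x u * N x v))"
    if "i \<in> Basis" for i
    using q[OF that] unfolding symb_def by auto metis
  then obtain q1 q2 C where c: "\<And>i. i \<in> Basis \<Longrightarrow> c2 (\<lambda>x. q x \<bullet> i) (q1 i) (q2 i)"
    and C: "\<And>i. i \<in> Basis \<Longrightarrow> C i \<ge> 0"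
    and C1: "\<And>i x u. i \<in> Basis \<Longrightarrow> x \<in> T \<Longrightarrow> \<bar>q1 i x u\<bar> \<le> C i * N x u"
    and C2: "\<And>i x u v. i \<in> Basis \<Longrightarrow> x \<in> T \<Longrightarrow> \<bar>q2 i x u v\<bar> \<le> C i * (N x u * N x v)"
    by metis
  define S where "S = sum C Basis"
  have S: "S \<ge> 0" unfolding S_def by (rule sum_nonneg) (rule C)
  have *: "\<bar>\<Sum>i\<in>Basis. a i * b i\<bar> \<le> S * n * K'" if "\<And>i. i \<in> Basis \<Longrightarrow> \<bar>a i\<bar> \<le> C i * n"
      "\<And>i. i \<in> Basis \<Longrightarrow> \<bar>b i\<bar> \<le> K'" "n \<ge> 0" for a b n K'
  proof -
    have "\<bar>\<Sum>i\<in>Basis. a i * b i\<bar> \<le> (\<Sum>i\<in>(Basis::'b set). (C i * n) * K')"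
      unfolding abs_mult
    proof (rule order_trans[OF sum_abs], rule sum_mono)
      fix i :: 'b assume i: "i \<in> Basis"
      show "\<bar>a i * b i\<bar> \<le> C i * n * K'"
        unfolding abs_mult using that(1,2)[OF i] C[OF i] \<open>n \<ge> 0\<close> by (intro mult_mono) auto
    qed
    then show ?thesis by (simp add: S_def sum_distrib_right)
  qed
  show ?thesis
  proof (rule symbI[OF c2_compose[OF c G1 G2], of "K + S * K + S * (S * K)"])
    fix x assume x: "x \<in> T"
    have k: "0 \<le> S * K" "0 \<le> S * (S * K)" using S K by auto
    show "\<bar>G (q x)\<bar> \<le> (K + S * K + S * (S * K)) * 1" using b0[OF x] k unfolding mult_1_right by linarith
    fix u
    have n: "N x u \<ge> 0" for u by (rule N[OF x])
    have "\<bar>\<Sum>i\<in>Basis. q1 i x u * G1 (q x) i\<bar> \<le> S * N x u * K"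
      by (rule *) (use C1 b1 x n in auto)
    also have "\<dots> \<le> (K + S * K + S * (S * K)) * N x u"
      using mult_right_mono[of "S * K" "K + S * K + S * (S * K)" "N x u"] n k K by (simp add: algebra_simps)
    finally show "\<bar>\<Sum>i\<in>Basis. q1 i x u * G1 (q x) i\<bar> \<le> (K + S * K + S * (S * K)) * 1 * N x u" by simp
    fix v
    let ?n = "N x u * N x v"
    have nn: "?n \<ge> 0" using n by simp
    have "\<bar>\<Sum>i\<in>Basis. q1 i x u * (\<Sum>j\<in>Basis. q1 j x v * G2 (q x) i j)\<bar> \<le> S * N x u * (S * N x v * K)"
    proof (rule *)
      show "\<bar>\<Sum>j\<in>Basis. q1 j x v * G2 (q x) i j\<bar> \<le> S * N x v * K" if "i \<in> Basis" for i
        by (rule *) (use C1 b2 x n that in auto)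
    qed (use C1 x n in auto)
    moreover have "\<bar>\<Sum>i\<in>Basis. q2 i x u v * G1 (q x) i\<bar> \<le> S * ?n * K"
      by (rule *) (use C2 b1 x nn in auto)
    moreover have "K * ?n \<ge> 0" using K nn by simp
    ultimately show "\<bar>\<Sum>i\<in>Basis. q1 i x u * (\<Sum>j\<in>Basis. q1 j x v * G2 (q x) i j) + q2 i x u v * G1 (q x) i\<bar>
        \<le> (K + S * K + S * (S * K)) * 1 * ?n"
      unfolding sum.distrib by (simp add: algebra_simps)
  qed (use S K in auto)
qed

section \<open>Geometry of anti-de Sitter space\<close>

text \<open>The radius in the ambient timelike plane: \<open>wt L x\<close> and the angle
  \<open>t / L\<close> are polar coordinates for the two timelike coordinates of the hyperboloid
  model.\<close>

definition wt :: "real \<Rightarrow> 'a::euclidean_space \<Rightarrow> real" where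
  "wt L x = sqrt (L\<^sup>2 + x \<bullet> x)"

text \<open>Closed form of the Christoffel symbols in this chart. The spatial part is proportional
  to the metric, so along null geodesics the Cartesian coordinates are unaccelerated.\<close>

definition ads_Gamma :: "real \<Rightarrow> real \<times> 'a::euclidean_space \<Rightarrow> real \<times> 'a \<Rightarrow> real \<times> 'a \<Rightarrow> real \<times> 'a" where
  "ads_Gamma L p u v = ((fst u * (snd p \<bullet> snd v) + fst v * (snd p \<bullet> snd u)) / (wt L (snd p))\<^sup>2,
     - (ads_metric L p u v / L\<^sup>2) *\<^sub>R snd p)"

definition raise :: "real \<Rightarrow> real \<times> 'a::euclidean_space \<Rightarrow> real \<times> 'a \<Rightarrow> real \<times> 'a" where
  "raise L p b = (- (L\<^sup>2 / (wt L (snd p))\<^sup>2) * fst b, snd b + ((snd p \<bullet> snd b) / L\<^sup>2) *\<^sub>R snd p)"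

text \<open>The trace of a bilinear form with respect to the inverse metric.\<close>

definition ads_trace :: "real \<Rightarrow> real \<times> 'a::euclidean_space \<Rightarrow> (real \<times> 'a \<Rightarrow> real \<times> 'a \<Rightarrow> real) \<Rightarrow> real" where
  "ads_trace L p B = - (L\<^sup>2 / (wt L (snd p))\<^sup>2) * B (1, 0) (1, 0) + (\<Sum>e\<in>Basis. B (0, e) (0, e))
     + B (0, snd p) (0, snd p) / L\<^sup>2"

lemma sum_Basis_Pair:
  fixes f :: "real \<times> 'a::euclidean_space \<Rightarrow> 'b::comm_monoid_add"
  shows "(\<Sum>b\<in>Basis. f b) = f (1, 0) + (\<Sum>e\<in>Basis. f (0, e))"
proof -
  have "(\<Sum>b\<in>Basis. f b) = (\<Sum>b\<in>(\<lambda>u. (u, 0)) ` (Basis :: real set). f b) + (\<Sum>b\<in>Pair 0 ` (Basis :: 'a set). f b)"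
    unfolding Basis_prod_def by (rule sum.union_disjoint) auto
  also have "\<dots> = f (1, 0) + (\<Sum>e\<in>Basis. f (0, e))"
    by (simp add: sum.reindex inj_on_def)
  finally show ?thesis .
qed

lemma bilinear_linear_left: "bilinear B \<Longrightarrow> linear (\<lambda>z. B z u)"
  unfolding bilinear_def by blast

lemma bilinear_linear_right: "bilinear B \<Longrightarrow> linear (B u)"
  unfolding bilinear_def by blast

lemma linear_Pair0: "linear (\<lambda>y::'a::real_vector. (0::real, y))"
  by (simp add: linear_iff)

lemma trace_commute:
  fixes A B :: "'a::euclidean_space \<Rightarrow> 'a"
  assumes "linear A" "linear B"
  shows "(\<Sum>b\<in>Basis. A (B b) \<bullet> b) = (\<Sum>b\<in>Basis. B (A b) \<bullet> b)"
proof -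
  have e: "(\<Sum>b\<in>Basis. A (B b) \<bullet> b) = (\<Sum>b\<in>Basis. \<Sum>c\<in>Basis. (B b \<bullet> c) * (A c \<bullet> b))"
    if "linear A" for A B :: "'a \<Rightarrow> 'a"
  proof (rule sum.cong[OF refl])
    fix b :: 'a
    have "A (B b) = (\<Sum>c\<in>Basis. (B b \<bullet> c) *\<^sub>R A c)" by (rule linear_expand[OF that])
    then show "A (B b) \<bullet> b = (\<Sum>c\<in>Basis. (B b \<bullet> c) * (A c \<bullet> b))" by (simp add: inner_sum_left)
  qed
  show ?thesis
    unfolding e[OF assms(1)] e[OF assms(2)] by (subst sum.swap) (simp add: mult.commute)
qed

locale ads =
  fixes L :: real
  assumes L_pos: "L > 0"
begin

lemma wt2: "(wt L x)\<^sup>2 = L\<^sup>2 + x \<bullet> x"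
  by (simp add: wt_def)

lemma wt_pos: "wt L x > 0"
  using L_pos by (simp add: wt_def add_pos_nonneg)

lemma wt_ge: "wt L x \<ge> L"
  unfolding wt_def using L_pos by (intro real_le_rsqrt) simp

lemma wt_nz [simp]: "wt L x \<noteq> 0" "L \<noteq> 0"
  using wt_pos[of x] L_pos by auto

lemma norm_le_wt: "norm x \<le> wt L x"
  unfolding wt_def norm_eq_sqrt_inner by simp

lemma metric_eq:
  "ads_metric L p u v = - ((wt L (snd p))\<^sup>2 / L\<^sup>2) * fst u * fst v + snd u \<bullet> snd v
     - (snd p \<bullet> snd u) * (snd p \<bullet> snd v) / (wt L (snd p))\<^sup>2"
  by (simp add: ads_metric_def Let_def wt2 power2_norm_eq_inner add_divide_distrib)

lemma metric_raise: "ads_metric L p (raise L p b) v = b \<bullet> v"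
proof -
  define x where "x = snd p"
  define W where "W = (wt L x)\<^sup>2"
  have "W \<noteq> 0" by (simp add: W_def)
  moreover have "x \<bullet> x = W - L\<^sup>2" by (simp add: W_def wt2)
  ultimately have W: "W \<noteq> 0" "x \<bullet> x = W - L\<^sup>2" by auto
  have "(x \<bullet> snd b) * (x \<bullet> snd v) / L\<^sup>2 -
      (x \<bullet> snd b + (x \<bullet> snd b) * (W - L\<^sup>2) / L\<^sup>2) * (x \<bullet> snd v) / W = 0"
    using W by (simp add: field_simps)
  then show ?thesis
    using W by (simp add: metric_eq raise_def x_def[symmetric] W_def[symmetric] inner_add_left
        inner_add_right inner_prod_def)
qed

lemma metric_symmetric_form: "symmetric_form (ads_metric L p)"
  unfolding symmetric_form_def bilinear_def metric_eq
  by (intro conjI allI linearI)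
    (simp_all add: inner_add_left inner_add_right inner_commute algebra_simps add_divide_distrib diff_divide_distrib)

lemma metric_bil: "bilinear (ads_metric L p)"
  using metric_symmetric_form[of p] unfolding symmetric_form_def by blast

lemma metric_commute: "ads_metric L p u v = ads_metric L p v u"
  using metric_symmetric_form[of p] unfolding symmetric_form_def by blast

lemma metric_raise': "ads_metric L p v (raise L p b) = v \<bullet> b"
  by (subst metric_commute) (simp add: metric_raise inner_commute)

lemma metric_nondegenerate: "nondegenerate (ads_metric L p)"
  unfolding nondegenerate_def using metric_raise'[of p _ _] by (metis inner_eq_zero_iff)

lemma c2_inner_self:
  "c2 (\<lambda>p::real \<times> 'a::euclidean_space. snd p \<bullet> snd p) (\<lambda>p u. 2 * (snd p \<bullet> snd u)) (\<lambda>p u v. 2 * (snd v \<bullet> snd u))"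
  unfolding c2_def by (auto intro!: derivative_eq_intros simp: inner_commute)

lemma twice_inner_self: "twice (\<lambda>p::real \<times> 'a::euclidean_space. snd p \<bullet> snd p)"
  using c2_inner_self unfolding twice_def by blast

lemma twice_snd_inner: "twice (\<lambda>p::real \<times> 'a::euclidean_space. snd p \<bullet> u)"
  by (rule twice_linear) (simp add: linear_iff inner_add_left)

lemma twice_fst: "twice (\<lambda>p::real \<times> 'a::euclidean_space. fst p)"
  by (rule twice_linear) (simp add: linear_iff)

lemma twice_wt2: "twice (\<lambda>p::real \<times> 'a::euclidean_space. (wt L (snd p))\<^sup>2)"
  unfolding wt2 by (intro twice_add twice_const twice_inner_self)

lemma twice_wt: "twice (\<lambda>p::real \<times> 'a::euclidean_space. wt L (snd p))"
  unfolding wt_def by (intro twice_sqrt twice_add twice_const twice_inner_self)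
    (use L_pos in \<open>simp add: add_pos_nonneg\<close>)

lemma metric_twice: "twice (\<lambda>p::real \<times> 'a::euclidean_space. ads_metric L p u v)"
  unfolding metric_eq
  by (intro twice_add twice_diff twice_divide twice_mult twice_minus twice_const twice_wt2 twice_snd_inner) simp_all

sublocale metric: smooth_tensor "ads_metric L :: (real \<times> 'a::euclidean_space) tensor2"
  by standard (rule metric_symmetric_form, rule metric_twice)

lemma metric_partial2:
  "partial2 (ads_metric L) p d u v = - (2 * (snd p \<bullet> snd d) / L\<^sup>2) * fst u * fst v
     - ((snd d \<bullet> snd u) * (snd p \<bullet> snd v) + (snd p \<bullet> snd u) * (snd d \<bullet> snd v)) / (wt L (snd p))\<^sup>2
     + 2 * (snd p \<bullet> snd d) * (snd p \<bullet> snd u) * (snd p \<bullet> snd v) / (wt L (snd p)) ^ 4"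
    (is "_ = ?D d")
proof -
  have d2: "((\<lambda>p. (wt L (snd p))\<^sup>2) has_derivative (\<lambda>d. 2 * (snd p \<bullet> snd d))) (at p)"
    unfolding wt2 by (rule has_derivative_eq_rhs, rule has_derivative_add[OF has_derivative_const c2D1[OF c2_inner_self]]) simp
  have "((\<lambda>p. ads_metric L p u v) has_derivative ?D) (at p)"
    unfolding metric_eq
    by (rule has_derivative_eq_rhs)
     (rule derivative_eq_intros d2 refl | simp add: fun_eq_iff field_simps power2_eq_square power4_eq_xxxx)+
  from has_derivative_unique[OF metric.D1 this] show ?thesis by (rule fun_cong)
qed

lemma Gamma_commute: "ads_Gamma L p u v = ads_Gamma L p v u"
  by (simp add: ads_Gamma_def metric_commute[of p u v] add.commute)

lemma metric_radial:
  "ads_metric L p (a, \<beta> *\<^sub>R snd p) v = - ((wt L (snd p))\<^sup>2 / L\<^sup>2) * a * fst v + \<beta> * L\<^sup>2 * (snd p \<bullet> snd v) / (wt L (snd p))\<^sup>2"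
proof -
  define W where "W = (wt L (snd p))\<^sup>2"
  have W: "W \<noteq> 0" by (simp add: W_def)
  have r: "snd p \<bullet> snd p = W - L\<^sup>2" by (simp add: W_def wt2)
  have key: "\<beta> * b - \<beta> * (W - L\<^sup>2) * b / W = \<beta> * L\<^sup>2 * b / W" for b
    using W by (simp add: field_simps)
  show ?thesis
    using key[of "snd p \<bullet> snd v"] by (simp add: metric_eq W_def[symmetric] r mult.commute mult.left_commute)
qed

text \<open>Together with the symmetry of \<open>ads_Gamma\<close> this characterizes the
  Levi-Civita connection, so the closed form is identified with \<open>christoffel\<close> by
  uniqueness.\<close>

lemma metric_compatible:
  "partial2 (ads_metric L) p d u v = ads_metric L p (ads_Gamma L p d u) v + ads_metric L p u (ads_Gamma L p d v)"
proof -
  define W where "W = (wt L (snd p))\<^sup>2"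
  have W: "W \<noteq> 0" "(wt L (snd p)) ^ 4 = W * W" by (simp_all add: W_def power4_eq_xxxx power2_eq_square)
  have G: "ads_metric L p (ads_Gamma L p d u) v = - (1 / L\<^sup>2) * (fst d * (snd p \<bullet> snd u) + fst u * (snd p \<bullet> snd d)) * fst v
     - ads_metric L p d u * (snd p \<bullet> snd v) / W" for u v
    unfolding ads_Gamma_def metric_radial W_def[symmetric] using W(1) by simp
  have m: "ads_metric L p d u = - (W / L\<^sup>2) * fst d * fst u + snd d \<bullet> snd u
     - (snd p \<bullet> snd d) * (snd p \<bullet> snd u) / W" for u
    by (simp add: metric_eq W_def)
  show ?thesis
    unfolding metric_commute[of p u "ads_Gamma L p d v"] G metric_partial2 W(2) W_def[symmetric] m
    using W(1) by (simp add: field_simps)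
qed

lemma christoffel_ads: "christoffel (ads_metric L) p u v = ads_Gamma L p u v"
  unfolding christoffel_koszul
proof (rule sharp_eqI[OF metric_bil metric_nondegenerate])
  fix w
  show "ads_metric L p (ads_Gamma L p u v) w = koszul (ads_metric L) p u v w"
    unfolding koszul_def metric_compatible Gamma_commute[of p v u] Gamma_commute[of p w]
      metric_commute[of p v "ads_Gamma L p u w"] metric_commute[of p u "ads_Gamma L p v w"]
    by simp
qed

lemma Gamma_has_derivative:
  "((\<lambda>p. ads_Gamma L p u v) has_derivative (\<lambda>d.
     ((fst u * (snd d \<bullet> snd v) + fst v * (snd d \<bullet> snd u)) / (wt L (snd p))\<^sup>2
       - (fst u * (snd p \<bullet> snd v) + fst v * (snd p \<bullet> snd u)) * (2 * (snd p \<bullet> snd d)) / (wt L (snd p)) ^ 4,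
      - (partial2 (ads_metric L) p d u v / L\<^sup>2) *\<^sub>R snd p - (ads_metric L p u v / L\<^sup>2) *\<^sub>R snd d))) (at p)"
proof -
  have d2: "((\<lambda>p. (wt L (snd p))\<^sup>2) has_derivative (\<lambda>d. 2 * (snd p \<bullet> snd d))) (at p)"
    unfolding wt2 by (rule has_derivative_eq_rhs, rule has_derivative_add[OF has_derivative_const c2D1[OF c2_inner_self]]) simp
  show ?thesis unfolding ads_Gamma_def
    by (rule has_derivative_eq_rhs)
      (rule derivative_eq_intros d2 metric.D1 refl | simp add: fun_eq_iff field_simps power2_eq_square power4_eq_xxxx)+
qed

text \<open>A direct computation for the time component. In the spatial component the contributions
  along \<open>snd p\<close> combine to a difference that vanishes by
  \<open>metric_compatible\<close>.\<close>

lemma riemann_ads: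
  "riemann (ads_metric L) p u v w = (ads_metric L p v w / L\<^sup>2) *\<^sub>R u - (ads_metric L p u w / L\<^sup>2) *\<^sub>R v"
proof (rule prod_eqI)
  define x where "x = snd p"
  define W where "W = (wt L x)\<^sup>2"
  have "W \<noteq> 0" by (simp add: W_def)
  moreover have "x \<bullet> x = W - L\<^sup>2" by (simp add: W_def wt2)
  moreover have "(wt L x) ^ 4 = W * W" by (simp add: W_def power4_eq_xxxx power2_eq_square)
  ultimately have W: "W \<noteq> 0" "(wt L x) ^ 4 = W * W" "x \<bullet> x = W - L\<^sup>2" by auto
  note fd = frechet_derivative_at[OF Gamma_has_derivative, symmetric]
  have m: "ads_metric L p u v = - (W / L\<^sup>2) * fst u * fst v + snd u \<bullet> snd v
     - (x \<bullet> snd u) * (x \<bullet> snd v) / W" for u v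
    by (simp add: metric_eq W_def x_def)
  show "fst (riemann (ads_metric L) p u v w) =
      fst ((ads_metric L p v w / L\<^sup>2) *\<^sub>R u - (ads_metric L p u w / L\<^sup>2) *\<^sub>R v)"
    unfolding riemann_def christoffel_ads fd unfolding ads_Gamma_def
    using W(1) by (simp add: x_def[symmetric] W_def[symmetric] W(2,3) m inner_commute) (simp add: field_simps)
  have "snd (riemann (ads_metric L) p u v w) =
      - ((partial2 (ads_metric L) p v u w + ads_metric L p v (ads_Gamma L p u w)
         - partial2 (ads_metric L) p u v w - ads_metric L p u (ads_Gamma L p v w)) / L\<^sup>2) *\<^sub>R x
      + (ads_metric L p v w / L\<^sup>2) *\<^sub>R snd u - (ads_metric L p u w / L\<^sup>2) *\<^sub>R snd v"
    unfolding riemann_def christoffel_ads fd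
    by (simp add: ads_Gamma_def x_def[symmetric] algebra_simps add_divide_distrib diff_divide_distrib)
  also have "partial2 (ads_metric L) p v u w + ads_metric L p v (ads_Gamma L p u w)
         - partial2 (ads_metric L) p u v w - ads_metric L p u (ads_Gamma L p v w) = 0"
    unfolding metric_compatible Gamma_commute[of p v u] by simp
  finally show "snd (riemann (ads_metric L) p u v w) =
      snd ((ads_metric L p v w / L\<^sup>2) *\<^sub>R u - (ads_metric L p u w / L\<^sup>2) *\<^sub>R v)"
    by simp
qed

lemma ricci_ads:
  fixes p :: "real \<times> 'a::euclidean_space"
  shows "ricci (ads_metric L) p u w = - (real DIM('a) / L\<^sup>2) * ads_metric L p u w"
proof -
  have "(\<Sum>b\<in>Basis. ads_metric L p b w * (u \<bullet> b)) = ads_metric L p u w"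
    using bilinear_expand[OF metric_bil, of p u w] by (simp add: mult.commute)
  then have "(\<Sum>b\<in>Basis. riemann (ads_metric L) p u b w \<bullet> b) =
      ads_metric L p u w / L\<^sup>2 - (\<Sum>b\<in>(Basis :: (real \<times> 'a) set). ads_metric L p u w / L\<^sup>2)"
    by (simp add: riemann_ads inner_diff_left sum_subtractf sum_divide_distrib[symmetric])
  then show ?thesis by (simp add: ricci_def field_simps)
qed

text \<open>The determinant of the metric in this chart is -1 everywhere, so the divergence of a
  vector field is its coordinate divergence, without a volume factor.\<close>

lemma trace_Gamma:
  fixes v :: "real \<times> 'a::euclidean_space"
  shows "(\<Sum>b\<in>Basis. ads_Gamma L p b v \<bullet> b) = 0"
proof -
  define x where "x = snd p"
  define W where "W = (wt L x)\<^sup>2"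
  have W: "W \<noteq> 0" by (simp add: W_def)
  have lin: "linear (\<lambda>y. ads_metric L p (0, y) v)"
    using linear_compose[OF linear_Pair0 bilinear_linear_left[OF metric_bil]] by (simp add: o_def)
  have "(\<Sum>e\<in>Basis. (x \<bullet> e) * ads_metric L p (0, e) v) = ads_metric L p (0, x) v"
    using linear_expand[OF lin, of x] by simp
  also have "\<dots> = L\<^sup>2 * (x \<bullet> snd v) / W"
    using metric_radial[of p 0 1 v] by (simp add: x_def W_def)
  finally have "(\<Sum>e\<in>Basis. (x \<bullet> e) * ads_metric L p (0, e) v) / L\<^sup>2 = (x \<bullet> snd v) / W" by simp
  then show ?thesis
    unfolding sum_Basis_Pair
    by (simp add: ads_Gamma_def x_def[symmetric] W_def[symmetric] sum_negf mult.commute sum_divide_distrib)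
qed

lemma trace_raise:
  fixes B :: "real \<times> 'a::euclidean_space \<Rightarrow> real \<times> 'a \<Rightarrow> real"
  assumes B: "bilinear B"
  shows "(\<Sum>b\<in>Basis. B b (raise L p b)) = ads_trace L p B"
    and "(\<Sum>b\<in>Basis. B (raise L p b) b) = ads_trace L p B"
proof -
  define x where "x = snd p"
  have r1: "raise L p (1, 0) = (- (L\<^sup>2 / (wt L x)\<^sup>2)) *\<^sub>R (1, 0)"
    by (simp add: raise_def x_def)
  have r2: "raise L p (0, e) = (0, e) + ((x \<bullet> e) / L\<^sup>2) *\<^sub>R (0, x)" for e
    by (simp add: raise_def x_def)
  note B_simps = bilinear_radd[OF B] bilinear_rmul[OF B] bilinear_ladd[OF B] bilinear_lmul[OF B]
  have l: "linear (\<lambda>y. B (0, y) u)" "linear (\<lambda>y. B u (0, y))" for u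
    using linear_compose[OF linear_Pair0 bilinear_linear_left[OF B]]
      linear_compose[OF linear_Pair0 bilinear_linear_right[OF B]] by (simp_all add: o_def)
  have "(\<Sum>e\<in>Basis. (x \<bullet> e) * B (0, e) (0, x)) = B (0, x) (0, x)"
    using linear_expand[OF l(1), of x "(0, x)"] by simp
  then show "(\<Sum>b\<in>Basis. B b (raise L p b)) = ads_trace L p B"
    unfolding sum_Basis_Pair ads_trace_def r1 r2 B_simps
    by (simp add: sum.distrib x_def[symmetric] sum_divide_distrib[symmetric])
  have "(\<Sum>e\<in>Basis. (x \<bullet> e) * B (0, x) (0, e)) = B (0, x) (0, x)"
    using linear_expand[OF l(2), of "(0, x)" x] by simp
  then show "(\<Sum>b\<in>Basis. B (raise L p b) b) = ads_trace L p B"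
    unfolding sum_Basis_Pair ads_trace_def r1 r2 B_simps
    by (simp add: sum.distrib x_def[symmetric] sum_divide_distrib[symmetric])
qed

end

lemma (in smooth_tensor) twice_tensor:
  assumes "\<And>i. i \<in> Basis \<Longrightarrow> twice (\<lambda>p. U p \<bullet> i)" "\<And>i. i \<in> Basis \<Longrightarrow> twice (\<lambda>p. V p \<bullet> i)"
  shows "twice (\<lambda>p. g p (U p) (V p))"
proof -
  have "(\<lambda>p. g p (U p) (V p)) = (\<lambda>p. \<Sum>i\<in>Basis. \<Sum>j\<in>Basis. ((U p \<bullet> i) * (V p \<bullet> j)) * g p i j)"
    by (rule ext, subst bilinear_expand2[OF bil]) simp
  then show ?thesis
    using assms tw by (auto intro!: twice_sum twice_mult)
qed

locale ads_perturbation = ads L + h: smooth_tensor h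
  for L :: real and h :: "(real \<times> 'a::euclidean_space) tensor2"
begin

sublocale metric_variation "ads_metric L" h
  by standard (rule metric_nondegenerate)

definition Tr :: "real \<times> 'a \<Rightarrow> real" where
  "Tr p = ads_trace L p (h p)"

lemma twice_Tr: "twice Tr"
proof -
  have b: "twice (\<lambda>p::real \<times> 'a. (0::real, snd p) \<bullet> i)" for i :: "real \<times> 'a"
    using twice_snd_inner[of "snd i"] by (simp add: inner_prod_def)
  show ?thesis
    unfolding Tr_def[abs_def] ads_trace_def
    by (intro twice_add twice_mult twice_minus twice_divide twice_const twice_wt2 twice_sum h.tw h.twice_tensor b) simp_all
qed

lemma Tr_deriv:
  "(Tr has_derivative (\<lambda>v. ads_trace L p (partial2 h p v) + 2 * L\<^sup>2 * (snd p \<bullet> snd v) / (wt L (snd p)) ^ 4 * h p (1, 0) (1, 0)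
     + 2 * h p (0, snd p) (0, snd v) / L\<^sup>2)) (at p)"
proof -
  have d2: "((\<lambda>p. (wt L (snd p))\<^sup>2) has_derivative (\<lambda>d. 2 * (snd p \<bullet> snd d))) (at p)"
    unfolding wt2 by (rule has_derivative_eq_rhs, rule has_derivative_add[OF has_derivative_const c2D1[OF c2_inner_self]]) simp
  have X: "((\<lambda>p::real \<times> 'a. (0::real, snd p)) has_derivative (\<lambda>v. (0, snd v))) (at p)"
    by (auto intro!: derivative_eq_intros)
  have d3: "((\<lambda>p. - (L\<^sup>2 / (wt L (snd p))\<^sup>2)) has_derivative (\<lambda>d. 2 * L\<^sup>2 * (snd p \<bullet> snd d) / (wt L (snd p)) ^ 4)) (at p)"
    by (rule has_derivative_eq_rhs)
      (rule derivative_eq_intros d2 refl | simp add: fun_eq_iff field_simps power2_eq_square power4_eq_xxxx)+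
  show ?thesis
    unfolding Tr_def[abs_def] ads_trace_def
  proof (rule has_derivative_eq_rhs[OF has_derivative_add[OF has_derivative_add[OF
            has_derivative_mult[OF d3 h.D1] has_derivative_sum[OF h.D1]]
          bounded_linear.has_derivative[OF bounded_linear_divide h.tensor_has_derivative[OF X X]]]], rule ext, goal_cases)
    case (1 v)
    show ?case
      unfolding h.commute[of p "(0, snd v)" "(0, snd p)"] by (simp add: add_divide_distrib)
  qed
qed

text \<open>The right-hand side is half the derivative of \<open>Tr\<close>, see
  \<open>Tr_deriv\<close>: the contracted variation of the connection is the gradient of the
  variation of the logarithm of the volume density. The extra terms come from differentiating the
  inverse metric inside the trace.\<close>

lemma trace_C: "(\<Sum>b\<in>Basis. C p b v \<bullet> b) = (1/2) *
    (ads_trace L p (partial2 h p v) + 2 * L\<^sup>2 * (snd p \<bullet> snd v) / (wt L (snd p)) ^ 4 * h p (1, 0) (1, 0)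
     + 2 * h p (0, snd p) (0, snd v) / L\<^sup>2)"
proof -
  define x where "x = snd p"
  define W where "W = (wt L x)\<^sup>2"
  have W: "W \<noteq> 0" by (simp add: W_def)
  have W4: "(wt L x) ^ 4 = W * W" by (simp add: W_def power4_eq_xxxx power2_eq_square)
  have r: "x \<bullet> x = W - L\<^sup>2" by (simp add: W_def wt2)
  have cb: "C p b v \<bullet> b = koszul h p b v (raise L p b) - h p (ads_Gamma L p b v) (raise L p b)" for b
    using C_solves[of p b v "raise L p b"] by (simp add: metric_raise' christoffel_ads)
  have bb: "bilinear (\<lambda>b c. partial2 h p b v c)"
    unfolding bilinear_def by (intro conjI allI h.lins)
  have "(\<Sum>b\<in>Basis. koszul h p b v (raise L p b)) = (1/2) *
    ((\<Sum>b\<in>Basis. partial2 h p b v (raise L p b)) + (\<Sum>b\<in>Basis. partial2 h p v b (raise L p b))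
      - (\<Sum>b\<in>Basis. partial2 h p (raise L p b) v b))"
    by (simp add: koszul_def sum_divide_distrib[symmetric] sum.distrib sum_subtractf h.partial2_commute[of p "raise L p _" _ v])
  also have "\<dots> = (1/2) * ads_trace L p (partial2 h p v)"
    using trace_raise[OF bb, of p] trace_raise[OF h.partial2_bil[of p v], of p] by simp
  finally have 1: "(\<Sum>b\<in>Basis. koszul h p b v (raise L p b)) = (1/2) * ads_trace L p (partial2 h p v)" .
  define T where "T = (1 :: real, 0 :: 'a)"
  define X where "X = (0 :: real, x)"
  define V where "V = (0 :: real, snd v)"
  have G: "ads_Gamma L p b v = ((fst b * (x \<bullet> snd v) + fst v * (x \<bullet> snd b)) / W) *\<^sub>R T - (ads_metric L p b v / L\<^sup>2) *\<^sub>R X" for b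
    by (simp add: ads_Gamma_def T_def X_def x_def[symmetric] W_def)
  note hl = bilinear_lsub[OF h.bil] bilinear_ladd[OF h.bil] bilinear_lmul[OF h.bil]
  have gT: "ads_metric L p T v = - (W / L\<^sup>2) * fst v" by (simp add: metric_eq T_def x_def[symmetric] W_def)
  have ge: "ads_metric L p (0, e) v = e \<bullet> snd v - (x \<bullet> e) * (x \<bullet> snd v) / W" for e
    by (simp add: metric_eq x_def[symmetric] W_def)
  have gX: "ads_metric L p X v = L\<^sup>2 * (x \<bullet> snd v) / W"
    using metric_radial[of p 0 1 v] by (simp add: x_def W_def X_def)
  have l: "linear (\<lambda>y. h p u (0, y))" for u
    using linear_compose[OF linear_Pair0 bilinear_linear_right[OF h.bil]] by (simp add: o_def)
  have eX: "(\<Sum>e\<in>Basis. (x \<bullet> e) * h p u (0, e)) = h p u X" and eV: "(\<Sum>e\<in>Basis. (e \<bullet> snd v) * h p u (0, e)) = h p u V" for u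
    using linear_expand[OF l, of u x] linear_expand[OF l, of u "snd v"] by (simp_all add: X_def V_def inner_commute)
  have "bilinear (\<lambda>b. h p (ads_Gamma L p b v))"
    using bilinear_linear_left[OF metric.christoffel_bil[OF metric_nondegenerate, of p], of v]
    unfolding bilinear_def christoffel_ads
    by (intro conjI allI bilinear_linear_right[OF h.bil] linear_compose[OF _ bilinear_linear_left[OF h.bil], unfolded o_def])
  then have "(\<Sum>b\<in>Basis. h p (ads_Gamma L p b v) (raise L p b)) = ads_trace L p (\<lambda>b. h p (ads_Gamma L p b v))"
    by (rule trace_raise)
  also have "\<dots> = - (L\<^sup>2 / W) * h p (ads_Gamma L p T v) T + (\<Sum>e\<in>Basis. h p (ads_Gamma L p (0, e) v) (0, e)) + h p (ads_Gamma L p X v) X / L\<^sup>2"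
    by (simp add: ads_trace_def T_def X_def x_def W_def)
  also have "(\<Sum>e\<in>Basis. h p (ads_Gamma L p (0, e) v) (0, e))
      = (\<Sum>e\<in>Basis. (fst v / W) * ((x \<bullet> e) * h p T (0, e)) - (1 / L\<^sup>2) * ((e \<bullet> snd v) * h p X (0, e))
          + ((x \<bullet> snd v) / (W * L\<^sup>2)) * ((x \<bullet> e) * h p X (0, e)))"
    unfolding G hl ge using W by (intro sum.cong refl) (simp add: field_simps)
  also have "\<dots> = (fst v / W) * h p T X - (1 / L\<^sup>2) * h p X V + ((x \<bullet> snd v) / (W * L\<^sup>2)) * h p X X"
    unfolding sum.distrib sum_subtractf sum_distrib_left[symmetric] eX eV ..
  also have "- (L\<^sup>2 / W) * h p (ads_Gamma L p T v) T + \<dots> + h p (ads_Gamma L p X v) X / L\<^sup>2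
      = - (L\<^sup>2 * (x \<bullet> snd v) / (W * W)) * h p T T - h p X V / L\<^sup>2"
    unfolding G hl gT gX h.commute[of p X T] using W by (simp add: T_def X_def r) (simp add: field_simps)
  finally have 2: "(\<Sum>b\<in>Basis. h p (ads_Gamma L p b v) (raise L p b)) =
      - (L\<^sup>2 * (x \<bullet> snd v) / (W * W)) * h p T T - h p X V / L\<^sup>2" .
  show ?thesis
    unfolding cb sum_subtractf 1 2
    by (simp add: x_def[symmetric] W4 T_def X_def V_def field_simps)
qed

text \<open>The Palatini identity: the divergence of the variation of the connection on
  \<open>k\<close>, \<open>k\<close>, minus half of the Hessian of the trace. Covariant derivatives
  are spelled out with \<open>ads_Gamma\<close>, and \<open>trace_Gamma\<close> removes the volume
  term of the divergence.\<close>

lemma delta_ricci_ads: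
  assumes c: "c2 Tr T1 T2"
  shows "delta_ricci (ads_metric L) h p k k = (\<Sum>b\<in>Basis. dC p b k k \<bullet> b)
    - 2 * (\<Sum>b\<in>Basis. C p k (ads_Gamma L p k b) \<bullet> b) - (T2 p k k - T1 p (ads_Gamma L p k k)) / 2"
proof -
  have T1: "T1 p v = 2 * (\<Sum>b\<in>Basis. C p b v \<bullet> b)" for p v
    using fun_cong[OF has_derivative_unique[OF c2D1[OF c] Tr_deriv[of p]], of v] by (simp add: trace_C)
  \<comment> \<open>Differentiating the trace identity along \<open>k\<close> turns the second
    \<open>dC\<close> sum of the Ricci formula into a second derivative of
    \<open>Tr\<close>.\<close>
  have "((\<lambda>p. \<Sum>b\<in>Basis. C p b k \<bullet> b) has_derivative (\<lambda>d. \<Sum>b\<in>Basis. dC p d b k \<bullet> b)) (at p)"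
    by (intro has_derivative_sum has_derivative_inner_left C_has_derivative)
  moreover have "((\<lambda>p. \<Sum>b\<in>Basis. C p b k \<bullet> b) has_derivative (\<lambda>d. (1/2) * T2 p k d)) (at p)"
    using has_derivative_mult_right[OF c2D2[OF c, of k p], of "1/2"] by (simp add: T1)
  ultimately have "(\<lambda>d. \<Sum>b\<in>Basis. dC p d b k \<bullet> b) = (\<lambda>d. (1/2) * T2 p k d)"
    by (rule has_derivative_unique)
  from fun_cong[OF this, of k] have d: "(\<Sum>b\<in>Basis. dC p k b k \<bullet> b) = T2 p k k / 2"
    by simp
  have "(\<Sum>b\<in>Basis. ads_Gamma L p k (C p b k) \<bullet> b) = (\<Sum>b\<in>Basis. ads_Gamma L p k (C p k b) \<bullet> b)"
    by (intro sum.cong refl) (subst C_commute, rule refl)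
  also have "\<dots> = (\<Sum>b\<in>Basis. C p k (ads_Gamma L p k b) \<bullet> b)"
    using trace_commute[OF bilinear_linear_right[OF metric.christoffel_bil[OF metric_nondegenerate, of p], of k]
        bilinear_linear_right[OF C_bil, of p k]]
    by (simp add: christoffel_ads)
  finally have comm: "(\<Sum>b\<in>Basis. ads_Gamma L p k (C p b k) \<bullet> b) = (\<Sum>b\<in>Basis. C p k (ads_Gamma L p k b) \<bullet> b)" .
  have comm2: "(\<Sum>b\<in>Basis. C p k (ads_Gamma L p b k) \<bullet> b) = (\<Sum>b\<in>Basis. C p k (ads_Gamma L p k b) \<bullet> b)"
    by (intro sum.cong refl) (subst Gamma_commute, rule refl)
  have tg: "(\<Sum>b\<in>Basis. ads_Gamma L p b (C p k k) \<bullet> b) = 0" by (rule trace_Gamma)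
  have tc: "(\<Sum>b\<in>Basis. C p b (ads_Gamma L p k k) \<bullet> b) = T1 p (ads_Gamma L p k k) / 2" by (simp add: T1)
  show ?thesis
    unfolding delta_ricci_formula christoffel_ads
    by (simp add: inner_add_left inner_diff_left sum.distrib sum_subtractf d tg tc comm
        comm2 diff_divide_distrib)
qed

end

section \<open>Horizons as graphs\<close>

text \<open>The null geodesics through the boundary points \<open>(tm \<mp> L pi / 2, \<mp> x1)\<close> project to the lines
  in direction \<open>x1\<close>, and sweep out the graph of \<open>hor\<close>.  It is the zero set of \<open>phi\<close>, a multiple of a linear
  function of the ambient space of the hyperboloid model; \<open>P\<close> is the gradient of \<open>phi\<close>.\<close>

locale ads_line = ads L for L :: real +
  fixes tm :: real and x1 :: "'a::euclidean_space"
  assumes x1: "x1 \<bullet> x1 = 1"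
begin

definition lam :: "'a \<Rightarrow> real" where "lam x = x \<bullet> x1"

text \<open>Only the part of \<open>x\<close> orthogonal to \<open>x1\<close> enters, so this is
  constant along each generator. On that part it is the height function of a hyperboloid of radius
  \<open>L\<close> whose points label the generators.\<close>

definition w0 :: "'a \<Rightarrow> real" where "w0 x = sqrt (L\<^sup>2 + (x \<bullet> x - (lam x)\<^sup>2))"

definition perp :: "'a \<Rightarrow> 'a" where "perp x = x - lam x *\<^sub>R x1"

definition hor :: "'a \<Rightarrow> real" where "hor x = tm + L * arctan (lam x / w0 x)"

definition graph :: "'a \<Rightarrow> real \<times> 'a" where "graph x = (hor x, x)"

text \<open>At once the tangent of the graph in direction \<open>x1\<close>, by
  \<open>hk_eq\<close>, and the gradient of \<open>phi\<close> on the graph, by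
  \<open>P_graph\<close>: the normal of a null hypersurface is tangent to it.\<close>

definition hk :: "'a \<Rightarrow> real \<times> 'a" where "hk x = (L * w0 x / (wt L x)\<^sup>2, x1)"

definition phi :: "real \<times> 'a \<Rightarrow> real" where
  "phi p = snd p \<bullet> x1 - wt L (snd p) * sin ((fst p - tm) / L)"

definition P :: "real \<times> 'a \<Rightarrow> real \<times> 'a" where
  "P p = (L * cos ((fst p - tm) / L) / wt L (snd p), x1 + (phi p / L\<^sup>2) *\<^sub>R snd p)"

definition dphi :: "real \<times> 'a \<Rightarrow> real \<times> 'a \<Rightarrow> real" where
  "dphi p d = x1 \<bullet> snd d - (snd p \<bullet> snd d) / wt L (snd p) * sin ((fst p - tm) / L)
     - wt L (snd p) / L * cos ((fst p - tm) / L) * fst d"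

definition dhor :: "'a \<Rightarrow> 'a \<Rightarrow> real" where
  "dhor x u = L / w0 x * (x1 \<bullet> u - lam x / (wt L x)\<^sup>2 * (x \<bullet> u))"

lemma norm_x1: "norm x1 = 1"
  by (simp add: norm_eq_sqrt_inner x1)

lemma perp_x1: "perp x \<bullet> x1 = 0"
  by (simp add: perp_def lam_def inner_diff_left x1)

lemma perp_inner: "perp x \<bullet> perp x = x \<bullet> x - (lam x)\<^sup>2"
  by (simp add: perp_def lam_def inner_diff_left inner_diff_right x1 power2_eq_square inner_commute)

lemma w02: "(w0 x)\<^sup>2 = L\<^sup>2 + perp x \<bullet> perp x"
  unfolding w0_def perp_inner[symmetric] by simp

lemma w0_pos: "w0 x > 0"
  unfolding w0_def perp_inner[symmetric] using L_pos by (simp add: add_pos_nonneg)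

lemma w0_nz [simp]: "w0 x \<noteq> 0"
  using w0_pos[of x] by simp

lemma wt2_w0: "(wt L x)\<^sup>2 = (w0 x)\<^sup>2 + (lam x)\<^sup>2"
  by (simp add: wt2 w02 perp_inner)

lemma inner_wt: "x \<bullet> x = (wt L x)\<^sup>2 - L\<^sup>2"
  by (simp add: wt2)

lemma sqrt_arctan: "sqrt (1 + (lam x / w0 x)\<^sup>2) = wt L x / w0 x"
proof -
  have "1 + (lam x / w0 x)\<^sup>2 = (wt L x / w0 x)\<^sup>2"
    by (simp add: power_divide wt2_w0 add_divide_distrib)
  then show ?thesis using wt_pos[of x] w0_pos[of x] by simp
qed

lemma sin_hor: "sin ((hor x - tm) / L) = lam x / wt L x"
  by (simp add: hor_def sin_arctan sqrt_arctan)

lemma cos_hor: "cos ((hor x - tm) / L) = w0 x / wt L x"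
  by (simp add: hor_def cos_arctan sqrt_arctan)

lemma phi_graph: "phi (graph x) = 0"
  by (simp add: phi_def graph_def sin_hor lam_def)

lemma P_graph: "P (graph x) = hk x"
  by (simp add: P_def hk_def phi_graph) (simp add: graph_def cos_hor power2_eq_square)

lemma wt_deriv: "((\<lambda>p::real \<times> 'a. wt L (snd p)) has_derivative (\<lambda>d. (snd p \<bullet> snd d) / wt L (snd p))) (at p)"
proof -
  have "((\<lambda>p::real \<times> 'a. L\<^sup>2 + snd p \<bullet> snd p) has_derivative (\<lambda>d. 0 + 2 * (snd p \<bullet> snd d))) (at p)"
    by (intro has_derivative_add has_derivative_const c2D1[OF c2_inner_self])
  note i = this
  have pos: "L\<^sup>2 + snd p \<bullet> snd p > 0" using L_pos by (simp add: add_pos_nonneg)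
  have "((\<lambda>p::real \<times> 'a. sqrt (L\<^sup>2 + snd p \<bullet> snd p)) has_derivative
      (\<lambda>d. (0 + 2 * (snd p \<bullet> snd d)) * (inverse (sqrt (L\<^sup>2 + snd p \<bullet> snd p)) / 2))) (at p)"
    by (rule has_derivative_real_sqrt[OF _ i]) (rule pos)
  then show ?thesis
    unfolding wt_def by (rule has_derivative_eq_rhs) (simp add: fun_eq_iff inverse_eq_divide)
qed

lemma phi_deriv: "(phi has_derivative dphi p) (at p)"
  unfolding phi_def[abs_def] dphi_def[abs_def]
  by (rule has_derivative_eq_rhs)
    (rule derivative_eq_intros wt_deriv refl | simp add: fun_eq_iff inner_commute field_simps)+

lemma metric_P: "ads_metric L p (P p) d = dphi p d"
proof -
  define x where "x = snd p"
  define s where "s = sin ((fst p - tm) / L)"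
  define c where "c = cos ((fst p - tm) / L)"
  define W where "W = wt L x"
  have W: "W \<noteq> 0" by (simp add: W_def)
  have r: "x \<bullet> x = W\<^sup>2 - L\<^sup>2" by (simp add: W_def wt2)
  have f: "phi p = x \<bullet> x1 - W * s" by (simp add: phi_def x_def W_def s_def)
  have xx: "x1 \<bullet> x = x \<bullet> x1" by (rule inner_commute)
  show ?thesis
    unfolding metric_eq dphi_def P_def x_def[symmetric] s_def[symmetric] c_def[symmetric] W_def[symmetric]
    using W by (simp add: inner_add_left inner_add_right f r xx) (simp add: field_simps power2_eq_square)
qed

text \<open>On the hyperboloid the Hessian of an ambient linear function is that function times the
  metric over \<open>L\<^sup>2\<close>. On the horizon, where \<open>phi\<close> vanishes,
  \<open>P\<close> is thus covariantly constant: its integral curves there are affinely parametrized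
  geodesics, and divergences of contractions with \<open>P\<close> contain no derivative of
  \<open>P\<close>.\<close>

lemma P_deriv: "(P has_derivative (\<lambda>d. (phi p / L\<^sup>2) *\<^sub>R d - ads_Gamma L p d (P p))) (at p)"
proof -
  define x where "x = snd p"
  define s where "s = sin ((fst p - tm) / L)"
  define c where "c = cos ((fst p - tm) / L)"
  define W where "W = wt L x"
  have W: "W \<noteq> 0" by (simp add: W_def)
  have r: "x \<bullet> x = W\<^sup>2 - L\<^sup>2" by (simp add: W_def wt2)
  have f: "phi p = x \<bullet> x1 - W * s" by (simp add: phi_def x_def W_def s_def)
  have "(P has_derivative (\<lambda>d. (- s * fst d / W - L * c * (x \<bullet> snd d) / W ^ 3,
      (dphi p d / L\<^sup>2) *\<^sub>R x + (phi p / L\<^sup>2) *\<^sub>R snd d))) (at p)"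
    unfolding P_def[abs_def]
    by (rule has_derivative_eq_rhs)
      (rule derivative_eq_intros wt_deriv phi_deriv refl
        | simp add: fun_eq_iff x_def[symmetric] W_def[symmetric] s_def[symmetric] c_def[symmetric] W
            field_simps power2_eq_square power3_eq_cube)+
  moreover have "(phi p / L\<^sup>2) *\<^sub>R d - ads_Gamma L p d (P p) = (- s * fst d / W - L * c * (x \<bullet> snd d) / W ^ 3,
      (dphi p d / L\<^sup>2) *\<^sub>R x + (phi p / L\<^sup>2) *\<^sub>R snd d)" for d
  proof (rule prod_eqI)
    show "snd ((phi p / L\<^sup>2) *\<^sub>R d - ads_Gamma L p d (P p)) = snd (- s * fst d / W - L * c * (x \<bullet> snd d) / W ^ 3,
      (dphi p d / L\<^sup>2) *\<^sub>R x + (phi p / L\<^sup>2) *\<^sub>R snd d)"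
      by (simp add: ads_Gamma_def metric_commute[of p d] metric_P x_def)
    show "fst ((phi p / L\<^sup>2) *\<^sub>R d - ads_Gamma L p d (P p)) = fst (- s * fst d / W - L * c * (x \<bullet> snd d) / W ^ 3,
      (dphi p d / L\<^sup>2) *\<^sub>R x + (phi p / L\<^sup>2) *\<^sub>R snd d)"
      unfolding ads_Gamma_def P_def x_def[symmetric] s_def[symmetric] c_def[symmetric] W_def[symmetric]
      using W by (simp add: inner_add_right f r) (simp add: field_simps power2_eq_square power3_eq_cube)
  qed
  ultimately show ?thesis by simp
qed

text \<open>The gradient of the Cartesian coordinate \<open>snd p \<bullet> e\<close>, by
  \<open>metric_eT\<close>. This coordinate is another ambient linear function, so the covariant
  derivative of the field is a multiple of the identity, as for \<open>P\<close>.\<close>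

definition eT :: "'a \<Rightarrow> real \<times> 'a \<Rightarrow> real \<times> 'a" where
  "eT e p = (0, e + ((snd p \<bullet> e) / L\<^sup>2) *\<^sub>R snd p)"

lemma eT_raise: "eT e p = raise L p (0, e)"
  by (simp add: eT_def raise_def)

lemma metric_eT: "ads_metric L p v (eT e p) = snd v \<bullet> e"
  by (simp add: eT_raise metric_raise' inner_prod_def)

lemma eT_deriv: "(eT e has_derivative (\<lambda>d. ((snd p \<bullet> e) / L\<^sup>2) *\<^sub>R d - ads_Gamma L p d (eT e p))) (at p)"
proof -
  have "(eT e has_derivative (\<lambda>d. (0, ((snd d \<bullet> e) / L\<^sup>2) *\<^sub>R snd p + ((snd p \<bullet> e) / L\<^sup>2) *\<^sub>R snd d))) (at p)"
    unfolding eT_def[abs_def]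
    by (rule has_derivative_eq_rhs) (rule derivative_eq_intros refl | simp add: fun_eq_iff)+
  moreover have "((snd p \<bullet> e) / L\<^sup>2) *\<^sub>R d - ads_Gamma L p d (eT e p) =
      (0, ((snd d \<bullet> e) / L\<^sup>2) *\<^sub>R snd p + ((snd p \<bullet> e) / L\<^sup>2) *\<^sub>R snd d)" for d
    by (simp add: prod_eq_iff ads_Gamma_def metric_eT)
      (simp add: eT_def inner_add_right inner_wt[of "snd p"] field_simps power2_eq_square)
  ultimately show ?thesis by simp
qed

lemma lam_deriv: "(lam has_derivative (\<lambda>u. x1 \<bullet> u)) (at x)"
  unfolding lam_def[abs_def] by (rule has_derivative_eq_rhs) (rule derivative_eq_intros refl | simp add: inner_commute)+

lemma w0_deriv: "(w0 has_derivative (\<lambda>u. (perp x \<bullet> u) / w0 x)) (at x)"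
proof -
  have "((\<lambda>x. L\<^sup>2 + (x \<bullet> x - (lam x)\<^sup>2)) has_derivative (\<lambda>u. 2 * (perp x \<bullet> u))) (at x)"
    by (rule has_derivative_eq_rhs)
      (rule derivative_eq_intros lam_deriv refl | simp add: fun_eq_iff perp_def inner_diff_left inner_diff_right inner_commute)+
  note i = this
  have pos: "L\<^sup>2 + (x \<bullet> x - (lam x)\<^sup>2) > 0"
    using w0_pos[of x] unfolding w0_def by simp
  have "((\<lambda>x. sqrt (L\<^sup>2 + (x \<bullet> x - (lam x)\<^sup>2))) has_derivative
      (\<lambda>u. (2 * (perp x \<bullet> u)) * (inverse (sqrt (L\<^sup>2 + (x \<bullet> x - (lam x)\<^sup>2))) / 2))) (at x)"
    by (rule has_derivative_real_sqrt[OF _ i]) (rule pos)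
  then show ?thesis
    unfolding w0_def[abs_def] by (rule has_derivative_eq_rhs) (simp add: fun_eq_iff inverse_eq_divide)
qed

lemma hor_deriv: "(hor has_derivative dhor x) (at x)"
proof -
  have a: "1 + (lam x / w0 x)\<^sup>2 = (wt L x)\<^sup>2 / (w0 x)\<^sup>2"
    by (simp add: wt2_w0 power_divide add_divide_distrib)
  have "((\<lambda>x. lam x / w0 x) has_derivative (\<lambda>u. ((x1 \<bullet> u) * w0 x - lam x * ((perp x \<bullet> u) / w0 x)) / (w0 x)\<^sup>2)) (at x)"
    by (rule has_derivative_eq_rhs)
      (rule derivative_eq_intros lam_deriv w0_deriv refl | simp add: fun_eq_iff field_simps power2_eq_square)+
  from has_derivative_compose[OF this DERIV_arctan[unfolded has_field_derivative_def, of "lam x / w0 x"]]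
  have "(hor has_derivative (\<lambda>u. L * (inverse (1 + (lam x / w0 x)\<^sup>2) * (((x1 \<bullet> u) * w0 x - lam x * ((perp x \<bullet> u) / w0 x)) / (w0 x)\<^sup>2)))) (at x)"
    unfolding hor_def[abs_def]
    by (intro has_derivative_eq_rhs[OF has_derivative_add[OF has_derivative_const has_derivative_mult_right]]) auto
  moreover have "L * (inverse (1 + (lam x / w0 x)\<^sup>2) * (((x1 \<bullet> u) * w0 x - lam x * ((perp x \<bullet> u) / w0 x)) / (w0 x)\<^sup>2)) = dhor x u" for u
  proof -
    define W where "W = (wt L x)\<^sup>2"
    have W: "W \<noteq> 0" "W = w0 x * w0 x + lam x * lam x" using wt2_w0[of x] by (simp_all add: W_def power2_eq_square)
    have "L * (inverse (1 + (lam x / w0 x)\<^sup>2) * (((x1 \<bullet> u) * w0 x - lam x * ((perp x \<bullet> u) / w0 x)) / (w0 x)\<^sup>2))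
      = L / (W * w0 x) * ((w0 x * w0 x + lam x * lam x) * (x1 \<bullet> u) - lam x * (x \<bullet> u))"
      unfolding a W_def[symmetric] perp_def using W(1)
      by (simp add: inner_diff_left field_simps power2_eq_square)
    also have "\<dots> = dhor x u"
      unfolding W(2)[symmetric] dhor_def W_def[symmetric] using W(1) by (simp add: field_simps)
    finally show ?thesis .
  qed
  ultimately show ?thesis by simp
qed

lemma graph_deriv: "(graph has_derivative (\<lambda>u. (dhor x u, u))) (at x)"
  unfolding graph_def[abs_def] by (intro has_derivative_Pair hor_deriv has_derivative_ident)

lemma dhor_linear: "linear (dhor x)"
  using hor_deriv has_derivative_linear by blast

lemma dhor_x1: "dhor x x1 = L * w0 x / (wt L x)\<^sup>2"
proof -
  have "x1 \<bullet> x1 - lam x / (wt L x)\<^sup>2 * (x \<bullet> x1) = (w0 x)\<^sup>2 / (wt L x)\<^sup>2"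
    unfolding x1 lam_def[of x, symmetric] using wt2_w0[of x] by (simp add: field_simps power2_eq_square)
  then show ?thesis by (simp add: dhor_def power2_eq_square)
qed

lemma hk_eq: "hk x = (dhor x x1, x1)"
  by (simp add: hk_def dhor_x1)

lemma dhor_self: "dhor x x = L ^ 3 * lam x / (w0 x * (wt L x)\<^sup>2)"
  by (simp add: dhor_def inner_wt[of x] lam_def inner_commute[of x1] field_simps power2_eq_square power3_eq_cube)

lemma dhor_eT: "dhor x (e + ((x \<bullet> e) / L\<^sup>2) *\<^sub>R x) = L / w0 x * (x1 \<bullet> e)"
  using dhor_self[of x]
  by (simp add: linear_add[OF dhor_linear] linear_scale[OF dhor_linear])
    (simp add: dhor_def field_simps power2_eq_square power3_eq_cube)

lemma hk_null: "ads_metric L (graph x) (hk x) (hk x) = 0"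
proof -
  have "ads_metric L (graph x) (hk x) (hk x) = 1 - ((w0 x)\<^sup>2 + (lam x)\<^sup>2) / (wt L x)\<^sup>2"
    by (simp add: metric_eq hk_def graph_def x1 lam_def) (simp add: field_simps power2_eq_square)
  then show ?thesis by (simp add: wt2_w0[symmetric])
qed

definition line :: "'a \<Rightarrow> real \<Rightarrow> 'a" where "line z s = z + s *\<^sub>R x1"

lemma lam_line: "z \<bullet> x1 = 0 \<Longrightarrow> lam (line z s) = s" and perp_line: "z \<bullet> x1 = 0 \<Longrightarrow> perp (line z s) = z"
  by (simp_all add: lam_def perp_def line_def inner_add_left x1)

lemma w0_line: "z \<bullet> x1 = 0 \<Longrightarrow> w0 (line z s) = w0 z"
proof -
  assume z: "z \<bullet> x1 = 0"
  have p: "perp z = z" using z by (simp add: perp_def lam_def)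
  have "(w0 (line z s))\<^sup>2 = (w0 z)\<^sup>2" by (simp add: w02 perp_line[OF z] p)
  then show ?thesis using w0_pos[of z] w0_pos[of "line z s"] by (simp add: power2_eq_iff)
qed

lemma wt2_line: "z \<bullet> x1 = 0 \<Longrightarrow> (wt L (line z s))\<^sup>2 = (w0 z)\<^sup>2 + s\<^sup>2"
  by (simp add: wt2_w0 lam_line w0_line)

end

section \<open>The null-null component of the linearized Ricci tensor on a horizon\<close>

text \<open>In \<open>c2\<close> the first derivative is differentiated in fixed directions, so a
  direction that varies with the point is first expanded in the basis. The same device gives
  \<open>c2_moving\<close>.\<close>

lemma c2_diagonal:
  assumes "c2 F F1 F2"
  shows "((\<lambda>y. F1 y y) has_derivative (\<lambda>v. F2 x x v + F1 x v)) (at x)"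
proof -
  have e: "F1 y v = (\<Sum>b\<in>Basis. (v \<bullet> b) * F1 y b)" for y v
    using linear_expand[OF linear_c2D1[OF assms], of y v] by simp
  have e2: "F2 x x v = (\<Sum>b\<in>Basis. (x \<bullet> b) * F2 x b v)" for v
    using linear_expand[OF linear_c2D2'[OF assms, of x v], of x] by simp
  have "((\<lambda>y. \<Sum>b\<in>Basis. (y \<bullet> b) * F1 y b) has_derivative
      (\<lambda>v. \<Sum>b\<in>Basis. (x \<bullet> b) * F2 x b v + (v \<bullet> b) * F1 x b)) (at x)"
    by (intro has_derivative_sum has_derivative_mult c2D2[OF assms] has_derivative_inner_left has_derivative_ident)
  then show ?thesis
    by (subst e, subst e2, subst e) (simp add: sum.distrib)
qed

lemma c2_moving:
  fixes U :: "'p::real_normed_vector \<Rightarrow> 'a::euclidean_space"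
  assumes c: "c2 F F1 F2" and q: "(q has_derivative q') (at x)" and U: "(U has_derivative U') (at x)"
  shows "((\<lambda>y. F1 (q y) (U y)) has_derivative (\<lambda>v. F2 (q x) (U x) (q' v) + F1 (q x) (U' v))) (at x)"
proof -
  have e: "F1 y v = (\<Sum>b\<in>Basis. (v \<bullet> b) * F1 y b)" for y v
    using linear_expand[OF linear_c2D1[OF c], of y v] by simp
  have e2: "F2 (q x) (U x) v = (\<Sum>b\<in>Basis. (U x \<bullet> b) * F2 (q x) b v)" for v
    using linear_expand[OF linear_c2D2'[OF c, of "q x" v], of "U x"] by simp
  have "((\<lambda>y. \<Sum>b\<in>Basis. (U y \<bullet> b) * F1 (q y) b) has_derivative
      (\<lambda>v. \<Sum>b\<in>Basis. (U x \<bullet> b) * F2 (q x) b (q' v) + (U' v \<bullet> b) * F1 (q x) b)) (at x)"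
    by (intro has_derivative_sum has_derivative_mult has_derivative_compose[OF q c2D2[OF c]]
        has_derivative_inner_left U)
  then show ?thesis
    by (subst e, subst e2, subst e) (simp add: sum.distrib)
qed

lemma transversal_algebra:
  fixes W L D m H h l r :: real
  assumes "W \<noteq> 0" "L \<noteq> 0"
    and "D = (m - (W - L\<^sup>2) / L\<^sup>2 * H - (h - l + (W - L\<^sup>2) / L\<^sup>2 * h) / 2) / W + l / (2 * W) + r - h / (2 * L\<^sup>2) + H / L\<^sup>2"
  shows "D = m / W + (H + l) / W - h / L\<^sup>2 + r"
  unfolding assms(3) using assms(1,2) by (simp add: field_simps)

locale horizon = ads_perturbation L h + ads_line L tm x1
  for L :: real and h :: "(real \<times> 'a::euclidean_space) tensor2" and tm :: real and x1 :: 'a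
begin

text \<open>Extending the null-null component off the horizon by means of \<open>P\<close>, which is
  defined everywhere, gives a meaning to its transversal derivative \<open>RR\<close>. The names
  with doubled letters denote functions of the spatial point, evaluated on the graph.\<close>

definition H :: "real \<times> 'a \<Rightarrow> real" where "H p = h p (P p) (P p)"
definition M :: "'a \<Rightarrow> real \<times> 'a \<Rightarrow> real" where "M e p = h p (P p) (eT e p)"
definition HH :: "'a \<Rightarrow> real" where "HH x = H (graph x)"
definition MM :: "'a \<Rightarrow> 'a \<Rightarrow> real" where "MM e x = M e (graph x)"
definition TT :: "'a \<Rightarrow> real" where "TT x = Tr (graph x)"
definition RR :: "'a \<Rightarrow> real" where "RR x = frechet_derivative H (at (graph x)) (1, 0)"
definition Z :: "real \<times> 'a \<Rightarrow> real \<times> 'a" where "Z p = C p (P p) (P p)"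

lemma HH_eq: "HH x = h (graph x) (hk x) (hk x)"
  by (simp add: HH_def H_def P_graph)

lemma twice_phi: "twice phi"
proof -
  have "twice (\<lambda>p::real \<times> 'a. sin ((fst p - tm) / L))"
    by (rule twice_comp_real[where \<phi> = sin and ?\<phi>1.0 = cos and ?\<phi>2.0 = "\<lambda>y. - sin y"])
      (auto intro!: twice_divide twice_diff twice_fst twice_const derivative_eq_intros)
  then show ?thesis unfolding phi_def[abs_def]
    by (intro twice_diff twice_mult twice_snd_inner twice_wt)
qed

lemma twice_P: "twice (\<lambda>p. P p \<bullet> i)"
proof -
  have "twice (\<lambda>p::real \<times> 'a. cos ((fst p - tm) / L))"
    by (rule twice_comp_real[where \<phi> = cos and ?\<phi>1.0 = "\<lambda>y. - sin y" and ?\<phi>2.0 = "\<lambda>y. - cos y"])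
      (auto intro!: twice_divide twice_diff twice_fst twice_const derivative_eq_intros)
  then show ?thesis unfolding P_def inner_prod_def
    by (simp add: inner_add_left) (intro twice_add twice_mult twice_divide twice_const twice_phi twice_snd_inner twice_wt; simp)
qed

lemma twice_eT: "twice (\<lambda>p. eT e p \<bullet> i)"
  unfolding eT_def inner_prod_def
  by (simp add: inner_add_left) (intro twice_add twice_mult twice_divide twice_const twice_snd_inner; simp)

lemma twice_H: "twice H"
  unfolding H_def[abs_def] by (intro h.twice_tensor twice_P)

lemma twice_M: "twice (M e)"
  unfolding M_def[abs_def] by (intro h.twice_tensor twice_P twice_eT)

lemma twice_lam: "twice lam"
  unfolding lam_def[abs_def] by (rule twice_linear) (simp add: linear_iff inner_add_left)

lemma twice_inner_self': "twice (\<lambda>x::'a. x \<bullet> x)"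
proof -
  have "c2 (\<lambda>x::'a. x \<bullet> x) (\<lambda>x u. 2 * (x \<bullet> u)) (\<lambda>x u v. 2 * (v \<bullet> u))"
    unfolding c2_def by (auto intro!: derivative_eq_intros simp: inner_commute)
  then show ?thesis unfolding twice_def by blast
qed

lemma twice_w0: "twice w0"
  unfolding w0_def[abs_def] power2_eq_square[of "lam _"]
  by (intro twice_sqrt twice_add twice_diff twice_mult twice_const twice_lam twice_inner_self')
    (use L_pos in \<open>simp add: perp_inner[symmetric] power2_eq_square[symmetric] add_pos_nonneg\<close>)

lemma twice_hor: "twice hor"
proof -
  have d: "((\<lambda>y. inverse (1 + y\<^sup>2)) has_real_derivative - (2 * y * (inverse (1 + y\<^sup>2))\<^sup>2)) (at y)" for y :: real
  proof -
    have n: "1 + y\<^sup>2 \<noteq> 0" by (metis add_pos_nonneg less_irrefl zero_le_power2 zero_less_one)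
    show ?thesis
      using n by (auto intro!: derivative_eq_intros simp: power2_eq_square)
  qed
  have "twice (\<lambda>x. arctan (lam x / w0 x))"
    by (rule twice_comp_real[where \<phi> = arctan and ?\<phi>1.0 = "\<lambda>y. inverse (1 + y\<^sup>2)"
        and ?\<phi>2.0 = "\<lambda>y. - (2 * y * (inverse (1 + y\<^sup>2))\<^sup>2)", OF twice_divide[OF twice_lam twice_w0 w0_nz] DERIV_arctan d])
  then show ?thesis unfolding hor_def[abs_def]
    by (intro twice_add twice_mult twice_const)
qed

lemma twice_graph: "twice (\<lambda>x. graph x \<bullet> i)"
proof -
  have "twice (\<lambda>x::'a. x \<bullet> snd i)" by (rule twice_linear) (simp add: linear_iff inner_add_left)
  then show ?thesis unfolding graph_def inner_prod_def
    by simp (intro twice_add twice_mult twice_hor twice_const)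
qed

lemma twice_on_graph: "twice F \<Longrightarrow> twice (\<lambda>x. F (graph x))"
  by (rule twice_compose[where q = graph, OF twice_graph c2D1[OF twice_c2] c2D2[OF twice_c2]])

lemma twice_HH: "twice HH" and twice_MM: "twice (MM e)" and twice_TT: "twice TT"
  unfolding HH_def[abs_def] MM_def[abs_def] TT_def[abs_def]
  by (intro twice_on_graph twice_H twice_M twice_Tr)+

text \<open>For fields whose covariant derivative is a multiple of the identity, differentiating
  \<open>h U V\<close> gives the covariant derivative of \<open>h\<close> and undifferentiated
  components only. This turns \<open>nabla2\<close> into ordinary derivatives of \<open>H\<close>
  and \<open>M\<close>.\<close>

lemma h_field_deriv:
  assumes "(U has_derivative (\<lambda>d. a *\<^sub>R d - ads_Gamma L p d (U p))) (at p)"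
    and "(V has_derivative (\<lambda>d. b *\<^sub>R d - ads_Gamma L p d (V p))) (at p)"
  shows "((\<lambda>q. h q (U q) (V q)) has_derivative (\<lambda>d. nabla2 (ads_metric L) h p d (U p) (V p)
     + a * h p d (V p) + b * h p (U p) d)) (at p)"
  by (rule has_derivative_eq_rhs[OF h.tensor_has_derivative[OF assms]])
    (simp add: fun_eq_iff nabla2_def christoffel_ads bilinear_lsub[OF h.bil] bilinear_rsub[OF h.bil]
      bilinear_lmul[OF h.bil] bilinear_rmul[OF h.bil])

lemma C_nabla: "ads_metric L p (C p u u) w =
    nabla2 (ads_metric L) h p u u w - nabla2 (ads_metric L) h p w u u / 2"
proof -
  have "ads_metric L p (C p u u) w = (nabla2 (ads_metric L) h p u u w + nabla2 (ads_metric L) h p u u w - nabla2 (ads_metric L) h p w u u) / 2"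
    unfolding C_solves nabla2_def koszul_def metric.christoffel_commute[OF metric_nondegenerate, of p w u]
      h.commute[of p u "christoffel (ads_metric L) p u w"]
    by (simp add: field_simps)
  then show ?thesis by simp
qed

text \<open>Pairing \<open>Z\<close> with the field \<open>eT e\<close> involves the covariant
  derivative of \<open>h\<close> along \<open>P\<close> in the slots \<open>P\<close>,
  \<open>eT e\<close>, and the one along \<open>eT e\<close> in the slots \<open>P\<close>,
  \<open>P\<close>. Up to zeroth order terms these are derivatives of \<open>M e\<close> and of
  \<open>H\<close>.\<close>

lemma Z_inner:
  assumes cH: "c2 H H1 H2" and cM: "c2 (M e) M1 M2"
  shows "snd (Z p) \<bullet> e = M1 p (P p) - (snd p \<bullet> e) / L\<^sup>2 * H p - H1 p (eT e p) / 2"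
proof -
  have M1: "M1 p d = nabla2 (ads_metric L) h p d (P p) (eT e p) + phi p / L\<^sup>2 * h p d (eT e p)
      + (snd p \<bullet> e) / L\<^sup>2 * h p (P p) d" for d
    using fun_cong[OF has_derivative_unique[OF c2D1[OF cM] h_field_deriv[OF P_deriv[of p] eT_deriv[of e p], folded M_def]]] .
  have H1: "H1 p d = nabla2 (ads_metric L) h p d (P p) (P p) + phi p / L\<^sup>2 * h p d (P p)
      + phi p / L\<^sup>2 * h p (P p) d" for d
    using fun_cong[OF has_derivative_unique[OF c2D1[OF cH] h_field_deriv[OF P_deriv[of p] P_deriv[of p], folded H_def]]] .
  have "snd (Z p) \<bullet> e = ads_metric L p (Z p) (eT e p)" by (rule metric_eT[symmetric])
  then show ?thesis
    unfolding Z_def C_nabla M1 H1 H_def h.commute[of p "eT e p" "P p"] by (simp add: add_divide_distrib)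
qed

text \<open>Pairing with \<open>P\<close> itself makes both covariant derivatives of
  \<open>h\<close> the one along \<open>P\<close> in the slots \<open>P\<close>, \<open>P\<close>,
  and half of it survives. As the identity also holds off the horizon, it can be differentiated
  across it.\<close>

lemma dphi_Z:
  assumes cH: "c2 H H1 H2"
  shows "dphi p (Z p) = H1 p (P p) / 2 - phi p / L\<^sup>2 * H p"
proof -
  have H1: "H1 p d = nabla2 (ads_metric L) h p d (P p) (P p) + phi p / L\<^sup>2 * h p d (P p)
      + phi p / L\<^sup>2 * h p (P p) d" for d
    using fun_cong[OF has_derivative_unique[OF c2D1[OF cH] h_field_deriv[OF P_deriv[of p] P_deriv[of p], folded H_def]]] .
  have "dphi p (Z p) = ads_metric L p (Z p) (P p)" by (simp add: metric_P[symmetric] metric_commute)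
  then show ?thesis unfolding Z_def C_nabla H1 H_def by (simp add: field_simps)
qed

definition DZ :: "real \<times> 'a \<Rightarrow> real \<times> 'a \<Rightarrow> real \<times> 'a" where
  "DZ p d = dC p d (P p) (P p) + C p ((phi p / L\<^sup>2) *\<^sub>R d - ads_Gamma L p d (P p)) (P p)
     + C p (P p) ((phi p / L\<^sup>2) *\<^sub>R d - ads_Gamma L p d (P p))"

lemma Z_deriv: "(Z has_derivative DZ p) (at p)"
  unfolding Z_def[abs_def] DZ_def[abs_def]
  by (rule bilinear_param_has_derivative[OF _ C_has_derivative P_deriv P_deriv]) (simp add: C_bil)

text \<open>Since \<open>P\<close> is parallel on the horizon, differentiating it inside
  \<open>Z\<close> contributes connection terms only, and these are exactly the ones that accompany
  \<open>dC\<close> in the Palatini identity.\<close>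

lemma div_Z:
  "(\<Sum>b\<in>Basis. DZ (graph x) b \<bullet> b) = (\<Sum>b\<in>Basis. dC (graph x) b (hk x) (hk x) \<bullet> b)
    - 2 * (\<Sum>b\<in>Basis. C (graph x) (hk x) (ads_Gamma L (graph x) (hk x) b) \<bullet> b)"
proof -
  have "DZ (graph x) b = dC (graph x) b (hk x) (hk x) - 2 *\<^sub>R C (graph x) (hk x) (ads_Gamma L (graph x) (hk x) b)" for b
    unfolding DZ_def P_graph phi_graph Gamma_commute[of "graph x" b "hk x"]
      C_commute[of "graph x" "(0 / L\<^sup>2) *\<^sub>R b - ads_Gamma L (graph x) (hk x) b" "hk x"]
    by (simp add: bilinear_rneg[OF C_bil] scaleR_2)
  then show ?thesis
    by (simp add: inner_diff_left sum_subtractf sum_distrib_left)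
qed

lemma on_graph_deriv:
  assumes "(F has_derivative F') (at (graph x))"
  shows "((\<lambda>x. F (graph x)) has_derivative (\<lambda>u. F' (dhor x u, u))) (at x)"
  by (rule has_derivative_compose[OF graph_deriv assms])

text \<open>The generators are affinely parametrized geodesics, so the second derivative of the
  restricted trace along a generator is the covariant Hessian on \<open>hk\<close>.\<close>

lemma TT2_eq:
  assumes cT: "c2 Tr T1 T2" and cTT: "c2 TT TT1 TT2"
  shows "TT2 x x1 x1 = T2 (graph x) (hk x) (hk x) - T1 (graph x) (ads_Gamma L (graph x) (hk x) (hk x))"
proof -
  have TT1: "TT1 x u = T1 (graph x) (dhor x u, u)" for x u
    using fun_cong[OF has_derivative_unique[OF c2D1[OF cTT] on_graph_deriv[OF c2D1[OF cT], of x, folded TT_def]]] .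
  have "((\<lambda>y. T1 (graph y) (P (graph y))) has_derivative (\<lambda>u. T2 (graph x) (P (graph x)) (dhor x u, u)
      + T1 (graph x) ((phi (graph x) / L\<^sup>2) *\<^sub>R (dhor x u, u) - ads_Gamma L (graph x) (dhor x u, u) (P (graph x))))) (at x)"
    by (rule c2_moving[OF cT graph_deriv on_graph_deriv[OF P_deriv]])
  then have "((\<lambda>y. TT1 y x1) has_derivative (\<lambda>u. T2 (graph x) (hk x) (dhor x u, u)
      + T1 (graph x) (- ads_Gamma L (graph x) (dhor x u, u) (hk x)))) (at x)"
    by (simp add: P_graph phi_graph TT1 hk_eq flip: zero_prod_def)
  from fun_cong[OF has_derivative_unique[OF c2D2[OF cTT] this], of x1]
  show ?thesis by (simp add: hk_eq[symmetric] linear_neg[OF linear_c2D1[OF cT]])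
qed

lemma HH1_eq:
  assumes cH: "c2 H H1 H2" and cHH: "c2 HH HH1 HH2"
  shows "HH1 x u = dhor x u * RR x + H1 (graph x) (0, u)" "RR x = H1 (graph x) (1, 0)"
    "HH1 x u = H1 (graph x) (dhor x u, u)"
proof -
  show 1: "HH1 x u = H1 (graph x) (dhor x u, u)"
    using fun_cong[OF has_derivative_unique[OF c2D1[OF cHH] on_graph_deriv[OF c2D1[OF cH], of x, folded HH_def]]] .
  show 2: "RR x = H1 (graph x) (1, 0)"
    unfolding RR_def frechet_derivative_at[OF c2D1[OF cH], symmetric] ..
  have "(dhor x u, u) = dhor x u *\<^sub>R (1, 0) + (0, u)" by simp
  then show "HH1 x u = dhor x u * RR x + H1 (graph x) (0, u)"
    unfolding 1 2
    using linear_add[OF linear_c2D1[OF cH, of "graph x"], of "dhor x u *\<^sub>R (1, 0)" "(0, u)"]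
      linear_scale[OF linear_c2D1[OF cH, of "graph x"], of "dhor x u" "(1, 0)"] by simp
qed

text \<open>\<open>RR\<close> is the only derivative transversal to the horizon that enters.\<close>

lemma Z_graph:
  assumes cHH: "c2 HH HH1 HH2" and cMM: "\<And>e. c2 (MM e) (MM1 e) (MM2 e)"
  shows "snd (Z (graph x)) \<bullet> e = MM1 e x x1 - (x \<bullet> e) / L\<^sup>2 * HH x
     - (HH1 x e + (x \<bullet> e) / L\<^sup>2 * HH1 x x) / 2 + L / (2 * w0 x) * (x1 \<bullet> e) * RR x"
proof -
  obtain H1 H2 where cH: "c2 H H1 H2" using twice_H by (auto simp: twice_def)
  obtain M1 M2 where cM: "c2 (M e) M1 M2" using twice_M[of e] by (auto simp: twice_def)
  have "MM1 e x u = M1 (graph x) (dhor x u, u)" for u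
    using fun_cong[OF has_derivative_unique[OF c2D1[OF cMM[of e]] on_graph_deriv[OF c2D1[OF cM], of x, folded MM_def]]] .
  then have m: "M1 (graph x) (hk x) = MM1 e x x1" by (simp add: hk_eq)
  have "HH1 x (e + ((x \<bullet> e) / L\<^sup>2) *\<^sub>R x) = L / w0 x * (x1 \<bullet> e) * RR x + H1 (graph x) (eT e (graph x))"
    using HH1_eq(1)[OF cH cHH, of x "e + ((x \<bullet> e) / L\<^sup>2) *\<^sub>R x"] by (simp add: dhor_eT eT_def graph_def)
  then have H1: "H1 (graph x) (eT e (graph x)) = HH1 x e + (x \<bullet> e) / L\<^sup>2 * HH1 x x - L / w0 x * (x1 \<bullet> e) * RR x"
    by (simp add: linear_add[OF linear_c2D1[OF cHH]] linear_scale[OF linear_c2D1[OF cHH]])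
  show ?thesis
    using Z_inner[OF cH cM, of "graph x"] unfolding H1 P_graph m HH_def[symmetric]
    by (simp add: graph_def field_simps)
qed

lemma dphi_graph: "dphi (graph x) v = w0 x / L * (dhor x (snd v) - fst v)"
proof -
  have "dphi (graph x) v = x1 \<bullet> snd v - lam x / (wt L x)\<^sup>2 * (x \<bullet> snd v) - w0 x / L * fst v"
    by (simp add: dphi_def graph_def sin_hor cos_hor power2_eq_square)
  also have "x1 \<bullet> snd v - lam x / (wt L x)\<^sup>2 * (x \<bullet> snd v) = w0 x / L * dhor x (snd v)"
    by (simp add: dhor_def)
  finally show ?thesis by (simp add: right_diff_distrib)
qed

lemma DZ_linear: "linear (DZ p)"
  using Z_deriv has_derivative_linear by blast

lemma RR_deriv:
  assumes cH: "c2 H H1 H2"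
  shows "(RR has_derivative (\<lambda>u. H2 (graph x) (1, 0) (dhor x u, u))) (at x)"
proof -
  have "RR = (\<lambda>x. H1 (graph x) (1, 0))"
    unfolding RR_def[abs_def] using frechet_derivative_at[OF c2D1[OF cH]] by simp
  then show ?thesis using on_graph_deriv[OF c2D2[OF cH]] by simp
qed

text \<open>The transversal derivatives \<open>H2 (graph x) (1, 0) (hk x)\<close> of the next two lemmas cancel in the full
  divergence of \<open>Z\<close>.\<close>

lemma div_Z_horizon:
  assumes cH: "c2 H H1 H2" and cHH: "c2 HH HH1 HH2" and cMM: "\<And>e. c2 (MM e) (MM1 e) (MM2 e)"
  shows "(\<Sum>e\<in>Basis. snd (DZ (graph x) (dhor x e, e)) \<bullet> e) =
    (\<Sum>e\<in>Basis. MM2 e x x1 e) - (real DIM('a) * HH x + HH1 x x) / L\<^sup>2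
    - ((\<Sum>e\<in>Basis. HH2 x e e) + (real (DIM('a) + 1) * HH1 x x + HH2 x x x) / L\<^sup>2) / 2
    + L / (2 * w0 x) * H2 (graph x) (1, 0) (hk x)"
proof -
  let ?R = "\<lambda>u. H2 (graph x) (1, 0) (dhor x u, u)"
  have "snd (DZ (graph x) (dhor x u, u)) \<bullet> e =
      MM2 e x x1 u - ((u \<bullet> e) * HH x + (x \<bullet> e) * HH1 x u) / L\<^sup>2
      - (HH2 x e u + ((u \<bullet> e) * HH1 x x + (x \<bullet> e) * (HH2 x x u + HH1 x u)) / L\<^sup>2) / 2
      + L / 2 * (x1 \<bullet> e) * (?R u / w0 x - RR x * (perp x \<bullet> u) / (w0 x) ^ 3)" for u e
  proof -
    have i: "((\<lambda>y. inverse (w0 y)) has_derivative (\<lambda>u. - (perp x \<bullet> u) / (w0 x) ^ 3)) (at x)"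
      by (rule has_derivative_eq_rhs[OF Deriv.has_derivative_inverse[OF w0_nz w0_deriv]])
        (simp add: fun_eq_iff field_simps power3_eq_cube)
    have "((\<lambda>y. MM1 e y x1 - (y \<bullet> e) * inverse (L\<^sup>2) * HH y
     - (HH1 y e + (y \<bullet> e) * inverse (L\<^sup>2) * HH1 y y) * inverse 2 + L / 2 * (x1 \<bullet> e) * (RR y * inverse (w0 y))) has_derivative
      (\<lambda>u. MM2 e x x1 u - ((x \<bullet> e) * inverse (L\<^sup>2) * HH1 x u + (u \<bullet> e) * inverse (L\<^sup>2) * HH x)
      - (HH2 x e u + ((x \<bullet> e) * inverse (L\<^sup>2) * (HH2 x x u + HH1 x u) + (u \<bullet> e) * inverse (L\<^sup>2) * HH1 x x)) * inverse 2
      + L / 2 * (x1 \<bullet> e) * (RR x * (- (perp x \<bullet> u) / (w0 x) ^ 3) + ?R u * inverse (w0 x)))) (at x)"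
      by (intro has_derivative_add has_derivative_diff has_derivative_mult has_derivative_mult_left has_derivative_mult_right
          c2D2[OF cMM] c2D2[OF cHH] c2D1[OF cHH] c2_diagonal[OF cHH] RR_deriv[OF cH] i
          has_derivative_inner_left has_derivative_ident)
    moreover have "(\<lambda>y. MM1 e y x1 - (y \<bullet> e) * inverse (L\<^sup>2) * HH y
     - (HH1 y e + (y \<bullet> e) * inverse (L\<^sup>2) * HH1 y y) * inverse 2 + L / 2 * (x1 \<bullet> e) * (RR y * inverse (w0 y)))
       = (\<lambda>y. snd (Z (graph y)) \<bullet> e)"
    proof
      fix y
      show "MM1 e y x1 - (y \<bullet> e) * inverse (L\<^sup>2) * HH y
     - (HH1 y e + (y \<bullet> e) * inverse (L\<^sup>2) * HH1 y y) * inverse 2 + L / 2 * (x1 \<bullet> e) * (RR y * inverse (w0 y))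
       = snd (Z (graph y)) \<bullet> e"
        unfolding Z_graph[OF cHH cMM, of y e] by (simp add: field_simps)
    qed
    ultimately have D: "((\<lambda>y. snd (Z (graph y)) \<bullet> e) has_derivative
      (\<lambda>u. MM2 e x x1 u - ((x \<bullet> e) * inverse (L\<^sup>2) * HH1 x u + (u \<bullet> e) * inverse (L\<^sup>2) * HH x)
      - (HH2 x e u + ((x \<bullet> e) * inverse (L\<^sup>2) * (HH2 x x u + HH1 x u) + (u \<bullet> e) * inverse (L\<^sup>2) * HH1 x x)) * inverse 2
      + L / 2 * (x1 \<bullet> e) * (RR x * (- (perp x \<bullet> u) / (w0 x) ^ 3) + ?R u * inverse (w0 x)))) (at x)"
      by simp
    have "((\<lambda>y. snd (Z (graph y)) \<bullet> e) has_derivative (\<lambda>u. snd (DZ (graph x) (dhor x u, u)) \<bullet> e)) (at x)"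
      by (intro has_derivative_inner_left has_derivative_snd on_graph_deriv[OF Z_deriv])
    from fun_cong[OF has_derivative_unique[OF this D], of u] show ?thesis
      by (simp add: field_simps power3_eq_cube)
  qed
  note eq = this
  have l1: "(\<Sum>e\<in>Basis. (x \<bullet> e) * F e) = F x" if "linear F" for F :: "'a \<Rightarrow> real" and x
    using linear_expand[OF that, of x] by simp
  have lR: "linear ?R"
    using RR_deriv[OF cH] has_derivative_linear by blast
  \<comment> \<open>The term with \<open>RR x\<close> drops out because \<open>x1\<close> is
    orthogonal to \<open>perp x\<close>; what survives is the derivative of the transversal
    derivative along the generator.\<close>
  have "(\<Sum>e\<in>Basis. (x1 \<bullet> e) * (?R e / w0 x - RR x * (perp x \<bullet> e) / (w0 x) ^ 3))
      = (\<Sum>e\<in>Basis. (x1 \<bullet> e) * ?R e) / w0 x - (RR x / (w0 x) ^ 3) * (\<Sum>e\<in>Basis. (x1 \<bullet> e) * (perp x \<bullet> e))"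
    by (simp add: sum_subtractf right_diff_distrib sum_divide_distrib sum_distrib_left mult_ac)
  also have "\<dots> = H2 (graph x) (1, 0) (hk x) / w0 x"
    using l1[OF lR, of x1] perp_x1[of x] euclidean_inner[of x1 "perp x"] by (simp add: hk_eq inner_commute)
  finally have R: "(\<Sum>e\<in>Basis. (x1 \<bullet> e) * (?R e / w0 x - RR x * (perp x \<bullet> e) / (w0 x) ^ 3)) = H2 (graph x) (1, 0) (hk x) / w0 x" .
  have n: "(\<Sum>e\<in>(Basis::'a set). (e \<bullet> e) * c) = real DIM('a) * c" for c :: real by simp
  show ?thesis
    unfolding eq
    unfolding sum.distrib sum_subtractf sum_divide_distrib[symmetric] mult.assoc[of "L / 2"] sum_distrib_left[symmetric] R n
      distrib_left[of "x \<bullet> _"] l1[OF linear_c2D1[OF cHH]] l1[OF linear_c2D2[OF cHH]]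
    by (simp add: field_simps)
qed

lemma div_Z_transversal:
  assumes cH: "c2 H H1 H2" and cHH: "c2 HH HH1 HH2"
  shows "w0 x / L * (dhor x (snd (DZ (graph x) (1, 0))) - fst (DZ (graph x) (1, 0))) =
     (x \<bullet> snd (Z (graph x))) * w0 x / (L * (wt L x)\<^sup>2) - lam x / L\<^sup>2 * fst (Z (graph x))
     + H2 (graph x) (1, 0) (hk x) / 2 - w0 x / (2 * L ^ 3) * HH1 x x + w0 x / L ^ 3 * HH x"
proof -
  \<comment> \<open>A curve leaving the graph in the time direction. The derivative of
    \<open>dphi\<close> on \<open>Z\<close> along it is computed once from the definition of
    \<open>dphi\<close> and once from \<open>dphi_Z\<close>.\<close>
  define c where "c \<tau> = (hor x + \<tau>, x)" for \<tau>
  have c0: "c 0 = graph x" by (simp add: c_def graph_def)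
  have c': "(c has_derivative (\<lambda>r. r *\<^sub>R (1, 0))) (at 0)"
    unfolding c_def[abs_def] by (auto intro!: derivative_eq_intros)
  have W: "wt L x \<noteq> 0" by simp
  define z0 z1 where "z0 = fst (DZ (graph x) (1, 0))" and "z1 = snd (DZ (graph x) (1, 0))"
  have "((\<lambda>\<tau>. Z (c \<tau>)) has_derivative (\<lambda>r. DZ (graph x) (r *\<^sub>R (1, 0)))) (at 0)"
    by (rule has_derivative_compose[OF c']) (simp add: c0 Z_deriv)
  then have Zc: "((\<lambda>\<tau>. Z (c \<tau>)) has_derivative (\<lambda>r. r *\<^sub>R (z0, z1))) (at 0)"
    by (simp only: linear_scale[OF DZ_linear] z0_def z1_def prod.collapse)
  have Z1: "((\<lambda>\<tau>. v \<bullet> snd (Z (c \<tau>))) has_real_derivative (v \<bullet> z1)) (at 0)" for v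
    unfolding has_field_derivative_def
    by (rule has_derivative_eq_rhs[OF has_derivative_inner_right[OF has_derivative_snd[OF Zc]]])
      (simp add: fun_eq_iff)
  have Z0: "((\<lambda>\<tau>. fst (Z (c \<tau>))) has_real_derivative z0) (at 0)"
    unfolding has_field_derivative_def
    by (rule has_derivative_eq_rhs[OF has_derivative_fst[OF Zc]]) (simp add: fun_eq_iff)
  have "((\<lambda>\<tau>. dphi (c \<tau>) (Z (c \<tau>))) has_real_derivative
     (x1 \<bullet> z1) - ((x \<bullet> z1) / wt L x * (lam x / wt L x) + (x \<bullet> snd (Z (graph x))) / wt L x * ((w0 x / wt L x) / L))
       - (wt L x / L * (w0 x / wt L x) * z0 - wt L x / L * ((lam x / wt L x) / L) * fst (Z (graph x)))) (at 0)"
    unfolding dphi_def c_def fst_conv snd_conv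
    by (rule derivative_eq_intros Z1[unfolded c_def] Z0[unfolded c_def] refl | simp)+
      (simp add: sin_hor cos_hor graph_def field_simps)
  also have "(x1 \<bullet> z1) - ((x \<bullet> z1) / wt L x * (lam x / wt L x) + (x \<bullet> snd (Z (graph x))) / wt L x * ((w0 x / wt L x) / L))
       - (wt L x / L * (w0 x / wt L x) * z0 - wt L x / L * ((lam x / wt L x) / L) * fst (Z (graph x)))
     = w0 x / L * (dhor x z1 - z0) - (x \<bullet> snd (Z (graph x))) * w0 x / (L * (wt L x)\<^sup>2) + lam x / L\<^sup>2 * fst (Z (graph x))"
    using W by (simp add: dhor_def field_simps power2_eq_square)
  finally have A: "((\<lambda>\<tau>. dphi (c \<tau>) (Z (c \<tau>))) has_real_derivative
     w0 x / L * (dhor x z1 - z0) - (x \<bullet> snd (Z (graph x))) * w0 x / (L * (wt L x)\<^sup>2) + lam x / L\<^sup>2 * fst (Z (graph x))) (at 0)" .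
  have G: "(phi (graph x) / L\<^sup>2) *\<^sub>R (1, 0) - ads_Gamma L (graph x) (1, 0) (P (graph x)) =
      (- lam x / (wt L x)\<^sup>2) *\<^sub>R (1, 0) + (- (w0 x / L ^ 3)) *\<^sub>R (0, x)"
  proof -
    have g: "ads_metric L (graph x) (1, 0) (hk x) = - (w0 x / L)"
      by (subst metric_commute) (simp add: P_graph[symmetric] metric_P dphi_graph linear_0[OF dhor_linear])
    show ?thesis
      unfolding P_graph phi_graph ads_Gamma_def g
      by (simp add: prod_eq_iff graph_def hk_def lam_def power3_eq_cube power2_eq_square)
  qed
  have B1: "((\<lambda>q. H1 q (P q)) has_derivative (\<lambda>d. H2 (graph x) (P (graph x)) d
      + H1 (graph x) ((phi (graph x) / L\<^sup>2) *\<^sub>R d - ads_Gamma L (graph x) d (P (graph x))))) (at (graph x))"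
    by (rule c2_moving[OF cH has_derivative_ident P_deriv])
  have "((\<lambda>q. H1 q (P q) * (1/2) - phi q * (1 / L\<^sup>2) * H q) has_derivative
      (\<lambda>d. (H2 (graph x) (P (graph x)) d
      + H1 (graph x) ((phi (graph x) / L\<^sup>2) *\<^sub>R d - ads_Gamma L (graph x) d (P (graph x)))) * (1/2)
      - (phi (graph x) * (1 / L\<^sup>2) * H1 (graph x) d + dphi (graph x) d * (1 / L\<^sup>2) * H (graph x)))) (at (graph x))"
    by (intro has_derivative_diff has_derivative_mult_left has_derivative_mult B1 phi_deriv c2D1[OF cH])
  then have "((\<lambda>q. dphi q (Z q)) has_derivative
      (\<lambda>d. (H2 (graph x) (P (graph x)) d
      + H1 (graph x) ((phi (graph x) / L\<^sup>2) *\<^sub>R d - ads_Gamma L (graph x) d (P (graph x)))) * (1/2)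
      - (phi (graph x) * (1 / L\<^sup>2) * H1 (graph x) d + dphi (graph x) d * (1 / L\<^sup>2) * H (graph x)))) (at (c 0))"
    by (simp add: dphi_Z[OF cH] c0)
  from has_derivative_compose[OF c' this]
  have "((\<lambda>\<tau>. dphi (c \<tau>) (Z (c \<tau>))) has_derivative (\<lambda>r. (H2 (graph x) (P (graph x)) (r *\<^sub>R (1, 0))
      + H1 (graph x) ((phi (graph x) / L\<^sup>2) *\<^sub>R (r *\<^sub>R (1, 0)) - ads_Gamma L (graph x) (r *\<^sub>R (1, 0)) (P (graph x)))) * (1/2)
      - (phi (graph x) * (1 / L\<^sup>2) * H1 (graph x) (r *\<^sub>R (1, 0)) + dphi (graph x) (r *\<^sub>R (1, 0)) * (1 / L\<^sup>2) * H (graph x)))) (at 0)" .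
  from fun_cong[OF has_derivative_unique[OF A[unfolded has_field_derivative_def] this], of 1]
  have "w0 x / L * (dhor x z1 - z0) - (x \<bullet> snd (Z (graph x))) * w0 x / (L * (wt L x)\<^sup>2) + lam x / L\<^sup>2 * fst (Z (graph x))
     = (H2 (graph x) (hk x) (1, 0) + H1 (graph x) ((- lam x / (wt L x)\<^sup>2) *\<^sub>R (1, 0) + (- (w0 x / L ^ 3)) *\<^sub>R (0, x))) / 2
       + w0 x / L ^ 3 * HH x"
    unfolding scaleR_one unfolding G unfolding P_graph
    by (simp add: phi_graph dphi_graph linear_0[OF dhor_linear] HH_def power3_eq_cube power2_eq_square mult.assoc)
  also have "H1 (graph x) ((- lam x / (wt L x)\<^sup>2) *\<^sub>R (1, 0) + (- (w0 x / L ^ 3)) *\<^sub>R (0, x))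
      = (- lam x / (wt L x)\<^sup>2) * RR x + (- (w0 x / L ^ 3)) * (HH1 x x - dhor x x * RR x)"
    unfolding linear_add[OF linear_c2D1[OF cH]] linear_scale[OF linear_c2D1[OF cH]] HH1_eq(1)[OF cH cHH, of x x]
      HH1_eq(2)[OF cH cHH] by simp
  also have "\<dots> = - (w0 x / L ^ 3) * HH1 x x"
    unfolding dhor_self by (simp add: field_simps)
  finally show ?thesis
    unfolding z0_def[symmetric] z1_def[symmetric] c2_symmetric[OF cH, of "graph x" "hk x"]
    by (simp add: add_divide_distrib diff_divide_distrib algebra_simps)
qed

text \<open>On a line in direction \<open>x1\<close> both \<open>perp x\<close> and
  \<open>w0 x\<close> are constant, so all terms after the first are derivatives along the line: of
  the divergence of \<open>MM\<close>, of \<open>MM (perp x)\<close>, of \<open>lam x * HH x\<close>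
  and of \<open>TT1 x x1\<close>. The first term contains derivatives of \<open>HH\<close>
  alone.\<close>

theorem delta_ricci_horizon:
  assumes cHH: "c2 HH HH1 HH2" and cMM: "\<And>e. c2 (MM e) (MM1 e) (MM2 e)" and cTT: "c2 TT TT1 TT2"
  shows "delta_ricci (ads_metric L) h (graph x) (hk x) (hk x) + real DIM('a) / L\<^sup>2 * HH x =
    - (1/2) * ((\<Sum>b\<in>Basis. HH2 x b b) + (HH2 x x x + real (DIM('a) + 1) * HH1 x x) / L\<^sup>2)
    + (\<Sum>b\<in>Basis. MM2 b x x1 b) - MM1 (perp x) x x1 / (w0 x)\<^sup>2
    - (HH x + lam x * HH1 x x1) / (w0 x)\<^sup>2 - TT2 x x1 x1 / 2"
proof -
  obtain H1 H2 where cH: "c2 H H1 H2" using twice_H by (auto simp: twice_def)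
  obtain T1 T2 where cT: "c2 Tr T1 T2" using twice_Tr by (auto simp: twice_def)
  let ?p = "graph x"
  define z0 z1 zt zx where "z0 = fst (DZ ?p (1, 0))" and "z1 = snd (DZ ?p (1, 0))"
    and "zt = fst (Z ?p)" and "zx = snd (Z ?p)"
  define R where "R = H2 ?p (1, 0) (hk x)"
  define S where "S = (\<Sum>e\<in>Basis. snd (DZ ?p (dhor x e, e)) \<bullet> e)"
  \<comment> \<open>The divergence along the graph differentiates in the directions
    \<open>(dhor x e, e)\<close>. It differs from the full divergence by
    \<open>dhor x z1 - z0\<close>, which \<open>div_Z_transversal\<close> evaluates.\<close>
  have "snd (DZ ?p (dhor x e, e)) \<bullet> e = (z1 \<bullet> e) * dhor x e + DZ ?p (0, e) \<bullet> (0, e)" for e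
    using linear_add[OF DZ_linear, of ?p "dhor x e *\<^sub>R (1, 0)" "(0, e)"] linear_scale[OF DZ_linear, of ?p "dhor x e" "(1, 0)"]
    by (simp add: inner_add_left z1_def inner_prod_def)
  then have "S = dhor x z1 + (\<Sum>e\<in>Basis. DZ ?p (0, e) \<bullet> (0, e))"
    using linear_expand[OF dhor_linear, of x z1] by (simp add: S_def sum.distrib)
  then have "(\<Sum>b\<in>Basis. DZ ?p b \<bullet> b) = z0 + S - dhor x z1"
    unfolding sum_Basis_Pair z0_def by (simp add: inner_prod_def)
  then have dR: "delta_ricci (ads_metric L) h ?p (hk x) (hk x) = S - (dhor x z1 - z0) - TT2 x x1 x1 / 2"
    unfolding delta_ricci_ads[OF cT] div_Z[symmetric] TT2_eq[OF cT cTT] by simp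
  have W: "(wt L x)\<^sup>2 = (w0 x)\<^sup>2 + (lam x)\<^sup>2" "(wt L x)\<^sup>2 \<noteq> 0" by (rule wt2_w0) simp
  have "w0 x / L * (dhor x zx - zt) = HH1 x x1 / 2"
    using dphi_Z[OF cH, of ?p] HH1_eq(3)[OF cH cHH, of x x1]
    by (simp add: dphi_graph phi_graph P_graph hk_eq zx_def zt_def)
  then have zt: "zt = dhor x zx - L / (2 * w0 x) * HH1 x x1"
    by (simp add: field_simps)
  have "w0 x / L * (dhor x z1 - z0) = (x \<bullet> zx) * w0 x / (L * (wt L x)\<^sup>2) - lam x / L\<^sup>2 * zt
     + R / 2 - w0 x / (2 * L ^ 3) * HH1 x x + w0 x / L ^ 3 * HH x"
    using div_Z_transversal[OF cH cHH, of x] by (simp add: z0_def z1_def zt_def zx_def R_def)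
  then have "dhor x z1 - z0 = L / w0 x * ((x \<bullet> zx) * w0 x / (L * (wt L x)\<^sup>2) - lam x / L\<^sup>2 * zt
     + R / 2 - w0 x / (2 * L ^ 3) * HH1 x x + w0 x / L ^ 3 * HH x)"
    by (simp add: field_simps)
  also have "\<dots> = (x \<bullet> zx) / (wt L x)\<^sup>2 - lam x / (L * w0 x) * zt + L / (2 * w0 x) * R - HH1 x x / (2 * L\<^sup>2) + HH x / L\<^sup>2"
    by (simp add: field_simps power2_eq_square power3_eq_cube)
  also have "(x \<bullet> zx) / (wt L x)\<^sup>2 - lam x / (L * w0 x) * zt = (perp x \<bullet> zx) / (w0 x)\<^sup>2 + lam x / (2 * (w0 x)\<^sup>2) * HH1 x x1"
  proof -
    have "(x \<bullet> zx) / (wt L x)\<^sup>2 - lam x / (L * w0 x) * zt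
      = (x \<bullet> zx) * (1 / (wt L x)\<^sup>2 + (lam x)\<^sup>2 / ((w0 x)\<^sup>2 * (wt L x)\<^sup>2)) - lam x / (w0 x)\<^sup>2 * (x1 \<bullet> zx)
        + lam x / (2 * (w0 x)\<^sup>2) * HH1 x x1"
      unfolding zt dhor_def by (simp add: field_simps power2_eq_square)
    also have "1 / (wt L x)\<^sup>2 + (lam x)\<^sup>2 / ((w0 x)\<^sup>2 * (wt L x)\<^sup>2) = ((w0 x)\<^sup>2 + (lam x)\<^sup>2) / ((w0 x)\<^sup>2 * (wt L x)\<^sup>2)"
      by (simp add: add_divide_distrib)
    also have "\<dots> = 1 / (w0 x)\<^sup>2" unfolding W(1)[symmetric] by simp
    finally show ?thesis
      by (simp add: perp_def inner_diff_left diff_divide_distrib)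
  qed
  also have "perp x \<bullet> zx = MM1 (perp x) x x1 - (x \<bullet> perp x) / L\<^sup>2 * HH x
     - (HH1 x (perp x) + (x \<bullet> perp x) / L\<^sup>2 * HH1 x x) / 2"
    using Z_graph[OF cHH cMM, of x "perp x"] perp_x1[of x] by (simp add: zx_def inner_commute)
  also have "x \<bullet> perp x = (w0 x)\<^sup>2 - L\<^sup>2"
    using w02[of x] perp_inner[of x] by (simp add: perp_def lam_def inner_diff_right inner_diff_left power2_eq_square inner_commute x1)
  also have "HH1 x (perp x) = HH1 x x - lam x * HH1 x x1"
    unfolding perp_def by (simp add: linear_diff[OF linear_c2D1[OF cHH]] linear_scale[OF linear_c2D1[OF cHH]])
  finally have "dhor x z1 - z0 = MM1 (perp x) x x1 / (w0 x)\<^sup>2 + (HH x + lam x * HH1 x x1) / (w0 x)\<^sup>2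
      - HH1 x x / L\<^sup>2 + L / (2 * w0 x) * R"
    using transversal_algebra[of "(w0 x)\<^sup>2" L "dhor x z1 - z0" "MM1 (perp x) x x1" "HH x" "HH1 x x" "lam x * HH1 x x1" "L / (2 * w0 x) * R"]
    by simp
  moreover have "S = (\<Sum>e\<in>Basis. MM2 e x x1 e) - (real DIM('a) * HH x + HH1 x x) / L\<^sup>2
    - ((\<Sum>e\<in>Basis. HH2 x e e) + (real (DIM('a) + 1) * HH1 x x + HH2 x x x) / L\<^sup>2) / 2
    + L / (2 * w0 x) * R"
    unfolding S_def R_def by (rule div_Z_horizon[OF cH cHH cMM])
  ultimately show ?thesis
    unfolding dR by (simp add: add_divide_distrib diff_divide_distrib algebra_simps)
qed

end

section \<open>Functions that are twice differentiable up to the boundary\<close>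

text \<open>In the application \<open>A\<close> is the interior, where derivatives are taken, and
  \<open>K\<close> a compact set reaching the boundary. Bounds are assumed around boundary points
  too, but concern \<open>A\<close> only.\<close>

lemma locally_bounded_imp_bounded:
  fixes g :: "'b::topological_space \<Rightarrow> real"
  assumes K: "compact K" and loc: "\<And>x. x \<in> K \<Longrightarrow> \<exists>U C. open U \<and> x \<in> U \<and> (\<forall>q\<in>U \<inter> A. g q \<le> C)"
  shows "\<exists>C\<ge>0. \<forall>q\<in>K \<inter> A. g q \<le> C"
proof -
  obtain U C where U: "\<And>x. x \<in> K \<Longrightarrow> open (U x)" "\<And>x. x \<in> K \<Longrightarrow> x \<in> U x"
    and C: "\<And>x q. x \<in> K \<Longrightarrow> q \<in> U x \<inter> A \<Longrightarrow> g q \<le> C x"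
    using loc by metis
  have "K \<subseteq> (\<Union>x\<in>K. U x)" using U(2) by blast
  from compactE_image[OF K U(1) this] obtain D where D: "D \<subseteq> K" "finite D" "K \<subseteq> (\<Union>x\<in>D. U x)"
    by metis
  show ?thesis
  proof (intro exI[of _ "\<Sum>x\<in>D. \<bar>C x\<bar>"] conjI ballI sum_nonneg abs_ge_zero)
    fix q assume q: "q \<in> K \<inter> A"
    then obtain x where x: "x \<in> D" "q \<in> U x" using D by blast
    have "g q \<le> \<bar>C x\<bar>" using C[of x q] x q D by force
    also have "\<dots> \<le> (\<Sum>x\<in>D. \<bar>C x\<bar>)" by (rule member_le_sum) (use x D in auto)
    finally show "g q \<le> (\<Sum>x\<in>D. \<bar>C x\<bar>)" .
  qed
qed

lemma Ck_on_2:
  "Ck_on 2 F U \<longleftrightarrow> F differentiable_on U \<and> (\<forall>d. (\<lambda>x. frechet_derivative F (at x) d) differentiable_on U \<and>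
     (\<forall>e. continuous_on U (\<lambda>x. frechet_derivative (\<lambda>y. frechet_derivative F (at y) d) (at x) e)))"
  by (simp add: numeral_2_eq_2)

context
  fixes f :: "'b::euclidean_space \<Rightarrow> real" and S B :: "'b set"
  assumes ck: "Ck_upto_boundary 2 f S" and B: "open B" "B \<subseteq> S"
begin

abbreviation "d1 g q \<equiv> frechet_derivative g (at q)"
abbreviation "d2 g q d \<equiv> frechet_derivative (\<lambda>z. frechet_derivative g (at z) d) (at q)"

text \<open>The derivatives of \<open>f\<close> are considered inside \<open>B\<close> only. There
  they agree with those of a local extension, which in turn behave well at boundary points.\<close>

lemma Ck_extension:
  assumes "x \<in> S"
  shows "\<exists>U F. open U \<and> x \<in> U \<and> Ck_on 2 F U \<and> (\<forall>y\<in>U \<inter> S. F y = f y) \<and>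
    (\<forall>q\<in>U \<inter> B. (f has_derivative d1 F q) (at q) \<and> (\<forall>d. ((\<lambda>z. d1 f z d) has_derivative d2 F q d) (at q)))"
proof -
  obtain U F where UF: "open U" "x \<in> U" "Ck_on 2 F U" "\<forall>y\<in>U \<inter> S. F y = f y"
    using ck assms unfolding Ck_upto_boundary_def by blast
  have op: "open (U \<inter> B)" using UF(1) B(1) by auto
  have ev: "eventually (\<lambda>y. y \<in> U \<inter> B) (nhds q)" if "q \<in> U \<inter> B" for q
    using eventually_nhds_in_open[OF op that] .
  have F1: "(F has_derivative d1 F q) (at q)" if "q \<in> U" for q
  proof -
    have "F differentiable_on U" using UF(3) unfolding Ck_on_2 by (rule conjunct1)
    then have "F differentiable (at q)" using that UF(1) differentiable_on_eq_differentiable_at by blast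
    then show ?thesis by (rule frechet_derivative_works[THEN iffD1])
  qed
  have F2: "((\<lambda>z. d1 F z d) has_derivative d2 F q d) (at q)" if "q \<in> U" for q d
  proof -
    have "(\<lambda>x. d1 F x d) differentiable_on U" using UF(3) unfolding Ck_on_2 by auto
    then have "(\<lambda>x. d1 F x d) differentiable (at q)" using that UF(1) differentiable_on_eq_differentiable_at by blast
    then show ?thesis by (rule frechet_derivative_works[THEN iffD1])
  qed
  have f1: "(f has_derivative d1 F q) (at q)" if q: "q \<in> U \<inter> B" for q
  proof (rule has_derivative_nhds_eq[OF F1])
    show "eventually (\<lambda>y. F y = f y) (nhds q)"
      using ev[OF q] by eventually_elim (use UF(4) B(2) in auto)
  qed (use q in auto)
  have f2: "((\<lambda>z. d1 f z d) has_derivative d2 F q d) (at q)" if q: "q \<in> U \<inter> B" for q d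
  proof (rule has_derivative_nhds_eq[OF F2])
    show "eventually (\<lambda>y. d1 F y d = d1 f y d) (nhds q)"
      using ev[OF q]
    proof eventually_elim
      case (elim y)
      from frechet_derivative_at[OF f1[OF elim]] show ?case by simp
    qed
  qed (use q in auto)
  show ?thesis
    by (intro exI[of _ U] exI[of _ F] conjI ballI allI UF f1 f2)
qed

lemma Ck_interior:
  assumes "q \<in> B"
  shows "(f has_derivative d1 f q) (at q)" "((\<lambda>z. d1 f z d) has_derivative d2 f q d) (at q)"
proof -
  have x: "q \<in> S" using assms B by blast
  obtain U F where U: "open U" "q \<in> U" "Ck_on 2 F U" and ext: "\<forall>y\<in>U \<inter> S. F y = f y"
      and F12: "\<forall>q\<in>U \<inter> B. (f has_derivative d1 F q) (at q) \<and> (\<forall>d. ((\<lambda>z. d1 f z d) has_derivative d2 F q d) (at q))"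
    using Ck_extension[OF x] by (elim exE conjE)
  note F1 = F12[rule_format, THEN conjunct1] and F2 = F12[rule_format, THEN conjunct2, rule_format]
  have q: "q \<in> U \<inter> B" using assms U(2) by blast
  show "(f has_derivative d1 f q) (at q)"
    using differentiableI[OF F1[OF q]] by (rule frechet_derivative_works[THEN iffD1])
  show "((\<lambda>z. d1 f z d) has_derivative d2 f q d) (at q)"
    using differentiableI[OF F2[OF q]] by (rule frechet_derivative_works[THEN iffD1])
qed

lemma Ck_continuous: "continuous_on S f"
  unfolding continuous_on_eq_continuous_within
proof
  fix x assume x: "x \<in> S"
  obtain U F where U: "open U" "x \<in> U" "Ck_on 2 F U" and ext: "\<forall>y\<in>U \<inter> S. F y = f y"
      and F12: "\<forall>q\<in>U \<inter> B. (f has_derivative d1 F q) (at q) \<and> (\<forall>d. ((\<lambda>z. d1 f z d) has_derivative d2 F q d) (at q))"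
    using Ck_extension[OF x] by (elim exE conjE)
  note F1 = F12[rule_format, THEN conjunct1] and F2 = F12[rule_format, THEN conjunct2, rule_format]
  have "F differentiable_on U" using U(3) unfolding Ck_on_2 by (rule conjunct1)
  then have "F differentiable (at x)" using U(1,2) differentiable_on_eq_differentiable_at by blast
  then have "continuous (at x) F" by (rule differentiable_imp_continuous_within)
  then have "(F \<longlongrightarrow> F x) (at x within S)"
    unfolding isCont_def by (rule tendsto_mono[OF at_le, rotated]) simp
  moreover have "eventually (\<lambda>y. F y = f y) (at x within S)"
    unfolding eventually_at_topological using U ext by (intro exI[of _ U]) auto
  ultimately have "(f \<longlongrightarrow> F x) (at x within S)"
    by (rule Lim_transform_eventually)
  then show "continuous (at x within S) f"
    using ext x U(2) by (simp add: continuous_within)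
qed

text \<open>Near each point of \<open>K\<close> an extension has continuous, hence locally bounded,
  derivatives; compactness makes the bounds uniform on approach to the boundary.\<close>

lemma Ck_bounded:
  assumes K: "compact K" "K \<subseteq> S"
  shows "\<exists>C\<ge>0. \<forall>q\<in>K \<inter> B. \<bar>f q\<bar> \<le> C \<and> (\<forall>d\<in>Basis. \<bar>d1 f q d\<bar> \<le> C) \<and> (\<forall>d\<in>Basis. \<forall>e\<in>Basis. \<bar>d2 f q d e\<bar> \<le> C)"
proof -
  define g where "g F q = \<bar>F q\<bar> + (\<Sum>d\<in>Basis. \<bar>d1 F q d\<bar>) + (\<Sum>d\<in>Basis. \<Sum>e\<in>Basis. \<bar>d2 F q d e\<bar>)"
    for F :: "'b \<Rightarrow> real" and q :: 'b
  have "\<exists>C\<ge>0. \<forall>q\<in>K \<inter> B. g f q \<le> C"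
  proof (rule locally_bounded_imp_bounded[OF K(1)])
    fix x assume "x \<in> K"
    then have x: "x \<in> S" using K by blast
    obtain U F where U: "open U" "x \<in> U" "Ck_on 2 F U" and ext: "\<forall>y\<in>U \<inter> S. F y = f y"
      and F12: "\<forall>q\<in>U \<inter> B. (f has_derivative d1 F q) (at q) \<and> (\<forall>d. ((\<lambda>z. d1 f z d) has_derivative d2 F q d) (at q))"
    using Ck_extension[OF x] by (elim exE conjE)
  note F1 = F12[rule_format, THEN conjunct1] and F2 = F12[rule_format, THEN conjunct2, rule_format]
    have c: "continuous_on U F" "continuous_on U (\<lambda>q. d1 F q d)" "continuous_on U (\<lambda>q. d2 F q d e)" for d e
      using U(3) unfolding Ck_on_2 by (auto intro: differentiable_imp_continuous_on)
    have "continuous_on U (g F)"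
      unfolding g_def by (intro continuous_intros c)
    then have "isCont (g F) x" using U by (simp add: continuous_on_eq_continuous_at)
    then have "eventually (\<lambda>y. dist (g F y) (g F x) < 1) (nhds x)"
      by (intro tendstoD isCont_tendsto_nhds) auto
    then obtain V where V: "open V" "x \<in> V" "\<And>y. y \<in> V \<Longrightarrow> dist (g F y) (g F x) < 1"
      unfolding eventually_nhds by blast
    have "g f q \<le> g F x + 1" if q: "q \<in> U \<inter> V \<inter> B" for q
    proof -
      have "g f q = g F q"
        unfolding g_def using frechet_derivative_at[OF F1, of q] frechet_derivative_at[OF F2, of q] ext q B(2)
        by auto
      then show ?thesis using V(3)[of q] q by (simp add: dist_real_def)
    qed
    then show "\<exists>U C. open U \<and> x \<in> U \<and> (\<forall>q\<in>U \<inter> B. g f q \<le> C)"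
      using U V by (intro exI[of _ "U \<inter> V"] exI[of _ "g F x + 1"]) auto
  qed
  then obtain C where C: "C \<ge> 0" "\<And>q. q \<in> K \<inter> B \<Longrightarrow> g f q \<le> C" by blast
  have s: "\<bar>f q\<bar> \<le> g f q" "d \<in> Basis \<Longrightarrow> \<bar>d1 f q d\<bar> \<le> g f q"
    "d \<in> Basis \<Longrightarrow> e \<in> Basis \<Longrightarrow> \<bar>d2 f q d e\<bar> \<le> g f q" for q d e
  proof -
    have n: "0 \<le> (\<Sum>d\<in>Basis. \<bar>d1 f q d\<bar>)" "0 \<le> (\<Sum>d\<in>Basis. \<Sum>e\<in>Basis. \<bar>d2 f q d e\<bar>)"
      by (intro sum_nonneg abs_ge_zero)+
    show "\<bar>f q\<bar> \<le> g f q" unfolding g_def using n by linarith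
    { assume d: "d \<in> Basis"
      have "\<bar>d1 f q d\<bar> \<le> (\<Sum>d\<in>Basis. \<bar>d1 f q d\<bar>)" by (rule member_le_sum) (use d in auto)
      then show "\<bar>d1 f q d\<bar> \<le> g f q" unfolding g_def using n by linarith
      assume e: "e \<in> Basis"
      have "\<bar>d2 f q d e\<bar> \<le> (\<Sum>e\<in>Basis. \<bar>d2 f q d e\<bar>)" by (rule member_le_sum) (use e in auto)
      also have "\<dots> \<le> (\<Sum>d\<in>Basis. \<Sum>e\<in>Basis. \<bar>d2 f q d e\<bar>)"
        by (rule member_le_sum[of d Basis "\<lambda>d. \<Sum>e\<in>Basis. \<bar>d2 f q d e\<bar>"]) (use d in \<open>auto intro: sum_nonneg\<close>)
      finally show "\<bar>d2 f q d e\<bar> \<le> g f q" unfolding g_def using n by linarith }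
  qed
  show ?thesis
    using C s by (intro exI[of _ C]) (meson order_trans)
qed

end

section \<open>Admissible perturbations\<close>

definition open_ads :: "(real \<times> 'a::euclidean_space) set" where
  "open_ads = UNIV \<times> ball 0 1"

context ads
begin

lemma norm_wt: "sqrt (L\<^sup>2 + (norm x)\<^sup>2) = wt L x"
  by (simp add: wt_def power2_norm_eq_inner)

lemma compactify_eq: "compactify L p = (fst p, inverse (L + wt L (snd p)) *\<^sub>R snd p)"
  by (simp add: compactify_def norm_wt)

lemma push_eq: "push L p u = (fst u, inverse (L + wt L (snd p)) *\<^sub>R snd u
    - ((snd p \<bullet> snd u) * inverse (wt L (snd p)) * (inverse (L + wt L (snd p)))\<^sup>2) *\<^sub>R snd p)"
  using frechet_derivative_at[OF compactify_has_derivative[OF L_pos, of p]]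
  by (simp add: push_def norm_wt fun_eq_iff field_simps)

lemma Lw_pos: "L + wt L x > 0"
  using L_pos wt_pos[of x] by simp

lemma Lw_nz [simp]: "L + wt L x \<noteq> 0"
  using Lw_pos[of x] by simp

lemma compactify_open: "compactify L p \<in> open_ads"
proof -
  have "norm (snd p) < L + wt L (snd p)" using norm_le_wt[of "snd p"] L_pos by linarith
  then show ?thesis using Lw_pos[of "snd p"]
    by (auto simp: open_ads_def compactify_eq mem_Times_iff field_simps)
qed

lemma open_ads_subset: "open_ads \<subseteq> ads_closure"
  by (auto simp: open_ads_def ads_closure_def)

lemma open_open_ads: "open (open_ads :: (real \<times> 'a::euclidean_space) set)"
  unfolding open_ads_def by (intro open_Times) auto

lemma conf_factor2: "(conf_factor L p)\<^sup>2 = L\<^sup>2 / (wt L (snd p))\<^sup>2"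
proof -
  have "1 + (norm (snd p))\<^sup>2 / L\<^sup>2 = (wt L (snd p))\<^sup>2 / L\<^sup>2"
    by (simp add: wt2 power2_norm_eq_inner add_divide_distrib)
  then show ?thesis
    by (simp add: conf_factor_def power_divide)
qed

lemma push_linear: "linear (push L p)"
  unfolding push_eq by (rule linearI) (simp_all add: inner_add_right scaleR_add_right scaleR_add_left algebra_simps)

end

text \<open>The existential witness in \<open>admissible\<close> becomes the parameter
  \<open>hb\<close>, so that its regularity is available throughout.\<close>

locale admissible_pert = ads L for L :: real +
  fixes dg hb :: "(real \<times> 'a::euclidean_space) tensor2"
  assumes hb_sym: "q \<in> ads_closure \<Longrightarrow> symmetric_form (hb q)"
    and hb_C2: "Ck_upto_boundary 2 (\<lambda>q. hb q u v) ads_closure"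
    and hb_pull: "hb (compactify L p) (push L p u) (push L p v) = (conf_factor L p)\<^sup>2 * dg p u v"
    and hb_bdry: "q \<in> ads_boundary \<Longrightarrow> \<exists>c. \<forall>u v. snd u \<bullet> snd q = 0 \<longrightarrow> snd v \<bullet> snd q = 0 \<longrightarrow>
        hb q u v = c * conf_metric L q u v"
begin

lemma hb_symc: "symmetric_form (hb (compactify L p))"
  using hb_sym compactify_open open_ads_subset by blast

lemma hb_bil: "bilinear (hb (compactify L p))"
  using hb_symc unfolding symmetric_form_def by blast

lemma dg_eq: "dg p u v = (wt L (snd p))\<^sup>2 / L\<^sup>2 * hb (compactify L p) (push L p u) (push L p v)"
  by (simp add: hb_pull conf_factor2)

text \<open>Constant basis arguments separate the point dependence of \<open>hb\<close> from that of
  \<open>push\<close>; differentiability and decay can then be read off factor by factor.\<close>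

lemma dg_expand: "dg p u v = (\<Sum>i\<in>Basis. \<Sum>j\<in>Basis. (wt L (snd p))\<^sup>2 / L\<^sup>2 *
    ((push L p u \<bullet> i) * (push L p v \<bullet> j)) * hb (compactify L p) i j)"
  unfolding dg_eq by (subst bilinear_expand2[OF hb_bil]) (simp add: sum_distrib_left mult.assoc)

lemmas hb_interior = Ck_interior[OF hb_C2 open_open_ads open_ads_subset]

lemma twice_inv_Lw: "twice (\<lambda>p::real \<times> 'a. inverse (L + wt L (snd p)))"
  by (intro twice_inverse twice_add twice_const twice_wt) simp

lemma twice_push: "twice (\<lambda>p. push L p u \<bullet> i)"
  unfolding push_eq inner_prod_def power2_eq_square
  by (simp add: inner_diff_left)
    (intro twice_add twice_diff twice_mult twice_const twice_snd_inner twice_inv_Lw twice_inverse twice_wt; simp)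

lemma twice_hb: "twice (\<lambda>p. hb (compactify L p) u v)"
proof (rule twice_compose[where q = "compactify L"])
  show "twice (\<lambda>p. compactify L p \<bullet> i)" for i :: "real \<times> 'a"
    unfolding compactify_eq inner_prod_def
    by simp (intro twice_add twice_mult twice_const twice_snd_inner twice_inv_Lw twice_fst)
qed (rule hb_interior[OF compactify_open])+

sublocale ads_perturbation L dg
proof (unfold_locales)
  show "symmetric_form (dg p)" for p
  proof -
    have s: "hb (compactify L p) a b = hb (compactify L p) b a" for a b
      using hb_symc[of p] unfolding symmetric_form_def by blast
    show ?thesis
      unfolding symmetric_form_def bilinear_def
    proof (intro conjI allI)
      show "dg p u v = dg p v u" for u v unfolding dg_eq by (subst s) (rule refl)
      show "linear (\<lambda>y. dg p x y)" for x
        unfolding dg_eq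
        by (rule linearI)
           (simp_all add: linear_add[OF push_linear] linear_scale[OF push_linear] bilinear_radd[OF hb_bil] bilinear_rmul[OF hb_bil] algebra_simps)
      show "linear (\<lambda>x. dg p x y)" for y
        unfolding dg_eq
        by (rule linearI)
           (simp_all add: linear_add[OF push_linear] linear_scale[OF push_linear] bilinear_ladd[OF hb_bil] bilinear_lmul[OF hb_bil] algebra_simps)
    qed
  qed
  show "twice (\<lambda>p. dg p u v)" for u v
    unfolding dg_expand
    by (intro twice_sum twice_mult twice_divide twice_wt2 twice_const twice_push twice_hb) simp
qed

end

section \<open>Decay along the generators\<close>

context ads_line
begin

text \<open>A derivative along \<open>x1\<close> gains a factor \<open>1 / wt\<close>; those in orthogonal directions do not.\<close>

definition Nw :: "'a \<Rightarrow> 'a \<Rightarrow> real" where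
  "Nw x u = norm (perp u) + \<bar>u \<bullet> x1\<bar> / wt L x"

definition tube :: "real \<Rightarrow> 'a set" where
  "tube R = {x. norm (perp x) \<le> R}"

text \<open>Constants may depend on the tube, that is on the distance of a generator from the axis.
  A single generator and its small variations stay in one tube.\<close>

definition Sy :: "int \<Rightarrow> ('a \<Rightarrow> real) \<Rightarrow> bool" where
  "Sy m F \<longleftrightarrow> (\<forall>R. symb Nw (tube R) (\<lambda>x. wt L x powi m) F)"

lemma Nw_nonneg: "Nw x u \<ge> 0"
  using wt_pos[of x] by (simp add: Nw_def)

lemma perp_add: "perp (x + y) = perp x + perp y" and perp_scale: "perp (c *\<^sub>R x) = c *\<^sub>R perp x"
  by (simp_all add: perp_def lam_def inner_add_left algebra_simps)

lemma perp_x1_zero: "perp x1 = 0"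
  by (simp add: perp_def lam_def x1)

lemma inner_perp: "x \<bullet> perp y = perp x \<bullet> y" "perp x \<bullet> perp y = perp x \<bullet> y"
  by (simp_all add: perp_def lam_def inner_diff_left inner_diff_right x1 inner_commute)

lemma lam_le_wt: "\<bar>lam x\<bar> \<le> wt L x"
  using Cauchy_Schwarz_ineq2[of x x1] norm_x1 norm_le_wt[of x] by (simp add: lam_def)

lemma w0_le_wt: "w0 x \<le> wt L x"
proof (rule power2_le_imp_le)
  show "(w0 x)\<^sup>2 \<le> (wt L x)\<^sup>2" unfolding wt2_w0 by simp
  show "0 \<le> wt L x" using wt_pos[of x] by simp
qed

lemma w0_ge: "w0 x \<ge> L"
proof (rule power2_le_imp_le)
  show "L\<^sup>2 \<le> (w0 x)\<^sup>2" unfolding w02 by simp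
  show "0 \<le> w0 x" using w0_pos[of x] by simp
qed

lemma Sy_mult: "Sy m F \<Longrightarrow> Sy n G \<Longrightarrow> Sy (m + n) (\<lambda>x. F x * G x)"
  unfolding Sy_def by (simp add: power_int_add symb_mult Nw_nonneg)

lemma Sy_add: "Sy m F \<Longrightarrow> Sy m G \<Longrightarrow> Sy m (\<lambda>x. F x + G x)"
  unfolding Sy_def by (simp add: symb_add)

text \<open>\<open>wt\<close> is bounded below by \<open>L\<close>, so lower powers are dominated by
  higher ones up to a constant.\<close>

lemma Sy_mono: assumes "Sy m F" "m \<le> n" shows "Sy n F"
  unfolding Sy_def
proof
  fix R
  show "symb Nw (tube R) (\<lambda>x. wt L x powi n) F"
  proof (rule symb_mono[of _ _ "\<lambda>x. wt L x powi m" _ "L powi (m - n)"])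
    show "symb Nw (tube R) (\<lambda>x. wt L x powi m) F" using assms by (simp add: Sy_def)
    show "wt L x powi m \<le> L powi (m - n) * wt L x powi n" for x
    proof -
      have "wt L x powi (m - n) \<le> L powi (m - n)"
      proof (cases "m = n")
        case False
        then show ?thesis using assms(2) L_pos wt_ge[of x] by (intro power_int_antimono) auto
      qed simp
      then have "wt L x powi (m - n) * wt L x powi n \<le> L powi (m - n) * wt L x powi n"
        using wt_pos[of x] by (intro mult_right_mono) auto
      then show ?thesis by (simp add: power_int_add[symmetric])
    qed
  qed (use L_pos in \<open>auto simp: Nw_nonneg\<close>)
qed

lemma Sy_const: "Sy 0 (\<lambda>x. c)"
  unfolding Sy_def by (auto intro: symb_const[of 1] simp: Nw_nonneg)

lemma Sy_cmult: "Sy m F \<Longrightarrow> Sy m (\<lambda>x. c * F x)"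
  using Sy_mult[OF Sy_const[of c]] by simp

lemma Sy_minus: "Sy m F \<Longrightarrow> Sy m (\<lambda>x. - F x)"
  using Sy_cmult[of m F "-1"] by simp

lemma Sy_diff: "Sy m F \<Longrightarrow> Sy m G \<Longrightarrow> Sy m (\<lambda>x. F x - G x)"
  using Sy_add[OF _ Sy_minus] by fastforce

lemma Sy_zero: "Sy m (\<lambda>x. 0)"
  using Sy_mono[OF Sy_const[of 0], of m] Sy_cmult[of m "\<lambda>_. 1" 0]
  unfolding Sy_def by (auto intro!: symbI[OF c2_const, of 0])

lemma Sy_sum: "(\<And>i. i \<in> A \<Longrightarrow> Sy m (F i)) \<Longrightarrow> Sy m (\<lambda>x. \<Sum>i\<in>A. F i x)"
  by (induction A rule: infinite_finite_induct) (auto intro: Sy_zero Sy_add)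

lemma Sy_lam: "Sy 1 lam"
  unfolding Sy_def
proof
  fix R
  have l: "linear lam" unfolding lam_def[abs_def] by (simp add: linear_iff inner_add_left)
  show "symb Nw (tube R) (\<lambda>x. wt L x powi 1) lam"
  proof (rule symbI[OF c2_linear[OF l], of 1])
    show "\<bar>lam x\<bar> \<le> 1 * wt L x powi 1" for x using lam_le_wt[of x] by simp
    show "\<bar>lam u\<bar> \<le> 1 * wt L x powi 1 * Nw x u" for x u
      using wt_pos[of x] by (simp add: Nw_def lam_def distrib_left)
    show "\<bar>0\<bar> \<le> 1 * wt L x powi 1 * (Nw x u * Nw x v)" for x u v
      using wt_pos[of x] Nw_nonneg[of x u] Nw_nonneg[of x v] by simp
  qed simp
qed

text \<open>The part of \<open>x\<close> orthogonal to \<open>x1\<close> is bounded on a tube, so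
  such a coordinate does not grow along a generator, unlike a general one.\<close>

lemma Sy_inner_perp: assumes e: "e \<bullet> x1 = 0" shows "Sy 0 (\<lambda>x. x \<bullet> e)"
  unfolding Sy_def
proof
  fix R
  have l: "linear (\<lambda>x. x \<bullet> e)" by (simp add: linear_iff inner_add_left)
  have x1e: "x1 \<bullet> e = 0" using e by (subst inner_commute)
  have e': "x \<bullet> e = perp x \<bullet> e" for x
    by (simp add: perp_def inner_diff_left x1e)
  have b: "\<bar>x \<bullet> e\<bar> \<le> norm (perp x) * norm e" for x
    by (subst e') (rule Cauchy_Schwarz_ineq2)
  show "symb Nw (tube R) (\<lambda>x. wt L x powi 0) (\<lambda>x. x \<bullet> e)"
  proof (rule symbI[OF c2_linear[OF l], of "(\<bar>R\<bar> + 1) * norm e"])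
    show "\<bar>x \<bullet> e\<bar> \<le> (\<bar>R\<bar> + 1) * norm e * wt L x powi 0" if "x \<in> tube R" for x
    proof -
      have "norm (perp x) * norm e \<le> (\<bar>R\<bar> + 1) * norm e"
        using that by (intro mult_right_mono) (auto simp: tube_def)
      then show ?thesis using b[of x] by simp
    qed
    show "\<bar>u \<bullet> e\<bar> \<le> (\<bar>R\<bar> + 1) * norm e * wt L x powi 0 * Nw x u" for x u
    proof -
      have "norm (perp u) * norm e \<le> Nw x u * norm e"
        using wt_pos[of x] by (intro mult_right_mono) (auto simp: Nw_def)
      also have "\<dots> \<le> (\<bar>R\<bar> + 1) * (Nw x u * norm e)"
        using Nw_nonneg[of x u] by (simp add: distrib_right)
      finally show ?thesis using b[of u] by (simp add: mult_ac)
    qed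
    show "\<bar>0\<bar> \<le> (\<bar>R\<bar> + 1) * norm e * wt L x powi 0 * (Nw x u * Nw x v)" for x u v
      using Nw_nonneg[of x u] Nw_nonneg[of x v] by simp
  qed simp
qed

lemma Sy_inner: "Sy 1 (\<lambda>x. x \<bullet> e)"
proof -
  have "x \<bullet> e = x \<bullet> perp e + (e \<bullet> x1) * lam x" for x
    by (simp add: perp_def lam_def inner_diff_right)
  then show ?thesis
    using Sy_add[OF Sy_mono[OF Sy_inner_perp[OF perp_x1[of e]], of 1] Sy_cmult[OF Sy_lam, of "e \<bullet> x1"]]
    by (simp add: perp_def lam_def inner_diff_right)
qed

lemma Sy_comp_real:
  assumes F: "Sy m F"
    and d1: "\<And>x. (\<phi> has_real_derivative \<phi>1 (F x)) (at (F x))"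
    and d2: "\<And>x. (\<phi>1 has_real_derivative \<phi>2 (F x)) (at (F x))"
    and b: "\<And>R. \<exists>K\<ge>0. \<forall>x\<in>tube R. \<bar>\<phi> (F x)\<bar> \<le> K * wt L x powi n \<and> \<bar>\<phi>1 (F x)\<bar> * wt L x powi m \<le> K * wt L x powi n \<and>
        \<bar>\<phi>2 (F x)\<bar> * (wt L x powi m)\<^sup>2 \<le> K * wt L x powi n"
  shows "Sy n (\<lambda>x. \<phi> (F x))"
  unfolding Sy_def
proof
  fix R
  obtain K where K: "K \<ge> 0" "\<forall>x\<in>tube R. \<bar>\<phi> (F x)\<bar> \<le> K * wt L x powi n \<and> \<bar>\<phi>1 (F x)\<bar> * wt L x powi m \<le> K * wt L x powi n \<and>
        \<bar>\<phi>2 (F x)\<bar> * (wt L x powi m)\<^sup>2 \<le> K * wt L x powi n"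
    using b by blast
  show "symb Nw (tube R) (\<lambda>x. wt L x powi n) (\<lambda>x. \<phi> (F x))"
  proof (rule symb_comp_real[where F = F and \<phi> = \<phi> and ?\<phi>1.0 = \<phi>1 and ?\<phi>2.0 = \<phi>2, OF _ _ _ d1 d2 _ K(1)])
    show "symb Nw (tube R) (\<lambda>x. wt L x powi m) F" using F by (simp add: Sy_def)
    show "0 \<le> wt L x powi m" "0 \<le> wt L x powi n" for x
      using wt_pos[of x] by (simp_all add: zero_le_power_int)
  qed (use K(2) in \<open>auto simp: Nw_nonneg\<close>)
qed

lemma Sy_w02: "Sy 0 (\<lambda>x. (w0 x)\<^sup>2)"
proof -
  have "(w0 x)\<^sup>2 = L\<^sup>2 + (\<Sum>b\<in>Basis. (x \<bullet> perp b) * (x \<bullet> perp b))" for x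
    unfolding w02 by (subst euclidean_inner) (simp add: inner_perp)
  then show ?thesis
    using Sy_add[OF Sy_const[of "L\<^sup>2"] Sy_sum[of Basis 0 "\<lambda>b x. (x \<bullet> perp b) * (x \<bullet> perp b)"]]
      Sy_mult[OF Sy_inner_perp Sy_inner_perp, OF perp_x1 perp_x1] by simp
qed

lemma w0_tube: "x \<in> tube R \<Longrightarrow> w0 x \<le> L + \<bar>R\<bar>"
proof -
  assume "x \<in> tube R"
  then have "norm (perp x) \<le> \<bar>R\<bar>" by (auto simp: tube_def)
  then have "(norm (perp x))\<^sup>2 \<le> \<bar>R\<bar>\<^sup>2" by (intro power_mono) auto
  moreover have "(w0 x)\<^sup>2 = L\<^sup>2 + (norm (perp x))\<^sup>2" by (simp only: w02 power2_norm_eq_inner)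
  moreover have "0 \<le> 2 * L * \<bar>R\<bar>" using L_pos by simp
  ultimately have le: "(w0 x)\<^sup>2 \<le> (L + \<bar>R\<bar>)\<^sup>2" unfolding power2_sum by linarith
  show ?thesis by (rule power2_le_imp_le[OF le]) (use L_pos in simp)
qed

lemma Sy_w0: "Sy 0 w0"
proof -
  have "Sy 0 (\<lambda>x. sqrt ((w0 x)\<^sup>2))"
  proof (rule Sy_comp_real[OF Sy_w02 DERIV_real_sqrt2])
    fix R
    show "\<exists>K\<ge>0. \<forall>x\<in>tube R. \<bar>sqrt ((w0 x)\<^sup>2)\<bar> \<le> K * wt L x powi 0 \<and>
       \<bar>1 / (2 * sqrt ((w0 x)\<^sup>2))\<bar> * wt L x powi 0 \<le> K * wt L x powi 0 \<and>
       \<bar>- 1 / (4 * sqrt ((w0 x)\<^sup>2) ^ 3)\<bar> * (wt L x powi 0)\<^sup>2 \<le> K * wt L x powi 0"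
    proof (intro exI[of _ "L + \<bar>R\<bar> + 1 / L + 1 / L ^ 3"] conjI ballI)
      fix x assume x: "x \<in> tube R"
      have p: "1 / L > 0" "1 / L ^ 3 > 0" using L_pos by auto
      have s: "sqrt ((w0 x)\<^sup>2) = w0 x" using w0_pos[of x] by simp
      have pos1: "1 / (2 * w0 x) > 0" and ab3: "\<bar>- 1 / (4 * w0 x ^ 3)\<bar> = 1 / (4 * w0 x ^ 3)"
        using w0_pos[of x] by simp_all
      have 1: "1 / (2 * w0 x) \<le> 1 / L" using w0_ge[of x] L_pos by (intro divide_left_mono) auto
      have "L ^ 3 \<le> w0 x ^ 3" using w0_ge[of x] L_pos by (intro power_mono) auto
      then have "L ^ 3 \<le> 4 * w0 x ^ 3" using zero_less_power[OF w0_pos[of x], of 3] by linarith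
      then have 2: "1 / (4 * w0 x ^ 3) \<le> 1 / L ^ 3" using L_pos w0_pos[of x] by (intro divide_left_mono) auto
      show "\<bar>sqrt ((w0 x)\<^sup>2)\<bar> \<le> (L + \<bar>R\<bar> + 1 / L + 1 / L ^ 3) * wt L x powi 0"
        using w0_tube[OF x] w0_pos[of x] p(1,2) unfolding s power_int_0_right mult_1_right by linarith
      show "\<bar>1 / (2 * sqrt ((w0 x)\<^sup>2))\<bar> * wt L x powi 0 \<le> (L + \<bar>R\<bar> + 1 / L + 1 / L ^ 3) * wt L x powi 0"
        using 1 w0_pos[of x] p L_pos unfolding s power_int_0_right mult_1_right abs_of_pos[OF pos1] by linarith
      show "\<bar>- 1 / (4 * sqrt ((w0 x)\<^sup>2) ^ 3)\<bar> * (wt L x powi 0)\<^sup>2 \<le> (L + \<bar>R\<bar> + 1 / L + 1 / L ^ 3) * wt L x powi 0"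
        using 2 w0_pos[of x] p L_pos unfolding s power_int_0_right power_one mult_1_right ab3 by linarith
    qed (use L_pos in simp)
  qed (use w0_pos in auto)
  then show ?thesis by (simp add: abs_of_pos[OF w0_pos])
qed

lemma Sy_wt2: "Sy 2 (\<lambda>x. (wt L x)\<^sup>2)"
  unfolding wt2_w0 power2_eq_square[of "lam _"]
proof (rule Sy_add)
  show "Sy 2 (\<lambda>x. (w0 x)\<^sup>2)" by (rule Sy_mono[OF Sy_w02]) simp
  show "Sy 2 (\<lambda>x. lam x * lam x)" using Sy_mult[OF Sy_lam Sy_lam] by simp
qed

lemma Sy_wt: "Sy 1 (wt L)"
proof -
  have "Sy 1 (\<lambda>x. sqrt ((wt L x)\<^sup>2))"
  proof (rule Sy_comp_real[OF Sy_wt2 DERIV_real_sqrt2])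
    fix R
    show "\<exists>K\<ge>0. \<forall>x\<in>tube R. \<bar>sqrt ((wt L x)\<^sup>2)\<bar> \<le> K * wt L x powi 1 \<and>
       \<bar>1 / (2 * sqrt ((wt L x)\<^sup>2))\<bar> * wt L x powi 2 \<le> K * wt L x powi 1 \<and>
       \<bar>- 1 / (4 * sqrt ((wt L x)\<^sup>2) ^ 3)\<bar> * (wt L x powi 2)\<^sup>2 \<le> K * wt L x powi 1"
    proof (intro exI[of _ 1] conjI ballI)
      fix x
      have s: "sqrt ((wt L x)\<^sup>2) = wt L x" and w: "wt L x > 0" using wt_pos[of x] by auto
      show "\<bar>sqrt ((wt L x)\<^sup>2)\<bar> \<le> 1 * wt L x powi 1" using w unfolding s by simp
      show "\<bar>1 / (2 * sqrt ((wt L x)\<^sup>2))\<bar> * wt L x powi 2 \<le> 1 * wt L x powi 1"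
        using w unfolding s by (simp add: power2_eq_square)
      show "\<bar>- 1 / (4 * sqrt ((wt L x)\<^sup>2) ^ 3)\<bar> * (wt L x powi 2)\<^sup>2 \<le> 1 * wt L x powi 1"
        using w unfolding s by (simp add: power2_eq_square power3_eq_cube)
    qed simp
  qed (use wt_pos in auto)
  then show ?thesis by (simp add: abs_of_pos[OF wt_pos])
qed

lemma DERIV_inverse2:
  fixes y :: real
  assumes "y \<noteq> 0"
  shows "(inverse has_real_derivative - (inverse y)\<^sup>2) (at y)"
    "((\<lambda>y. - (inverse y)\<^sup>2) has_real_derivative 2 * (inverse y) ^ 3) (at y)"
  using assms by (auto intro!: derivative_eq_intros simp: power2_eq_square power3_eq_cube)

lemma Sy_inverse:
  assumes F: "Sy m F" and F0: "\<And>x. F x > 0" and c: "c > 0" "\<And>x::'a. c * wt L x powi m \<le> F x"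
  shows "Sy (- m) (\<lambda>x. inverse (F x))"
proof (rule Sy_comp_real[OF F DERIV_inverse2])
  fix R
  define K where "K = inverse c + (inverse c)\<^sup>2 + 2 * (inverse c) ^ 3"
  show "\<exists>K\<ge>0. \<forall>x\<in>tube R. \<bar>inverse (F x)\<bar> \<le> K * wt L x powi - m \<and>
       \<bar>- (inverse (F x))\<^sup>2\<bar> * wt L x powi m \<le> K * wt L x powi - m \<and>
       \<bar>2 * (inverse (F x)) ^ 3\<bar> * (wt L x powi m)\<^sup>2 \<le> K * wt L x powi - m"
  proof (intro exI[of _ K] conjI ballI)
    fix x :: 'a
    define w where "w = wt L x powi m"
    have w: "w > 0" and wi: "wt L x powi - m = inverse w"
      using wt_pos[of x] by (simp_all add: w_def power_int_minus)
    have i: "inverse (F x) \<le> inverse c * inverse w"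
      using c(1) c(2)[of x] w by (simp add: w_def[symmetric] le_imp_inverse_le flip: inverse_mult_distrib)
    have i0: "inverse (F x) > 0" using F0[of x] by simp
    have ic: "inverse c > 0" using c by simp
    have K: "inverse c \<le> K" "(inverse c)\<^sup>2 \<le> K" "2 * (inverse c) ^ 3 \<le> K"
      using ic by (auto simp: K_def intro: add_nonneg_nonneg)
    show "\<bar>inverse (F x)\<bar> \<le> K * wt L x powi - m"
    proof -
      have "inverse c * inverse w \<le> K * inverse w" using K(1) w by (intro mult_right_mono) auto
      then show ?thesis using i i0 unfolding wi by linarith
    qed
    have "(inverse (F x))\<^sup>2 \<le> (inverse c * inverse w)\<^sup>2" using i i0 by (intro power_mono) auto
    then have "(inverse (F x))\<^sup>2 * w \<le> (inverse c * inverse w)\<^sup>2 * w" using w by (intro mult_right_mono) auto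
    also have "\<dots> = (inverse c)\<^sup>2 * inverse w" using w by (simp add: power2_eq_square)
    also have "\<dots> \<le> K * inverse w" using K(2) w by (intro mult_right_mono) auto
    finally show "\<bar>- (inverse (F x))\<^sup>2\<bar> * wt L x powi m \<le> K * wt L x powi - m" unfolding wi w_def by simp
    have "(inverse (F x)) ^ 3 \<le> (inverse c * inverse w) ^ 3" using i i0 by (intro power_mono) auto
    then have "2 * (inverse (F x)) ^ 3 * w\<^sup>2 \<le> 2 * (inverse c * inverse w) ^ 3 * w\<^sup>2" using w by (intro mult_right_mono) auto
    also have "\<dots> = 2 * (inverse c) ^ 3 * inverse w" using w c(1) by (simp add: field_simps power2_eq_square power3_eq_cube)
    also have "\<dots> \<le> K * inverse w" using K(3) w by (intro mult_right_mono) auto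
    finally show "\<bar>2 * (inverse (F x)) ^ 3\<bar> * (wt L x powi m)\<^sup>2 \<le> K * wt L x powi - m"
      unfolding wi w_def[symmetric] using i0 by (simp add: abs_mult)
  next
    show "K \<ge> 0" using c by (simp add: K_def)
  qed
qed (use F0 in \<open>auto simp: less_imp_neq[symmetric]\<close>)

lemma Sy_inv_w0: "Sy 0 (\<lambda>x. inverse (w0 x))"
  using Sy_inverse[OF Sy_w0 w0_pos L_pos] w0_ge by simp

lemma Sy_inv_wt: "Sy (-1) (\<lambda>x. inverse (wt L x))"
  using Sy_inverse[OF Sy_wt wt_pos zero_less_one] by simp

lemma Sy_inv_Lw: "Sy (-1) (\<lambda>x. inverse (L + wt L x))"
  using Sy_inverse[OF Sy_add[OF Sy_mono[OF Sy_const[of L], of 1] Sy_wt] Lw_pos zero_less_one] L_pos by simp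

text \<open>The argument \<open>lam x / w0 x\<close> is of size \<open>wt\<close>, but there the
  first two derivatives of the arctangent are of inverse square and inverse cubic size, which more
  than compensates the one or two factors \<open>wt\<close> of the chain rule.\<close>

lemma Sy_hor: "Sy 0 hor"
proof -
  have "Sy 0 (\<lambda>x. arctan (lam x * inverse (w0 x)))"
  proof (rule Sy_comp_real[where \<phi> = arctan and ?\<phi>1.0 = "\<lambda>y. inverse (1 + y\<^sup>2)"
        and ?\<phi>2.0 = "\<lambda>y. - (2 * y * (inverse (1 + y\<^sup>2))\<^sup>2)" and m = 1])
    show "Sy 1 (\<lambda>x. lam x * inverse (w0 x))" using Sy_mult[OF Sy_lam Sy_inv_w0] by simp
    fix x
    have n: "1 + y\<^sup>2 \<noteq> 0" for y :: real by (metis add_pos_nonneg less_irrefl zero_le_power2 zero_less_one)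
    show "(arctan has_real_derivative inverse (1 + (lam x * inverse (w0 x))\<^sup>2)) (at (lam x * inverse (w0 x)))"
      by (rule DERIV_arctan)
    show "((\<lambda>y. inverse (1 + y\<^sup>2)) has_real_derivative - (2 * (lam x * inverse (w0 x)) * (inverse (1 + (lam x * inverse (w0 x))\<^sup>2))\<^sup>2)) (at (lam x * inverse (w0 x)))"
      using n by (auto intro!: derivative_eq_intros simp: power2_eq_square)
  next
    fix R
    define B where "B = L + \<bar>R\<bar>"
    define K where "K = 2 + B + 2 * B\<^sup>2"
    have B: "B \<ge> 0" using L_pos by (simp add: B_def)
    show "\<exists>K\<ge>0. \<forall>x\<in>tube R. \<bar>arctan (lam x * inverse (w0 x))\<bar> \<le> K * wt L x powi 0 \<and>
       \<bar>inverse (1 + (lam x * inverse (w0 x))\<^sup>2)\<bar> * wt L x powi 1 \<le> K * wt L x powi 0 \<and>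
       \<bar>- (2 * (lam x * inverse (w0 x)) * (inverse (1 + (lam x * inverse (w0 x))\<^sup>2))\<^sup>2)\<bar> * (wt L x powi 1)\<^sup>2 \<le> K * wt L x powi 0"
    proof (intro exI[of _ K] conjI ballI)
      fix x assume x: "x \<in> tube R"
      have w: "wt L x > 0" "w0 x > 0" by (rule wt_pos, rule w0_pos)
      have i: "inverse (1 + (lam x * inverse (w0 x))\<^sup>2) = (w0 x)\<^sup>2 / (wt L x)\<^sup>2"
        using w unfolding wt2_w0 by (simp add: field_simps)
      show "\<bar>arctan (lam x * inverse (w0 x))\<bar> \<le> K * wt L x powi 0"
      proof -
        have "\<bar>arctan (lam x * inverse (w0 x))\<bar> \<le> 2"
          using arctan_bounded[of "lam x * inverse (w0 x)"] pi_less_4 by linarith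
        also have "\<dots> \<le> K" using B by (simp add: K_def)
        finally show ?thesis by simp
      qed
      have "(w0 x)\<^sup>2 / (wt L x)\<^sup>2 * wt L x = w0 x * (w0 x / wt L x)"
        using w by (simp add: power2_eq_square)
      also have "\<dots> \<le> w0 x * 1" using w w0_le_wt[of x] by (intro mult_left_mono) auto
      also have "\<dots> \<le> B" using w0_tube[OF x] by (simp add: B_def)
      also have "\<dots> \<le> K" using B by (simp add: K_def)
      finally show "\<bar>inverse (1 + (lam x * inverse (w0 x))\<^sup>2)\<bar> * wt L x powi 1 \<le> K * wt L x powi 0"
        unfolding i by simp
      have "\<bar>- (2 * (lam x * inverse (w0 x)) * (inverse (1 + (lam x * inverse (w0 x))\<^sup>2))\<^sup>2)\<bar> * (wt L x powi 1)\<^sup>2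
         = 2 * w0 x * (w0 x * (\<bar>lam x\<bar> / wt L x) * (w0 x / wt L x))"
        unfolding i using w by (simp add: abs_mult field_simps power2_eq_square)
      also have "\<dots> \<le> 2 * w0 x * (w0 x * 1 * 1)"
        using w w0_le_wt[of x] lam_le_wt[of x] by (intro mult_mono mult_left_mono) auto
      also have "\<dots> \<le> 2 * (B * B)"
        using w0_tube[OF x] w B by (simp add: B_def[symmetric] mult_mono)
      also have "\<dots> \<le> K" using B by (simp add: K_def power2_eq_square)
      finally show "\<bar>- (2 * (lam x * inverse (w0 x)) * (inverse (1 + (lam x * inverse (w0 x))\<^sup>2))\<^sup>2)\<bar> * (wt L x powi 1)\<^sup>2 \<le> K * wt L x powi 0"
        by simp
    qed (use B in \<open>simp add: K_def\<close>)
  qed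
  then have "Sy 0 (\<lambda>x. tm + L * arctan (lam x * inverse (w0 x)))"
    by (intro Sy_add Sy_const Sy_cmult)
  then show ?thesis by (simp add: hor_def[abs_def] divide_inverse)
qed

end

text \<open>Here \<open>V\<close> stands for \<open>L + w\<close>. The last two identities are
  cancellations between the isotropic and the radial part of \<open>push\<close>: for large
  \<open>w\<close> the difference is smaller than either term.\<close>

lemma push_algebra:
  fixes w V L s :: real
  assumes "w \<noteq> 0" "L \<noteq> 0" "V \<noteq> 0" "V = L + w"
  shows "inverse V = (w * V) * (inverse w * (inverse V)\<^sup>2)"
    "inverse V * (s / L\<^sup>2) - (s + s / L\<^sup>2 * (w\<^sup>2 - L\<^sup>2)) * inverse w * (inverse V)\<^sup>2 = s / L * (inverse V * inverse V)"
    "inverse V - (w\<^sup>2 - L\<^sup>2) * inverse w * (inverse V)\<^sup>2 = L * (inverse w * inverse V)"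
proof -
  show "inverse V = (w * V) * (inverse w * (inverse V)\<^sup>2)"
    using assms(1,3) by (simp add: field_simps power2_eq_square)
  have 1: "s + s / L\<^sup>2 * (w\<^sup>2 - L\<^sup>2) = s * w\<^sup>2 / L\<^sup>2" using assms(2) by (simp add: field_simps)
  have 2: "inverse V - w * (inverse V)\<^sup>2 = L * (inverse V)\<^sup>2"
  proof -
    have "inverse V - w * (inverse V)\<^sup>2 = (V - w) * (inverse V)\<^sup>2"
      using assms(3) by (simp add: field_simps power2_eq_square)
    then show ?thesis using assms(4) by simp
  qed
  have "inverse V * (s / L\<^sup>2) - (s * w\<^sup>2 / L\<^sup>2) * inverse w * (inverse V)\<^sup>2 = (s / L\<^sup>2) * (inverse V - w * (inverse V)\<^sup>2)"
    using assms(1-3) by (simp add: field_simps power2_eq_square)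
  then show "inverse V * (s / L\<^sup>2) - (s + s / L\<^sup>2 * (w\<^sup>2 - L\<^sup>2)) * inverse w * (inverse V)\<^sup>2 = s / L * (inverse V * inverse V)"
    unfolding 1 2 using assms(2) by (simp add: power2_eq_square)
  have L: "L = V - w" using assms(4) by simp
  show "inverse V - (w\<^sup>2 - L\<^sup>2) * inverse w * (inverse V)\<^sup>2 = L * (inverse w * inverse V)"
    unfolding L using assms(1,3) by (simp add: field_simps power2_eq_square)
qed

locale admissible_horizon = admissible_pert L dg hb + ads_line L tm x1
  for L :: real and dg hb :: "(real \<times> 'a::euclidean_space) tensor2" and tm :: real and x1 :: 'a
begin

sublocale horizon L dg tm x1 ..

section \<open>The horizon and its tangents in the compactified chart\<close>

definition cg :: "'a \<Rightarrow> real \<times> 'a" where "cg x = compactify L (graph x)"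

definition pk :: "'a \<Rightarrow> real \<times> 'a" where "pk x = push L (graph x) (hk x)"

lemma cg_eq: "cg x = (hor x, inverse (L + wt L x) *\<^sub>R x)"
  by (simp add: cg_def compactify_eq graph_def)

definition Kc :: "(real \<times> 'a) set" where
  "Kc = {tm - L * (pi / 2) .. tm + L * (pi / 2)} \<times> cball 0 1"

lemma Kc_compact: "compact Kc"
  unfolding Kc_def by (intro compact_Times) auto

lemma Kc_sub: "Kc \<subseteq> ads_closure"
  by (auto simp: Kc_def ads_closure_def)

lemma hor_bounds: "hor x \<in> {tm - L * (pi / 2) .. tm + L * (pi / 2)}"
proof -
  have "\<bar>L * arctan (lam x / w0 x)\<bar> \<le> L * (pi / 2)"
    unfolding abs_mult using arctan_bounded[of "lam x / w0 x"] L_pos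
    by (intro mult_mono) auto
  then show ?thesis by (auto simp: hor_def abs_le_iff)
qed

lemma cg_open: "cg x \<in> open_ads"
  unfolding cg_def by (rule compactify_open)

lemma cg_Kc: "cg x \<in> Kc \<inter> open_ads"
  using cg_open[of x] hor_bounds[of x] open_ads_def
  by (auto simp: Kc_def cg_eq open_ads_def mem_Times_iff)

text \<open>\<open>hor\<close> takes values in a bounded time interval, so the compactified horizon
  lies in the compact set \<open>Kc\<close> and the bounds are uniform in \<open>x\<close>.\<close>

lemma hb_bounds:
  "\<exists>C\<ge>0. \<forall>x. \<forall>i\<in>Basis. \<forall>j\<in>Basis. \<bar>hb (cg x) i j\<bar> \<le> C \<and>
     (\<forall>d\<in>Basis. \<bar>frechet_derivative (\<lambda>q. hb q i j) (at (cg x)) d\<bar> \<le> C) \<and>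
     (\<forall>d\<in>Basis. \<forall>e\<in>Basis. \<bar>frechet_derivative (\<lambda>z. frechet_derivative (\<lambda>q. hb q i j) (at z) d) (at (cg x)) e\<bar> \<le> C)"
proof -
  define Q where "Q i j C \<longleftrightarrow> C \<ge> 0 \<and> (\<forall>q\<in>Kc \<inter> open_ads. \<bar>hb q i j\<bar> \<le> C \<and>
     (\<forall>d\<in>Basis. \<bar>frechet_derivative (\<lambda>q. hb q i j) (at q) d\<bar> \<le> C) \<and>
     (\<forall>d\<in>Basis. \<forall>e\<in>Basis. \<bar>frechet_derivative (\<lambda>z. frechet_derivative (\<lambda>q. hb q i j) (at z) d) (at q) e\<bar> \<le> C))"
    for i j C
  have "\<exists>C. Q i j C" for i j
    using Ck_bounded[OF hb_C2 open_open_ads open_ads_subset Kc_compact Kc_sub, of i j] unfolding Q_def by blast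
  then obtain C where C: "\<And>i j. Q i j (C i j)" by metis
  define S where "S = (\<Sum>i\<in>Basis. \<Sum>j\<in>Basis. C i j)"
  have C0: "C i j \<ge> 0" for i j using C by (simp add: Q_def)
  have CS: "C i j \<le> S" if "i \<in> Basis" "j \<in> Basis" for i j
  proof -
    have "C i j \<le> (\<Sum>j\<in>Basis. C i j)" by (rule member_le_sum) (use that C0 in auto)
    also have "\<dots> \<le> S" unfolding S_def
      by (rule member_le_sum[of i Basis "\<lambda>i. \<Sum>j\<in>Basis. C i j"]) (use that C0 in \<open>auto intro: sum_nonneg\<close>)
    finally show ?thesis .
  qed
  show ?thesis
  proof (intro exI[of _ S] conjI allI ballI)
    show "S \<ge> 0" unfolding S_def by (intro sum_nonneg C0)
    fix x :: 'a and i j :: "real \<times> 'a" assume ij: "i \<in> Basis" "j \<in> Basis"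
    have Q: "Q i j (C i j)" by (rule C)
    show "\<bar>hb (cg x) i j\<bar> \<le> S" using Q CS[OF ij] cg_Kc[of x] unfolding Q_def by (meson order_trans)
    fix d :: "real \<times> 'a" assume d: "d \<in> Basis"
    show "\<bar>frechet_derivative (\<lambda>q. hb q i j) (at (cg x)) d\<bar> \<le> S"
      using Q CS[OF ij] cg_Kc[of x] d unfolding Q_def by (meson order_trans)
    fix e :: "real \<times> 'a" assume "e \<in> Basis"
    then show "\<bar>frechet_derivative (\<lambda>z. frechet_derivative (\<lambda>q. hb q i j) (at z) d) (at (cg x)) e\<bar> \<le> S"
      using Q CS[OF ij] cg_Kc[of x] d unfolding Q_def by (meson order_trans)
  qed
qed

lemma Sy_cg: "Sy 0 (\<lambda>x. cg x \<bullet> i)"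
proof -
  have "Sy (1 + (-1)) (\<lambda>x. (x \<bullet> snd i) * inverse (L + wt L x))" by (intro Sy_mult Sy_inner Sy_inv_Lw)
  then have "Sy 0 (\<lambda>x. fst i * hor x + (x \<bullet> snd i) * inverse (L + wt L x))"
    by (intro Sy_add Sy_cmult Sy_hor) simp
  then show ?thesis by (simp add: cg_eq inner_prod_def mult.commute)
qed

lemma Sy_hb: assumes "i \<in> Basis" "j \<in> Basis" shows "Sy 0 (\<lambda>x. hb (cg x) i j)"
  unfolding Sy_def
proof
  fix R
  obtain C where C: "C \<ge> 0" "\<forall>x. \<forall>i\<in>Basis. \<forall>j\<in>Basis. \<bar>hb (cg x) i j\<bar> \<le> C \<and>
     (\<forall>d\<in>Basis. \<bar>frechet_derivative (\<lambda>q. hb q i j) (at (cg x)) d\<bar> \<le> C) \<and>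
     (\<forall>d\<in>Basis. \<forall>e\<in>Basis. \<bar>frechet_derivative (\<lambda>z. frechet_derivative (\<lambda>q. hb q i j) (at z) d) (at (cg x)) e\<bar> \<le> C)"
    using hb_bounds by blast
  have "symb Nw (tube R) (\<lambda>_. 1) (\<lambda>x. hb (cg x) i j)"
  proof (rule symb_compose[where q = cg and G = "\<lambda>q. hb q i j" and K = C
        and ?G1.0 = "\<lambda>q. frechet_derivative (\<lambda>q. hb q i j) (at q)"
        and ?G2.0 = "\<lambda>q d. frechet_derivative (\<lambda>z. frechet_derivative (\<lambda>q. hb q i j) (at z) d) (at q)"])
    show "symb Nw (tube R) (\<lambda>_. 1) (\<lambda>x. cg x \<bullet> i)" for i
      using Sy_cg[of i] by (simp add: Sy_def)
    show "((\<lambda>q. hb q i j) has_derivative frechet_derivative (\<lambda>q. hb q i j) (at (cg x))) (at (cg x))" for x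
      by (rule hb_interior[OF cg_open])
    show "((\<lambda>z. frechet_derivative (\<lambda>q. hb q i j) (at z) d) has_derivative
        frechet_derivative (\<lambda>z. frechet_derivative (\<lambda>q. hb q i j) (at z) d) (at (cg x))) (at (cg x))" for x d
      by (rule hb_interior[OF cg_open])
  qed (use Nw_nonneg C assms in blast)+
  then show "symb Nw (tube R) (\<lambda>x. wt L x powi 0) (\<lambda>x. hb (cg x) i j)" by simp
qed

text \<open>Separating \<open>x1\<close> from \<open>perp x\<close> makes the decay visible: the
  coefficient of \<open>x1\<close> is a difference of terms of order \<open>1 / wt\<close>, but is
  itself of order \<open>1 / wt\<^sup>2\<close> on a tube.\<close>

lemma pk_eq: "pk x = (L * w0 x * (inverse (wt L x) * inverse (wt L x)),
    (((w0 x)\<^sup>2 + L * wt L x) * (inverse (wt L x) * (inverse (L + wt L x) * inverse (L + wt L x)))) *\<^sub>R x1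
    - (lam x * (inverse (wt L x) * (inverse (L + wt L x) * inverse (L + wt L x)))) *\<^sub>R perp x)"
proof (rule prod_eqI)
  define w where "w = wt L x"
  define c where "c = inverse w * (inverse (L + w))\<^sup>2"
  have w: "w > 0" "L + w > 0" by (simp_all add: w_def wt_pos Lw_pos)
  have i: "inverse (L + w) = ((w0 x)\<^sup>2 + L * w + (lam x)\<^sup>2) * c"
  proof -
    have "(w0 x)\<^sup>2 + L * w + (lam x)\<^sup>2 = w * (L + w)"
      using wt2_w0[of x] by (simp add: w_def power2_eq_square algebra_simps)
    then show ?thesis using push_algebra(1)[of w L "L + w"] w L_pos unfolding c_def by simp
  qed
  show "snd (pk x) = snd (L * w0 x * (inverse (wt L x) * inverse (wt L x)),
    (((w0 x)\<^sup>2 + L * wt L x) * (inverse (wt L x) * (inverse (L + wt L x) * inverse (L + wt L x)))) *\<^sub>R x1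
    - (lam x * (inverse (wt L x) * (inverse (L + wt L x) * inverse (L + wt L x)))) *\<^sub>R perp x)"
  proof -
    have "snd (pk x) = inverse (L + w) *\<^sub>R x1 - (lam x * c) *\<^sub>R x"
      by (simp add: pk_def push_eq hk_def graph_def lam_def w_def c_def mult.assoc)
    also have "\<dots> = (((w0 x)\<^sup>2 + L * w) * c) *\<^sub>R x1 - (lam x * c) *\<^sub>R perp x"
      unfolding i perp_def by (simp add: algebra_simps power2_eq_square)
    finally show ?thesis by (simp add: w_def c_def power2_eq_square mult.assoc)
  qed
qed (simp add: pk_def push_eq hk_def graph_def power2_eq_square divide_inverse)

lemma Sy_c: "Sy (-3) (\<lambda>x. inverse (wt L x) * (inverse (L + wt L x) * inverse (L + wt L x)))"
  using Sy_mult[OF Sy_inv_wt Sy_mult[OF Sy_inv_Lw Sy_inv_Lw]] by simp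

lemma Sy_pk: "Sy (-2) (\<lambda>x. pk x \<bullet> i)"
proof -
  have 1: "Sy (-2) (\<lambda>x. L * w0 x * (inverse (wt L x) * inverse (wt L x)))"
    using Sy_mult[OF Sy_cmult[OF Sy_w0, of L] Sy_mult[OF Sy_inv_wt Sy_inv_wt]] by simp
  have "Sy 1 (\<lambda>x. (w0 x)\<^sup>2 + L * wt L x)"
    by (intro Sy_add Sy_cmult Sy_wt Sy_mono[OF Sy_w02]) simp
  from Sy_mult[OF this Sy_c] have 2: "Sy (-2) (\<lambda>x. ((w0 x)\<^sup>2 + L * wt L x) * (inverse (wt L x) * (inverse (L + wt L x) * inverse (L + wt L x))))"
    by simp
  have "Sy 0 (\<lambda>x. perp x \<bullet> snd i)"
    using Sy_inner_perp[OF perp_x1[of "snd i"]] by (simp add: inner_perp)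
  from Sy_mult[OF Sy_mult[OF Sy_lam Sy_c] this]
  have 3: "Sy (-2) (\<lambda>x. lam x * (inverse (wt L x) * (inverse (L + wt L x) * inverse (L + wt L x))) * (perp x \<bullet> snd i))"
    by simp
  have "Sy (-2) (\<lambda>x. fst i * (L * w0 x * (inverse (wt L x) * inverse (wt L x)))
     + ((x1 \<bullet> snd i) * (((w0 x)\<^sup>2 + L * wt L x) * (inverse (wt L x) * (inverse (L + wt L x) * inverse (L + wt L x))))
       - lam x * (inverse (wt L x) * (inverse (L + wt L x) * inverse (L + wt L x))) * (perp x \<bullet> snd i)))"
    by (intro Sy_add Sy_diff Sy_cmult 1 2 3)
  then show ?thesis
    unfolding pk_eq inner_prod_def by (simp add: inner_diff_left mult_ac)
qed

lemma push_eT: "push L (graph x) (eT e (graph x)) = (0, inverse (L + wt L x) *\<^sub>R e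
    + ((x \<bullet> e) / L * (inverse (L + wt L x) * inverse (L + wt L x))) *\<^sub>R x)"
proof -
  define w where "w = wt L x"
  have w: "w > 0" "L + w > 0" "x \<bullet> x = w\<^sup>2 - L\<^sup>2" by (simp_all add: w_def wt_pos Lw_pos wt2)
  have "inverse (L + w) * ((x \<bullet> e) / L\<^sup>2) - (x \<bullet> e + (x \<bullet> e) / L\<^sup>2 * (w\<^sup>2 - L\<^sup>2)) * inverse w * (inverse (L + w))\<^sup>2
     = (x \<bullet> e) / L * (inverse (L + w) * inverse (L + w))"
    using push_algebra(2)[of w L "L + w" "x \<bullet> e"] w(1,2) L_pos by simp
  then show ?thesis
    unfolding push_eq by (simp add: eT_def graph_def w_def[symmetric] w(3) inner_add_right scaleR_add_right)
      (simp flip: scaleR_left_diff_distrib)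
qed

lemma Sy_push_eT:
  assumes "Sy m (\<lambda>x. x \<bullet> e)" "m \<ge> 0"
  shows "Sy (m - 1) (\<lambda>x. push L (graph x) (eT e (graph x)) \<bullet> i)"
proof -
  have 1: "Sy (m - 1) (\<lambda>x. (e \<bullet> snd i) * inverse (L + wt L x))"
    using assms(2) by (intro Sy_cmult Sy_mono[OF Sy_inv_Lw]) simp
  have 2: "Sy (m - 1) (\<lambda>x. (1 / L) * ((x \<bullet> e) * ((inverse (L + wt L x) * inverse (L + wt L x)) * (x \<bullet> snd i))))"
    using Sy_cmult[where c = "1 / L", OF Sy_mult[OF assms(1) Sy_mult[OF Sy_mult[OF Sy_inv_Lw Sy_inv_Lw] Sy_inner[of "snd i"]]]] by simp
  show ?thesis
    using Sy_add[OF 1 2] unfolding push_eT inner_prod_def by (simp add: inner_add_left mult_ac)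
qed

text \<open>The shift by 2 is the factor \<open>(wt L x)\<^sup>2 / L\<^sup>2\<close>, the inverse
  square of the conformal factor, between \<open>dg\<close> and the regular tensor
  \<open>hb\<close>.\<close>

lemma Sy_dg:
  assumes U: "\<And>i. Sy m (\<lambda>x. push L (graph x) (U x) \<bullet> i)" and V: "\<And>i. Sy n (\<lambda>x. push L (graph x) (V x) \<bullet> i)"
  shows "Sy (m + n + 2) (\<lambda>x. dg (graph x) (U x) (V x))"
proof -
  have "Sy (m + n + 2) (\<lambda>x. \<Sum>i\<in>Basis. \<Sum>j\<in>Basis. (1 / L\<^sup>2) * ((((push L (graph x) (U x) \<bullet> i) * (push L (graph x) (V x) \<bullet> j))
      * (wt L x)\<^sup>2) * hb (cg x) i j))"
    using Sy_mult[OF Sy_mult[OF Sy_mult[OF U V] Sy_wt2] Sy_hb] by (intro Sy_sum Sy_cmult) simp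
  then show ?thesis
    unfolding dg_expand by (simp add: graph_def cg_def[unfolded graph_def] mult_ac)
qed

lemma Sy_HH: "Sy (-2) HH"
  using Sy_dg[of "-2" hk "-2" hk] Sy_pk unfolding pk_def HH_eq[abs_def] by simp

text \<open>Applied with \<open>m = 0\<close> for \<open>e\<close> orthogonal to \<open>x1\<close>
  and with \<open>m = 1\<close> in general. The order gained in the orthogonal case is used to make
  boundary terms vanish at the ends of a generator.\<close>

lemma Sy_MM:
  assumes "Sy m (\<lambda>x. x \<bullet> e)" "m \<ge> 0"
  shows "Sy (m - 1) (MM e)"
  using Sy_dg[of "-2" hk "m - 1" "\<lambda>x. eT e (graph x)"] Sy_pk Sy_push_eT[OF assms]
  unfolding pk_def MM_def[abs_def] M_def P_graph by simp

lemma Sy_MM_perp: "e \<bullet> x1 = 0 \<Longrightarrow> Sy (-1) (MM e)"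
  using Sy_MM[OF Sy_inner_perp] by simp

lemma Sy_MM_gen: "Sy 0 (MM e)"
  using Sy_MM[OF Sy_inner] by simp

lemma push_radial: "push L (graph x) (0, x) = (0, (L * (inverse (wt L x) * inverse (L + wt L x))) *\<^sub>R x)"
proof -
  define w where "w = wt L x"
  have w: "w > 0" "L + w > 0" "x \<bullet> x = w\<^sup>2 - L\<^sup>2" by (simp_all add: w_def wt_pos Lw_pos wt2)
  have "inverse (L + w) - (w\<^sup>2 - L\<^sup>2) * inverse w * (inverse (L + w))\<^sup>2 = L * (inverse w * inverse (L + w))"
    using push_algebra(3)[of w L "L + w"] w(1,2) L_pos by simp
  then show ?thesis
    unfolding push_eq by (simp add: graph_def w_def[symmetric] w(3) flip: scaleR_left_diff_distrib)
qed

lemma Sy_TT: "Sy 0 TT"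
proof -
  have p1: "push L (graph x) (1, 0) = (1, 0)" for x by (simp add: push_eq)
  have e1: "Sy (-1) (\<lambda>x. push L (graph x) (0, e) \<bullet> i)" for e i
  proof -
    have 1: "Sy (-1) (\<lambda>x. (e \<bullet> snd i) * inverse (L + wt L x))" by (intro Sy_cmult Sy_inv_Lw)
    have 2: "Sy (-1) (\<lambda>x. ((x \<bullet> e) * (x \<bullet> snd i)) * (inverse (wt L x) * (inverse (L + wt L x) * inverse (L + wt L x))))"
      using Sy_mult[OF Sy_mult[OF Sy_inner Sy_inner] Sy_c] by simp
    show ?thesis
      using Sy_diff[OF 1 2] unfolding push_eq inner_prod_def
      by (simp add: graph_def inner_diff_left mult_ac power2_eq_square)
  qed
  have X1: "Sy (-1) (\<lambda>x. push L (graph x) (0, x) \<bullet> i)" for i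
  proof -
    have "Sy (-1) (\<lambda>x. L * ((inverse (wt L x) * inverse (L + wt L x)) * (x \<bullet> snd i)))"
      using Sy_cmult[OF Sy_mult[OF Sy_mult[OF Sy_inv_wt Sy_inv_Lw] Sy_inner]] by simp
    then show ?thesis unfolding push_radial inner_prod_def by (simp add: mult_ac)
  qed
  have t: "Sy 2 (\<lambda>x. dg (graph x) (1, 0) (1, 0))"
    using Sy_dg[of 0 "\<lambda>_. (1, 0)" 0 "\<lambda>_. (1, 0)"] Sy_const unfolding p1 by simp
  have "Sy 0 (\<lambda>x. (- (L\<^sup>2)) * ((inverse (wt L x) * inverse (wt L x)) * dg (graph x) (1, 0) (1, 0))
     + (\<Sum>e\<in>Basis. dg (graph x) (0, e) (0, e)) + (1 / L\<^sup>2) * dg (graph x) (0, x) (0, x))"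
    using Sy_mult[OF Sy_mult[OF Sy_inv_wt Sy_inv_wt] t] Sy_dg[OF e1 e1] Sy_dg[OF X1 X1]
    by (intro Sy_add Sy_cmult Sy_sum) auto
  moreover have "TT = (\<lambda>x. (- (L\<^sup>2)) * ((inverse (wt L x) * inverse (wt L x)) * dg (graph x) (1, 0) (1, 0))
     + (\<Sum>e\<in>Basis. dg (graph x) (0, e) (0, e)) + (1 / L\<^sup>2) * dg (graph x) (0, x) (0, x))"
    by (rule ext) (simp add: TT_def Tr_def ads_trace_def graph_def power2_eq_square divide_inverse mult_ac)
  ultimately show ?thesis by simp
qed

end

section \<open>Integrals over the real line\<close>

lemma integrable_inverse_square: "integrable lborel (\<lambda>s::real. 1 / (1 + s\<^sup>2))"
proof -
  have n: "1 + s\<^sup>2 \<noteq> 0" for s :: real by (metis add_pos_nonneg less_irrefl zero_le_power2 zero_less_one)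
  have "set_integrable lborel (einterval (-\<infinity>) \<infinity>) (\<lambda>s::real. inverse (1 + s\<^sup>2))"
  proof (rule interval_integral_FTC_nonneg(1)[where F = arctan and A = "- (pi / 2)" and B = "pi / 2"])
    show "((arctan \<circ> real_of_ereal) \<longlongrightarrow> - (pi / 2)) (at_right (-\<infinity>))"
      by (simp add: ereal_tendsto_simps tendsto_arctan_at_bot)
    show "((arctan \<circ> real_of_ereal) \<longlongrightarrow> pi / 2) (at_left \<infinity>)"
      by (simp add: ereal_tendsto_simps tendsto_arctan_at_top)
    show "(arctan has_real_derivative inverse (1 + x\<^sup>2)) (at x)" for x by (rule DERIV_arctan)
    show "isCont (\<lambda>s::real. inverse (1 + s\<^sup>2)) x" for x using n by (intro continuous_intros) auto
    show "AE x in lborel. - \<infinity> < ereal x \<longrightarrow> ereal x < \<infinity> \<longrightarrow> 0 \<le> inverse (1 + x\<^sup>2)"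
      by (intro always_eventually allI impI) (simp add: add_nonneg_nonneg)
  qed simp
  then show ?thesis by (simp add: einterval_def set_integrable_def inverse_eq_divide)
qed

lemma integrable_decay:
  fixes f :: "real \<Rightarrow> real"
  assumes "f \<in> borel_measurable borel" "\<And>s. \<bar>f s\<bar> \<le> C / (1 + s\<^sup>2)"
  shows "integrable lborel f"
proof (rule Bochner_Integration.integrable_bound)
  show "integrable lborel (\<lambda>s. C * (1 / (1 + s\<^sup>2)))"
    by (intro integrable_mult_right integrable_inverse_square)
  show "AE s in lborel. norm (f s) \<le> norm (C * (1 / (1 + s\<^sup>2)))"
  proof (intro always_eventually allI)
    fix s show "norm (f s) \<le> norm (C * (1 / (1 + s\<^sup>2)))"
      using order_trans[OF assms(2)[of s] abs_ge_self] by simp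
  qed
qed (use assms in simp)

text \<open>A derivative is the pointwise limit of continuous difference quotients.\<close>

lemma measurable_derivative:
  fixes B :: "real \<Rightarrow> real"
  assumes B: "\<And>s. (B has_real_derivative B' s) (at s)"
  shows "B' \<in> borel_measurable borel"
proof (rule borel_measurable_LIMSEQ_real)
  have cont: "continuous_on UNIV B"
    using B DERIV_isCont continuous_at_imp_continuous_on by blast
  have m: "B \<in> borel_measurable borel" by (rule borel_measurable_continuous_onI[OF cont])
  have m2: "(\<lambda>s. B (s + c)) \<in> borel_measurable borel" for c
    by (rule borel_measurable_continuous_onI) (intro continuous_on_compose2[OF cont] continuous_intros, simp)
  show "(\<lambda>s. (B (s + inverse (real (Suc n))) - B s) / inverse (real (Suc n))) \<in> borel_measurable borel" for n
    by (intro borel_measurable_divide borel_measurable_diff m m2) simp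
  show "(\<lambda>n. (B (s + inverse (real (Suc n))) - B s) / inverse (real (Suc n))) \<longlonglongrightarrow> B' s" for s
  proof -
    have "((\<lambda>t. (B (s + t) - B s) / t) \<longlongrightarrow> B' s) (at 0)" using B by (simp add: DERIV_def)
    moreover have "filterlim (\<lambda>n. inverse (real (Suc n))) (at 0) sequentially"
      by (rule filterlim_atI[OF LIMSEQ_inverse_real_of_nat]) simp
    ultimately show ?thesis by (rule filterlim_compose)
  qed
qed

text \<open>The derivative is only known to exist and to decay, so the fundamental theorem is taken
  for the gauge integral on compact intervals; the bound makes it a Lebesgue integral and justifies
  the passage to the whole line.\<close>

lemma integral_derivative_line:
  fixes B :: "real \<Rightarrow> real"
  assumes B: "\<And>s. (B has_real_derivative B' s) (at s)"
    and bd: "\<And>s. \<bar>B' s\<bar> \<le> C / (1 + s\<^sup>2)"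
    and lim: "(B \<longlongrightarrow> a) at_bot" "(B \<longlongrightarrow> b) at_top"
  shows "integrable lborel B'" "(LINT s|lborel. B' s) = b - a"
proof -
  show i: "integrable lborel B'" by (rule integrable_decay[OF measurable_derivative[OF B] bd])
  have fin: "(LINT s|lborel. indicator {- real n..real n} s *\<^sub>R B' s) = B (real n) - B (- real n)" for n :: nat
  proof -
    have si: "set_integrable lborel {- real n..real n} B'"
      unfolding set_integrable_def by (rule integrable_mult_indicator[OF _ i]) simp
    have "(B' has_integral (B (real n) - B (- real n))) {- real n..real n}"
      by (rule fundamental_theorem_of_calculus)
        (use B in \<open>auto simp: has_real_derivative_iff_has_vector_derivative[symmetric] intro: has_field_derivative_at_within\<close>)
    then have "integral {- real n..real n} B' = B (real n) - B (- real n)" by (rule integral_unique)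
    then show ?thesis
      using set_borel_integral_eq_integral(2)[OF si] by (simp add: set_lebesgue_integral_def)
  qed
  have "(\<lambda>n::nat. LINT s|lborel. indicator {- real n..real n} s *\<^sub>R B' s) \<longlonglongrightarrow> (LINT s|lborel. B' s)"
  proof (rule integral_dominated_convergence[where w = "\<lambda>s. \<bar>B' s\<bar>"])
    show "AE s in lborel. (\<lambda>n. indicator {- real n..real n} s *\<^sub>R B' s) \<longlonglongrightarrow> B' s"
    proof (intro always_eventually allI)
      fix s :: real
      obtain N :: nat where N: "\<bar>s\<bar> \<le> real N" using real_arch_simple by blast
      have "eventually (\<lambda>n. indicator {- real n..real n} s *\<^sub>R B' s = B' s) sequentially"
        using eventually_ge_at_top[of N]
        by eventually_elim (use N in \<open>auto simp: indicator_def\<close>)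
      then show "(\<lambda>n. indicator {- real n..real n} s *\<^sub>R B' s) \<longlonglongrightarrow> B' s"
        by (rule tendsto_eventually)
    qed
    show "AE s in lborel. norm (indicator {- real n..real n} s *\<^sub>R B' s) \<le> \<bar>B' s\<bar>" for n
      by (auto simp: indicator_def)
  qed (use i in auto)
  moreover have "(\<lambda>n::nat. B (real n) - B (- real n)) \<longlonglongrightarrow> b - a"
  proof (rule tendsto_diff)
    show "(\<lambda>n. B (real n)) \<longlonglongrightarrow> b" by (rule filterlim_compose[OF lim(2) filterlim_real_sequentially])
    have "filterlim (\<lambda>n::nat. - real n) at_bot sequentially"
      by (simp add: filterlim_uminus_at_bot filterlim_real_sequentially)
    then show "(\<lambda>n. B (- real n)) \<longlonglongrightarrow> a" by (rule filterlim_compose[OF lim(1)])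
  qed
  ultimately show "(LINT s|lborel. B' s) = b - a"
    unfolding fin using LIMSEQ_unique by blast
qed

lemma dominated_at_right:
  fixes g :: "real \<Rightarrow> real \<Rightarrow> real"
  assumes T: "T > 0" and m: "\<And>t. 0 < t \<Longrightarrow> t < T \<Longrightarrow> g t \<in> borel_measurable borel"
    and bd: "\<And>t s. 0 < t \<Longrightarrow> t < T \<Longrightarrow> \<bar>g t s\<bar> \<le> C / (1 + s\<^sup>2)"
    and lim: "\<And>s. ((\<lambda>t. g t s) \<longlongrightarrow> G s) (at_right 0)"
  shows "integrable lborel G" "((\<lambda>t. LINT s|lborel. g t s) \<longlongrightarrow> (LINT s|lborel. G s)) (at_right 0)"
proof -
  have seq: "(\<lambda>n. g (S n) s) \<longlonglongrightarrow> G s" if "\<And>n. 0 < S n" "S \<longlonglongrightarrow> 0" for S :: "nat \<Rightarrow> real" and s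
  proof (rule filterlim_compose[OF lim])
    show "filterlim S (at_right 0) sequentially"
      using that by (auto simp: filterlim_at less_imp_neq[symmetric])
  qed
  have mG: "G \<in> borel_measurable borel"
  proof (rule borel_measurable_LIMSEQ_real)
    define S where "S n = T / (2 + real n)" for n :: nat
    have S: "0 < S n" "S n < T" for n using T by (auto simp: S_def field_simps add_pos_nonneg)
    have "S \<longlonglongrightarrow> 0" unfolding S_def
      by (intro tendsto_divide_0[OF tendsto_const] filterlim_at_top_imp_at_infinity
        filterlim_tendsto_add_at_top[OF tendsto_const filterlim_real_sequentially])
    then show "(\<lambda>n. g (S n) s) \<longlonglongrightarrow> G s" for s by (rule seq[OF S(1)])
    show "g (S n) \<in> borel_measurable borel" for n by (rule m[OF S])
  qed
  have bG: "\<bar>G s\<bar> \<le> C / (1 + s\<^sup>2)" for s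
  proof (rule tendsto_upperbound[OF tendsto_rabs[OF lim]])
    show "eventually (\<lambda>t. \<bar>g t s\<bar> \<le> C / (1 + s\<^sup>2)) (at_right 0)"
      using eventually_at_right_real[OF T] by eventually_elim (use bd in auto)
  qed simp
  show "integrable lborel G" by (rule integrable_decay[OF mG bG])
  show "((\<lambda>t. LINT s|lborel. g t s) \<longlongrightarrow> (LINT s|lborel. G s)) (at_right 0)"
  proof (rule tendsto_at_right_sequentially[OF T])
    fix S :: "nat \<Rightarrow> real"
    assume S: "\<And>n. 0 < S n" "\<And>n. S n < T" "S \<longlonglongrightarrow> 0"
    show "(\<lambda>n. LINT s|lborel. g (S n) s) \<longlonglongrightarrow> (LINT s|lborel. G s)"
    proof (rule integral_dominated_convergence[where w = "\<lambda>s. C * (1 / (1 + s\<^sup>2))"])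
      show "integrable lborel (\<lambda>s. C * (1 / (1 + s\<^sup>2)))"
        by (intro integrable_mult_right integrable_inverse_square)
    qed (use S mG m bd seq in auto)
  qed
qed

lemma c2_first_difference:
  assumes c: "c2 F F1 F2"
  shows "((\<lambda>t. (F (x + t *\<^sub>R u) - F x) / t) \<longlongrightarrow> F1 x u) (at_right 0)"
    and "0 < t \<Longrightarrow> (\<And>\<tau>. \<bar>\<tau>\<bar> \<le> t \<Longrightarrow> \<bar>F1 (x + \<tau> *\<^sub>R u) u\<bar> \<le> D) \<Longrightarrow> \<bar>(F (x + t *\<^sub>R u) - F x) / t\<bar> \<le> D"
proof -
  have d: "((\<lambda>\<tau>. F (x + \<tau> *\<^sub>R u)) has_real_derivative F1 (x + \<tau> *\<^sub>R u) u) (at \<tau>)" for \<tau>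
  proof -
    have "((\<lambda>\<tau>. x + \<tau> *\<^sub>R u) has_derivative (\<lambda>h. h *\<^sub>R u)) (at \<tau>)"
      by (auto intro!: derivative_eq_intros)
    from has_derivative_compose[OF this c2D1[OF c]] show ?thesis
      unfolding has_field_derivative_def
      by (rule has_derivative_eq_rhs) (simp add: fun_eq_iff linear_scale[OF linear_c2D1[OF c]])
  qed
  show "((\<lambda>t. (F (x + t *\<^sub>R u) - F x) / t) \<longlongrightarrow> F1 x u) (at_right 0)"
    using d[of 0] by (auto simp: DERIV_def intro: tendsto_mono[OF at_le])
  show "\<bar>(F (x + t *\<^sub>R u) - F x) / t\<bar> \<le> D"
    if t: "0 < t" and b: "\<And>\<tau>. \<bar>\<tau>\<bar> \<le> t \<Longrightarrow> \<bar>F1 (x + \<tau> *\<^sub>R u) u\<bar> \<le> D"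
  proof -
    from MVT2[OF t d] obtain z where z: "0 < z" "z < t"
      "F (x + t *\<^sub>R u) - F (x + 0 *\<^sub>R u) = (t - 0) * F1 (x + z *\<^sub>R u) u" by blast
    then show ?thesis using b[of z] t by simp
  qed
qed

lemma c2_second_difference:
  assumes c: "c2 F F1 F2"
  shows "((\<lambda>t. (F (x + t *\<^sub>R u) + F (x - t *\<^sub>R u) - 2 * F x) / t\<^sup>2) \<longlongrightarrow> F2 x u u) (at_right 0)"
    and "0 < t \<Longrightarrow> (\<And>\<tau>. \<bar>\<tau>\<bar> \<le> t \<Longrightarrow> \<bar>F2 (x + \<tau> *\<^sub>R u) u u\<bar> \<le> D) \<Longrightarrow>
      \<bar>(F (x + t *\<^sub>R u) + F (x - t *\<^sub>R u) - 2 * F x) / t\<^sup>2\<bar> \<le> 2 * D"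
proof -
  have "((\<lambda>t. - ((F (x + t *\<^sub>R u + t *\<^sub>R (- u)) - F (x + t *\<^sub>R u) - F (x + t *\<^sub>R (- u)) + F x) / t\<^sup>2)) \<longlongrightarrow> - F2 x u (- u)) (at_right 0)"
    by (intro tendsto_minus second_difference_tendsto[OF c])
  moreover have "- ((F (x + t *\<^sub>R u + t *\<^sub>R (- u)) - F (x + t *\<^sub>R u) - F (x + t *\<^sub>R (- u)) + F x) / t\<^sup>2)
      = (F (x + t *\<^sub>R u) + F (x - t *\<^sub>R u) - 2 * F x) / t\<^sup>2" for t
    by (simp add: field_simps diff_divide_distrib)
  ultimately show "((\<lambda>t. (F (x + t *\<^sub>R u) + F (x - t *\<^sub>R u) - 2 * F x) / t\<^sup>2) \<longlongrightarrow> F2 x u u) (at_right 0)"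
    by (simp add: linear_neg[OF linear_c2D2[OF c]])
  show "\<bar>(F (x + t *\<^sub>R u) + F (x - t *\<^sub>R u) - 2 * F x) / t\<^sup>2\<bar> \<le> 2 * D"
    if t: "0 < t" and b: "\<And>\<tau>. \<bar>\<tau>\<bar> \<le> t \<Longrightarrow> \<bar>F2 (x + \<tau> *\<^sub>R u) u u\<bar> \<le> D"
  proof -
    have l: "((\<lambda>\<tau>. x + \<tau> *\<^sub>R u) has_derivative (\<lambda>h. h *\<^sub>R u)) (at \<tau>)" for \<tau>
      by (auto intro!: derivative_eq_intros)
    have d: "((\<lambda>\<tau>. F (x + \<tau> *\<^sub>R u)) has_real_derivative F1 (x + \<tau> *\<^sub>R u) u) (at \<tau>)" for \<tau>
      using has_derivative_compose[OF l c2D1[OF c]] unfolding has_field_derivative_def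
      by (rule has_derivative_eq_rhs) (simp add: fun_eq_iff linear_scale[OF linear_c2D1[OF c]])
    have d2: "((\<lambda>\<tau>. F1 (x + \<tau> *\<^sub>R u) u) has_real_derivative F2 (x + \<tau> *\<^sub>R u) u u) (at \<tau>)" for \<tau>
      using has_derivative_compose[OF l c2D2[OF c]] unfolding has_field_derivative_def
      by (rule has_derivative_eq_rhs) (simp add: fun_eq_iff linear_scale[OF linear_c2D2[OF c]])
    define \<phi> where "\<phi> \<tau> = F (x + \<tau> *\<^sub>R u) + F (x + (- \<tau>) *\<^sub>R u)" for \<tau>
    have "(\<phi> has_real_derivative (F1 (x + \<tau> *\<^sub>R u) u - F1 (x + (- \<tau>) *\<^sub>R u) u)) (at \<tau>)" for \<tau>
    proof -
      have "((\<lambda>\<tau>. F (x + (- \<tau>) *\<^sub>R u)) has_real_derivative F1 (x + (- \<tau>) *\<^sub>R u) u * (- 1)) (at \<tau>)"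
        by (rule DERIV_chain2[OF d]) (auto intro!: derivative_eq_intros)
      from DERIV_add[OF d[of \<tau>] this] show ?thesis by (simp add: \<phi>_def[abs_def])
    qed
    from MVT2[OF t this] obtain z where z: "0 < z" "z < t"
      and e: "\<phi> t - \<phi> 0 = (t - 0) * (F1 (x + z *\<^sub>R u) u - F1 (x + (- z) *\<^sub>R u) u)" by blast
    have zz: "- z < z" using z by simp
    from MVT2[OF zz d2] obtain y where y: "- z < y" "y < z"
      and e2: "F1 (x + z *\<^sub>R u) u - F1 (x + (- z) *\<^sub>R u) u = (z - (- z)) * F2 (x + y *\<^sub>R u) u u" by blast
    have "\<bar>F2 (x + y *\<^sub>R u) u u\<bar> \<le> D" using b[of y] y z by simp
    then have "\<bar>\<phi> t - \<phi> 0\<bar> \<le> t * (2 * z * D)"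
      unfolding e e2 abs_mult using t z by simp
    also have "\<dots> \<le> t * (2 * t * D)"
      using t z b[of 0] by (intro mult_left_mono mult_right_mono) auto
    finally have "\<bar>\<phi> t - \<phi> 0\<bar> / t\<^sup>2 \<le> 2 * D"
      using t by (simp add: divide_le_eq power2_eq_square mult_ac)
    then show ?thesis by (simp add: \<phi>_def abs_divide)
  qed
qed

text \<open>Since \<open>s\<^sup>2 \<le> 2 * (s + a)\<^sup>2 + 2 * a\<^sup>2\<close>, shifting the
  origin by at most \<open>A\<close> and rescaling the square by \<open>c\<close> costs only a
  constant; this gives one integrable majorant for a whole family of varied lines.\<close>

lemma square_shift_bound:
  fixes a s K :: real
  assumes "L > 0" "c > 0" "\<bar>a\<bar> \<le> A"
  shows "1 / (L\<^sup>2 + c * (s + a)\<^sup>2) \<le> (1 / L\<^sup>2 + (2 / c + 2 * A\<^sup>2 / L\<^sup>2)) / (1 + s\<^sup>2)"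
proof -
  define q where "q = L\<^sup>2 + c * (s + a)\<^sup>2"
  have q: "q \<ge> L\<^sup>2" "q \<ge> c * (s + a)\<^sup>2" "q > 0"
    using assms by (auto simp: q_def intro: add_pos_nonneg)
  have "s\<^sup>2 \<le> 2 * (s + a)\<^sup>2 + 2 * a\<^sup>2"
  proof -
    have "0 \<le> (s + 2 * a)\<^sup>2" by simp
    then show ?thesis by (simp add: power2_eq_square algebra_simps)
  qed
  also have "\<dots> \<le> 2 * (q / c) + 2 * (A\<^sup>2 * (q / L\<^sup>2))"
  proof (intro add_mono mult_left_mono)
    show "(s + a)\<^sup>2 \<le> q / c" using q assms by (simp add: field_simps)
    have "a\<^sup>2 \<le> A\<^sup>2" using assms(3) by (simp add: abs_le_square_iff[symmetric])
    then have "a\<^sup>2 * 1 \<le> A\<^sup>2 * (q / L\<^sup>2)" using q assms by (intro mult_mono) auto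
    then show "a\<^sup>2 \<le> A\<^sup>2 * (q / L\<^sup>2)" by simp
  qed auto
  finally have "s\<^sup>2 \<le> 2 * (q / c) + 2 * (A\<^sup>2 * (q / L\<^sup>2))" .
  then have "1 + s\<^sup>2 \<le> q * (1 / L\<^sup>2 + (2 / c + 2 * A\<^sup>2 / L\<^sup>2))"
  proof -
    assume a: "s\<^sup>2 \<le> 2 * (q / c) + 2 * (A\<^sup>2 * (q / L\<^sup>2))"
    have "1 \<le> q / L\<^sup>2" using q(1) assms(1) by (simp add: field_simps)
    with a have "1 + s\<^sup>2 \<le> q / L\<^sup>2 + (2 * (q / c) + 2 * (A\<^sup>2 * (q / L\<^sup>2)))" by linarith
    also have "\<dots> = q * (1 / L\<^sup>2 + (2 / c + 2 * A\<^sup>2 / L\<^sup>2))" by (simp add: distrib_left mult_ac)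
    finally show ?thesis .
  qed
  moreover have "1 + s\<^sup>2 > 0" by (simp add: add_pos_nonneg)
  ultimately show ?thesis
    unfolding q_def[symmetric] using q(3) by (simp add: field_simps)
qed

section \<open>The null curvature integral of a horizon generator\<close>

context admissible_horizon
begin

definition "HH1 x = frechet_derivative HH (at x)"
definition "HH2 x u = frechet_derivative (\<lambda>y. HH1 y u) (at x)"
definition "MM1 e x = frechet_derivative (MM e) (at x)"
definition "MM2 e x u = frechet_derivative (\<lambda>y. MM1 e y u) (at x)"
definition "TT1 x = frechet_derivative TT (at x)"
definition "TT2 x u = frechet_derivative (\<lambda>y. TT1 y u) (at x)"

lemma c2_HH: "c2 HH HH1 HH2" and c2_MM: "c2 (MM e) (MM1 e) (MM2 e)" and c2_TT: "c2 TT TT1 TT2"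
  using twice_c2[OF twice_HH] twice_c2[OF twice_MM] twice_c2[OF twice_TT]
  by (simp_all add: HH1_def[abs_def] HH2_def[abs_def] MM1_def[abs_def] MM2_def[abs_def] TT1_def[abs_def] TT2_def[abs_def])

lemma Sy_bounds:
  assumes "Sy m F" "c2 F F1 F2"
  shows "\<exists>C\<ge>0. \<forall>x\<in>tube R. \<bar>F x\<bar> \<le> C * wt L x powi m \<and> (\<forall>u. \<bar>F1 x u\<bar> \<le> C * wt L x powi m * Nw x u) \<and>
    (\<forall>u v. \<bar>F2 x u v\<bar> \<le> C * wt L x powi m * (Nw x u * Nw x v))"
proof -
  have s: "symb Nw (tube R) (\<lambda>x. wt L x powi m) F" using assms(1) by (simp add: Sy_def)
  obtain C where "C \<ge> 0" "\<And>x. x \<in> tube R \<Longrightarrow> \<bar>F x\<bar> \<le> C * wt L x powi m"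
    "\<And>x u. x \<in> tube R \<Longrightarrow> \<bar>F1 x u\<bar> \<le> C * wt L x powi m * Nw x u"
    "\<And>x u v. x \<in> tube R \<Longrightarrow> \<bar>F2 x u v\<bar> \<le> C * wt L x powi m * (Nw x u * Nw x v)"
    using symbE[OF s assms(2)] by blast
  then show ?thesis by blast
qed

lemma wt_powi_m2: "wt L x powi (-2) = 1 / (wt L x)\<^sup>2" and wt_powi_m1: "wt L x powi (-1) = 1 / wt L x"
  by (simp_all add: power_int_minus divide_inverse)

lemma HH_continuous: "continuous_on UNIV HH"
  using c2D1[OF c2_HH] by (intro continuous_at_imp_continuous_on ballI has_derivative_continuous)

text \<open>Differentiation under the integral for a displacement \<open>u\<close> of a generator,
  phrased with one-sided difference quotients, so that nothing is claimed about the
  differentiability of \<open>I\<close>. The \<open>x1\<close> part of \<open>u\<close> may grow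
  linearly, because \<open>Nw\<close> divides it by \<open>wt\<close>; the lower bound on
  \<open>wt\<close> supplies the integrable majorant.\<close>

lemma line_variation:
  fixes u :: "real \<Rightarrow> 'a"
  assumes T: "T > 0" and u: "continuous_on UNIV u"
    and tub: "\<And>s \<tau>. \<bar>\<tau>\<bar> \<le> T \<Longrightarrow> line z s + \<tau> *\<^sub>R u s \<in> tube R"
    and c: "c > 0" and low: "\<And>s \<tau>. \<bar>\<tau>\<bar> \<le> T \<Longrightarrow> (wt L (line z s + \<tau> *\<^sub>R u s))\<^sup>2 \<ge> L\<^sup>2 + c * (s + a \<tau>)\<^sup>2"
    and a: "\<And>\<tau>. \<bar>\<tau>\<bar> \<le> T \<Longrightarrow> \<bar>a \<tau>\<bar> \<le> A"
    and N: "\<And>s \<tau>. \<bar>\<tau>\<bar> \<le> T \<Longrightarrow> Nw (line z s + \<tau> *\<^sub>R u s) (u s) \<le> B"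
  defines "I \<equiv> \<lambda>\<tau>. LINT s|lborel. HH (line z s + \<tau> *\<^sub>R u s)"
  shows "\<And>\<tau>. \<bar>\<tau>\<bar> \<le> T \<Longrightarrow> integrable lborel (\<lambda>s. HH (line z s + \<tau> *\<^sub>R u s))"
    and "integrable lborel (\<lambda>s. HH1 (line z s) (u s))"
    and "((\<lambda>t. (I t - I 0) / t) \<longlongrightarrow> (LINT s|lborel. HH1 (line z s) (u s))) (at_right 0)"
    and "((\<lambda>t. (I (- t) - I 0) / t) \<longlongrightarrow> - (LINT s|lborel. HH1 (line z s) (u s))) (at_right 0)"
    and "integrable lborel (\<lambda>s. HH2 (line z s) (u s) (u s))"
    and "((\<lambda>t. (I t + I (- t) - 2 * I 0) / t\<^sup>2) \<longlongrightarrow> (LINT s|lborel. HH2 (line z s) (u s) (u s))) (at_right 0)"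
proof -
  obtain C where C: "C \<ge> 0" "\<forall>x\<in>tube R. \<bar>HH x\<bar> \<le> C * wt L x powi (-2) \<and> (\<forall>u. \<bar>HH1 x u\<bar> \<le> C * wt L x powi (-2) * Nw x u) \<and>
    (\<forall>u v. \<bar>HH2 x u v\<bar> \<le> C * wt L x powi (-2) * (Nw x u * Nw x v))"
    using Sy_bounds[OF Sy_HH c2_HH] by blast
  define K where "K = 1 / L\<^sup>2 + (2 / c + 2 * A\<^sup>2 / L\<^sup>2)"
  have w: "wt L (line z s + \<tau> *\<^sub>R u s) powi (-2) \<le> K / (1 + s\<^sup>2)" if "\<bar>\<tau>\<bar> \<le> T" for \<tau> s
  proof -
    have p: "L\<^sup>2 + c * (s + a \<tau>)\<^sup>2 > 0" using L_pos c by (intro add_pos_nonneg) auto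
    have "1 / (wt L (line z s + \<tau> *\<^sub>R u s))\<^sup>2 \<le> 1 / (L\<^sup>2 + c * (s + a \<tau>)\<^sup>2)"
      by (intro divide_left_mono low that mult_pos_pos p) (use wt_pos in auto)
    also have "\<dots> \<le> K / (1 + s\<^sup>2)" unfolding K_def
      by (rule square_shift_bound[OF L_pos c a[OF that]])
    finally show ?thesis unfolding wt_powi_m2 .
  qed
  have wp: "wt L x powi (-2) \<ge> 0" for x :: 'a unfolding wt_powi_m2 by simp
  have B: "B \<ge> 0" using order_trans[OF Nw_nonneg N[of 0]] T by simp
  have K0: "K \<ge> 0" using L_pos c by (simp add: K_def)
  have b0: "\<bar>HH (line z s + \<tau> *\<^sub>R u s)\<bar> \<le> (C * K) / (1 + s\<^sup>2)" if "\<bar>\<tau>\<bar> \<le> T" for s \<tau>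
    using C(2) tub[OF that, of s] mult_left_mono[OF w[OF that, of s] C(1)] by force
  have b1: "\<bar>HH1 (line z s + \<tau> *\<^sub>R u s) (u s)\<bar> \<le> (C * K * B) / (1 + s\<^sup>2)" if "\<bar>\<tau>\<bar> \<le> T" for s \<tau>
  proof -
    let ?x = "line z s + \<tau> *\<^sub>R u s"
    have "\<bar>HH1 ?x (u s)\<bar> \<le> C * wt L ?x powi (-2) * Nw ?x (u s)" using C(2) tub[OF that] by blast
    also have "\<dots> \<le> C * (K / (1 + s\<^sup>2)) * B"
      by (intro mult_mono mult_left_mono w N that C mult_nonneg_nonneg Nw_nonneg divide_nonneg_nonneg K0) auto
    finally show ?thesis by (simp add: mult_ac)
  qed
  have b2: "\<bar>HH2 (line z s + \<tau> *\<^sub>R u s) (u s) (u s)\<bar> \<le> (C * K * (B * B)) / (1 + s\<^sup>2)" if "\<bar>\<tau>\<bar> \<le> T" for s \<tau>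
  proof -
    let ?x = "line z s + \<tau> *\<^sub>R u s"
    have "\<bar>HH2 ?x (u s) (u s)\<bar> \<le> C * wt L ?x powi (-2) * (Nw ?x (u s) * Nw ?x (u s))" using C(2) tub[OF that] by blast
    also have "\<dots> \<le> C * (K / (1 + s\<^sup>2)) * (B * B)"
      by (intro mult_mono mult_left_mono w N that C mult_nonneg_nonneg Nw_nonneg divide_nonneg_nonneg K0 B) auto
    finally show ?thesis by (simp add: mult_ac)
  qed
  have m: "(\<lambda>s. HH (line z s + \<tau> *\<^sub>R u s)) \<in> borel_measurable borel" for \<tau>
    by (intro borel_measurable_continuous_onI continuous_on_compose2[OF HH_continuous])
      (auto simp: line_def intro!: continuous_intros u)
  show int: "integrable lborel (\<lambda>s. HH (line z s + \<tau> *\<^sub>R u s))" if "\<bar>\<tau>\<bar> \<le> T" for \<tau>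
    by (rule integrable_decay[OF m b0[OF that]])
  have e1: "LINT s|lborel. (HH (line z s + t *\<^sub>R u s) - HH (line z s)) / t = (I t - I 0) / t" if "\<bar>t\<bar> \<le> T" for t
    unfolding I_def using int[OF that] int[of 0] T by simp
  have first: "integrable lborel (\<lambda>s. HH1 (line z s) (u s))"
    "((\<lambda>t. LINT s|lborel. (HH (line z s + t *\<^sub>R u s) - HH (line z s)) / t) \<longlongrightarrow> (LINT s|lborel. HH1 (line z s) (u s))) (at_right 0)"
  proof -
    note d = dominated_at_right[OF T, where g = "\<lambda>t s. (HH (line z s + t *\<^sub>R u s) - HH (line z s)) / t"
        and C = "C * K * B" and G = "\<lambda>s. HH1 (line z s) (u s)"]
    have p: "(\<lambda>s. (HH (line z s + t *\<^sub>R u s) - HH (line z s)) / t) \<in> borel_measurable borel" for t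
      using m[of t] m[of 0] by simp
    have q: "\<bar>(HH (line z s + t *\<^sub>R u s) - HH (line z s)) / t\<bar> \<le> C * K * B / (1 + s\<^sup>2)" if "0 < t" "t < T" for t s
      using c2_first_difference(2)[OF c2_HH that(1), of "line z s" "u s"] b1[of _ s] that by force
    note r = c2_first_difference(1)[OF c2_HH]
    show "integrable lborel (\<lambda>s. HH1 (line z s) (u s))" by (rule d(1)[OF p q r])
    show "((\<lambda>t. LINT s|lborel. (HH (line z s + t *\<^sub>R u s) - HH (line z s)) / t) \<longlongrightarrow> (LINT s|lborel. HH1 (line z s) (u s))) (at_right 0)"
      by (rule d(2)[OF p q r])
  qed
  then show "integrable lborel (\<lambda>s. HH1 (line z s) (u s))" by blast
  have evT: "eventually (\<lambda>t. 0 < t \<and> t < T) (at_right (0::real))"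
    using eventually_at_right_real[OF T] by eventually_elim auto
  show l1: "((\<lambda>t. (I t - I 0) / t) \<longlongrightarrow> (LINT s|lborel. HH1 (line z s) (u s))) (at_right 0)"
    by (rule Lim_transform_eventually[OF first(2)]) (use evT in eventually_elim, rule e1, simp)
  have e2: "LINT s|lborel. (HH (line z s + t *\<^sub>R u s) + HH (line z s - t *\<^sub>R u s) - 2 * HH (line z s)) / t\<^sup>2 = (I t + I (- t) - 2 * I 0) / t\<^sup>2" if "\<bar>t\<bar> \<le> T" for t
    unfolding I_def using int[OF that] int[of "- t"] int[of 0] that T by simp
  have second: "integrable lborel (\<lambda>s. HH2 (line z s) (u s) (u s))"
    "((\<lambda>t. LINT s|lborel. (HH (line z s + t *\<^sub>R u s) + HH (line z s - t *\<^sub>R u s) - 2 * HH (line z s)) / t\<^sup>2) \<longlongrightarrow> (LINT s|lborel. HH2 (line z s) (u s) (u s))) (at_right 0)"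
  proof -
    note d = dominated_at_right[OF T, where g = "\<lambda>t s. (HH (line z s + t *\<^sub>R u s) + HH (line z s - t *\<^sub>R u s) - 2 * HH (line z s)) / t\<^sup>2"
        and C = "2 * (C * K * (B * B))" and G = "\<lambda>s. HH2 (line z s) (u s) (u s)"]
    have p: "(\<lambda>s. (HH (line z s + t *\<^sub>R u s) + HH (line z s - t *\<^sub>R u s) - 2 * HH (line z s)) / t\<^sup>2) \<in> borel_measurable borel" for t
      using m[of t] m[of "- t"] m[of 0] by simp
    have q: "\<bar>(HH (line z s + t *\<^sub>R u s) + HH (line z s - t *\<^sub>R u s) - 2 * HH (line z s)) / t\<^sup>2\<bar> \<le> 2 * (C * K * (B * B)) / (1 + s\<^sup>2)" if "0 < t" "t < T" for t s
      using c2_second_difference(2)[OF c2_HH that(1), of "line z s" "u s" "C * K * (B * B) / (1 + s\<^sup>2)"] b2[of _ s] that by force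
    note r = c2_second_difference(1)[OF c2_HH]
    show "integrable lborel (\<lambda>s. HH2 (line z s) (u s) (u s))" by (rule d(1)[OF p q r])
    show "((\<lambda>t. LINT s|lborel. (HH (line z s + t *\<^sub>R u s) + HH (line z s - t *\<^sub>R u s) - 2 * HH (line z s)) / t\<^sup>2) \<longlongrightarrow> (LINT s|lborel. HH2 (line z s) (u s) (u s))) (at_right 0)"
      by (rule d(2)[OF p q r])
  qed
  then show "integrable lborel (\<lambda>s. HH2 (line z s) (u s) (u s))" by blast
  show l2: "((\<lambda>t. (I t + I (- t) - 2 * I 0) / t\<^sup>2) \<longlongrightarrow> (LINT s|lborel. HH2 (line z s) (u s) (u s))) (at_right 0)"
    by (rule Lim_transform_eventually[OF second(2)]) (use evT in eventually_elim, rule e2, simp)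
  \<comment> \<open>The first quotient at \<open>- t\<close> equals \<open>t\<close> times the
    second quotient minus the first quotient at \<open>t\<close>, so its limit is already
    determined.\<close>
  have "((\<lambda>t. t * ((I t + I (- t) - 2 * I 0) / t\<^sup>2) - (I t - I 0) / t) \<longlongrightarrow>
      0 * (LINT s|lborel. HH2 (line z s) (u s) (u s)) - (LINT s|lborel. HH1 (line z s) (u s))) (at_right 0)"
    by (intro tendsto_diff tendsto_mult l1 l2 tendsto_ident_at)
  then have "((\<lambda>t. t * ((I t + I (- t) - 2 * I 0) / t\<^sup>2) - (I t - I 0) / t) \<longlongrightarrow>
      - (LINT s|lborel. HH1 (line z s) (u s))) (at_right 0)" by simp
  then show "((\<lambda>t. (I (- t) - I 0) / t) \<longlongrightarrow> - (LINT s|lborel. HH1 (line z s) (u s))) (at_right 0)"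
    by (rule Lim_transform_eventually)
      (use evT in eventually_elim, auto simp: field_simps power2_eq_square)
qed

context
  fixes z :: 'a assumes z: "z \<bullet> x1 = 0"
begin

lemmas lam_ln = lam_line[OF z] and perp_ln = perp_line[OF z]
  and wt2_ln = wt2_line[OF z] and w0_ln = w0_line[OF z]

lemma wt_ln_bound: "1 / (wt L (line z s))\<^sup>2 \<le> (1 / L\<^sup>2 + 2) / (1 + s\<^sup>2)"
proof -
  have "L\<^sup>2 + s\<^sup>2 \<le> (wt L (line z s))\<^sup>2" unfolding wt2_ln w02 by simp
  moreover have "L\<^sup>2 + s\<^sup>2 > 0" using L_pos by (simp add: add_pos_nonneg)
  ultimately have "1 / (wt L (line z s))\<^sup>2 \<le> 1 / (L\<^sup>2 + 1 * (s + 0)\<^sup>2)"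
    by (intro divide_left_mono mult_pos_pos) (auto intro: wt_pos)
  also have "\<dots> \<le> (1 / L\<^sup>2 + 2) / (1 + s\<^sup>2)"
    using square_shift_bound[OF L_pos, of 1 0 0 s] by simp
  finally show ?thesis .
qed

lemma ln_tube: "line z s \<in> tube (norm z)"
  by (simp add: tube_def perp_ln)

lemma Nw_ln_x1: "Nw (line z s) x1 = 1 / wt L (line z s)"
  by (simp add: Nw_def perp_x1_zero x1)

lemma Nw_ln_perp: "Nw (line z s) (perp e) = norm (perp e)"
  by (simp add: Nw_def perp_x1) (simp add: perp_def lam_def inner_diff_left x1)

text \<open>Pure decay along one generator, without control of derivatives; the \<open>Sy\<close>
  bounds are translated into it once the derivatives have been taken.\<close>

definition dec :: "nat \<Rightarrow> (real \<Rightarrow> real) \<Rightarrow> bool" where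
  "dec n f \<longleftrightarrow> (\<exists>C. \<forall>s. \<bar>f s\<bar> \<le> C / wt L (line z s) ^ n)"

lemma dec_add: "dec n f \<Longrightarrow> dec n g \<Longrightarrow> dec n (\<lambda>s. f s + g s)"
proof -
  assume "dec n f" "dec n g"
  then obtain C D where "\<And>s. \<bar>f s\<bar> \<le> C / wt L (line z s) ^ n" "\<And>s. \<bar>g s\<bar> \<le> D / wt L (line z s) ^ n"
    unfolding dec_def by blast
  then have "\<bar>f s + g s\<bar> \<le> (C + D) / wt L (line z s) ^ n" for s
    using abs_triangle_ineq[of "f s" "g s"] by (smt (verit) add_divide_distrib)
  then show ?thesis unfolding dec_def by blast
qed

lemma dec_cmult: "dec n f \<Longrightarrow> dec n (\<lambda>s. c * f s)"
proof -
  assume "dec n f"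
  then obtain C where C: "\<And>s. \<bar>f s\<bar> \<le> C / wt L (line z s) ^ n" unfolding dec_def by blast
  have "\<bar>c * f s\<bar> \<le> (\<bar>c\<bar> * C) / wt L (line z s) ^ n" for s
    using mult_left_mono[OF C[of s], of "\<bar>c\<bar>"] by (simp add: abs_mult)
  then show ?thesis unfolding dec_def by blast
qed

lemma dec_diff: "dec n f \<Longrightarrow> dec n g \<Longrightarrow> dec n (\<lambda>s. f s - g s)"
  using dec_add[of n f "\<lambda>s. (-1) * g s"] dec_cmult[of n g "-1"] by simp

lemma dec_sum: "finite A \<Longrightarrow> (\<And>i. i \<in> A \<Longrightarrow> dec n (f i)) \<Longrightarrow> dec n (\<lambda>s. \<Sum>i\<in>A. f i s)"
proof (induction A rule: finite_induct)
  case empty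
  show ?case unfolding dec_def by (intro exI[of _ 0]) simp
qed (auto intro: dec_add)

lemma dec_s: "dec (Suc n) f \<Longrightarrow> dec n (\<lambda>s. s * f s)"
proof -
  assume "dec (Suc n) f"
  then obtain C where C: "\<And>s. \<bar>f s\<bar> \<le> C / wt L (line z s) ^ Suc n" unfolding dec_def by blast
  define q where "q = wt L (line z 0) ^ Suc n"
  have q: "q > 0" unfolding q_def by (rule zero_less_power[OF wt_pos])
  have "0 \<le> C / q" unfolding q_def by (rule order_trans[OF abs_ge_zero C[of 0]])
  then have C0: "C \<ge> 0" using q by (simp add: zero_le_divide_iff)
  have "\<bar>s * f s\<bar> \<le> C / wt L (line z s) ^ n" for s
  proof -
    have "\<bar>s\<bar> \<le> wt L (line z s)" using lam_le_wt[of "line z s"] by (simp add: lam_ln)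
    then have "\<bar>s\<bar> * \<bar>f s\<bar> \<le> wt L (line z s) * (C / wt L (line z s) ^ Suc n)"
      using C[of s] wt_pos[of "line z s"] by (intro mult_mono) auto
    then show ?thesis by (simp add: abs_mult)
  qed
  then show ?thesis unfolding dec_def by blast
qed

lemma dec_1_tendsto:
  assumes "dec 1 f"
  shows "(f \<longlongrightarrow> 0) at_top" "(f \<longlongrightarrow> 0) at_bot"
proof -
  obtain C where C: "\<And>s. \<bar>f s\<bar> \<le> C / wt L (line z s) ^ 1" using assms unfolding dec_def by blast
  have lw: "\<bar>s\<bar> \<le> wt L (line z s)" for s using lam_le_wt[of "line z s"] by (simp add: lam_ln)
  have t: "filterlim (\<lambda>s. wt L (line z s)) at_top at_top"
    by (rule filterlim_at_top_mono[OF filterlim_ident]) (intro always_eventually allI order_trans[OF abs_ge_self lw])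
  have b: "filterlim (\<lambda>s. wt L (line z s)) at_top at_bot"
    by (rule filterlim_at_top_mono[OF filterlim_uminus_at_top_at_bot]) (intro always_eventually allI order_trans[OF abs_ge_minus_self lw])
  show "(f \<longlongrightarrow> 0) at_top"
  proof (rule Lim_null_comparison)
    show "eventually (\<lambda>s. norm (f s) \<le> C / wt L (line z s)) at_top" using C by simp
    show "((\<lambda>s. C / wt L (line z s)) \<longlongrightarrow> 0) at_top"
      by (rule tendsto_divide_0[OF tendsto_const filterlim_at_top_imp_at_infinity[OF t]])
  qed
  show "(f \<longlongrightarrow> 0) at_bot"
  proof (rule Lim_null_comparison)
    show "eventually (\<lambda>s. norm (f s) \<le> C / wt L (line z s)) at_bot" using C by simp
    show "((\<lambda>s. C / wt L (line z s)) \<longlongrightarrow> 0) at_bot"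
      by (rule tendsto_divide_0[OF tendsto_const filterlim_at_top_imp_at_infinity[OF b]])
  qed
qed

lemma dec_2_bound:
  assumes "dec 2 f" obtains C where "\<And>s. \<bar>f s\<bar> \<le> C / (1 + s\<^sup>2)"
proof -
  obtain C where C: "\<And>s. \<bar>f s\<bar> \<le> C / wt L (line z s) ^ 2" using assms unfolding dec_def by blast
  have "\<bar>f s\<bar> \<le> (\<bar>C\<bar> * (1 / L\<^sup>2 + 2)) / (1 + s\<^sup>2)" for s
  proof -
    have "\<bar>f s\<bar> \<le> \<bar>C\<bar> * (1 / (wt L (line z s))\<^sup>2)"
      by (rule order_trans[OF C[of s]]) (simp add: divide_right_mono)
    also have "\<dots> \<le> \<bar>C\<bar> * ((1 / L\<^sup>2 + 2) / (1 + s\<^sup>2))" by (intro mult_left_mono wt_ln_bound) auto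
    finally show ?thesis by simp
  qed
  then show ?thesis by (rule that)
qed

lemma dec_Sy:
  assumes F: "Sy (- int n) F" and c: "c2 F F1 F2"
  shows "dec n (\<lambda>s. F (line z s))" "dec (Suc n) (\<lambda>s. F1 (line z s) x1)" "dec n (\<lambda>s. F1 (line z s) (perp e))"
    "dec (Suc n) (\<lambda>s. F2 (line z s) (perp e) x1)" "dec (Suc (Suc n)) (\<lambda>s. F2 (line z s) x1 x1)"
proof -
  obtain C where C: "C \<ge> 0" "\<forall>x\<in>tube (norm z). \<bar>F x\<bar> \<le> C * wt L x powi (- int n) \<and> (\<forall>u. \<bar>F1 x u\<bar> \<le> C * wt L x powi (- int n) * Nw x u) \<and>
    (\<forall>u v. \<bar>F2 x u v\<bar> \<le> C * wt L x powi (- int n) * (Nw x u * Nw x v))"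
    using Sy_bounds[OF F c] by blast
  have p: "wt L x powi (- int n) = 1 / wt L x ^ n" for x :: 'a
    by (simp add: power_int_minus divide_inverse)
  note C' = C(2)[rule_format, OF ln_tube, unfolded p]
  show "dec n (\<lambda>s. F (line z s))" unfolding dec_def using C' by (intro exI[of _ C] allI) simp
  show "dec (Suc n) (\<lambda>s. F1 (line z s) x1)" unfolding dec_def
  proof (intro exI[of _ C] allI)
    fix s
    have "\<bar>F1 (line z s) x1\<bar> \<le> C * (1 / wt L (line z s) ^ n) * Nw (line z s) x1" using C' by blast
    then show "\<bar>F1 (line z s) x1\<bar> \<le> C / wt L (line z s) ^ Suc n" by (simp add: Nw_ln_x1 mult_ac)
  qed
  show "dec n (\<lambda>s. F1 (line z s) (perp e))" unfolding dec_def
  proof (intro exI[of _ "C * norm (perp e)"] allI)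
    fix s
    have "\<bar>F1 (line z s) (perp e)\<bar> \<le> C * (1 / wt L (line z s) ^ n) * Nw (line z s) (perp e)" using C' by blast
    then show "\<bar>F1 (line z s) (perp e)\<bar> \<le> C * norm (perp e) / wt L (line z s) ^ n" by (simp add: Nw_ln_perp mult_ac)
  qed
  show "dec (Suc n) (\<lambda>s. F2 (line z s) (perp e) x1)" unfolding dec_def
  proof (intro exI[of _ "C * norm (perp e)"] allI)
    fix s
    have "\<bar>F2 (line z s) (perp e) x1\<bar> \<le> C * (1 / wt L (line z s) ^ n) * (Nw (line z s) (perp e) * Nw (line z s) x1)" using C' by blast
    then show "\<bar>F2 (line z s) (perp e) x1\<bar> \<le> C * norm (perp e) / wt L (line z s) ^ Suc n" by (simp add: Nw_ln_perp Nw_ln_x1 mult_ac)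
  qed
  show "dec (Suc (Suc n)) (\<lambda>s. F2 (line z s) x1 x1)" unfolding dec_def
  proof (intro exI[of _ C] allI)
    fix s
    have "\<bar>F2 (line z s) x1 x1\<bar> \<le> C * (1 / wt L (line z s) ^ n) * (Nw (line z s) x1 * Nw (line z s) x1)" using C' by blast
    then show "\<bar>F2 (line z s) x1 x1\<bar> \<le> C / wt L (line z s) ^ Suc (Suc n)" by (simp add: Nw_ln_x1 mult_ac)
  qed
qed

end

lemma MM_linear: "MM (a *\<^sub>R e + b *\<^sub>R e') x = a * MM e x + b * MM e' x"
proof -
  have "eT (a *\<^sub>R e + b *\<^sub>R e') (graph x) = a *\<^sub>R eT e (graph x) + b *\<^sub>R eT e' (graph x)"
    by (simp add: eT_def inner_add_right algebra_simps add_divide_distrib)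
  then show ?thesis
    by (simp add: MM_def M_def bilinear_radd[OF h.bil] bilinear_rmul[OF h.bil])
qed

lemma MM12_linear: "MM1 (a *\<^sub>R e + b *\<^sub>R e') x u = a * MM1 e x u + b * MM1 e' x u"
  "MM2 (a *\<^sub>R e + b *\<^sub>R e') x u v = a * MM2 e x u v + b * MM2 e' x u v"
proof -
  have c: "c2 (MM (a *\<^sub>R e + b *\<^sub>R e')) (\<lambda>x u. a * MM1 e x u + b * MM1 e' x u) (\<lambda>x u v. a * MM2 e x u v + b * MM2 e' x u v)"
    unfolding MM_linear[abs_def] c2_def
    by (intro conjI allI has_derivative_add has_derivative_mult_right c2D1[OF c2_MM] c2D2[OF c2_MM])
  show "MM1 (a *\<^sub>R e + b *\<^sub>R e') x u = a * MM1 e x u + b * MM1 e' x u"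
    using c2_unique(1)[OF c2_MM c] by (rule fun_cong[OF fun_cong])
  show "MM2 (a *\<^sub>R e + b *\<^sub>R e') x u v = a * MM2 e x u v + b * MM2 e' x u v"
    using c2_unique(2)[OF c2_MM c] by (rule fun_cong[OF fun_cong[OF fun_cong]])
qed

lemma MM12_bil: "bilinear (\<lambda>e. MM1 e x)" "bilinear (\<lambda>e f. MM2 e x f v)"
proof -
  have "linear (\<lambda>e. MM1 e x u)" for u
  proof (rule linearI)
    show "MM1 (e + e') x u = MM1 e x u + MM1 e' x u" for e e' using MM12_linear(1)[of 1 e 1 e' x u] by simp
    show "MM1 (c *\<^sub>R e) x u = c *\<^sub>R MM1 e x u" for c e using MM12_linear(1)[of c e 0 e x u] by simp
  qed
  then show "bilinear (\<lambda>e. MM1 e x)" unfolding bilinear_def by (intro conjI allI linear_c2D1[OF c2_MM])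
  have "linear (\<lambda>e. MM2 e x f v)" for f
  proof (rule linearI)
    show "MM2 (e + e') x f v = MM2 e x f v + MM2 e' x f v" for e e' using MM12_linear(2)[of 1 e 1 e' x f v] by simp
    show "MM2 (c *\<^sub>R e) x f v = c *\<^sub>R MM2 e x f v" for c e using MM12_linear(2)[of c e 0 e x f v] by simp
  qed
  then show "bilinear (\<lambda>e f. MM2 e x f v)" unfolding bilinear_def by (intro conjI allI linear_c2D2'[OF c2_MM])
qed

text \<open>Separates \<open>x1\<close> from the directions orthogonal to it, in which derivatives
  decay at different rates. The mixed terms vanish because \<open>perp x1\<close> is 0.\<close>

lemma trace_perp:
  assumes "bilinear Q"
  shows "(\<Sum>b\<in>Basis. Q b b) = (\<Sum>b\<in>Basis. Q (perp b) (perp b)) + (Q x1 x1 :: real)"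
proof -
  note q = bilinear_ladd[OF assms] bilinear_radd[OF assms] bilinear_lmul[OF assms] bilinear_rmul[OF assms]
  have "Q b b = Q (perp b) (perp b) + (x1 \<bullet> b) * Q (perp b) x1 + (x1 \<bullet> b) * Q x1 (perp b) + (x1 \<bullet> b) * (x1 \<bullet> b) * Q x1 x1" for b
  proof -
    have "b = perp b + (x1 \<bullet> b) *\<^sub>R x1" by (simp add: perp_def lam_def inner_commute[of b])
    from arg_cong2[where f = Q, OF this this]
    have "Q b b = Q (perp b + (x1 \<bullet> b) *\<^sub>R x1) (perp b + (x1 \<bullet> b) *\<^sub>R x1)" .
    also have "\<dots> = Q (perp b) (perp b) + (x1 \<bullet> b) * Q (perp b) x1 + (x1 \<bullet> b) * Q x1 (perp b) + (x1 \<bullet> b) * (x1 \<bullet> b) * Q x1 x1"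
      unfolding q by (simp add: algebra_simps)
    finally show ?thesis .
  qed
  note e = this
  have "(\<Sum>b\<in>Basis. (x1 \<bullet> b) * Q (perp b) x1) = 0" "(\<Sum>b\<in>Basis. (x1 \<bullet> b) * Q x1 (perp b)) = 0"
  proof -
    have lp: "linear perp" by (rule linearI) (simp_all add: perp_add perp_scale)
    have "linear (\<lambda>b. Q (perp b) x1)" "linear (\<lambda>b. Q x1 (perp b))"
      using linear_compose[OF lp bilinear_linear_left[OF assms]] linear_compose[OF lp bilinear_linear_right[OF assms]]
      by (simp_all add: o_def)
    from this[THEN linear_expand, of x1]
    show "(\<Sum>b\<in>Basis. (x1 \<bullet> b) * Q (perp b) x1) = 0" "(\<Sum>b\<in>Basis. (x1 \<bullet> b) * Q x1 (perp b)) = 0"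
      by (simp_all add: perp_x1_zero bilinear_lzero[OF assms] bilinear_rzero[OF assms])
  qed
  moreover have "(\<Sum>b\<in>Basis. (x1 \<bullet> b) * (x1 \<bullet> b)) = 1"
    using euclidean_inner[of x1 x1] by (simp add: x1)
  ultimately show ?thesis
    by (subst e) (simp add: sum.distrib sum_distrib_right[symmetric])
qed

text \<open>Up to a derivative along the generator, \<open>- EE / 2\<close> is the null curvature \<open>JJ\<close>.\<close>

definition EE :: "'a \<Rightarrow> real" where
  "EE x = (\<Sum>b\<in>Basis. HH2 x b b) + (HH2 x x x + real (DIM('a) + 1) * HH1 x x) / L\<^sup>2"

definition JJ :: "'a \<Rightarrow> real" where
  "JJ x = delta_ricci (ads_metric L) dg (graph x) (hk x) (hk x) + real DIM('a) / L\<^sup>2 * HH x"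

context
  fixes z :: 'a assumes z: "z \<bullet> x1 = 0"
begin

lemma line_deriv: "(line z has_derivative (\<lambda>r. r *\<^sub>R x1)) (at s)"
  unfolding line_def[abs_def] by (auto intro!: derivative_eq_intros)

lemma on_line_deriv:
  assumes "(F has_derivative F') (at (line z s))"
  shows "((\<lambda>s. F (line z s)) has_real_derivative F' x1) (at s)"
  unfolding has_field_derivative_def
  by (rule has_derivative_eq_rhs[OF has_derivative_compose[OF line_deriv assms]])
    (simp add: fun_eq_iff linear_scale[OF has_derivative_linear[OF assms]])

lemma JJ_integral:
  assumes E: "integrable lborel (\<lambda>s. EE (line z s))"
  shows "integrable lborel (\<lambda>s. JJ (line z s))" "(LINT s|lborel. JJ (line z s)) = - (1/2) * (LINT s|lborel. EE (line z s))"
proof -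
  \<comment> \<open>An antiderivative of all terms of \<open>delta_ricci_horizon\<close> other than
    the operator in \<open>HH\<close>; the explicit \<open>s\<close> is the value of
    \<open>lam\<close> on the line.\<close>
  define B where "B s = (\<Sum>b\<in>Basis. MM1 b (line z s) b) - (1 / (w0 z)\<^sup>2) * MM z (line z s)
     - (1 / (w0 z)\<^sup>2) * (s * HH (line z s)) - (1/2) * TT1 (line z s) x1" for s
  define B' where "B' s = (\<Sum>b\<in>Basis. MM2 b (line z s) b x1) - (1 / (w0 z)\<^sup>2) * MM1 z (line z s) x1
     - (1 / (w0 z)\<^sup>2) * (HH (line z s) + s * HH1 (line z s) x1) - (1/2) * TT2 (line z s) x1 x1" for s
  have d: "(B has_real_derivative B' s) (at s)" for s
    unfolding B_def[abs_def] B'_def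
    by (intro DERIV_diff DERIV_cmult DERIV_sum on_line_deriv[OF c2D2[OF c2_MM]] on_line_deriv[OF c2D1[OF c2_MM]]
        on_line_deriv[OF c2D2[OF c2_TT]])
      (auto intro!: derivative_eq_intros on_line_deriv[OF c2D1[OF c2_HH]])
  have B: "B = (\<lambda>s. ((\<Sum>b\<in>Basis. MM1 (perp b) (line z s) (perp b)) + MM1 x1 (line z s) x1) - (1 / (w0 z)\<^sup>2) * MM z (line z s)
     - (1 / (w0 z)\<^sup>2) * (s * HH (line z s)) - (1/2) * TT1 (line z s) x1)"
    unfolding B_def[abs_def] by (simp add: trace_perp[OF MM12_bil(1)])
  have B': "B' = (\<lambda>s. ((\<Sum>b\<in>Basis. MM2 (perp b) (line z s) (perp b) x1) + MM2 x1 (line z s) x1 x1) - (1 / (w0 z)\<^sup>2) * MM1 z (line z s) x1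
     - (1 / (w0 z)\<^sup>2) * (HH (line z s) + s * HH1 (line z s) x1) - (1/2) * TT2 (line z s) x1 x1)"
    unfolding B'_def[abs_def] by (simp add: trace_perp[OF MM12_bil(2)])
  have Mp: "Sy (- int 1) (MM (perp b))" for b using Sy_MM_perp[OF perp_x1] by simp
  have Mz: "Sy (- int 1) (MM z)" using Sy_MM_perp[OF z] by simp
  have M1: "Sy (- int 0) (MM x1)" using Sy_MM_gen by simp
  have T0: "Sy (- int 0) TT" using Sy_TT by simp
  have H2: "Sy (- int 2) HH" using Sy_HH by simp
  have "dec z 1 B"
    unfolding B
    using dec_Sy(3)[OF z Mp c2_MM] dec_Sy(2)[OF z M1 c2_MM] dec_Sy(1)[OF z Mz c2_MM] dec_Sy(2)[OF z T0 c2_TT]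
      dec_s[OF z, of 1] dec_Sy(1)[OF z H2 c2_HH]
    by (intro dec_diff[OF z] dec_add[OF z] dec_sum[OF z] dec_cmult[OF z]) (auto simp: numeral_2_eq_2)
  note lim = dec_1_tendsto[OF z this]
  have "dec z 2 B'"
    unfolding B'
    using dec_Sy(4)[OF z Mp c2_MM] dec_Sy(5)[OF z M1 c2_MM] dec_Sy(2)[OF z Mz c2_MM] dec_Sy(5)[OF z T0 c2_TT]
      dec_s[OF z, of 2] dec_Sy(2)[OF z H2 c2_HH] dec_Sy(1)[OF z H2 c2_HH]
    by (intro dec_diff[OF z] dec_add[OF z] dec_sum[OF z] dec_cmult[OF z]) (auto simp: numeral_2_eq_2)
  then obtain C where C: "\<And>s. \<bar>B' s\<bar> \<le> C / (1 + s\<^sup>2)" by (rule dec_2_bound[OF z]) blast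
  note ftc = integral_derivative_line[OF d C lim(2) lim(1)]
  have J: "JJ (line z s) = - (1/2) * EE (line z s) + B' s" for s
    unfolding JJ_def delta_ricci_horizon[OF c2_HH c2_MM c2_TT] EE_def B'_def
    by (simp add: perp_ln[OF z] lam_ln[OF z] w0_ln[OF z] c2_symmetric[OF c2_MM, of _ _ x1] algebra_simps add_divide_distrib)
  show "integrable lborel (\<lambda>s. JJ (line z s))"
    unfolding J using E ftc(1) by simp
  show "(LINT s|lborel. JJ (line z s)) = - (1/2) * (LINT s|lborel. EE (line z s))"
    unfolding J using E ftc by simp
qed

lemma variation_const:
  fixes b :: 'a
  defines "I \<equiv> \<lambda>\<tau>. LINT s|lborel. HH (line (z + \<tau> *\<^sub>R b) s)"
  shows "integrable lborel (\<lambda>s. HH (line z s))" "integrable lborel (\<lambda>s. HH2 (line z s) b b)"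
    "((\<lambda>t. (I t + I (- t) - 2 * I 0) / t\<^sup>2) \<longlongrightarrow> (LINT s|lborel. HH2 (line z s) b b)) (at_right 0)"
proof -
  have l: "line z s + \<tau> *\<^sub>R b = line (z + \<tau> *\<^sub>R b) s" for s \<tau> by (simp add: line_def algebra_simps)
  have t: "line z s + \<tau> *\<^sub>R b \<in> tube (norm z + norm (perp b))" if "\<bar>\<tau>\<bar> \<le> 1" for s \<tau>
  proof -
    have "norm (perp (line z s + \<tau> *\<^sub>R b)) \<le> norm z + \<bar>\<tau>\<bar> * norm (perp b)"
      unfolding perp_add perp_scale perp_ln[OF z] by (rule order_trans[OF norm_triangle_ineq]) simp
    also have "\<dots> \<le> norm z + 1 * norm (perp b)" using that by (intro add_left_mono mult_right_mono) auto
    finally show ?thesis by (simp add: tube_def)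
  qed
  have lo: "L\<^sup>2 + 1 * (s + \<tau> * (b \<bullet> x1))\<^sup>2 \<le> (wt L (line z s + \<tau> *\<^sub>R b))\<^sup>2" for s \<tau>
  proof -
    have "lam (line z s + \<tau> *\<^sub>R b) = s + \<tau> * (b \<bullet> x1)"
      using lam_ln[OF z, of s] by (simp add: lam_def inner_add_left)
    then show ?thesis unfolding wt2_w0 w02 by simp
  qed
  have n: "Nw (line z s + \<tau> *\<^sub>R b) b \<le> norm (perp b) + \<bar>b \<bullet> x1\<bar> / L" for s \<tau>
    unfolding Nw_def using wt_ge L_pos by (intro add_left_mono divide_left_mono mult_pos_pos wt_pos) auto
  have a: "\<bar>\<tau> * (b \<bullet> x1)\<bar> \<le> \<bar>b \<bullet> x1\<bar>" if "\<bar>\<tau>\<bar> \<le> 1" for \<tau>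
    unfolding abs_mult using mult_right_mono[OF that, of "\<bar>b \<bullet> x1\<bar>"] by simp
  note v = line_variation[where u = "\<lambda>_. b" and T = 1 and c = 1 and a = "\<lambda>\<tau>. \<tau> * (b \<bullet> x1)" and z = z, OF zero_less_one continuous_on_const t zero_less_one lo a n]
  show "integrable lborel (\<lambda>s. HH (line z s))" using v(1)[of 0] by simp
  show "integrable lborel (\<lambda>s. HH2 (line z s) b b)" by (rule v(5))
  show "((\<lambda>t. (I t + I (- t) - 2 * I 0) / t\<^sup>2) \<longlongrightarrow> (LINT s|lborel. HH2 (line z s) b b)) (at_right 0)"
    using v(6) unfolding I_def l .
qed

text \<open>The displacement field \<open>line z\<close> generates dilations of space, which map
  generators to reparametrized generators. The range 1/2 keeps \<open>1 + \<tau>\<close> away from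
  0, and its square is the constant 1/4 in the bound on \<open>wt\<close>.\<close>

lemma variation_scale:
  defines "I \<equiv> \<lambda>\<tau>. LINT s|lborel. HH ((1 + \<tau>) *\<^sub>R line z s)"
  shows "integrable lborel (\<lambda>s. HH1 (line z s) (line z s))" "integrable lborel (\<lambda>s. HH2 (line z s) (line z s) (line z s))"
    "((\<lambda>t. (I t - I 0) / t) \<longlongrightarrow> (LINT s|lborel. HH1 (line z s) (line z s))) (at_right 0)"
    "((\<lambda>t. (I (- t) - I 0) / t) \<longlongrightarrow> - (LINT s|lborel. HH1 (line z s) (line z s))) (at_right 0)"
    "((\<lambda>t. (I t + I (- t) - 2 * I 0) / t\<^sup>2) \<longlongrightarrow> (LINT s|lborel. HH2 (line z s) (line z s) (line z s))) (at_right 0)"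
proof -
  have l: "line z s + \<tau> *\<^sub>R line z s = (1 + \<tau>) *\<^sub>R line z s" for s \<tau> by (simp add: algebra_simps)
  have cu: "continuous_on UNIV (line z)" unfolding line_def[abs_def] by (intro continuous_intros)
  have pt: "1 / 2 \<le> 1 + \<tau>" "1 + \<tau> \<le> 2" if "\<bar>\<tau>\<bar> \<le> 1 / 2" for \<tau> :: real using that by auto
  have t: "line z s + \<tau> *\<^sub>R line z s \<in> tube (2 * norm z)" if "\<bar>\<tau>\<bar> \<le> 1 / 2" for s \<tau>
    unfolding l tube_def using pt[OF that] by (simp add: perp_scale perp_ln[OF z] mult_right_mono)
  have la: "lam ((1 + \<tau>) *\<^sub>R line z s) = (1 + \<tau>) * s" for s \<tau>
    using lam_ln[OF z, of s] by (simp add: lam_def)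
  have lo: "L\<^sup>2 + (1/4) * (s + 0)\<^sup>2 \<le> (wt L (line z s + \<tau> *\<^sub>R line z s))\<^sup>2" if "\<bar>\<tau>\<bar> \<le> 1 / 2" for s \<tau>
  proof -
    have "(1/2)\<^sup>2 \<le> (1 + \<tau>)\<^sup>2" using pt[OF that] by (intro power_mono) auto
    then have "(1/4) * s\<^sup>2 \<le> ((1 + \<tau>) * s)\<^sup>2"
      unfolding power_mult_distrib by (intro mult_right_mono) (auto simp: power2_eq_square)
    then show ?thesis unfolding l wt2_w0 w02 la by (simp add: add_mono)
  qed
  have n: "Nw (line z s + \<tau> *\<^sub>R line z s) (line z s) \<le> norm z + 2" if "\<bar>\<tau>\<bar> \<le> 1 / 2" for s \<tau>
  proof -
    have "\<bar>s\<bar> = (1/2) * (2 * \<bar>s\<bar>)" by simp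
    have "(1/2) * \<bar>s\<bar> \<le> (1 + \<tau>) * \<bar>s\<bar>" using pt[OF that] by (intro mult_right_mono) auto
    also have "\<dots> \<le> wt L ((1 + \<tau>) *\<^sub>R line z s)"
      using lam_le_wt[of "(1 + \<tau>) *\<^sub>R line z s"] pt[OF that] unfolding la by (simp add: abs_mult)
    finally have "\<bar>s\<bar> / wt L ((1 + \<tau>) *\<^sub>R line z s) \<le> 2"
      using wt_pos[of "(1 + \<tau>) *\<^sub>R line z s"] by (simp add: divide_le_eq)
    then show ?thesis
      unfolding l Nw_def using lam_ln[OF z, of s] by (simp add: perp_ln[OF z] lam_def)
  qed
  have h: "(0::real) < 1/2" "(0::real) < 1/4" by auto
  have a0: "\<bar>0::real\<bar> \<le> 0" by simp
  note v = line_variation[where u = "line z" and T = "1/2" and c = "1/4" and a = "\<lambda>\<tau>. 0" and z = z, OF h(1) cu t h(2) lo a0 n]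
  show "integrable lborel (\<lambda>s. HH1 (line z s) (line z s))" by (rule v(2))
  show "integrable lborel (\<lambda>s. HH2 (line z s) (line z s) (line z s))" by (rule v(5))
  show "((\<lambda>t. (I t - I 0) / t) \<longlongrightarrow> (LINT s|lborel. HH1 (line z s) (line z s))) (at_right 0)"
    using v(3) unfolding I_def l .
  show "((\<lambda>t. (I (- t) - I 0) / t) \<longlongrightarrow> - (LINT s|lborel. HH1 (line z s) (line z s))) (at_right 0)"
    using v(4) unfolding I_def l .
  show "((\<lambda>t. (I t + I (- t) - 2 * I 0) / t\<^sup>2) \<longlongrightarrow> (LINT s|lborel. HH2 (line z s) (line z s) (line z s))) (at_right 0)"
    using v(6) unfolding I_def l .
qed

lemma EE_integral:
  "integrable lborel (\<lambda>s. EE (line z s))"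
  "(LINT s|lborel. EE (line z s)) = (\<Sum>b\<in>Basis. LINT s|lborel. HH2 (line z s) b b)
    + ((LINT s|lborel. HH2 (line z s) (line z s) (line z s)) + real (DIM('a) + 1) * (LINT s|lborel. HH1 (line z s) (line z s))) / L\<^sup>2"
  unfolding EE_def using variation_const(2) variation_scale(1,2) by auto

lemmas JJ_integral' = JJ_integral[OF EE_integral(1)]

end

end

section \<open>The maximum principle on the space of generators\<close>

context admissible_horizon
begin

section \<open>Generator integrals and their behaviour at infinity\<close>

definition ff :: "'a \<Rightarrow> real" where "ff z = (LINT s|lborel. HH (line z s))"

text \<open>Spelled out in the basis, this is visibly continuous in the point and the vector jointly
  once the components of \<open>hb\<close> are.\<close>

definition quad :: "real \<times> 'a \<Rightarrow> real \<times> 'a \<Rightarrow> real" where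
  "quad q v = (\<Sum>i\<in>Basis. \<Sum>j\<in>Basis. ((v \<bullet> i) * (v \<bullet> j)) * hb q i j)"

lemma quad_eq: "q \<in> ads_closure \<Longrightarrow> quad q v = hb q v v"
proof -
  assume "q \<in> ads_closure"
  then have "bilinear (hb q)" using hb_sym unfolding symmetric_form_def by blast
  from bilinear_expand2[OF this, of v v] show ?thesis by (simp add: quad_def)
qed

text \<open>Otherwise, by compactness, a subsequence converges to a boundary point with a null
  vector tangent to the boundary. There the boundary condition makes \<open>hb\<close> a multiple of
  the conformal metric, hence zero on that vector.\<close>

lemma quad_boundary_limit:
  fixes q v :: "nat \<Rightarrow> real \<times> 'a"
  assumes q: "\<And>n. q n \<in> Kc" and v: "\<And>n. norm (v n) \<le> B"
    and l1: "(\<lambda>n. (norm (snd (q n)))\<^sup>2) \<longlonglongrightarrow> 1" and l2: "(\<lambda>n. snd (q n) \<bullet> snd (v n)) \<longlonglongrightarrow> 0"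
    and null: "\<And>n. conf_metric L (q n) (v n) (v n) = 0"
  shows "(\<lambda>n. quad (q n) (v n)) \<longlonglongrightarrow> 0"
proof (rule ccontr)
  assume "\<not> (\<lambda>n. quad (q n) (v n)) \<longlonglongrightarrow> 0"
  then obtain e where e: "e > 0" "\<exists>\<^sub>F n in sequentially. \<not> dist (quad (q n) (v n)) 0 < e"
    unfolding tendsto_iff not_all frequently_def by auto
  then have "infinite {n. \<not> dist (quad (q n) (v n)) 0 < e}"
    by (simp add: frequently_sequentially infinite_nat_iff_unbounded_le Collect_neg_eq)
  from infinite_enumerate[OF this] obtain r where r: "strict_mono (r :: nat \<Rightarrow> nat)" "\<And>n. r n \<in> {n. \<not> dist (quad (q n) (v n)) 0 < e}"
    by (elim exE conjE) simp
  have "compact (Kc \<times> cball (0 :: real \<times> 'a) B)" by (intro compact_Times Kc_compact) auto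
  moreover have "\<forall>n. (q (r n), v (r n)) \<in> Kc \<times> cball 0 B" using q v by auto
  ultimately have "\<exists>l\<in>Kc \<times> cball (0 :: real \<times> 'a) B. \<exists>r'. strict_mono r' \<and> ((\<lambda>n. (q (r n), v (r n))) \<circ> r') \<longlonglongrightarrow> l"
    unfolding compact_def by (elim allE[of _ "\<lambda>n. (q (r n), v (r n))"] mp)
  then obtain l r' where l: "l \<in> Kc \<times> cball (0 :: real \<times> 'a) B" and r': "strict_mono (r' :: nat \<Rightarrow> nat)"
    and lim: "((\<lambda>n. (q (r n), v (r n))) \<circ> r') \<longlonglongrightarrow> l"
    by (elim bexE exE conjE)
  define s where "s = r \<circ> r'"
  have s: "strict_mono s" unfolding s_def by (rule strict_mono_o[OF r(1) r'])
  have lq: "(\<lambda>n. q (s n)) \<longlonglongrightarrow> fst l" and lv: "(\<lambda>n. v (s n)) \<longlonglongrightarrow> snd l"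
    using tendsto_fst[OF lim] tendsto_snd[OF lim] by (simp_all add: s_def o_def)
  have sub: "(\<lambda>n. F (s n)) \<longlonglongrightarrow> a" if "F \<longlonglongrightarrow> a" for F :: "nat \<Rightarrow> real" and a
    using LIMSEQ_subseq_LIMSEQ[OF that s] by (simp add: o_def)
  have n1: "(norm (snd (fst l)))\<^sup>2 = 1"
    by (rule LIMSEQ_unique[OF _ sub[OF l1]]) (intro tendsto_intros lq)
  have t0: "snd (fst l) \<bullet> snd (snd l) = 0"
    by (rule LIMSEQ_unique[OF _ sub[OF l2]]) (intro tendsto_intros lq lv)
  have "(\<lambda>n. conf_metric L (q (s n)) (v (s n)) (v (s n))) \<longlonglongrightarrow> conf_metric L (fst l) (snd l) (snd l)"
    unfolding conf_metric_def by (intro tendsto_intros lq lv) (simp add: n1)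
  then have c0: "conf_metric L (fst l) (snd l) (snd l) = 0" by (simp add: null LIMSEQ_const_iff)
  have bd: "fst l \<in> ads_boundary"
    using n1 by (auto simp: ads_boundary_def mem_Times_iff power2_eq_1_iff) (metis norm_ge_zero not_one_le_zero neg_0_le_iff_le one_neq_neg_one)
  have cl: "fst l \<in> ads_closure" using l Kc_sub by auto
  obtain c where c: "\<forall>u v. snd u \<bullet> snd (fst l) = 0 \<longrightarrow> snd v \<bullet> snd (fst l) = 0 \<longrightarrow> hb (fst l) u v = c * conf_metric L (fst l) u v"
    using hb_bdry[OF bd] by blast
  have t0': "snd (snd l) \<bullet> snd (fst l) = 0" using t0 by (simp only: inner_commute)
  have "quad (fst l) (snd l) = 0"
    unfolding quad_eq[OF cl] c[rule_format, OF t0' t0'] c0 by simp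
  moreover have "(\<lambda>n. quad (q (s n)) (v (s n))) \<longlonglongrightarrow> quad (fst l) (snd l)"
  proof -
    have "(\<lambda>n. hb (q (s n)) i j) \<longlonglongrightarrow> hb (fst l) i j" for i j
    proof -
      have "continuous_on ads_closure (\<lambda>q. hb q i j)"
        by (rule Ck_continuous[OF hb_C2 open_open_ads open_ads_subset])
      moreover have "\<forall>n. q (s n) \<in> ads_closure" using q Kc_sub by blast
      ultimately show ?thesis
        using cl lq unfolding continuous_on_sequentially by (auto simp: o_def)
    qed
    then show ?thesis unfolding quad_def by (intro tendsto_intros lv)
  qed
  ultimately have "(\<lambda>n. quad (q (s n)) (v (s n))) \<longlonglongrightarrow> 0" by simp
  then have "eventually (\<lambda>n. dist (quad (q (s n)) (v (s n))) 0 < e) sequentially" using e(1) by (rule tendstoD)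
  then obtain n where "dist (quad (q (s n)) (v (s n))) 0 < e" using eventually_sequentially by auto
  then show False using r(2)[of "r' n"] by (simp add: s_def)
qed

text \<open>The pushed tangent normalized to unit time component. It stays bounded above and away
  from zero, whereas \<open>pk\<close> itself tends to zero along the generator.\<close>

definition kh :: "'a \<Rightarrow> real \<times> 'a" where "kh x = ((wt L x)\<^sup>2 / (L * w0 x)) *\<^sub>R pk x"

lemma kh_null: "conf_metric L (cg x) (kh x) (kh x) = 0"
proof -
  have "conf_metric L (cg x) (pk x) (pk x) = 0"
    unfolding cg_def pk_def conf_metric_pullback[OF L_pos] hk_null by simp
  moreover have "conf_metric L q (a *\<^sub>R u) (a *\<^sub>R u) = a\<^sup>2 * conf_metric L q u u" for q :: "real \<times> 'a" and a u
    by (simp add: conf_metric_def power2_eq_square algebra_simps)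
  ultimately show ?thesis by (simp add: kh_def)
qed

lemma kh_fst: "fst (kh x) = 1"
proof -
  have "fst (pk x) = L * w0 x / (wt L x)\<^sup>2" by (simp add: pk_def push_eq hk_def)
  then show ?thesis using L_pos by (simp add: kh_def)
qed

lemma norm_cg: "(norm (snd (cg x)))\<^sup>2 = (wt L x - L) / (wt L x + L)"
proof -
  have "x \<bullet> x = (wt L x - L) * (wt L x + L)"
    using wt2[of x] by (simp add: power2_eq_square algebra_simps)
  then have "(norm x)\<^sup>2 = (wt L x - L) * (wt L x + L)" by (simp only: power2_norm_eq_inner)
  moreover have "(norm (snd (cg x)))\<^sup>2 = (inverse (L + wt L x))\<^sup>2 * (norm x)\<^sup>2"
    unfolding cg_eq snd_conv norm_scaleR power_mult_distrib power2_abs ..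
  ultimately have "(norm (snd (cg x)))\<^sup>2 = (inverse (L + wt L x))\<^sup>2 * ((wt L x - L) * (wt L x + L))"
    by (simp only:)
  moreover have "(inverse (c + w))\<^sup>2 * ((w - c) * (w + c)) = (w - c) / (w + c)" if "c + w > 0" for c w :: real
  proof -
    have "(inverse (c + w))\<^sup>2 * ((w - c) * (w + c)) = (w - c) * inverse (c + w) * (inverse (c + w) * (c + w))"
      by (simp add: power2_eq_square algebra_simps)
    then show ?thesis using that by (simp add: divide_inverse add.commute)
  qed
  ultimately show ?thesis using Lw_pos[of x] by presburger
qed

text \<open>The time component is 1, so nullness in the conformal metric fixes the length of the
  spatial part.\<close>

lemma kh_bound: "norm (kh x) \<le> 1 + 1 / L"
proof -
  define k where "k = norm (snd (kh x))"
  define y where "y = (norm (snd (cg x)))\<^sup>2"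
  have y: "y \<le> 1" "y \<ge> 0" unfolding y_def using cg_Kc[of x] by (auto simp: Kc_def mem_Times_iff power_le_one)
  have "- 1 * 1 + 4 * L\<^sup>2 / (1 + y)\<^sup>2 * k\<^sup>2 = 0"
    using kh_null[of x] unfolding conf_metric_def kh_fst k_def y_def power2_norm_eq_inner .
  then have "4 * L\<^sup>2 / (1 + y)\<^sup>2 * k\<^sup>2 = 1" by linarith
  then have "4 * L\<^sup>2 * k\<^sup>2 = (1 + y)\<^sup>2" using y by (simp add: field_simps)
  also have "\<dots> \<le> 2\<^sup>2" using y by (intro power_mono) auto
  finally have "(L * k)\<^sup>2 \<le> 1\<^sup>2" by (simp add: power_mult_distrib)
  then have "L * k \<le> 1" by (rule power2_le_imp_le) simp
  then have k: "k \<le> 1 / L" using L_pos by (simp add: field_simps)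
  have "norm (kh x) \<le> norm (fst (kh x)) + norm (snd (kh x))"
    using norm_Pair_le[of "fst (kh x)" "snd (kh x)"] by simp
  then show ?thesis using k by (simp add: kh_fst k_def)
qed

text \<open>The bound on the radial component is independent of the position along the generator:
  far from the centre a whole generator becomes tangent to the boundary.\<close>

lemma kh_tangent: "\<bar>snd (cg x) \<bullet> snd (kh x)\<bar> \<le> 1 / w0 x"
proof -
  define w where "w = wt L x"
  define V where "V = L + w"
  have w: "w > 0" "V > 0" "w \<noteq> 0" "V \<noteq> 0" using wt_pos[of x] Lw_pos[of x] by (auto simp: w_def V_def)
  have r: "x \<bullet> x = (V - 2 * L) * V" using wt2[of x] by (simp add: w_def V_def power2_eq_square algebra_simps)
  have L: "L = V - w" by (simp add: V_def)
  have "snd (cg x) \<bullet> snd (pk x) = inverse V * (inverse V * lam x - (lam x * inverse w * (inverse V)\<^sup>2) * (x \<bullet> x))"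
    by (simp add: cg_eq pk_def push_eq hk_def graph_def lam_def w_def V_def inner_diff_right right_diff_distrib)
  also have "\<dots> = L * lam x * inverse w * (inverse V)\<^sup>2"
    unfolding r L using w(3,4) by (simp add: field_simps power2_eq_square)
  finally have "snd (cg x) \<bullet> snd (kh x) = w\<^sup>2 / (L * w0 x) * (L * lam x * inverse w * (inverse V)\<^sup>2)"
    by (simp add: kh_def w_def)
  also have "\<dots> = lam x * w * (inverse V)\<^sup>2 / w0 x"
    using w L_pos by (simp add: field_simps power2_eq_square)
  finally have e: "snd (cg x) \<bullet> snd (kh x) = lam x * w * (inverse V)\<^sup>2 / w0 x" .
  have "\<bar>lam x\<bar> * w \<le> V * V"
    using lam_le_wt[of x] w L_pos by (intro mult_mono) (auto simp: w_def V_def)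
  then have "\<bar>lam x * w * (inverse V)\<^sup>2\<bar> \<le> 1"
    using w by (simp add: abs_mult field_simps power2_eq_square)
  then show ?thesis
    unfolding e abs_divide using w0_pos[of x] by (simp add: divide_right_mono)
qed

lemma HH_kh: "HH x = (w0 x)\<^sup>2 / (wt L x)\<^sup>2 * quad (cg x) (kh x)"
proof -
  have "HH x = (wt L x)\<^sup>2 / L\<^sup>2 * quad (cg x) (pk x)"
    using cg_open[of x] open_ads_subset unfolding HH_eq dg_eq pk_def[symmetric] cg_def[symmetric]
    by (subst quad_eq) (auto simp: graph_def)
  moreover have "quad q (a *\<^sub>R v) = a\<^sup>2 * quad q v" for q a v
    by (simp add: quad_def sum_distrib_left power2_eq_square mult_ac)
  then have "quad (cg x) (kh x) = ((wt L x)\<^sup>2 / (L * w0 x))\<^sup>2 * quad (cg x) (pk x)"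
    unfolding kh_def .
  ultimately show ?thesis using L_pos by (simp add: power2_eq_square)
qed

lemma quad_bound: "\<exists>C\<ge>0. \<forall>x. \<bar>quad (cg x) (kh x)\<bar> \<le> C"
proof -
  obtain C where C: "C \<ge> 0" "\<forall>x. \<forall>i\<in>Basis. \<forall>j\<in>Basis. \<bar>hb (cg x) i j\<bar> \<le> C"
    using hb_bounds by blast
  define B where "B = 1 + 1 / L"
  have B: "B \<ge> 0" using L_pos by (simp add: B_def)
  have k: "\<bar>kh x \<bullet> i\<bar> \<le> B" if "i \<in> Basis" for x i
    using Basis_le_norm[OF that, of "kh x"] kh_bound[of x] by (simp add: B_def)
  have "\<bar>quad (cg x) (kh x)\<bar> \<le> (\<Sum>i\<in>(Basis :: (real \<times> 'a) set). \<Sum>j\<in>(Basis :: (real \<times> 'a) set). (B * B) * C)" for x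
    unfolding quad_def
    by (intro order_trans[OF sum_abs] sum_mono)
      (auto simp only: abs_mult intro!: mult_mono k C(2)[rule_format] B C(1) mult_nonneg_nonneg abs_ge_zero)
  then show ?thesis
    by (intro exI[of _ "\<Sum>i\<in>(Basis :: (real \<times> 'a) set). \<Sum>j\<in>(Basis :: (real \<times> 'a) set). (B * B) * C"] conjI allI)
      (auto intro!: sum_nonneg mult_nonneg_nonneg B C)
qed

lemma ff_scaled: 
  assumes "c > 0"
  shows "ff z = c * (LINT s|lborel. HH (line z (c * s)))"
  unfolding ff_def using lborel_integral_real_affine[of c "\<lambda>s. HH (line z s)" 0] assms by simp

text \<open>In the parameter \<open>s / w0 z\<close> and rescaled by \<open>kh\<close>, the tangents of a generator far away from the centre become
  null vectors tangent to the boundary, on which \<open>hb\<close> vanishes.\<close>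

lemma ff_decay:
  assumes e: "e > 0"
  shows "\<exists>R. \<forall>z. z \<bullet> x1 = 0 \<longrightarrow> norm z \<ge> R \<longrightarrow> \<bar>ff z\<bar> \<le> e * w0 z"
proof (rule ccontr)
  assume "\<not> ?thesis"
  then have "\<forall>n::nat. \<exists>z. z \<bullet> x1 = 0 \<and> norm z \<ge> real n \<and> \<bar>ff z\<bar> > e * w0 z" by force
  then obtain z where z: "\<And>n. z n \<bullet> x1 = 0" "\<And>n. norm (z n) \<ge> real n" "\<And>n. \<bar>ff (z n)\<bar> > e * w0 (z n)" by metis
  have w0n: "w0 (z n) \<ge> real n" for n
  proof (rule power2_le_imp_le)
    have "(norm (z n))\<^sup>2 \<le> (w0 (z n))\<^sup>2"
      using z(1)[of n] by (simp add: w02 perp_def lam_def power2_norm_eq_inner)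
    moreover have "(real n)\<^sup>2 \<le> (norm (z n))\<^sup>2" using z(2) by (intro power_mono) auto
    ultimately show "(real n)\<^sup>2 \<le> (w0 (z n))\<^sup>2" by linarith
  qed (use w0_pos less_imp_le in blast)
  have w0lim: "filterlim (\<lambda>n. w0 (z n)) at_top sequentially"
    by (rule filterlim_at_top_mono[OF filterlim_real_sequentially]) (use w0n in simp)
  define X where "X n m = line (z n) (w0 (z n) * m)" for n m
  have wX: "(wt L (X n m))\<^sup>2 = (w0 (z n))\<^sup>2 * (1 + m\<^sup>2)" and w0X: "w0 (X n m) = w0 (z n)" for n m
    unfolding X_def using z(1) by (simp_all add: wt2_ln w0_ln power_mult_distrib algebra_simps)
  have HX: "HH (X n m) = quad (cg (X n m)) (kh (X n m)) / (1 + m\<^sup>2)" for n m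
    unfolding HH_kh wX w0X by simp
  obtain C where C: "C \<ge> 0" "\<And>x. \<bar>quad (cg x) (kh x)\<bar> \<le> C" using quad_bound by blast
  have lim: "(\<lambda>n. quad (cg (X n m)) (kh (X n m))) \<longlonglongrightarrow> 0" for m
  proof (rule quad_boundary_limit[OF _ kh_bound _ _ kh_null])
    show "cg (X n m) \<in> Kc" for n using cg_Kc by blast
    have wl: "w0 (z n) \<le> wt L (X n m)" for n using w0_le_wt[of "X n m"] by (simp add: w0X)
    have wlim: "filterlim (\<lambda>n. wt L (X n m)) at_top sequentially"
      by (rule filterlim_at_top_mono[OF w0lim]) (use wl in simp)
    have wL: "filterlim (\<lambda>n. wt L (X n m) + L) at_top sequentially"
      by (rule filterlim_at_top_mono[OF wlim]) (use L_pos in simp)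
    have "(\<lambda>n. 1 - 2 * L / (wt L (X n m) + L)) \<longlonglongrightarrow> 1 - 0"
      by (intro tendsto_diff tendsto_const tendsto_divide_0[OF tendsto_const filterlim_at_top_imp_at_infinity[OF wL]])
    moreover have "1 - 2 * L / (wt L (X n m) + L) = (norm (snd (cg (X n m))))\<^sup>2" for n
      unfolding norm_cg using Lw_pos[of "X n m"] by (simp add: field_simps)
    ultimately show "(\<lambda>n. (norm (snd (cg (X n m))))\<^sup>2) \<longlonglongrightarrow> 1" by simp
    show "(\<lambda>n. snd (cg (X n m)) \<bullet> snd (kh (X n m))) \<longlonglongrightarrow> 0"
    proof (rule Lim_null_comparison)
      show "eventually (\<lambda>n. norm (snd (cg (X n m)) \<bullet> snd (kh (X n m))) \<le> 1 / w0 (z n)) sequentially"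
        using kh_tangent[of "X _ m", unfolded w0X] by simp
      show "(\<lambda>n. 1 / w0 (z n)) \<longlonglongrightarrow> 0"
        by (rule tendsto_divide_0[OF tendsto_const filterlim_at_top_imp_at_infinity[OF w0lim]])
    qed
  qed
  have mX: "(\<lambda>m. HH (X n m)) \<in> borel_measurable borel" for n
    unfolding X_def line_def
    by (intro borel_measurable_continuous_onI continuous_on_compose2[OF HH_continuous] continuous_intros) auto
  have "(\<lambda>n. LINT m|lborel. HH (X n m)) \<longlonglongrightarrow> (LINT m|(lborel :: real measure). (0::real))"
  proof (rule integral_dominated_convergence[where f = "\<lambda>_. 0" and w = "\<lambda>m. C * (1 / (1 + m\<^sup>2))"])
    show "integrable lborel (\<lambda>m. C * (1 / (1 + m\<^sup>2)))" by (intro integrable_mult_right integrable_inverse_square)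
    show "AE m in lborel. (\<lambda>n. HH (X n m)) \<longlonglongrightarrow> 0"
    proof (intro always_eventually allI)
      fix m :: real
      have "(\<lambda>n. inverse (1 + m\<^sup>2) * quad (cg (X n m)) (kh (X n m))) \<longlonglongrightarrow> inverse (1 + m\<^sup>2) * 0"
        by (intro tendsto_mult tendsto_const lim)
      then show "(\<lambda>n. HH (X n m)) \<longlonglongrightarrow> 0" unfolding HX by (simp add: divide_inverse mult.commute)
    qed
    show "AE m in lborel. norm (HH (X n m)) \<le> C * (1 / (1 + m\<^sup>2))" for n
    proof (intro always_eventually allI)
      fix m :: real
      have "1 + m\<^sup>2 > 0" by (simp add: add_pos_nonneg)
      then show "norm (HH (X n m)) \<le> C * (1 / (1 + m\<^sup>2))"
        unfolding HX using C(2)[of "X n m"] by (simp add: divide_right_mono)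
    qed
  qed (use mX in auto)
  then have "(\<lambda>n. LINT m|lborel. HH (X n m)) \<longlonglongrightarrow> 0" by simp
  then have "eventually (\<lambda>n. dist (LINT m|lborel. HH (X n m)) 0 < e) sequentially" using e by (rule tendstoD)
  then obtain n where n: "\<bar>LINT m|lborel. HH (X n m)\<bar> < e" using eventually_sequentially by auto
  have "\<bar>ff (z n)\<bar> = w0 (z n) * \<bar>LINT m|lborel. HH (X n m)\<bar>"
    unfolding ff_scaled[OF w0_pos[of "z n"]] X_def abs_mult using w0_pos[of "z n"] by simp
  also have "\<dots> \<le> w0 (z n) * e" using n w0_pos[of "z n"] by (intro mult_left_mono) auto
  finally show False using z(3)[of n] by (simp add: mult.commute)
qed

text \<open>Moving the base point along \<open>x1\<close> only shifts the parameter of the line.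
  Thus \<open>ff\<close> is defined on all of space and difference quotients in arbitrary basis
  directions make sense.\<close>

lemma ff_perp: "ff y = ff (perp y)"
proof -
  have "line y s = line (perp y) (lam y + 1 * s)" for s
    by (simp add: line_def perp_def algebra_simps)
  then show ?thesis
    unfolding ff_def using lborel_integral_real_affine[of 1 "\<lambda>s. HH (line (perp y) s)" "lam y"] by simp
qed

lemma HH_bound_tube:
  "\<exists>C\<ge>0. \<forall>z s. z \<bullet> x1 = 0 \<longrightarrow> norm z \<le> R \<longrightarrow> \<bar>HH (line z s)\<bar> \<le> C / (1 + s\<^sup>2)"
proof -
  obtain C where C: "C \<ge> 0" "\<forall>x\<in>tube R. \<bar>HH x\<bar> \<le> C * wt L x powi (-2)"
    using Sy_bounds[OF Sy_HH c2_HH, of R] by blast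
  have "\<bar>HH (line z s)\<bar> \<le> (C * (1 / L\<^sup>2 + 2)) / (1 + s\<^sup>2)" if z: "z \<bullet> x1 = 0" "norm z \<le> R" for z s
  proof -
    have "line z s \<in> tube R" using z by (simp add: tube_def perp_ln)
    then have "\<bar>HH (line z s)\<bar> \<le> C * (1 / (wt L (line z s))\<^sup>2)" using C(2) unfolding wt_powi_m2 by blast
    also have "\<dots> \<le> C * ((1 / L\<^sup>2 + 2) / (1 + s\<^sup>2))" by (intro mult_left_mono wt_ln_bound z C)
    finally show ?thesis by simp
  qed
  then show ?thesis using C(1) L_pos by (intro exI[of _ "C * (1 / L\<^sup>2 + 2)"]) auto
qed

lemma ff_continuous: "continuous_on {z. z \<bullet> x1 = 0 \<and> norm z \<le> R} ff"
  unfolding continuous_on_sequentially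
proof (intro allI ballI impI, elim conjE)
  fix X :: "nat \<Rightarrow> 'a" and a
  assume a: "a \<in> {z. z \<bullet> x1 = 0 \<and> norm z \<le> R}" and X: "\<forall>n. X n \<in> {z. z \<bullet> x1 = 0 \<and> norm z \<le> R}" "X \<longlonglongrightarrow> a"
  obtain C where C: "C \<ge> 0" "\<forall>z s. z \<bullet> x1 = 0 \<longrightarrow> norm z \<le> R \<longrightarrow> \<bar>HH (line z s)\<bar> \<le> C / (1 + s\<^sup>2)"
    using HH_bound_tube by blast
  have m: "(\<lambda>s. HH (line z s)) \<in> borel_measurable borel" for z
    unfolding line_def
    by (intro borel_measurable_continuous_onI continuous_on_compose2[OF HH_continuous] continuous_intros) auto
  show "(ff \<circ> X) \<longlonglongrightarrow> ff a" unfolding o_def ff_def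
  proof (rule integral_dominated_convergence[where w = "\<lambda>s. C * (1 / (1 + s\<^sup>2))"])
    show "integrable lborel (\<lambda>m. C * (1 / (1 + m\<^sup>2)))" by (intro integrable_mult_right integrable_inverse_square)
    show "AE s in lborel. (\<lambda>n. HH (line (X n) s)) \<longlonglongrightarrow> HH (line a s)"
    proof (intro always_eventually allI)
      fix s
      have "isCont HH (line a s)" using HH_continuous by (simp add: continuous_on_eq_continuous_at)
      moreover have "(\<lambda>n. line (X n) s) \<longlonglongrightarrow> line a s" unfolding line_def by (intro tendsto_intros X)
      ultimately show "(\<lambda>n. HH (line (X n) s)) \<longlonglongrightarrow> HH (line a s)" by (rule isCont_tendsto_compose)
    qed
    show "AE s in lborel. norm (HH (line (X n) s)) \<le> C * (1 / (1 + s\<^sup>2))" for n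
      using C(2) X(1) by simp
  qed (use m in auto)
qed

lemma c2_w0: "c2 w0 (\<lambda>x u. (perp x \<bullet> u) / w0 x)
   (\<lambda>x u v. (perp v \<bullet> u) / w0 x - (perp x \<bullet> u) * (perp x \<bullet> v) / (w0 x) ^ 3)"
  unfolding c2_def
proof (intro conjI allI w0_deriv)
  fix x u
  have i: "((\<lambda>y. inverse (w0 y)) has_derivative (\<lambda>v. - (perp x \<bullet> v) / (w0 x) ^ 3)) (at x)"
    by (rule has_derivative_eq_rhs[OF Deriv.has_derivative_inverse[OF w0_nz w0_deriv]])
      (simp add: fun_eq_iff field_simps power3_eq_cube)
  have lp: "linear (\<lambda>y. perp y \<bullet> u)"
    by (rule linearI) (simp_all add: perp_add perp_scale inner_add_left)
  from has_derivative_mult[OF linear_imp_has_derivative[OF lp] i]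
  show "((\<lambda>y. perp y \<bullet> u / w0 y) has_derivative (\<lambda>v. perp v \<bullet> u / w0 x - perp x \<bullet> u * (perp x \<bullet> v) / w0 x ^ 3)) (at x)"
    unfolding divide_inverse
    by (rule has_derivative_eq_rhs) (simp add: fun_eq_iff divide_inverse)
qed

text \<open>\<open>w0 + L\<close> is a positive strict supersolution of the operator that \<open>EE\<close> induces on functions of the
  generator.  At a negative minimum of \<open>ff / (w0 + L)\<close>, the variations of \<open>ff\<close> in the constant
  and the radial directions are bounded below by those of a multiple of \<open>w0 + L\<close>.\<close>

theorem averaged_null_energy_positive:
  assumes d: "DIM('a) \<ge> 2"
    and ancc: "\<And>z. z \<bullet> x1 = 0 \<Longrightarrow> 0 \<le> (LINT s|lborel. JJ (line z s))"
    and zs: "zs \<bullet> x1 = 0"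
  shows "ff zs \<ge> 0"
proof (rule ccontr)
  assume "\<not> ff zs \<ge> 0"
  then have neg: "ff zs < 0" by simp
  define \<rho> where "\<rho> z = ff z / (w0 z + L)" for z
  have wL: "w0 z + L > 0" for z using w0_pos[of z] L_pos by simp
  have rn: "\<rho> zs < 0" unfolding \<rho>_def using neg wL by (simp add: divide_neg_pos)
  \<comment> \<open>With half of the value of \<open>\<rho>\<close> at \<open>zs\<close> as
    tolerance, \<open>\<rho>\<close> exceeds that value outside a ball; so a minimum over a ball is
    a minimum over all generators.\<close>
  obtain R where R: "\<forall>z. z \<bullet> x1 = 0 \<longrightarrow> norm z \<ge> R \<longrightarrow> \<bar>ff z\<bar> \<le> (- \<rho> zs / 2) * w0 z"
    using ff_decay[of "- \<rho> zs / 2"] rn by auto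
  have far: "\<rho> zs < \<rho> z" if "z \<bullet> x1 = 0" "norm z \<ge> R" for z
  proof -
    have "- ff z \<le> (- \<rho> zs / 2) * w0 z" using R that by (smt (verit) abs_le_iff)
    also have "\<dots> < - \<rho> zs * (w0 z + L)"
    proof -
      have "(- \<rho> zs / 2) * w0 z < (- \<rho> zs) * w0 z" using rn w0_pos[of z] by (intro mult_strict_right_mono) auto
      also have "\<dots> < (- \<rho> zs) * (w0 z + L)" using rn L_pos by (intro mult_strict_left_mono) auto
      finally show ?thesis .
    qed
    finally show ?thesis unfolding \<rho>_def[of z] using wL[of z] by (simp add: field_simps)
  qed
  define S where "S = {z. z \<bullet> x1 = 0 \<and> norm z \<le> max R (norm zs)}"
  have "S = {z. x1 \<bullet> z = 0} \<inter> cball 0 (max R (norm zs))" by (auto simp: S_def inner_commute)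
  then have cS: "compact S" using closed_hyperplane[of x1 0] by (simp add: closed_Int_compact)
  have cont: "continuous_on S \<rho>" unfolding \<rho>_def S_def
    using wL by (intro continuous_intros ff_continuous) (auto simp: less_imp_neq[symmetric]
      intro!: continuous_at_imp_continuous_on has_derivative_continuous[OF w0_deriv])
  obtain z where zS: "z \<in> S" and zmin: "\<And>y. y \<in> S \<Longrightarrow> \<rho> z \<le> \<rho> y"
  proof -
    have "S \<noteq> {}" using zs by (auto simp: S_def)
    from continuous_attains_inf[OF cS this cont] show thesis by (rule bexE) (rule that, assumption, erule bspec)
  qed
  have z: "z \<bullet> x1 = 0" using zS by (simp add: S_def)
  have pz: "perp z = z" using z by (simp add: perp_def lam_def)
  have zzs: "\<rho> z \<le> \<rho> zs" using zmin[of zs] zs by (simp add: S_def)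
  have min: "\<rho> z \<le> \<rho> y" if "y \<bullet> x1 = 0" for y
  proof (cases "norm y \<le> max R (norm zs)")
    case False
    then have "R \<le> norm y" by simp
    from far[OF that this] zzs show ?thesis by linarith
  qed (use zmin that in \<open>simp add: S_def\<close>)
  define m where "m = - \<rho> z"
  have m: "m > 0" using zzs rn by (simp add: m_def)
  \<comment> \<open>Touches zero from above at the minimum \<open>z\<close>, so its second
    difference quotients there are nonnegative, as are its first ones from the right.\<close>
  define E where "E y = ff y + m * (w0 y + L)" for y
  have "w0 (perp y) = w0 y" for y
  proof -
    have "(w0 (perp y))\<^sup>2 = (w0 y)\<^sup>2" by (simp add: w02 perp_def lam_def inner_diff_left x1)
    then show ?thesis using w0_pos[of y] w0_pos[of "perp y"] by (simp add: power2_eq_iff)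
  qed
  then have Epos: "E y \<ge> 0" for y
    using min[OF perp_x1[of y]] wL[of "perp y"] unfolding E_def ff_perp[of y]
    by (simp add: \<rho>_def[of "perp y"] m_def field_simps)
  have E0: "E z = 0" using wL[of z] by (simp add: E_def m_def \<rho>_def)
  define w where "w = w0 z"
  define r where "r = z \<bullet> z"
  have w: "w > 0" "w\<^sup>2 = L\<^sup>2 + r" by (simp_all add: w_def w0_pos w02 pz r_def)
  have T1: "(LINT s|lborel. HH2 (line z s) b b) + m * ((perp b \<bullet> b) / w - (z \<bullet> b)\<^sup>2 / w ^ 3) \<ge> 0" for b
  proof -
    define I where "I \<tau> = (LINT s|lborel. HH (line (z + \<tau> *\<^sub>R b) s))" for \<tau>
    have I: "I \<tau> = ff (z + \<tau> *\<^sub>R b)" for \<tau> by (simp add: I_def ff_def)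
    have "((\<lambda>t. (I t + I (- t) - 2 * I 0) / t\<^sup>2 + m * ((w0 (z + t *\<^sub>R b) + w0 (z - t *\<^sub>R b) - 2 * w0 z) / t\<^sup>2)) \<longlongrightarrow>
      (LINT s|lborel. HH2 (line z s) b b) + m * ((perp b \<bullet> b) / w0 z - (perp z \<bullet> b) * (perp z \<bullet> b) / (w0 z) ^ 3)) (at_right 0)"
      unfolding I_def by (intro tendsto_add tendsto_mult tendsto_const variation_const(3)[OF z] c2_second_difference(1)[OF c2_w0])
    moreover have "(I t + I (- t) - 2 * I 0) / t\<^sup>2 + m * ((w0 (z + t *\<^sub>R b) + w0 (z - t *\<^sub>R b) - 2 * w0 z) / t\<^sup>2)
       = (E (z + t *\<^sub>R b) + E (z - t *\<^sub>R b) - 2 * E z) / t\<^sup>2" for t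
      unfolding I E_def by (simp add: add_divide_distrib diff_divide_distrib algebra_simps)
    ultimately have "((\<lambda>t. (E (z + t *\<^sub>R b) + E (z - t *\<^sub>R b) - 2 * E z) / t\<^sup>2) \<longlongrightarrow>
      (LINT s|lborel. HH2 (line z s) b b) + m * ((perp b \<bullet> b) / w - (z \<bullet> b)\<^sup>2 / w ^ 3)) (at_right 0)"
      by (simp add: pz w_def power2_eq_square)
    then show ?thesis
      by (rule tendsto_lowerbound) (use Epos E0 in \<open>auto intro!: always_eventually\<close>)
  qed
  define I where "I \<tau> = (LINT s|lborel. HH ((1 + \<tau>) *\<^sub>R line z s))" for \<tau>
  define h1 where "h1 = (LINT s|lborel. HH1 (line z s) (line z s))"
  define h2 where "h2 = (LINT s|lborel. HH2 (line z s) (line z s) (line z s))"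
  \<comment> \<open>Dilating space also stretches the parameter of the generator, whence the factor
    \<open>1 + t\<close> between the integral over the dilated line and \<open>ff\<close>.\<close>
  have I: "(1 + t) * I t = ff (z + t *\<^sub>R z)" if "1 + t > 0" for t
  proof -
    have "(1 + t) *\<^sub>R line z s = line (z + t *\<^sub>R z) ((1 + t) * s)" for s by (simp add: line_def algebra_simps)
    then show ?thesis unfolding I_def using ff_scaled[OF that, of "z + t *\<^sub>R z"] by simp
  qed
  have I0: "I 0 = - m * (w + L)" using E0 by (simp add: I_def E_def ff_def w_def)
  have evt: "eventually (\<lambda>t. 0 < t \<and> t < 1) (at_right (0::real))"
    using eventually_at_right_real[of 0 1] by (auto elim: eventually_mono)
  have id0: "((\<lambda>t. t) \<longlongrightarrow> 0) (at_right (0::real))" by (rule tendsto_ident_at)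
  have It: "(I \<longlongrightarrow> I 0) (at_right 0)"
  proof -
    have "((\<lambda>t. t * ((I t - I 0) / t) + I 0) \<longlongrightarrow> 0 * h1 + I 0) (at_right 0)"
      unfolding h1_def I_def by (intro tendsto_intros variation_scale(3)[OF z] tendsto_ident_at)
    then have "((\<lambda>t. t * ((I t - I 0) / t) + I 0) \<longlongrightarrow> I 0) (at_right 0)" by simp
    then show ?thesis by (rule Lim_transform_eventually) (use evt in eventually_elim, simp)
  qed
  have Imt: "((\<lambda>t. I (- t)) \<longlongrightarrow> I 0) (at_right 0)"
  proof -
    have "((\<lambda>t. t * ((I (- t) - I 0) / t) + I 0) \<longlongrightarrow> 0 * (- h1) + I 0) (at_right 0)"
      unfolding h1_def I_def by (intro tendsto_intros variation_scale(4)[OF z] tendsto_ident_at)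
    then have "((\<lambda>t. t * ((I (- t) - I 0) / t) + I 0) \<longlongrightarrow> I 0) (at_right 0)" by simp
    then show ?thesis by (rule Lim_transform_eventually) (use evt in eventually_elim, simp)
  qed
  have p1: "((\<lambda>t. (w0 (z + t *\<^sub>R z) - w0 z) / t) \<longlongrightarrow> r / w) (at_right 0)"
    using c2_first_difference(1)[OF c2_w0, of z z] by (simp add: pz r_def w_def)
  have p2: "((\<lambda>t. (w0 (z + t *\<^sub>R z) + w0 (z - t *\<^sub>R z) - 2 * w0 z) / t\<^sup>2) \<longlongrightarrow> r / w - r * r / w ^ 3) (at_right 0)"
    using c2_second_difference(1)[OF c2_w0, of z z] by (simp add: pz r_def w_def)
  have "h1 + I 0 + m * (r / w) \<ge> 0"
  proof -
    have "((\<lambda>t. (I t - I 0) / t + I t + m * ((w0 (z + t *\<^sub>R z) - w0 z) / t)) \<longlongrightarrow> h1 + I 0 + m * (r / w)) (at_right 0)"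
      unfolding h1_def by (intro tendsto_intros variation_scale(3)[OF z, folded I_def] It p1)
    moreover have "eventually (\<lambda>t. 0 \<le> (I t - I 0) / t + I t + m * ((w0 (z + t *\<^sub>R z) - w0 z) / t)) (at_right 0)"
      using evt
    proof eventually_elim
      case (elim t)
      have "(I t - I 0) / t + I t + m * ((w0 (z + t *\<^sub>R z) - w0 z) / t) = (E (z + t *\<^sub>R z) - E z) / t"
        unfolding E_def using I[of t] I[of 0] elim by (simp add: field_simps)
      then show ?case using Epos[of "z + t *\<^sub>R z"] E0 elim by simp
    qed
    ultimately show ?thesis by (rule tendsto_lowerbound) simp
  qed
  have "h2 + 2 * h1 + m * (r / w - r * r / w ^ 3) \<ge> 0"
  proof -
    have "((\<lambda>t. (I t + I (- t) - 2 * I 0) / t\<^sup>2 + ((I t - I 0) / t - (I (- t) - I 0) / t)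
        + m * ((w0 (z + t *\<^sub>R z) + w0 (z - t *\<^sub>R z) - 2 * w0 z) / t\<^sup>2)) \<longlongrightarrow> h2 + (h1 - (- h1)) + m * (r / w - r * r / w ^ 3)) (at_right 0)"
      unfolding h1_def h2_def by (intro tendsto_intros variation_scale(3-5)[OF z, folded I_def] p2)
    moreover have "eventually (\<lambda>t. 0 \<le> (I t + I (- t) - 2 * I 0) / t\<^sup>2 + ((I t - I 0) / t - (I (- t) - I 0) / t)
        + m * ((w0 (z + t *\<^sub>R z) + w0 (z - t *\<^sub>R z) - 2 * w0 z) / t\<^sup>2)) (at_right 0)"
      using evt
    proof eventually_elim
      case (elim t)
      have "(I t + I (- t) - 2 * I 0) / t\<^sup>2 + ((I t - I 0) / t - (I (- t) - I 0) / t)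
        + m * ((w0 (z + t *\<^sub>R z) + w0 (z - t *\<^sub>R z) - 2 * w0 z) / t\<^sup>2)
        = ((1 + t) * I t + (1 + - t) * I (- t) - 2 * I 0 + m * (w0 (z + t *\<^sub>R z) + w0 (z - t *\<^sub>R z) - 2 * w0 z)) / t\<^sup>2"
        using elim by (simp add: field_simps power2_eq_square)
      also have "\<dots> = (E (z + t *\<^sub>R z) + E (z - t *\<^sub>R z) - 2 * E z) / t\<^sup>2"
        unfolding E_def using I[of t] I[of "- t"] I[of 0] elim by (simp add: algebra_simps)
      finally show ?case using Epos[of "z + t *\<^sub>R z"] Epos[of "z - t *\<^sub>R z"] E0 by simp
    qed
    ultimately show ?thesis using tendsto_lowerbound[of _ _ "at_right 0" 0] by fastforce
  qed
  note h2ge = this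
  have h1eq: "h1 + I 0 + m * (r / w) \<ge> 0" by fact
  have "(LINT s|lborel. EE (line z s)) > 0"
  proof -
    have n: "real DIM('a) - 1 > 0" using d by simp
    have "(\<Sum>b\<in>Basis. (LINT s|lborel. HH2 (line z s) b b) + m * ((perp b \<bullet> b) / w - (z \<bullet> b)\<^sup>2 / w ^ 3)) \<ge> 0"
      by (intro sum_nonneg T1)
    moreover have "(\<Sum>b\<in>Basis. perp b \<bullet> b) = real DIM('a) - 1"
    proof -
      have "(\<Sum>b\<in>Basis. perp b \<bullet> b) = (\<Sum>b\<in>(Basis::'a set). 1 - (x1 \<bullet> b) * (x1 \<bullet> b))"
        by (intro sum.cong refl) (simp add: perp_def lam_def inner_diff_left inner_diff_right inner_commute)
      then show ?thesis using euclidean_inner[of x1 x1] by (simp add: sum_subtractf x1)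
    qed
    moreover have "(\<Sum>b\<in>Basis. (z \<bullet> b)\<^sup>2) = r"
      using euclidean_inner[of z z] by (simp add: r_def power2_eq_square)
    ultimately have A: "(\<Sum>b\<in>Basis. LINT s|lborel. HH2 (line z s) b b) \<ge> - m * ((real DIM('a) - 1) / w - r / w ^ 3)"
      by (simp add: sum.distrib sum_distrib_left[symmetric] sum_subtractf sum_divide_distrib[symmetric])
    \<comment> \<open>By the factor \<open>1 + t\<close>, the combination \<open>h2 + 2 * h1\<close>
      is the radial second variation of \<open>ff\<close>. The remaining first-order term has the
      positive coefficient d - 1, so the inequality for \<open>h1\<close> can be inserted.\<close>
    have "h2 + real (DIM('a) + 1) * h1 = (h2 + 2 * h1) + (real DIM('a) - 1) * h1" by (simp add: algebra_simps)
    also have "\<dots> \<ge> - m * (r / w - r * r / w ^ 3) + (real DIM('a) - 1) * (m * (w + L) - m * (r / w))"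
      using h2ge h1eq n unfolding I0 by (intro add_mono mult_left_mono) (auto simp: algebra_simps)
    finally have Bq: "(h2 + real (DIM('a) + 1) * h1) / L\<^sup>2 \<ge>
      (- m * (r / w - r * r / w ^ 3) + (real DIM('a) - 1) * (m * (w + L) - m * (r / w))) / L\<^sup>2"
      by (intro divide_right_mono) auto
    have rr: "r = w\<^sup>2 - L\<^sup>2" using w(2) by simp
    \<comment> \<open>The contributions of \<open>w0\<close> cancel, as \<open>w0\<close> lies in
      the kernel of the operator; the positive remainder stems from the constant \<open>L\<close> of
      the comparison function.\<close>
    have "- m * ((real DIM('a) - 1) / w - r / w ^ 3)
      + (- m * (r / w - r * r / w ^ 3) + (real DIM('a) - 1) * (m * (w + L) - m * (r / w))) / L\<^sup>2
      = m * (real DIM('a) - 1) / L"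
    proof -
      have p: "(r / w - r * r / w ^ 3) / L\<^sup>2 = r / w ^ 3"
      proof -
        have "r / w - r * r / w ^ 3 = (r * (w\<^sup>2 - r)) / w ^ 3"
          using w(1) by (simp add: field_simps power2_eq_square power3_eq_cube)
        also have "w\<^sup>2 - r = L\<^sup>2" by (simp add: rr)
        finally show ?thesis by simp
      qed
      have q: "((w + L) - r / w) / L\<^sup>2 = 1 / L + 1 / w"
        unfolding rr using w(1) by (simp add: field_simps power2_eq_square)
      have X: "(- m * (r / w - r * r / w ^ 3) + (real DIM('a) - 1) * (m * (w + L) - m * (r / w))) / L\<^sup>2
        = - m * ((r / w - r * r / w ^ 3) / L\<^sup>2) + (real DIM('a) - 1) * m * (((w + L) - r / w) / L\<^sup>2)"
        by (simp only: add_divide_distrib right_diff_distrib times_divide_eq_right mult.assoc)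
      show ?thesis unfolding X p q by (simp add: divide_inverse algebra_simps)
    qed
    then show ?thesis
      unfolding EE_integral(2)[OF z] h1_def[symmetric] h2_def[symmetric]
      using A Bq m n L_pos by (smt (verit) divide_pos_pos mult_pos_pos)
  qed
  moreover have "(LINT s|lborel. JJ (line z s)) = - (1/2) * (LINT s|lborel. EE (line z s))"
    by (rule JJ_integral'(2)[OF z])
  ultimately show False using ancc[OF z] by simp
qed

end

section \<open>The null geodesics of anti-de Sitter space\<close>

context ads_line
begin

lemma graph_line_deriv: "((\<lambda>s. graph (line z s)) has_vector_derivative hk (line z s)) (at s)"
proof -
  have l: "((\<lambda>s. line z s) has_derivative (\<lambda>t. t *\<^sub>R x1)) (at s)"
    unfolding line_def by (rule has_derivative_eq_rhs) (rule derivative_eq_intros refl | simp)+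
  show ?thesis
    unfolding has_vector_derivative_def
    by (rule has_derivative_eq_rhs[OF has_derivative_compose[OF l graph_deriv]])
      (simp add: fun_eq_iff hk_eq linear_scale[OF dhor_linear])
qed

lemma hk_line_deriv:
  "((\<lambda>s. hk (line z s)) has_vector_derivative - ads_Gamma L (graph (line z s)) (hk (line z s)) (hk (line z s))) (at s)"
proof -
  have "((\<lambda>s. P (graph (line z s))) has_derivative (\<lambda>t. (phi (graph (line z s)) / L\<^sup>2) *\<^sub>R (t *\<^sub>R hk (line z s))
      - ads_Gamma L (graph (line z s)) (t *\<^sub>R hk (line z s)) (P (graph (line z s))))) (at s)"
    by (rule has_derivative_compose[OF graph_line_deriv[unfolded has_vector_derivative_def] P_deriv])
  then have "((\<lambda>s. hk (line z s)) has_derivative (\<lambda>t. - ads_Gamma L (graph (line z s)) (t *\<^sub>R hk (line z s)) (hk (line z s)))) (at s)"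
    by (simp add: P_graph phi_graph)
  moreover have "ads_Gamma L p (t *\<^sub>R u) v = t *\<^sub>R ads_Gamma L p u v" for p :: "real \<times> 'a" and t u v
    by (simp add: ads_Gamma_def metric_eq) (simp add: algebra_simps add_divide_distrib diff_divide_distrib)
  ultimately show ?thesis by (simp add: has_vector_derivative_def)
qed

lemma metric_time_hk: "ads_metric L (graph x) time_vec (hk x) = - w0 x / L"
  by (simp add: metric_eq time_vec_def graph_def hk_def field_simps power2_eq_square)

lemma complete_null_geodesic_line:
  "complete_null_geodesic L (\<lambda>s. graph (line z s))" "tangent (\<lambda>s. graph (line z s)) = (\<lambda>s. hk (line z s))"
proof -
  show t: "tangent (\<lambda>s. graph (line z s)) = (\<lambda>s. hk (line z s))"
    unfolding tangent_def[abs_def] using vector_derivative_at[OF graph_line_deriv] by simp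
  show "complete_null_geodesic L (\<lambda>s. graph (line z s))"
    unfolding complete_null_geodesic_def t cov_along_def christoffel_ads metric_time_hk hk_null
      vector_derivative_at[OF hk_line_deriv]
    using w0_pos L_pos
    by (auto intro: differentiableI_vector[OF graph_line_deriv] differentiableI_vector[OF hk_line_deriv])
qed

lemma wt_line: "z \<bullet> x1 = 0 \<Longrightarrow> wt L (line z s) = sqrt ((w0 z)\<^sup>2 + s\<^sup>2)"
  by (metis wt2_line wt_pos less_imp_le real_sqrt_unique)

lemma compactify_line_tendsto:
  assumes z: "z \<bullet> x1 = 0"
  shows "((\<lambda>s. compactify L (graph (line z s))) \<longlongrightarrow> (tm + L * (pi / 2), x1)) at_top"
proof -
  define W where "W = w0 z"
  have W: "W > 0" by (simp add: W_def w0_pos)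
  have L: "L > 0" by (rule L_pos)
  have "((\<lambda>s. tm + L * arctan (s / W)) \<longlongrightarrow> tm + L * (pi / 2)) at_top" using W by real_asymp
  moreover have "((\<lambda>s. inverse (L + sqrt (W\<^sup>2 + s\<^sup>2)) *\<^sub>R z + (s / (L + sqrt (W\<^sup>2 + s\<^sup>2))) *\<^sub>R x1) \<longlongrightarrow> 0 *\<^sub>R z + 1 *\<^sub>R x1) at_top"
    by (intro tendsto_add tendsto_scaleR tendsto_const) (use W L in real_asymp)+
  ultimately have "((\<lambda>s. (tm + L * arctan (s / W), inverse (L + sqrt (W\<^sup>2 + s\<^sup>2)) *\<^sub>R z + (s / (L + sqrt (W\<^sup>2 + s\<^sup>2))) *\<^sub>R x1))
      \<longlongrightarrow> (tm + L * (pi / 2), x1)) at_top"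
    using tendsto_Pair by fastforce
  moreover have "compactify L (graph (line z s)) = (tm + L * arctan (s / W), inverse (L + sqrt (W\<^sup>2 + s\<^sup>2)) *\<^sub>R z + (s / (L + sqrt (W\<^sup>2 + s\<^sup>2))) *\<^sub>R x1)" for s
    unfolding compactify_eq graph_def hor_def fst_conv snd_conv lam_line[OF z] w0_line[OF z] wt_line[OF z] W_def
    by (simp add: line_def scaleR_add_right divide_inverse mult.commute)
  ultimately show ?thesis by simp
qed

end

context ads
begin

text \<open>The spatial Christoffel symbols are proportional to the metric, so the Cartesian part of
  a null geodesic is a straight line. The null condition and the time orientation then determine the
  time component of the tangent, hence the geodesic up to the time offset \<open>tm\<close>.\<close>

lemma null_geodesic_cases:
  fixes \<gamma> :: "real \<Rightarrow> real \<times> 'a::euclidean_space"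
  assumes g: "complete_null_geodesic L \<gamma>"
  shows "\<exists>tm x1 z \<kappa> c. x1 \<bullet> x1 = 1 \<and> \<kappa> > 0 \<and> z \<bullet> x1 = 0 \<and>
    \<gamma> = (\<lambda>s. ads_line.graph L tm x1 (ads_line.line x1 z (\<kappa> * s + c)))"
proof -
  define k where "k = tangent \<gamma>"
  have gd: "(\<gamma> has_vector_derivative k s) (at s)" for s
    using g unfolding complete_null_geodesic_def k_def tangent_def
    by (simp add: vector_derivative_works[symmetric])
  define k' where "k' s = vector_derivative k (at s)" for s
  have kd: "(k has_vector_derivative k' s) (at s)" for s
    using g unfolding complete_null_geodesic_def k_def k'_def
    by (simp add: vector_derivative_works[symmetric])
  have geo: "k' s + ads_Gamma L (\<gamma> s) (k s) (k s) = 0" and null: "ads_metric L (\<gamma> s) (k s) (k s) = 0"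
    and fut: "ads_metric L (\<gamma> s) time_vec (k s) < 0" for s
    using g unfolding complete_null_geodesic_def cov_along_def christoffel_ads k'_def k_def by blast+
  have t': "fst (k s) > 0" for s
  proof -
    have "ads_metric L (\<gamma> s) time_vec (k s) = - ((wt L (snd (\<gamma> s)))\<^sup>2 / L\<^sup>2) * fst (k s)"
      by (simp add: metric_eq time_vec_def)
    then have "(wt L (snd (\<gamma> s)))\<^sup>2 / L\<^sup>2 * fst (k s) > 0" using fut[of s] by simp
    then show ?thesis by (simp add: zero_less_mult_iff zero_less_divide_iff)
  qed
  have fd: "((\<lambda>s. fst (\<gamma> s)) has_real_derivative fst (k s)) (at s)" for s
    using bounded_linear.has_vector_derivative[OF bounded_linear_fst gd]
    by (simp add: has_real_derivative_iff_has_vector_derivative)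
  have sd: "((\<lambda>s. snd (\<gamma> s)) has_vector_derivative snd (k s)) (at s)" for s
    by (rule bounded_linear.has_vector_derivative[OF bounded_linear_snd gd])
  have "snd (k' s) = 0" for s
    using arg_cong[OF geo[of s], of snd] by (simp add: ads_Gamma_def null)
  then have "((\<lambda>s. snd (k s)) has_vector_derivative 0) (at s)" for s
    using bounded_linear.has_vector_derivative[OF bounded_linear_snd kd[of s]] by simp
  then obtain b where b: "\<And>s. snd (k s) = b"
    using has_vector_derivative_zero_constant[of UNIV "\<lambda>s. snd (k s)"] by auto
  have "((\<lambda>s. snd (\<gamma> s) - s *\<^sub>R b) has_vector_derivative (snd (k s) - b)) (at s)" for s
    by (intro has_vector_derivative_diff sd) (auto intro!: derivative_eq_intros)
  then have "((\<lambda>s. snd (\<gamma> s) - s *\<^sub>R b) has_vector_derivative 0) (at s)" for s by (simp add: b)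
  then obtain a where "\<And>s. snd (\<gamma> s) - s *\<^sub>R b = a"
    using has_vector_derivative_zero_constant[of UNIV "\<lambda>s. snd (\<gamma> s) - s *\<^sub>R b"] by auto
  then have a: "snd (\<gamma> s) = a + s *\<^sub>R b" for s by (metis diff_add_cancel)
  define \<kappa> where "\<kappa> = norm b"
  have "b \<noteq> 0"
  proof
    assume "b = 0"
    then have "- ((wt L (snd (\<gamma> 0)))\<^sup>2 / L\<^sup>2) * fst (k 0) * fst (k 0) = 0"
      using null[of 0] by (simp add: metric_eq b)
    then show False using t'[of 0] by simp
  qed
  then have \<kappa>: "\<kappa> > 0" by (simp add: \<kappa>_def)
  define x1 where "x1 = (1 / \<kappa>) *\<^sub>R b"
  have x1: "x1 \<bullet> x1 = 1"
    using \<kappa> by (simp add: x1_def \<kappa>_def power2_norm_eq_inner[symmetric] power2_eq_square)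
  have bx: "b = \<kappa> *\<^sub>R x1" using \<kappa> by (simp add: x1_def)
  interpret l: ads_line L 0 x1 by standard (rule x1)
  \<comment> \<open>\<open>z\<close> is the foot of the perpendicular from the origin to the line,
    \<open>c\<close> the resulting offset of the parameter, and \<open>\<kappa>\<close> the constant
    Cartesian speed.\<close>
  define c where "c = a \<bullet> x1"
  define z where "z = a - c *\<^sub>R x1"
  have z: "z \<bullet> x1 = 0" by (simp add: z_def c_def inner_diff_left x1)
  have s: "snd (\<gamma> s) = l.line z (\<kappa> * s + c)" for s
    by (simp add: a bx z_def l.line_def algebra_simps)
  have ft: "fst (k s) = \<kappa> * l.dhor (snd (\<gamma> s)) x1" for s
  proof -
    define w where "w = wt L (snd (\<gamma> s))"
    define W where "W = l.w0 (snd (\<gamma> s))"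
    have w: "w > 0" "W > 0" "w \<noteq> 0" by (simp_all add: w_def W_def wt_pos l.w0_pos)
    have "- (w\<^sup>2 / L\<^sup>2) * fst (k s) * fst (k s) + \<kappa>\<^sup>2 - \<kappa>\<^sup>2 * (l.lam (snd (\<gamma> s)))\<^sup>2 / w\<^sup>2 = 0"
      using null[of s] by (simp add: metric_eq b bx x1 w_def l.lam_def power2_eq_square)
    also have "(l.lam (snd (\<gamma> s)))\<^sup>2 = w\<^sup>2 - W\<^sup>2" using l.wt2_w0[of "snd (\<gamma> s)"] by (simp add: w_def W_def)
    finally have "(w\<^sup>2 * fst (k s))\<^sup>2 = (\<kappa> * L * W)\<^sup>2"
      using w(3) by (simp add: field_simps power2_eq_square)
    then have "w\<^sup>2 * fst (k s) = \<kappa> * L * W"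
      using t'[of s] w \<kappa> L_pos by (simp add: power2_eq_iff_nonneg)
    then show ?thesis using w(3) by (simp add: l.dhor_x1 w_def W_def field_simps)
  qed
  have "((\<lambda>s. fst (\<gamma> s) - l.hor (snd (\<gamma> s))) has_real_derivative 0) (at s)" for s
  proof -
    have "((\<lambda>s. l.hor (snd (\<gamma> s))) has_real_derivative \<kappa> * l.dhor (snd (\<gamma> s)) x1) (at s)"
      unfolding has_field_derivative_def
      by (rule has_derivative_eq_rhs[OF has_derivative_compose[OF sd[unfolded has_vector_derivative_def] l.hor_deriv]])
        (simp add: fun_eq_iff b bx linear_scale[OF l.dhor_linear])
    from DERIV_diff[OF fd this] show ?thesis by (simp add: ft)
  qed
  then obtain tm where "\<And>s. fst (\<gamma> s) - l.hor (snd (\<gamma> s)) = tm"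
    using DERIV_isconst_all[of "\<lambda>s. fst (\<gamma> s) - l.hor (snd (\<gamma> s))"] by blast
  then have tm: "fst (\<gamma> s) = tm + l.hor (snd (\<gamma> s))" for s by (metis add.commute diff_add_cancel)
  interpret m: ads_line L tm x1 by standard (rule x1)
  have "m.hor x = tm + l.hor x" for x by (simp add: m.hor_def l.hor_def)
  then have "\<gamma> = (\<lambda>s. m.graph (m.line z (\<kappa> * s + c)))"
    by (simp add: fun_eq_iff prod_eq_iff m.graph_def tm s)
  then show ?thesis using x1 \<kappa> z by (intro exI[of _ tm] exI[of _ x1] exI[of _ z] exI[of _ \<kappa>] exI[of _ c]) simp
qed

end

section \<open>Decay of the source of the geodesic deviation equation\<close>

context admissible_horizon
begin

text \<open>The time derivative of the field \<open>P\<close> at a point of the horizon, obtained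
  from \<open>P_deriv\<close> with \<open>phi = 0\<close>.\<close>

definition dtP :: "'a \<Rightarrow> real \<times> 'a" where
  "dtP x = (- lam x / (wt L x)\<^sup>2, (- w0 x / L ^ 3) *\<^sub>R x)"

lemma RR_eq: "RR x = partial2 dg (graph x) (1, 0) (hk x) (hk x) + 2 * dg (graph x) (dtP x) (hk x)"
proof -
  have "- ads_Gamma L (graph x) (1, 0) (hk x) = dtP x"
    using metric_time_hk[of x]
    by (simp add: ads_Gamma_def time_vec_def dtP_def graph_def hk_def lam_def power3_eq_cube power2_eq_square)
  then have G: "(phi (graph x) / L\<^sup>2) *\<^sub>R (1, 0) - ads_Gamma L (graph x) (1, 0) (hk x) = dtP x"
    by (simp add: phi_graph flip: zero_prod_def)
  have "RR x = partial2 dg (graph x) (1, 0) (P (graph x)) (P (graph x))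
     + dg (graph x) ((phi (graph x) / L\<^sup>2) *\<^sub>R (1, 0) - ads_Gamma L (graph x) (1, 0) (P (graph x))) (P (graph x))
     + dg (graph x) (P (graph x)) ((phi (graph x) / L\<^sup>2) *\<^sub>R (1, 0) - ads_Gamma L (graph x) (1, 0) (P (graph x)))"
    unfolding RR_def H_def[abs_def]
    by (rule fun_cong[OF frechet_derivative_at[symmetric], OF h.tensor_has_derivative[OF P_deriv P_deriv]])
  then show ?thesis unfolding P_graph G h.commute[of "graph x" "hk x" "dtP x"] by simp
qed

lemma Sy_dtP: "Sy (-1) (\<lambda>x. push L (graph x) (dtP x) \<bullet> i)"
proof -
  have p: "push L (graph x) (dtP x) = (- lam x / (wt L x)\<^sup>2) *\<^sub>R (1, 0) + (- w0 x / L ^ 3) *\<^sub>R push L (graph x) (0, x)" for x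
  proof -
    have "dtP x = (- lam x / (wt L x)\<^sup>2) *\<^sub>R (1, 0) + (- w0 x / L ^ 3) *\<^sub>R (0, x)" by (simp add: dtP_def)
    moreover have "push L (graph x) (1, 0) = (1, 0)" by (simp add: push_eq)
    ultimately show ?thesis by (simp only: linear_add[OF push_linear] linear_scale[OF push_linear])
  qed
  have 1: "Sy (-1) (\<lambda>x. (- fst i) * (lam x * (inverse (wt L x) * inverse (wt L x))))"
    by (rule Sy_cmult) (use Sy_mult[OF Sy_lam Sy_mult[OF Sy_inv_wt Sy_inv_wt]] in simp)
  have 2: "Sy (-1) (\<lambda>x. (- 1 / L ^ 2) * (w0 x * ((inverse (wt L x) * inverse (L + wt L x)) * (x \<bullet> snd i))))"
    by (rule Sy_cmult) (use Sy_mult[OF Sy_w0 Sy_mult[OF Sy_mult[OF Sy_inv_wt Sy_inv_Lw] Sy_inner]] in simp)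
  have "push L (graph x) (dtP x) \<bullet> i = (- fst i) * (lam x * (inverse (wt L x) * inverse (wt L x)))
    + (- 1 / L ^ 2) * (w0 x * ((inverse (wt L x) * inverse (L + wt L x)) * (x \<bullet> snd i)))" for x
    unfolding p push_radial inner_prod_def by (simp add: field_simps power2_eq_square power3_eq_cube)
  then show ?thesis using Sy_add[OF 1 2] by simp
qed

text \<open>AdS is static: neither the conformal weight nor \<open>push\<close> depends on time, so
  a time derivative falls on \<open>hb\<close> alone and loses no decay.\<close>

lemma partial2_time:
  "partial2 dg (graph x) (1, 0) u v = (\<Sum>i\<in>Basis. \<Sum>j\<in>Basis. (wt L x)\<^sup>2 / L\<^sup>2 *
    ((push L (graph x) u \<bullet> i) * (push L (graph x) v \<bullet> j)) * frechet_derivative (\<lambda>q. hb q i j) (at (cg x)) (1, 0))"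
    (is "_ = ?R")
proof -
  have l: "((\<lambda>t. p + t *\<^sub>R (1, 0)) has_derivative (\<lambda>t. t *\<^sub>R (1, 0))) (at 0)" for p :: "real \<times> 'a"
    by (rule has_derivative_eq_rhs) (rule derivative_eq_intros refl | simp)+
  have l': "((\<lambda>t. F (p + t *\<^sub>R (1, 0))) has_real_derivative F' (1, 0)) (at 0)" if F: "(F has_derivative F') (at p)"
    for F :: "real \<times> 'a \<Rightarrow> real" and F' p
  proof -
    have "(F has_derivative F') (at (p + 0 *\<^sub>R (1, 0)))" unfolding scaleR_zero_left add_0_right by (rule F)
    from has_derivative_compose[OF l this] show ?thesis
      unfolding has_field_derivative_def linear_scale[OF has_derivative_linear[OF F]]
      by (rule has_derivative_eq_rhs) (simp add: fun_eq_iff mult.commute)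
  qed
  have "((\<lambda>t. dg (graph x + t *\<^sub>R (1, 0)) u v) has_real_derivative partial2 dg (graph x) (1, 0) u v) (at 0)"
    by (rule l'[OF h.D1])
  moreover have "dg (graph x + t *\<^sub>R (1, 0)) u v = (\<Sum>i\<in>Basis. \<Sum>j\<in>Basis. (wt L x)\<^sup>2 / L\<^sup>2 *
    ((push L (graph x) u \<bullet> i) * (push L (graph x) v \<bullet> j)) * hb (cg x + t *\<^sub>R (1, 0)) i j)" for t
  proof -
    have c: "compactify L (graph x + t *\<^sub>R (1, 0)) = cg x + t *\<^sub>R (1, 0)"
      by (simp add: compactify_eq cg_def graph_def)
    have p: "push L (graph x + t *\<^sub>R (1, 0)) = push L (graph x)"
      by (simp add: fun_eq_iff push_eq graph_def)
    show ?thesis unfolding dg_expand c p by (simp add: graph_def)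
  qed
  ultimately have "((\<lambda>t. \<Sum>i\<in>Basis. \<Sum>j\<in>Basis. (wt L x)\<^sup>2 / L\<^sup>2 *
    ((push L (graph x) u \<bullet> i) * (push L (graph x) v \<bullet> j)) * hb (cg x + t *\<^sub>R (1, 0)) i j)
      has_real_derivative partial2 dg (graph x) (1, 0) u v) (at 0)" by simp
  moreover have "((\<lambda>t. \<Sum>i\<in>Basis. \<Sum>j\<in>Basis. (wt L x)\<^sup>2 / L\<^sup>2 *
    ((push L (graph x) u \<bullet> i) * (push L (graph x) v \<bullet> j)) * hb (cg x + t *\<^sub>R (1, 0)) i j) has_real_derivative ?R) (at 0)"
    by (intro DERIV_sum DERIV_cmult l' hb_interior(1) cg_open)
  ultimately show ?thesis by (rule DERIV_unique)
qed

context
  fixes z :: 'a assumes z: "z \<bullet> x1 = 0"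
begin

lemma dec_Suc: "dec z (Suc n) f \<Longrightarrow> dec z n f"
proof -
  assume "dec z (Suc n) f"
  then obtain C where C: "\<And>s. \<bar>f s\<bar> \<le> C / wt L (line z s) ^ Suc n" unfolding dec_def[OF z] by blast
  have "\<bar>f s\<bar> \<le> (\<bar>C\<bar> / L) / wt L (line z s) ^ n" for s
  proof -
    define w where "w = wt L (line z s)"
    have w: "w > 0" "L \<le> w" by (simp_all add: w_def wt_pos wt_ge)
    have "\<bar>f s\<bar> \<le> C / w ^ Suc n" using C by (simp add: w_def)
    also have "\<dots> \<le> \<bar>C\<bar> / (L * w ^ n)"
      using w L_pos by (intro frac_le mult_mono) (auto intro: mult_right_mono)
    finally show ?thesis by (simp add: w_def)
  qed
  then show ?thesis unfolding dec_def[OF z] by blast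
qed

lemma dec_RR: "dec z 1 (\<lambda>s. RR (line z s))"
proof -
  have S: "Sy (- int 1) (\<lambda>x. dg (graph x) (dtP x) (hk x))"
    using Sy_dg[of "-1" dtP "-2" hk] Sy_dtP Sy_pk unfolding pk_def by simp
  obtain F1 F2 where c: "c2 (\<lambda>x. dg (graph x) (dtP x) (hk x)) F1 F2"
    using S unfolding Sy_def symb_def by blast
  have 2: "dec z 1 (\<lambda>s. dg (graph (line z s)) (dtP (line z s)) (hk (line z s)))" by (rule dec_Sy(1)[OF z S c])
  obtain C where C: "C \<ge> 0" and Cb: "\<And>x i j d. i \<in> Basis \<Longrightarrow> j \<in> Basis \<Longrightarrow> d \<in> Basis \<Longrightarrow> \<bar>frechet_derivative (\<lambda>q. hb q i j) (at (cg x)) d\<bar> \<le> C"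
    using hb_bounds by blast
  \<comment> \<open>On the line \<open>pk\<close> is \<open>kh\<close> times
    \<open>L * w0 z / wt\<^sup>2\<close>, and \<open>kh\<close> is bounded by
    \<open>1 + 1 / L\<close>.\<close>
  define A where "A = L * w0 z * (1 + 1 / L)"
  have A: "A \<ge> 0" using L_pos w0_pos[of z] by (simp add: A_def)
  have pkb: "\<bar>pk (line z s) \<bullet> i\<bar> \<le> A / (wt L (line z s))\<^sup>2" if "i \<in> Basis" for s i
  proof -
    have "pk (line z s) = (L * w0 z / (wt L (line z s))\<^sup>2) *\<^sub>R kh (line z s)"
      by (simp add: kh_def w0_ln[OF z])
    then have "\<bar>pk (line z s) \<bullet> i\<bar> = L * w0 z / (wt L (line z s))\<^sup>2 * \<bar>kh (line z s) \<bullet> i\<bar>"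
      using L_pos w0_pos[of z] by (simp add: abs_mult)
    also have "\<dots> \<le> L * w0 z / (wt L (line z s))\<^sup>2 * (1 + 1 / L)"
      using order_trans[OF Basis_le_norm[OF that] kh_bound] L_pos w0_pos[of z] by (intro mult_left_mono) auto
    finally show ?thesis by (simp add: A_def)
  qed
  have "dec z 2 (\<lambda>s. partial2 dg (graph (line z s)) (1, 0) (hk (line z s)) (hk (line z s)))"
    unfolding partial2_time pk_def[symmetric]
  proof (intro dec_sum[OF z] finite_Basis)
    fix i j :: "real \<times> 'a" assume ij: "i \<in> Basis" "j \<in> Basis"
    have "\<bar>(wt L (line z s))\<^sup>2 / L\<^sup>2 * ((pk (line z s) \<bullet> i) * (pk (line z s) \<bullet> j)) * frechet_derivative (\<lambda>q. hb q i j) (at (cg (line z s))) (1, 0)\<bar>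
       \<le> (A * A * C / L\<^sup>2) / wt L (line z s) ^ 2" for s
    proof -
      define w where "w = wt L (line z s)"
      have w: "w > 0" by (simp add: w_def wt_pos)
      have b: "((1::real), 0::'a) \<in> Basis" by (simp add: Basis_prod_def)
      have "\<bar>(pk (line z s) \<bullet> i) * (pk (line z s) \<bullet> j)\<bar> \<le> (A / w\<^sup>2) * (A / w\<^sup>2)"
        unfolding abs_mult w_def using A by (intro mult_mono pkb ij) auto
      then have "\<bar>(pk (line z s) \<bullet> i) * (pk (line z s) \<bullet> j) * frechet_derivative (\<lambda>q. hb q i j) (at (cg (line z s))) (1, 0)\<bar> \<le> ((A / w\<^sup>2) * (A / w\<^sup>2)) * C"
        unfolding abs_mult[of "_ * _"] using A by (intro mult_mono Cb ij b) auto
      then have "w\<^sup>2 / L\<^sup>2 * \<bar>(pk (line z s) \<bullet> i) * (pk (line z s) \<bullet> j) * frechet_derivative (\<lambda>q. hb q i j) (at (cg (line z s))) (1, 0)\<bar> \<le> w\<^sup>2 / L\<^sup>2 * (((A / w\<^sup>2) * (A / w\<^sup>2)) * C)"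
        by (intro mult_left_mono) auto
      also have "\<dots> = (A * A * C / L\<^sup>2) / w\<^sup>2" using w by (simp add: field_simps power2_eq_square)
      finally show ?thesis by (simp add: abs_mult w_def mult.assoc)
    qed
    then show "dec z 2 (\<lambda>s. (wt L (line z s))\<^sup>2 / L\<^sup>2 * ((pk (line z s) \<bullet> i) * (pk (line z s) \<bullet> j)) * frechet_derivative (\<lambda>q. hb q i j) (at (cg (line z s))) (1, 0))"
      unfolding dec_def[OF z] by blast
  qed
  then have 1: "dec z 1 (\<lambda>s. partial2 dg (graph (line z s)) (1, 0) (hk (line z s)) (hk (line z s)))"
    using dec_Suc[of 1] by (simp add: numeral_2_eq_2)
  show ?thesis unfolding RR_eq by (intro dec_add[OF z] dec_cmult[OF z] 1 2)
qed

text \<open>These are the two source terms in the second-order equation for a Cartesian component of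
  the deviation vector. That they tend to zero makes the component grow more slowly than
  quadratically.\<close>

lemma dec_source:
  "dec z 1 (\<lambda>s. (line z s \<bullet> e) * HH (line z s))" "dec z 1 (\<lambda>s. snd (Z (graph (line z s))) \<bullet> e)"
proof -
  have xe: "line z s \<bullet> e = z \<bullet> e + s * (x1 \<bullet> e)" for s by (simp add: line_def inner_add_left)
  have M0: "Sy (- int 0) (MM e)" using Sy_MM_gen by simp
  have H2: "Sy (- int 2) HH" using Sy_HH by simp
  have pz: "perp z = z" using z by (simp add: perp_def lam_def)
  have x: "HH1 (line z s) (line z s) = HH1 (line z s) (perp z) + s * HH1 (line z s) x1" for s
    using linear_add[OF linear_c2D1[OF c2_HH], of "line z s" z "s *\<^sub>R x1"] linear_scale[OF linear_c2D1[OF c2_HH], of "line z s" s x1]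
    by (simp add: pz line_def)
  have e: "HH1 (line z s) e = HH1 (line z s) (perp e) + (e \<bullet> x1) * HH1 (line z s) x1" for s
    using linear_add[OF linear_c2D1[OF c2_HH], of "line z s" "perp e" "(e \<bullet> x1) *\<^sub>R x1"] linear_scale[OF linear_c2D1[OF c2_HH], of "line z s" "e \<bullet> x1" x1]
    by (simp add: perp_def lam_def)
  have m: "dec z 2 f \<Longrightarrow> dec z 1 f" "dec z 3 f \<Longrightarrow> dec z 2 f" for f
    using dec_Suc[of 1 f] dec_Suc[of 2 f] by (simp_all add: numeral_2_eq_2 numeral_3_eq_3)
  have t: "dec z 2 f \<Longrightarrow> dec z 1 (\<lambda>s. s * f s)" "dec z 3 f \<Longrightarrow> dec z 2 (\<lambda>s. s * f s)" for f
    using dec_s[OF z, of 1 f] dec_s[OF z, of 2 f] by (simp_all add: numeral_2_eq_2 numeral_3_eq_3)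
  have h0: "dec z 2 (\<lambda>s. HH (line z s))" by (rule dec_Sy(1)[OF z H2 c2_HH])
  have h1: "dec z 3 (\<lambda>s. HH1 (line z s) x1)" using dec_Sy(2)[OF z H2 c2_HH] by (simp add: numeral_3_eq_3 numeral_2_eq_2)
  have hp: "dec z 2 (\<lambda>s. HH1 (line z s) (perp v))" for v by (rule dec_Sy(3)[OF z H2 c2_HH])
  have m1: "dec z 1 (\<lambda>s. MM1 e (line z s) x1)" using dec_Sy(2)[OF z M0 c2_MM] by simp
  have hx: "dec z 2 (\<lambda>s. HH1 (line z s) (line z s))" unfolding x by (intro dec_add[OF z] hp t h1)
  have xf: "dec z 1 (\<lambda>s. (line z s \<bullet> e) * f s)" if "dec z 2 f" for f
  proof -
    have "dec z 1 (\<lambda>s. (z \<bullet> e) * f s + (x1 \<bullet> e) * (s * f s))"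
      by (intro dec_add[OF z] dec_cmult[OF z] m t that)
    then show ?thesis by (simp add: xe algebra_simps)
  qed
  show "dec z 1 (\<lambda>s. (line z s \<bullet> e) * HH (line z s))" by (rule xf[OF h0])
  have he: "dec z 1 (\<lambda>s. HH1 (line z s) e)" unfolding e by (intro dec_add[OF z] dec_cmult[OF z] m hp h1)
  have "dec z 1 (\<lambda>s. MM1 e (line z s) x1 - (1 / L\<^sup>2) * ((line z s \<bullet> e) * HH (line z s))
     - ((1/2) * HH1 (line z s) e + (1 / (L\<^sup>2 * 2)) * ((line z s \<bullet> e) * HH1 (line z s) (line z s)))
     + (L / (2 * w0 z) * (x1 \<bullet> e)) * RR (line z s))"
    by (intro dec_add[OF z] dec_diff[OF z] dec_cmult[OF z] m1 he xf h0 hx dec_RR)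
  then show "dec z 1 (\<lambda>s. snd (Z (graph (line z s))) \<bullet> e)"
    unfolding Z_graph[OF c2_HH c2_MM] w0_ln[OF z] by (simp add: add_divide_distrib mult.assoc)
qed

end

end

section \<open>Geodesic deviation along a generator\<close>

lemma filterlim_affine_at_top: "\<kappa> > 0 \<Longrightarrow> filterlim (\<lambda>s::real. \<kappa> * s + c) at_top at_top"
  by real_asymp

text \<open>Two applications of l'Hospital's rule; the affine denominator is the parameter of an
  arbitrarily parametrized generator.\<close>

lemma tendsto_over_square:
  fixes u :: "real \<Rightarrow> real"
  assumes \<kappa>: "\<kappa> > 0" and u: "\<And>s. (u has_real_derivative u1 s) (at s)" "\<And>s. (u1 has_real_derivative u2 s) (at s)"
    and lim: "(u2 \<longlongrightarrow> 0) at_top"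
  shows "((\<lambda>s. u s / (\<kappa> * s + c)\<^sup>2) \<longlongrightarrow> 0) at_top"
proof -
  have l: "filterlim (\<lambda>s. \<kappa> * s + c) at_top at_top" by (rule filterlim_affine_at_top[OF \<kappa>])
  have ev: "eventually (\<lambda>s. \<kappa> * s + c > 0) at_top"
    using l unfolding filterlim_at_top_dense by blast
  have 1: "((\<lambda>s. u1 s / (\<kappa> * s + c)) \<longlongrightarrow> 0) at_top"
  proof (rule lhospital_at_top_at_top[where f' = u2 and g' = "\<lambda>_. \<kappa>", OF l])
    show "((\<lambda>s. u2 s / \<kappa>) \<longlongrightarrow> 0) at_top" using tendsto_divide[OF lim tendsto_const[of \<kappa>]] \<kappa> by simp
  qed (use \<kappa> u in \<open>auto intro!: always_eventually derivative_eq_intros\<close>)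
  show ?thesis
  proof (rule lhospital_at_top_at_top[where f' = u1 and g' = "\<lambda>s. 2 * \<kappa> * (\<kappa> * s + c)"])
    show "filterlim (\<lambda>s. (\<kappa> * s + c)\<^sup>2) at_top at_top"
      unfolding power2_eq_square by (rule filterlim_at_top_mult_at_top[OF l l])
    show "eventually (\<lambda>s. 2 * \<kappa> * (\<kappa> * s + c) \<noteq> 0) at_top" using ev by eventually_elim (use \<kappa> in auto)
    have "((\<lambda>s. (1 / (2 * \<kappa>)) * (u1 s / (\<kappa> * s + c))) \<longlongrightarrow> (1 / (2 * \<kappa>)) * 0) at_top"
      by (intro tendsto_mult tendsto_const 1)
    then show "((\<lambda>s. u1 s / (2 * \<kappa> * (\<kappa> * s + c))) \<longlongrightarrow> 0) at_top" by simp
  qed (use u in \<open>auto intro!: always_eventually derivative_eq_intros\<close>)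
qed

lemma push_coefficients:
  fixes L w W l a b V :: real
  assumes w: "w > 0" and V: "V > 0" "V = L + w" and W: "W\<^sup>2 = w\<^sup>2 - l\<^sup>2"
  shows "(L + W\<^sup>2 / w) * (inverse V * a - b * inverse w * (inverse V)\<^sup>2 * l)
      - (l / w) * (inverse V * (b - l * a) - b * inverse w * (inverse V)\<^sup>2 * (w\<^sup>2 - L\<^sup>2 - l\<^sup>2)) = a - l * b / w\<^sup>2"
proof -
  have L: "L = V - w" using V by simp
  show ?thesis
    unfolding W L using w V(1) by (simp add: field_simps power2_eq_square)
qed

context ads_line
begin

text \<open>Written with the pushed vector, the pairing has coefficients that converge at both ends
  of a generator, so its limits follow from those of the pushed deviation vector.\<close>

lemma metric_hk_push:
  "ads_metric L (graph x) (hk x) u = - (w0 x / L) * fst (push L (graph x) u)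
    + ((L + (w0 x)\<^sup>2 / wt L x) *\<^sub>R x1 - (lam x / wt L x) *\<^sub>R perp x) \<bullet> snd (push L (graph x) u)"
proof -
  define w where "w = wt L x"
  define V where "V = L + w"
  define a where "a = x1 \<bullet> snd u"
  define b where "b = x \<bullet> snd u"
  have w: "w > 0" "V > 0" by (simp_all add: w_def V_def wt_pos Lw_pos)
  have W: "(w0 x)\<^sup>2 = w\<^sup>2 - (lam x)\<^sup>2" by (simp add: wt2_w0 w_def)
  have p: "snd (push L (graph x) u) = inverse V *\<^sub>R snd u - (b * inverse w * (inverse V)\<^sup>2) *\<^sub>R x"
    by (simp add: push_eq graph_def b_def w_def V_def)
  have "x1 \<bullet> snd (push L (graph x) u) = inverse V * a - b * inverse w * (inverse V)\<^sup>2 * lam x"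
    unfolding p by (simp add: inner_diff_right a_def lam_def inner_commute)
  moreover have "perp x \<bullet> x = w\<^sup>2 - L\<^sup>2 - (lam x)\<^sup>2"
    using inner_wt[of x] by (simp add: perp_def inner_diff_left w_def lam_def inner_commute[of x1] power2_eq_square)
  then have "perp x \<bullet> snd (push L (graph x) u) = inverse V * (b - lam x * a) - b * inverse w * (inverse V)\<^sup>2 * (w\<^sup>2 - L\<^sup>2 - (lam x)\<^sup>2)"
    unfolding p inner_diff_right inner_scaleR_right by (simp add: perp_def inner_diff_left a_def b_def)
  ultimately have "((L + (w0 x)\<^sup>2 / w) *\<^sub>R x1 - (lam x / w) *\<^sub>R perp x) \<bullet> snd (push L (graph x) u) = a - lam x * b / w\<^sup>2"
    unfolding inner_diff_left inner_scaleR_left using push_coefficients[OF w(1,2) V_def W] by simp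
  moreover have "ads_metric L (graph x) (hk x) u = - (w0 x / L) * fst u + (a - lam x * b / w\<^sup>2)"
    using w(1) by (simp add: metric_eq graph_def hk_def a_def b_def lam_def w_def power2_eq_square)
  ultimately show ?thesis by (simp add: w_def push_eq)
qed

text \<open>\<open>x1\<close> is normal to the boundary at the endpoint. Along a generator both
  coefficients decay like the inverse square of the parameter, which is what the growth bound on the
  deviation vector is matched against.\<close>

lemma push_x1:
  "x1 \<bullet> snd (push L (graph x) u) = (x1 \<bullet> snd u) * (((w0 x)\<^sup>2 + L * wt L x) / (wt L x * (L + wt L x)\<^sup>2))
     - (perp x \<bullet> snd u) * (lam x / (wt L x * (L + wt L x)\<^sup>2))"
proof -
  define w where "w = wt L x"
  define V where "V = L + w"
  define a where "a = x1 \<bullet> snd u"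
  have w: "w > 0" "V > 0" by (simp_all add: w_def V_def wt_pos Lw_pos)
  have W: "(w0 x)\<^sup>2 = w * w - lam x * lam x" using wt2_w0[of x] by (simp add: w_def power2_eq_square)
  have b: "x \<bullet> snd u = perp x \<bullet> snd u + lam x * a" by (simp add: perp_def inner_diff_left a_def)
  have "x1 \<bullet> snd (push L (graph x) u) = inverse V * a - (x \<bullet> snd u) * inverse w * (inverse V)\<^sup>2 * lam x"
    by (simp add: push_eq graph_def a_def w_def V_def inner_diff_right lam_def inner_commute)
  also have "\<dots> = a * ((w * V - lam x * lam x) / (w * V\<^sup>2)) - (perp x \<bullet> snd u) * (lam x / (w * V\<^sup>2))"
    unfolding b using w by (simp add: field_simps power2_eq_square)
  also have "w * V - lam x * lam x = (w0 x)\<^sup>2 + L * w" unfolding W V_def by (simp add: algebra_simps)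
  finally show ?thesis by (simp add: a_def w_def V_def)
qed

end

context admissible_horizon
begin

context
  fixes z :: 'a and \<kappa> c :: real and \<eta> :: "real \<Rightarrow> real \<times> 'a" and v :: "real \<times> 'a" and \<gamma>
  defines "\<gamma> \<equiv> \<lambda>s. graph (line z (\<kappa> * s + c))"
  assumes z: "z \<bullet> x1 = 0" and \<kappa>: "\<kappa> > 0"
    and dev: "deviation_vector L dg \<gamma> \<eta>" and lim: "((\<lambda>s. push L (\<gamma> s) (\<eta> s)) \<longlongrightarrow> v) at_top"
begin

section \<open>The deviation equation in Cartesian components and its limit\<close>

definition "X s = line z (\<kappa> * s + c)"
definition "kk s = \<kappa> *\<^sub>R hk (X s)"
definition "NN = cov_along (ads_metric L) \<gamma> \<eta>"
definition "GG s = ads_metric L (\<gamma> s) (kk s) (\<eta> s)"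

lemma \<gamma>_eq: "\<gamma> s = graph (X s)"
  by (simp add: \<gamma>_def X_def)

lemma snd_\<gamma>: "snd (\<gamma> s) = X s"
  by (simp add: \<gamma>_eq graph_def)

lemma affine_deriv: "((\<lambda>s. \<kappa> * s + c) has_vector_derivative \<kappa>) (at s)"
  unfolding has_real_derivative_iff_has_vector_derivative[symmetric] by (auto intro!: derivative_eq_intros)

lemma \<gamma>_deriv: "(\<gamma> has_vector_derivative kk s) (at s)"
  using vector_diff_chain_at[OF affine_deriv[of s] graph_line_deriv[of z]] by (simp add: \<gamma>_def o_def kk_def X_def)

lemma tangent_\<gamma>: "tangent \<gamma> s = kk s"
  unfolding tangent_def by (rule vector_derivative_at[OF \<gamma>_deriv])

lemma Gamma_scale: "ads_Gamma L p (a *\<^sub>R u) (b *\<^sub>R w) = (a * b) *\<^sub>R ads_Gamma L p u w"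
  by (simp add: ads_Gamma_def metric_eq) (simp add: algebra_simps add_divide_distrib diff_divide_distrib)

lemma kk_deriv: "(kk has_vector_derivative - ads_Gamma L (\<gamma> s) (kk s) (kk s)) (at s)"
proof -
  have "((\<lambda>s. hk (line z (\<kappa> * s + c))) has_vector_derivative \<kappa> *\<^sub>R - ads_Gamma L (\<gamma> s) (hk (X s)) (hk (X s))) (at s)"
    using vector_diff_chain_at[OF affine_deriv[of s] hk_line_deriv[of z]] by (simp add: \<gamma>_def o_def X_def)
  then have "((\<lambda>s. \<kappa> *\<^sub>R hk (line z (\<kappa> * s + c))) has_vector_derivative \<kappa> *\<^sub>R (\<kappa> *\<^sub>R - ads_Gamma L (\<gamma> s) (hk (X s)) (hk (X s)))) (at s)"
    by (rule bounded_linear.has_vector_derivative[OF bounded_linear_scaleR_right])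
  then show ?thesis unfolding kk_def[abs_def] Gamma_scale by (simp add: X_def)
qed

lemma dg_kk: "dg (\<gamma> s) (kk s) (kk s) = \<kappa>\<^sup>2 * HH (X s)"
  unfolding HH_eq kk_def \<gamma>_eq by (simp add: bilinear_lmul[OF h.bil] bilinear_rmul[OF h.bil] power2_eq_square)

lemma deviation_facts:
  "\<eta> differentiable (at s)" "NN differentiable (at s)"
  "cov_along (ads_metric L) \<gamma> NN s + riemann (ads_metric L) (\<gamma> s) (kk s) (\<eta> s) (kk s)
            = - delta_christoffel (ads_metric L) dg (\<gamma> s) (kk s) (kk s)"
  "(GG has_real_derivative - (1/2) * (\<kappa>\<^sup>2 * HH (X s))) (at s)"
  "((\<lambda>s. push L (\<gamma> s) (\<eta> s)) \<longlongrightarrow> 0) at_bot"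
  using dev unfolding deviation_vector_def Let_def tangent_\<gamma> NN_def[symmetric] GG_def[abs_def, symmetric] dg_kk by blast+

lemma \<eta>_deriv: "(\<eta> has_vector_derivative NN s - ads_Gamma L (\<gamma> s) (kk s) (\<eta> s)) (at s)"
  using deviation_facts(1)[of s] unfolding NN_def cov_along_def christoffel_ads tangent_\<gamma>
  by (simp add: vector_derivative_works[symmetric])

text \<open>The linearized null condition, with the derivative moved onto the deviation vector by
  metric compatibility and the geodesic equation.\<close>

lemma metric_kk_NN: "ads_metric L (\<gamma> s) (kk s) (NN s) = - (1/2) * (\<kappa>\<^sup>2 * HH (X s))"
proof -
  have B: "((\<lambda>q. ads_metric L (\<gamma> q) a b) has_derivative (\<lambda>d. partial2 (ads_metric L) (\<gamma> s) (d *\<^sub>R kk s) a b)) (at s)" for a b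
    by (rule has_derivative_compose[OF \<gamma>_deriv[unfolded has_vector_derivative_def] metric.D1])
  have "(GG has_derivative (\<lambda>d. partial2 (ads_metric L) (\<gamma> s) (d *\<^sub>R kk s) (kk s) (\<eta> s)
      + ads_metric L (\<gamma> s) (d *\<^sub>R - ads_Gamma L (\<gamma> s) (kk s) (kk s)) (\<eta> s)
      + ads_metric L (\<gamma> s) (kk s) (d *\<^sub>R (NN s - ads_Gamma L (\<gamma> s) (kk s) (\<eta> s))))) (at s)"
    unfolding GG_def[abs_def]
    by (rule bilinear_param_has_derivative[OF always_eventually B kk_deriv[unfolded has_vector_derivative_def] \<eta>_deriv[unfolded has_vector_derivative_def]])
      (simp add: metric_bil)
  from fun_cong[OF has_derivative_unique[OF this deviation_facts(4)[unfolded has_field_derivative_def]], of 1]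
  have "partial2 (ads_metric L) (\<gamma> s) (kk s) (kk s) (\<eta> s)
      + ads_metric L (\<gamma> s) (- ads_Gamma L (\<gamma> s) (kk s) (kk s)) (\<eta> s)
      + ads_metric L (\<gamma> s) (kk s) (NN s - ads_Gamma L (\<gamma> s) (kk s) (\<eta> s)) = - (1/2) * (\<kappa>\<^sup>2 * HH (X s))"
    by simp
  then show ?thesis
    unfolding metric_compatible by (simp add: bilinear_lneg[OF metric_bil] bilinear_rsub[OF metric_bil])
qed

lemma snd_Gamma: "snd (ads_Gamma L (\<gamma> s) a b) \<bullet> e = - (ads_metric L (\<gamma> s) a b / L\<^sup>2) * (X s \<bullet> e)"
  by (simp add: ads_Gamma_def snd_\<gamma>)

lemma blin_snd: "bounded_linear (\<lambda>p::real \<times> 'a. snd p \<bullet> e)"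
  by (rule bounded_linear_compose[OF bounded_linear_inner_left bounded_linear_snd])

lemma \<eta>_component_deriv:
  "((\<lambda>s. snd (\<eta> s) \<bullet> e) has_real_derivative snd (NN s) \<bullet> e + GG s / L\<^sup>2 * (X s \<bullet> e)) (at s)"
  using bounded_linear.has_vector_derivative[OF blin_snd[of e] \<eta>_deriv[of s]]
  unfolding has_real_derivative_iff_has_vector_derivative snd_diff inner_diff_left snd_Gamma GG_def by simp

text \<open>The curvature term along \<open>kk\<close> cancels against the derivative of
  \<open>X s\<close> in the connection term, and the two contributions of \<open>HH\<close> add up.
  What remains no longer contains \<open>\<eta>\<close>, so the growth of each Cartesian component
  is governed by known sources.\<close>

lemma \<eta>_component_deriv2:
  "((\<lambda>s. snd (NN s) \<bullet> e + GG s / L\<^sup>2 * (X s \<bullet> e)) has_real_derivative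
     - (\<kappa>\<^sup>2 / L\<^sup>2) * ((X s \<bullet> e) * HH (X s)) - \<kappa>\<^sup>2 * (snd (Z (\<gamma> s)) \<bullet> e)) (at s)"
proof -
  define N' where "N' = vector_derivative NN (at s)"
  have N': "(NN has_vector_derivative N') (at s)"
    using deviation_facts(2)[of s] by (simp add: N'_def vector_derivative_works[symmetric])
  have C: "delta_christoffel (ads_metric L) dg (\<gamma> s) (kk s) (kk s) = \<kappa>\<^sup>2 *\<^sub>R Z (\<gamma> s)"
    unfolding kk_def Z_def by (simp add: \<gamma>_eq P_graph bilinear_lmul[OF C_bil] bilinear_rmul[OF C_bil] power2_eq_square)
  have R: "riemann (ads_metric L) (\<gamma> s) (kk s) (\<eta> s) (kk s) = (GG s / L\<^sup>2) *\<^sub>R kk s"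
    using hk_null[of "X s"]
    by (simp add: riemann_ads GG_def metric_commute[of "\<gamma> s" "\<eta> s"])
      (simp add: kk_def \<gamma>_eq bilinear_lmul[OF metric_bil] bilinear_rmul[OF metric_bil])
  have "N' + ads_Gamma L (\<gamma> s) (kk s) (NN s) + (GG s / L\<^sup>2) *\<^sub>R kk s = - (\<kappa>\<^sup>2 *\<^sub>R Z (\<gamma> s))"
    using deviation_facts(3)[of s] unfolding R C cov_along_def christoffel_ads tangent_\<gamma> N'_def .
  then have "N' = - (\<kappa>\<^sup>2 *\<^sub>R Z (\<gamma> s)) - (GG s / L\<^sup>2) *\<^sub>R kk s - ads_Gamma L (\<gamma> s) (kk s) (NN s)"
    by (metis add_diff_cancel_right' diff_diff_add add.commute)
  then have N: "snd N' \<bullet> e = - \<kappa>\<^sup>2 * (snd (Z (\<gamma> s)) \<bullet> e) - GG s / L\<^sup>2 * (\<kappa> * (x1 \<bullet> e)) - (\<kappa>\<^sup>2 * HH (X s)) / (2 * L\<^sup>2) * (X s \<bullet> e)"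
    by (simp add: inner_diff_left snd_Gamma metric_kk_NN) (simp add: kk_def hk_def)
  have d1: "((\<lambda>s. snd (NN s) \<bullet> e) has_real_derivative snd N' \<bullet> e) (at s)"
    using bounded_linear.has_vector_derivative[OF blin_snd N']
    by (simp add: has_real_derivative_iff_has_vector_derivative)
  have d2: "((\<lambda>s. X s \<bullet> e) has_real_derivative \<kappa> * (x1 \<bullet> e)) (at s)"
    unfolding X_def[abs_def] line_def inner_add_left inner_scaleR_left by (auto intro!: derivative_eq_intros)
  show ?thesis
    by (rule DERIV_cong[OF DERIV_add[OF d1 DERIV_mult[OF DERIV_cdivide[OF deviation_facts(4)] d2]]])
      (simp add: N field_simps)
qed

lemma \<eta>_growth: "((\<lambda>s. snd (\<eta> s) \<bullet> e / (\<kappa> * s + c)\<^sup>2) \<longlongrightarrow> 0) at_top"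
proof (rule tendsto_over_square[OF \<kappa> \<eta>_component_deriv \<eta>_component_deriv2])
  have t: "((\<lambda>s. f (\<kappa> * s + c)) \<longlongrightarrow> 0) at_top" if "dec z 1 f" for f
    by (rule filterlim_compose[OF dec_1_tendsto(1)[OF z that] filterlim_affine_at_top[OF \<kappa>]])
  have "((\<lambda>s. - (\<kappa>\<^sup>2 / L\<^sup>2) * ((X s \<bullet> e) * HH (X s)) - \<kappa>\<^sup>2 * (snd (Z (\<gamma> s)) \<bullet> e)) \<longlongrightarrow> - (\<kappa>\<^sup>2 / L\<^sup>2) * 0 - \<kappa>\<^sup>2 * 0) at_top"
    using t[OF dec_source(1)[OF z, of e]] t[OF dec_source(2)[OF z, of e]]
    by (intro tendsto_diff tendsto_mult tendsto_const) (simp_all add: X_def \<gamma>_def)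
  then show "((\<lambda>s. - (\<kappa>\<^sup>2 / L\<^sup>2) * ((X s \<bullet> e) * HH (X s)) - \<kappa>\<^sup>2 * (snd (Z (\<gamma> s)) \<bullet> e)) \<longlongrightarrow> 0) at_top" by simp
qed

text \<open>The \<open>x1\<close> component of the pushed vector combines Cartesian components with
  coefficients of inverse square order, and by \<open>\<eta>_growth\<close> those components are of
  smaller order than the square. The limits \<open>L\<close> and 1 of \<open>f1\<close> and
  \<open>f2\<close> make this precise.\<close>

lemma deviation_tangential: "x1 \<bullet> snd v = 0"
proof -
  define W where "W = w0 z"
  have W: "W > 0" and L: "L > 0" by (simp_all add: W_def w0_pos L_pos)
  define f1 where "f1 l = l\<^sup>2 * ((W\<^sup>2 + L * sqrt (W\<^sup>2 + l\<^sup>2)) / (sqrt (W\<^sup>2 + l\<^sup>2) * (L + sqrt (W\<^sup>2 + l\<^sup>2))\<^sup>2))" for l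
  define f2 where "f2 l = l\<^sup>2 * (l / (sqrt (W\<^sup>2 + l\<^sup>2) * (L + sqrt (W\<^sup>2 + l\<^sup>2))\<^sup>2))" for l
  have f: "(f1 \<longlongrightarrow> L) at_top" "(f2 \<longlongrightarrow> 1) at_top"
    unfolding f1_def f2_def using W L by real_asymp+
  note la = filterlim_affine_at_top[OF \<kappa>, of c]
  have "((\<lambda>s. (snd (\<eta> s) \<bullet> x1 / (\<kappa> * s + c)\<^sup>2) * f1 (\<kappa> * s + c) - (snd (\<eta> s) \<bullet> z / (\<kappa> * s + c)\<^sup>2) * f2 (\<kappa> * s + c))
      \<longlongrightarrow> 0 * L - 0 * 1) at_top"
    by (intro tendsto_diff tendsto_mult \<eta>_growth filterlim_compose[OF f(1) la] filterlim_compose[OF f(2) la])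
  moreover have "eventually (\<lambda>s. (snd (\<eta> s) \<bullet> x1 / (\<kappa> * s + c)\<^sup>2) * f1 (\<kappa> * s + c) - (snd (\<eta> s) \<bullet> z / (\<kappa> * s + c)\<^sup>2) * f2 (\<kappa> * s + c)
      = x1 \<bullet> snd (push L (\<gamma> s) (\<eta> s))) at_top"
  proof -
    have "eventually (\<lambda>s. \<kappa> * s + c > 0) at_top" using la unfolding filterlim_at_top_dense by blast
    then show ?thesis
    proof eventually_elim
      case (elim s)
      then show ?case
        unfolding \<gamma>_def push_x1 lam_line[OF z] perp_line[OF z] w0_line[OF z] wt_line[OF z] f1_def f2_def W_def[symmetric]
        by (simp add: inner_commute)
    qed
  qed
  ultimately have "((\<lambda>s. x1 \<bullet> snd (push L (\<gamma> s) (\<eta> s))) \<longlongrightarrow> 0) at_top"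
    by (simp add: Lim_transform_eventually)
  moreover have "((\<lambda>s. x1 \<bullet> snd (push L (\<gamma> s) (\<eta> s))) \<longlongrightarrow> x1 \<bullet> snd v) at_top"
    by (intro tendsto_intros lim)
  ultimately show ?thesis using tendsto_unique[OF trivial_limit_at_top_linorder] by blast
qed

text \<open>The pairing of \<open>hk\<close> with the deviation vector has derivative
  \<open>- HH / 2\<close> along the line. It vanishes at the start by the initial condition and
  tends to the right-hand side at the end.\<close>

lemma deviation_limit: "- (1/2) * ff z = - (w0 z / L) * fst v + (L *\<^sub>R x1 - z) \<bullet> snd v"
proof -
  define W where "W = w0 z"
  have W: "W > 0" and L: "L > 0" by (simp_all add: W_def w0_pos L_pos)
  define S where "S l = (l - c) / \<kappa>" for l
  have S: "\<kappa> * S l + c = l" for l using \<kappa> by (simp add: S_def)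
  have St: "filterlim S at_top at_top" "filterlim S at_bot at_bot"
    unfolding S_def using \<kappa> by real_asymp+
  define B where "B l = ads_metric L (graph (line z l)) (hk (line z l)) (\<eta> (S l))" for l
  have GB: "GG s = \<kappa> * B (\<kappa> * s + c)" for s
  proof -
    have "S (\<kappa> * s + c) = s" using \<kappa> by (simp add: S_def)
    then show ?thesis by (simp add: GG_def B_def kk_def \<gamma>_def X_def bilinear_lmul[OF metric_bil])
  qed
  then have B: "B l = (1 / \<kappa>) * GG (S l)" for l using GB[of "S l"] \<kappa> by (simp add: S)
  have dB: "(B has_real_derivative - (1/2) * HH (line z l)) (at l)" for l
  proof -
    have "(S has_real_derivative 1 / \<kappa>) (at l)" unfolding S_def[abs_def] by (auto intro!: derivative_eq_intros simp: divide_inverse)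
    from DERIV_chain2[OF deviation_facts(4) this]
    have "((\<lambda>l. GG (S l)) has_real_derivative - (1/2) * (\<kappa>\<^sup>2 * HH (X (S l))) * (1 / \<kappa>)) (at l)" .
    from DERIV_cmult[OF this, of "1 / \<kappa>"] show ?thesis
      unfolding B[abs_def] using \<kappa> by (simp add: X_def S power2_eq_square)
  qed
  obtain C where "C \<ge> 0" and C: "\<And>s. \<bar>HH (line z s)\<bar> \<le> C / (1 + s\<^sup>2)" using HH_bound_tube[of "norm z"] z by blast
  have Cb: "\<bar>- (1/2) * HH (line z s)\<bar> \<le> C / (1 + s\<^sup>2)" for s
  proof -
    have "\<bar>- (1/2) * HH (line z s)\<bar> \<le> \<bar>HH (line z s)\<bar>" by simp
    then show ?thesis using C[of s] by (rule order_trans)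
  qed
  have Bp: "B l = - (W / L) * fst (push L (\<gamma> (S l)) (\<eta> (S l)))
    + ((L + W\<^sup>2 / sqrt (W\<^sup>2 + l\<^sup>2)) *\<^sub>R x1 - (l / sqrt (W\<^sup>2 + l\<^sup>2)) *\<^sub>R z) \<bullet> snd (push L (\<gamma> (S l)) (\<eta> (S l)))" for l
    unfolding B_def metric_hk_push lam_line[OF z] perp_line[OF z] w0_line[OF z] wt_line[OF z] \<gamma>_def S W_def ..
  have p: "((\<lambda>l. push L (\<gamma> (S l)) (\<eta> (S l))) \<longlongrightarrow> v) at_top" "((\<lambda>l. push L (\<gamma> (S l)) (\<eta> (S l))) \<longlongrightarrow> 0) at_bot"
    by (rule filterlim_compose[OF lim St(1)], rule filterlim_compose[OF deviation_facts(5) St(2)])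
  have top: "((\<lambda>l. W\<^sup>2 / sqrt (W\<^sup>2 + l\<^sup>2)) \<longlongrightarrow> 0) at_top" "((\<lambda>l. l / sqrt (W\<^sup>2 + l\<^sup>2)) \<longlongrightarrow> 1) at_top"
    and bot: "((\<lambda>l. W\<^sup>2 / sqrt (W\<^sup>2 + l\<^sup>2)) \<longlongrightarrow> 0) at_bot" "((\<lambda>l. l / sqrt (W\<^sup>2 + l\<^sup>2)) \<longlongrightarrow> - 1) at_bot"
    using W by real_asymp+
  have "(B \<longlongrightarrow> - (W / L) * fst v + ((L + 0) *\<^sub>R x1 - 1 *\<^sub>R z) \<bullet> snd v) at_top"
    unfolding Bp by (intro tendsto_intros p top)
  moreover have "(B \<longlongrightarrow> - (W / L) * fst (0 :: real \<times> 'a) + ((L + 0) *\<^sub>R x1 - (- 1) *\<^sub>R z) \<bullet> snd (0 :: real \<times> 'a)) at_bot"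
    unfolding Bp by (intro tendsto_intros p bot)
  ultimately have "(LINT s|lborel. - (1/2) * HH (line z s)) = (- (W / L) * fst v + (L *\<^sub>R x1 - z) \<bullet> snd v) - 0"
    by (intro integral_derivative_line(2)[OF dB Cb]) simp_all
  then show ?thesis by (simp add: ff_def W_def)
qed

text \<open>Cauchy-Schwarz together with the strict inequality \<open>norm z < w0 z\<close>: for a
  past causal limit the time term outweighs the pairing of \<open>z\<close> with the spatial
  part.\<close>

lemma deviation_not_past:
  assumes pos: "ff z \<ge> 0" and q: "norm (snd q) = 1"
  shows "\<not> past_causal L q v"
proof
  assume "past_causal L q v"
  then have c: "conf_metric L q v v \<le> 0" and t: "conf_metric L q time_vec v > 0" by (simp_all add: past_causal_def)
  define T where "T = - fst v"
  have T: "T > 0" using t by (simp add: conf_metric_def time_vec_def T_def)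
  have e: "(L * norm (snd v))\<^sup>2 = L\<^sup>2 * (snd v \<bullet> snd v)" by (simp only: power_mult_distrib power2_norm_eq_inner)
  have "(L * norm (snd v))\<^sup>2 \<le> T\<^sup>2"
    unfolding e using c q by (simp add: conf_metric_def T_def power2_eq_square)
  then have y: "L * norm (snd v) \<le> T" using T by (intro power2_le_imp_le[of "L * norm (snd v)" T]) auto
  have "norm z < w0 z"
  proof (rule power2_less_imp_less)
    have "perp z = z" using z by (simp add: perp_def lam_def)
    then show "(norm z)\<^sup>2 < (w0 z)\<^sup>2" by (simp add: w02 power2_norm_eq_inner)
  qed (rule less_imp_le[OF w0_pos])
  have "L * (z \<bullet> snd v) \<le> L * (norm z * norm (snd v))"
    using norm_cauchy_schwarz[of z "snd v"] L_pos by (intro mult_left_mono) auto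
  also have "\<dots> = norm z * (L * norm (snd v))" by simp
  also have "\<dots> \<le> norm z * T" using y by (intro mult_left_mono) auto
  also have "\<dots> < w0 z * T" using T \<open>norm z < w0 z\<close> by (intro mult_strict_right_mono) auto
  finally have "z \<bullet> snd v < w0 z * T / L" using L_pos by (simp add: field_simps)
  moreover have "- (1/2) * ff z = w0 z * T / L - z \<bullet> snd v"
    using deviation_limit by (simp add: inner_diff_left deviation_tangential T_def)
  ultimately show False using pos by simp
qed

end

end

section \<open>The averaged null curvature condition implies boundary causality\<close>

context admissible_horizon
begin

lemma linearized_ANCC_line:
  assumes "linearized_ANCC L dg"
  shows "0 \<le> (LINT s|lborel. JJ (line z s))"
proof -
  \<comment> \<open>A variation in the time direction alone, scaled so as to satisfy the linearized
    null condition.\<close>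
  define dk where "dk s = (HH (line z s) * L / (2 * w0 (line z s)), 0::'a)" for s
  have g: "ads_metric L (graph x) (hk x) (a, 0) = - (w0 x / L) * a" for x a
    by (simp add: metric_eq graph_def hk_def power2_eq_square)
  have dk: "ads_metric L (graph (line z s)) (hk (line z s)) (dk s) = - (1/2) * dg (graph (line z s)) (hk (line z s)) (hk (line z s))" for s
    unfolding dk_def g HH_eq by simp
  have "0 \<le> (LINT s|lborel. delta_ricci (ads_metric L) dg (graph (line z s)) (hk (line z s)) (hk (line z s))
      + 2 * ricci (ads_metric L) (graph (line z s)) (hk (line z s)) (dk s))"
    using assms[unfolded linearized_ANCC_def, rule_format, OF complete_null_geodesic_line(1), unfolded complete_null_geodesic_line(2), OF dk] .
  then show ?thesis unfolding JJ_def ricci_ads dk HH_eq by simp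
qed

end

context admissible_pert
begin

text \<open>Every horizon generator is brought into the normal form of
  \<open>null_geodesic_cases\<close>; comparing its limit with the given endpoint identifies that
  endpoint as a boundary point, where the conformal metric is the standard one.\<close>

lemma preserves_BCC_if:
  assumes pos: "\<And>tm x1 z. x1 \<bullet> x1 = 1 \<Longrightarrow> z \<bullet> x1 = 0 \<Longrightarrow> 0 \<le> admissible_horizon.ff L dg tm x1 z"
  shows "preserves_BCC L dg"
  unfolding preserves_BCC_def
proof (intro ballI allI impI)
  fix q :: "real \<times> 'a" and \<gamma> \<eta> v
  assume g: "horizon_generator L q \<gamma>" and dev: "deviation_vector L dg \<gamma> \<eta>"
    and lim: "((\<lambda>s. push L (\<gamma> s) (\<eta> s)) \<longlongrightarrow> v) at_top"
  obtain tm x1 z \<kappa> c where x1: "x1 \<bullet> x1 = 1" and \<kappa>: "\<kappa> > 0" and z: "z \<bullet> x1 = 0"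
    and \<gamma>: "\<gamma> = (\<lambda>s. ads_line.graph L tm x1 (ads_line.line x1 z (\<kappa> * s + c)))"
    using null_geodesic_cases[of \<gamma>] g unfolding horizon_generator_def by blast
  interpret admissible_horizon L dg hb tm x1 by unfold_locales (rule x1)
  have "((\<lambda>s. compactify L (\<gamma> s)) \<longlongrightarrow> (tm + L * (pi / 2), x1)) at_top"
    unfolding \<gamma> by (rule filterlim_compose[OF compactify_line_tendsto[OF z] filterlim_affine_at_top[OF \<kappa>]])
  moreover have "((\<lambda>s. compactify L (\<gamma> s)) \<longlongrightarrow> reconvergence_point L q) at_top"
    using g unfolding horizon_generator_def by blast
  ultimately have "reconvergence_point L q = (tm + L * (pi / 2), x1)"
    using tendsto_unique[OF trivial_limit_at_top_linorder] by blast
  then have n: "norm (snd (reconvergence_point L q)) = 1" by (simp add: norm_x1)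
  show "\<not> past_causal L (reconvergence_point L q) v"
    by (rule deviation_not_past[OF z \<kappa> dev[unfolded \<gamma>] lim[unfolded \<gamma>] pos[OF x1 z] n])
qed

lemma ANCC_imp_BCC:
  assumes d: "DIM('a) \<ge> 2" and ancc: "linearized_ANCC L dg"
  shows "preserves_BCC L dg"
proof (rule preserves_BCC_if)
  fix tm :: real and x1 z :: 'a
  assume x1: "x1 \<bullet> x1 = 1" and z: "z \<bullet> x1 = 0"
  interpret admissible_horizon L dg hb tm x1 by unfold_locales (rule x1)
  show "0 \<le> ff z" by (rule averaged_null_energy_positive[OF d linearized_ANCC_line[OF ancc] z])
qed

end

lemma admissible_obtain:
  assumes "L > 0" "admissible L dg"
  obtains hb where "admissible_pert L dg hb"
proof -
  from assms(2) obtain h where h: "\<forall>q\<in>ads_closure. symmetric_form (h q)"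
    "\<forall>u v. Ck_upto_boundary 2 (\<lambda>q. h q u v) ads_closure"
    "\<forall>p u v. h (compactify L p) (push L p u) (push L p v) = (conf_factor L p)\<^sup>2 * dg p u v"
    "\<forall>q\<in>ads_boundary. \<exists>c. \<forall>u v. snd u \<bullet> snd q = 0 \<longrightarrow> snd v \<bullet> snd q = 0 \<longrightarrow> h q u v = c * conf_metric L q u v"
    unfolding admissible_def by (elim exE conjE)
  have "admissible_pert L dg h"
    by (standard, fact assms(1), use h(1) in blast, use h(2) in blast, use h(3) in blast, use h(4) in blast)
  then show thesis by (rule that)
qed

section \<open>A perturbation preserving boundary causality that violates the averaged condition\<close>

text \<open>The first factor vanishes on the boundary, so the boundary condition holds with the
  multiple 0. The second vanishes to second order on a hyperplane, which contains generators, and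
  the product of time components makes the value on a pair of equal vectors nonnegative.\<close>

definition bump :: "'a::euclidean_space \<Rightarrow> (real \<times> 'a) tensor2" where
  "bump j q u v = (1 - snd q \<bullet> snd q) * (snd q \<bullet> j)\<^sup>2 * (fst u * fst v)"

definition bump_pert :: "real \<Rightarrow> 'a::euclidean_space \<Rightarrow> (real \<times> 'a) tensor2" where
  "bump_pert L j p u v = (wt L (snd p))\<^sup>2 / L\<^sup>2 * bump j (compactify L p) (push L p u) (push L p v)"

lemma bump_Ck: "Ck_upto_boundary 2 (\<lambda>q. bump j q u v) S"
proof -
  define c where "c = fst u * fst v"
  define F where "F = (\<lambda>q::real \<times> 'a. (1 - snd q \<bullet> snd q) * (snd q \<bullet> j)\<^sup>2 * c)"
  define F1 where "F1 q d = c * (- (2 * (snd q \<bullet> snd d)) * (snd q \<bullet> j)\<^sup>2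
    + (1 - snd q \<bullet> snd q) * (2 * (snd q \<bullet> j) * (snd d \<bullet> j)))" for q d :: "real \<times> 'a"
  define F2 where "F2 q d e = c * (- (2 * (snd e \<bullet> snd d)) * (snd q \<bullet> j)\<^sup>2
    - (2 * (snd q \<bullet> snd d)) * (2 * (snd q \<bullet> j) * (snd e \<bullet> j))
    - (2 * (snd q \<bullet> snd e)) * (2 * (snd q \<bullet> j) * (snd d \<bullet> j))
    + (1 - snd q \<bullet> snd q) * (2 * (snd e \<bullet> j) * (snd d \<bullet> j)))" for q d e :: "real \<times> 'a"
  have 1: "(F has_derivative F1 q) (at q)" for q
    unfolding F_def F1_def[abs_def]
    by (rule has_derivative_eq_rhs)
      (rule derivative_eq_intros refl | simp add: fun_eq_iff inner_commute algebra_simps)+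
  have f1: "frechet_derivative F (at q) = F1 q" for q
    using frechet_derivative_at[OF 1] by simp
  have 2: "((\<lambda>q. F1 q d) has_derivative F2 q d) (at q)" for q d
    unfolding F2_def[abs_def] F1_def
    by (rule has_derivative_eq_rhs)
      (rule derivative_eq_intros refl | simp add: fun_eq_iff inner_commute algebra_simps)+
  have f2: "frechet_derivative (\<lambda>q. F1 q d) (at q) = F2 q d" for q d
    using frechet_derivative_at[OF 2] by simp
  have 3: "continuous_on UNIV (\<lambda>q. F2 q d e)" for d e
    unfolding F2_def by (intro continuous_intros)
  have "Ck_on 2 F UNIV"
    unfolding Ck_on_2 f1 f2 differentiable_on_def
    by (intro conjI allI ballI 3 differentiableI[OF 1] differentiableI[OF 2])
  then show ?thesis
    unfolding Ck_upto_boundary_def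
    by (intro ballI exI[of _ UNIV] exI[of _ F]) (simp add: F_def bump_def c_def mult.assoc)
qed

lemma bump_symmetric_form: "symmetric_form (bump j q)"
  unfolding symmetric_form_def bilinear_def bump_def
  by (auto intro!: linearI simp: algebra_simps)

lemma admissible_bump:
  fixes j :: "'a::euclidean_space"
  assumes L: "L > 0" shows "admissible_pert L (bump_pert L j) (bump j)"
proof -
  interpret ads L by standard (rule L)
  show ?thesis
  proof
    show "bump j (compactify L p) (push L p u) (push L p v) = (conf_factor L p)\<^sup>2 * bump_pert L j p u v" for p u v
      unfolding conf_factor2 bump_pert_def by simp
    show "\<exists>c. \<forall>u v. snd u \<bullet> snd q = 0 \<longrightarrow> snd v \<bullet> snd q = 0 \<longrightarrow> bump j q u v = c * conf_metric L q u v"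
      if "q \<in> ads_boundary" for q :: "real \<times> 'a"
      using that by (intro exI[of _ 0]) (simp add: bump_def ads_boundary_def mem_Times_iff norm_eq_1)
  qed (simp_all add: bump_symmetric_form bump_Ck)
qed

lemma admissible_pert_imp: "admissible_pert L dg hb \<Longrightarrow> admissible L dg"
  unfolding admissible_def admissible_pert_def admissible_pert_axioms_def by blast

locale bump_horizon = ads_line L tm x1 for L :: real and tm :: real and x1 :: "'a::euclidean_space" +
  fixes j :: 'a

sublocale bump_horizon \<subseteq> admissible_horizon L "bump_pert L j" "bump j" tm x1
proof -
  interpret admissible_pert L "bump_pert L j" "bump j" by (rule admissible_bump[OF L_pos])
  show "admissible_horizon L (bump_pert L j) (bump j) x1" by unfold_locales
qed

context bump_horizon
begin

text \<open>The factor of \<open>HH\<close> that remains after splitting off the square vanishing on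
  the hyperplane: conformal weight, distance to the boundary, chart scaling and the squared time
  component of \<open>hk\<close>.\<close>

definition BB :: "'a \<Rightarrow> real" where
  "BB x = (wt L x)\<^sup>2 / L\<^sup>2 * ((2 * L / (L + wt L x)) * (1 / (L + wt L x))\<^sup>2 * (L * w0 x / (wt L x)\<^sup>2)\<^sup>2)"

lemma HH_bump: "HH x = BB x * (x \<bullet> j)\<^sup>2"
proof -
  have "x \<bullet> x = (wt L x - L) * (wt L x + L)" using wt2[of x] by (simp add: power2_eq_square algebra_simps)
  then have "1 - snd (cg x) \<bullet> snd (cg x) = 1 - (inverse (L + wt L x) * inverse (L + wt L x)) * ((wt L x - L) * (wt L x + L))"
    by (simp add: cg_eq)
  also have "\<dots> = 2 * L / (L + wt L x)"
  proof -
    define i where "i = inverse (L + wt L x)"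
    have i: "i * (L + wt L x) = 1" using Lw_nz[of x] by (simp add: i_def)
    have "1 - (i * i) * ((wt L x - L) * (wt L x + L)) = 1 - i * (wt L x - L) * (i * (L + wt L x))"
      by (simp add: algebra_simps)
    also have "\<dots> = i * (L + wt L x) - i * (wt L x - L)" unfolding i by simp
    finally show ?thesis by (simp add: i_def divide_inverse algebra_simps)
  qed
  finally have "bump j (cg x) (pk x) (pk x) = (2 * L / (L + wt L x)) * (inverse (L + wt L x) * (x \<bullet> j))\<^sup>2 * (fst (pk x) * fst (pk x))"
    unfolding bump_def by (simp add: cg_eq)
  moreover have "fst (pk x) = L * w0 x / (wt L x)\<^sup>2" by (simp add: pk_def push_eq hk_def)
  ultimately show ?thesis
    unfolding HH_eq bump_pert_def cg_def[symmetric] pk_def[symmetric] BB_def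
    by (simp add: graph_def power_mult_distrib divide_inverse power2_eq_square mult_ac)
qed

lemma BB_pos: "BB x > 0"
  unfolding BB_def using L_pos Lw_pos[of x] w0_pos[of x] wt_pos[of x] by simp

lemma HH_nonneg: "HH x \<ge> 0"
  using BB_pos[of x] by (simp add: HH_bump)

lemma ff_nonneg: "ff z \<ge> 0"
  unfolding ff_def by (intro integral_nonneg_AE always_eventually allI HH_nonneg)

lemma BB_cont: "isCont BB x"
proof -
  have w: "isCont w0 x" by (rule has_derivative_continuous[OF w0_deriv])
  have W: "isCont (wt L) x" unfolding wt_def by (intro continuous_intros)
  show ?thesis unfolding BB_def by (intro continuous_intros w W) simp_all
qed

text \<open>\<open>HH\<close> is nonnegative and vanishes at such a point, which is therefore a
  minimum.\<close>

lemma HH2_ge_0: assumes "x \<bullet> j = 0" shows "HH1 x u = 0" "HH2 x u u \<ge> 0"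
proof -
  have 0: "HH x = 0" using assms by (simp add: HH_bump)
  have ev: "eventually (\<lambda>t. 0 < t) (at_right (0::real))" by (simp add: eventually_at_filter)
  have ge: "HH1 x u \<ge> 0" for u
    by (rule tendsto_lowerbound[OF c2_first_difference(1)[OF c2_HH]])
      (use ev in eventually_elim, use HH_nonneg in \<open>auto simp: 0\<close>)
  show "HH1 x u = 0"
    using ge[of u] ge[of "- u"] linear_neg[OF linear_c2D1[OF c2_HH], of x u] by simp
  show "HH2 x u u \<ge> 0"
    by (rule tendsto_lowerbound[OF c2_second_difference(1)[OF c2_HH]])
      (use ev in eventually_elim, use HH_nonneg in \<open>auto simp: 0 intro!: divide_nonneg_nonneg add_nonneg_nonneg\<close>)
qed

text \<open>On the hyperplane both derivatives must fall on the square. Computing with second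
  differences uses only the continuity of \<open>BB\<close>.\<close>

lemma HH2_bump:
  assumes x: "x \<bullet> j = 0" shows "HH2 x u u = 2 * (u \<bullet> j)\<^sup>2 * BB x"
proof (rule tendsto_unique[OF _ c2_second_difference(1)[OF c2_HH]])
  have t: "((\<lambda>t. BB (x + t *\<^sub>R u)) \<longlongrightarrow> BB x) (at_right 0)" "((\<lambda>t. BB (x - t *\<^sub>R u)) \<longlongrightarrow> BB x) (at_right 0)"
    using BB_cont[of x] by (intro isCont_tendsto_compose[of x BB] tendsto_eq_intros | simp)+
  have "((\<lambda>t. (u \<bullet> j)\<^sup>2 * BB (x + t *\<^sub>R u) + (u \<bullet> j)\<^sup>2 * BB (x - t *\<^sub>R u)) \<longlongrightarrow> (u \<bullet> j)\<^sup>2 * BB x + (u \<bullet> j)\<^sup>2 * BB x) (at_right 0)"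
    by (intro tendsto_intros t)
  then have "((\<lambda>t. (u \<bullet> j)\<^sup>2 * BB (x + t *\<^sub>R u) + (u \<bullet> j)\<^sup>2 * BB (x - t *\<^sub>R u)) \<longlongrightarrow> 2 * (u \<bullet> j)\<^sup>2 * BB x) (at_right 0)"
    by (simp add: mult.commute mult.left_commute)
  then show "((\<lambda>t. (HH (x + t *\<^sub>R u) + HH (x - t *\<^sub>R u) - 2 * HH x) / t\<^sup>2) \<longlongrightarrow> 2 * (u \<bullet> j)\<^sup>2 * BB x) (at_right 0)"
  proof (rule Lim_transform_eventually)
    have "eventually (\<lambda>t. 0 < t) (at_right (0::real))" by (simp add: eventually_at_filter)
    then show "eventually (\<lambda>t. (u \<bullet> j)\<^sup>2 * BB (x + t *\<^sub>R u) + (u \<bullet> j)\<^sup>2 * BB (x - t *\<^sub>R u)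
        = (HH (x + t *\<^sub>R u) + HH (x - t *\<^sub>R u) - 2 * HH x) / t\<^sup>2) (at_right 0)"
      by eventually_elim (simp add: HH_bump x inner_add_left inner_diff_left power_mult_distrib add_divide_distrib mult.commute)
  qed
qed simp

text \<open>The line through the centre lies in the hyperplane. On it the first derivatives of
  \<open>HH\<close> vanish, and its second derivatives are nonnegative and strictly positive in
  direction \<open>j\<close>; so \<open>EE\<close> is positive there, while the null curvature
  integral is minus half the integral of \<open>EE\<close>.\<close>

lemma bump_violates_ANCC:
  assumes j: "j \<in> Basis" and x1j: "x1 \<bullet> j = 0"
  shows "\<not> linearized_ANCC L (bump_pert L j)"
proof
  assume ancc: "linearized_ANCC L (bump_pert L j)"
  have z: "0 \<bullet> x1 = 0" by simp
  have "0 \<le> - (1/2) * (LINT s|lborel. EE (line 0 s))"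
    using linearized_ANCC_line[OF ancc, of 0] unfolding JJ_integral'(2)[OF z] .
  moreover have pos: "EE (line 0 s) > 0" for s
  proof -
    have x: "line 0 s \<bullet> j = 0" by (simp add: line_def x1j)
    have "HH2 (line 0 s) j j \<le> (\<Sum>b\<in>Basis. HH2 (line 0 s) b b)"
      by (rule member_le_sum[OF j]) (use HH2_ge_0(2)[OF x] in auto)
    moreover have "HH2 (line 0 s) j j > 0" unfolding HH2_bump[OF x] using BB_pos[of "line 0 s"] j by simp
    ultimately show ?thesis unfolding EE_def HH2_ge_0(1)[OF x] HH2_bump[OF x, of "line 0 s"] x by simp
  qed
  moreover have "(LINT s|lborel. EE (line 0 s)) \<ge> 0"
    by (intro integral_nonneg_AE always_eventually allI less_imp_le pos)
  ultimately have "(LINT s|lborel. EE (line 0 s)) = 0" by simp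
  then have "AE s in lborel. EE (line 0 s) = 0"
    using integral_nonneg_eq_0_iff_AE[OF EE_integral(1)[OF z]] less_imp_le[OF pos] by simp
  then have "AE s in (lborel :: real measure). False"
    by eventually_elim (use pos less_irrefl in metis)
  then show False by (simp add: eventually_False ae_filter_eq_bot_iff)
qed

end

theorem theorem2:
  fixes L :: real
  assumes "CARD('n::finite) \<ge> 2" and "L > 0"
  shows "(\<forall>dg :: (real \<times> (real ^ 'n)) tensor2.
            admissible L dg \<longrightarrow> linearized_ANCC L dg \<longrightarrow> preserves_BCC L dg)
       \<and> (\<exists>dg :: (real \<times> (real ^ 'n)) tensor2.
            admissible L dg \<and> preserves_BCC L dg \<and> \<not> linearized_ANCC L dg)"
proof
  have d: "DIM(real ^ 'n) \<ge> 2" using assms(1) by simp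
  show "\<forall>dg :: (real \<times> (real ^ 'n)) tensor2. admissible L dg \<longrightarrow> linearized_ANCC L dg \<longrightarrow> preserves_BCC L dg"
  proof (intro allI impI)
    fix dg :: "(real \<times> (real ^ 'n)) tensor2"
    assume a: "admissible L dg" "linearized_ANCC L dg"
    obtain hb where "admissible_pert L dg hb" by (rule admissible_obtain[OF assms(2) a(1)])
    then show "preserves_BCC L dg" by (rule admissible_pert.ANCC_imp_BCC[OF _ d a(2)])
  qed
  \<comment> \<open>Two distinct basis vectors exist because d \<ge> 2: \<open>i\<close> is the
    direction of the violating generator, \<open>j\<close> the normal of the hyperplane on which the
    bump vanishes.\<close>
  obtain i j :: "real ^ 'n" where ij: "i \<in> Basis" "j \<in> Basis" "i \<noteq> j"
    using d card_le_Suc0_iff_eq[of "Basis :: (real ^ 'n) set"] by fastforce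
  note adm = admissible_bump[OF assms(2), of j]
  show "\<exists>dg :: (real \<times> (real ^ 'n)) tensor2. admissible L dg \<and> preserves_BCC L dg \<and> \<not> linearized_ANCC L dg"
  proof (intro exI[of _ "bump_pert L j"] conjI)
    show "admissible L (bump_pert L j)" by (rule admissible_pert_imp[OF adm])
    show "preserves_BCC L (bump_pert L j)"
    proof (rule admissible_pert.preserves_BCC_if[OF adm])
      fix tm :: real and x1 z :: "real ^ 'n"
      assume x1: "x1 \<bullet> x1 = 1"
      interpret bump_horizon L tm x1 j by unfold_locales (use assms(2) x1 in auto)
      show "0 \<le> ff z" by (rule ff_nonneg)
    qed
    interpret bump_horizon L 0 i j by unfold_locales (use assms(2) ij in auto)
    show "\<not> linearized_ANCC L (bump_pert L j)"
      by (rule bump_violates_ANCC) (use ij in \<open>auto simp: inner_not_same_Basis\<close>)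
  qed
qed

end
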